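(* Let $Q$ be a face operator satisfying (2Dsimple). Then the operators $\overline Q^{\infty_{WE}}$, $\overline Q^{\infty_{WE},\infty_S}$ and $\overline Q^{\infty_{WE},\infty_N}$ belong respectively to $\mathcal Q_{\infty_{WE},1}$, $\mathcal Q_{\infty_{WE},\infty_S}$ and $\mathcal Q_{\infty_{WE},\infty_N}$. Moreover, if $Q$ satisfies (2Dsimple) and (Dihedral invariance), then, with $\overline Q^{W},\overline Q^{E},\overline Q^{S},\overline Q^{N}$ the half-strip fixed points and $\overline Q^{SW},\overline Q^{SE},\overline Q^{NW},\overline Q^{NE}$ the corner fixed points of $Q$, and $M|M'$ denoting gluing along the common vertical side ($M'$ to the East of $M$, base point placed on the cut), $$\overline Q^{\infty_{WE}}=\overline Q^{W}|\overline Q^{E},\qquad \overline Q^{\infty_{WE},\infty_S}=\overline Q^{SW}|\overline Q^{SE},\qquad\overline Q^{\infty_{WE},\infty_N}=\overline Q^{NW}|\overline Q^{NE}.$$ Similarly in the second direction, with $M/M'$ denoting gluing along the common horizontal side ($M'$ to the North of $M$), $$\overline Q^{\infty_{SN}}=\overline Q^{S}/\overline Q^{N},\qquad \overline Q^{\infty_W,\infty_{SN}}=\overline Q^{SW}/\overline Q^{NW},\qquad\overline Q^{\infty_E,\infty_{SN}}=\overline Q^{SE}/\overline Q^{NE}.$$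
   Context: $\mathcal H_1,\mathcal H_2$ are finite-dimensional (real or complex) Hilbert spaces (in the real case, functions on $S^1$ take values in complexifications). A face operator is a self-adjoint positive definite operator $Q$ on $\mathcal H_1\oplus\mathcal H_1\oplus\mathcal H_2\oplus\mathcal H_2$, the summands being attached to the South, North, West, East sides ($S,N,W,E$) of a unit square. $Q_{[ab],[cd]}$ denotes the $2\times 2$ block extraction (rows $a,b$, columns $c,d$). Schur complement: $\mathrm{Schur}_{V_2}(M)=M_{11}-M_{12}M_{22}^{-1}M_{21}$. (Dihedral invariance): $\mathcal H_1=\mathcal H_2=\mathcal H$ and there are self-adjoint $T,A,U$ on $\mathcal H$ with $Q=\begin{pmatrix}T&A&U&U\\ A&T&U&U\\ U&U&T&A\\ U&U&A&T\end{pmatrix}$ (order $S,N,W,E$). (2Dsimple): let $\phi^{SN}(w)=Q_{SS}+Q_{NN}+wQ_{SN}+w^{-1}Q_{NS}$, $\phi^{WE}(z)=Q_{WW}+Q_{EE}+zQ_{WE}+z^{-1}Q_{EW}$, $\Psi_Q(z,w)=\begin{pmatrix}\phi^{SN}(w)&Q_{SW}+zQ_{SE}+w^{-1}Q_{NW}+w^{-1}zQ_{NE}\\ Q_{WS}+z^{-1}Q_{ES}+wQ_{WN}+wz^{-1}Q_{EN}&\phi^{WE}(z)\end{pmatrix}$. The zeroes of $\det\phi^{SN}$, $\det\phi^{WE}$ in $\mathbb C^*$ and of $\det\Psi_Q$ in $(\mathbb C^* )^2$ have multiplicity one with one-dimensional kernels there, and those of $\det\Psi_Q$ lie outside $S^1\times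 S^1$; for $\det\Psi_Q$, multiplicity one is understood in particular to mean that for each fixed $u\in S^1$ the zeroes in $\mathbb C^*$ of $w\mapsto\det\Psi_Q(u,w)$ and $z\mapsto\det\Psi_Q(z,u)$ are simple. Strip functions: for $z,w\in S^1$, $\mathcal S_{WE}(z)=Q_{[SN],[SN]}-(Q_{[SN],W}+zQ_{[SN],E})\phi^{WE}(z)^{-1}(Q_{W,[SN]}+z^{-1}Q_{E,[SN]})$ on $\mathcal H_1^2$, and $\mathcal S_{SN}(w)=Q_{[WE],[WE]}-(Q_{[WE],S}+w^{-1}Q_{[WE],N})\phi^{SN}(w)^{-1}(Q_{S,[WE]}+wQ_{N,[WE]})$ on $\mathcal H_2^2$. For a self-adjoint positive definite $K=\begin{pmatrix}K_{LL}&K_{LR}\\ K_{RL}&K_{RR}\end{pmatrix}$, put $\phi_K(z)=K_{LL}+K_{RR}+zK_{LR}+z^{-1}K_{RL}$ and suppose that the non-zero roots of $\det(z\phi_K(z))$ are simple with $\dim\ker\phi_K=1$; $W^L_K$ (resp. $W_K^R$) is the unique operator with $W^L_Kv=z^{-1}v$ for $v\in\ker\phi_K(z)$, $|z|>1$, and $W^L_Kv=0$ for $v\in\ker K_{LR}$ (resp. $W_K^Rv=zv$ for $v\in\ker\phi_K(z)$, $|z|<1$, and $W^R_Kv=0$ for $v\in\ker K_{RL}$). Then $G_L(K)=K_{RR}+K_{RL}W_K^L$ and $G_R(K)=K_{LL}+K_{LR}W_K^R$ (they are the positive definite solutions of $G=K_{RR}-K_{RL}(G+K_{LL})^{-1}K_{LR}$,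 resp. $G=K_{LL}-K_{LR}(G+K_{RR})^{-1}K_{RL}$). For $u\in S^1$: $G^*_{\infty_S}(u)=G_L(\mathcal S_{WE}(u))$, $G^*_{\infty_N}(u)=G_R(\mathcal S_{WE}(u))$ (with $L=S,R=N$), $G^*_{\infty_W}(u)=G_L(\mathcal S_{SN}(u))$, $G^*_{\infty_E}(u)=G_R(\mathcal S_{SN}(u))$ (with $L=W,R=E$). $\overline Q^{\infty_{WE}}$, $\overline Q^{\infty_{WE},\infty_S}$, $\overline Q^{\infty_{WE},\infty_N}$ are the operators on $\ell^2(\mathbb Z;\mathcal H_1)^2$, $\ell^2(\mathbb Z;\mathcal H_1)$, $\ell^2(\mathbb Z;\mathcal H_1)$ conjugate, through Fourier series $\hat f(e^{i\theta})=\sum_kf(k)e^{ik\theta}$, to pointwise multiplication on $L^2(S^1)$ by $\mathcal S_{WE}$, $G^*_{\infty_S}$, $G^*_{\infty_N}$. Likewise $\overline Q^{\infty_{SN}}$, $\overline Q^{\infty_W,\infty_{SN}}$, $\overline Q^{\infty_E,\infty_{SN}}$ on $\ell^2(\mathbb Z;\mathcal H_2)^2$, $\ell^2(\mathbb Z;\mathcal H_2)$, $\ell^2(\mathbb Z;\mathcal H_2)$ from $\mathcal S_{SN}$, $G^*_{\infty_W}$, $G^*_{\infty_E}$. Spaces: $\mathcal W_W=\ell^2(\mathbb Z_{<0};\mathcal H_1)$, $\mathcal W_E=\ell^2(\mathbb Z_{\ge0};\mathcal H_1)$, $\mathcal W_S=\ell^2(\mathbb Z_{<0};\mathcal H_2)$,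 $\mathcal W_N=\ell^2(\mathbb Z_{\ge0};\mathcal H_2)$. Shifts (unitary): $D_1^L(w,h)(-1)=h$, $D_1^L(w,h)(k)=w(k+1)$ for $k<-1$; $D_1^R(h,w)(0)=h$, $D_1^R(h,w)(k)=w(k-1)$ for $k\ge1$. Shapes and sides: unit face; horizontal half-strips of direction $a\in\{W,E\}$: $S,N$ sides $\mathcal W_a$, one vertical side $\mathcal H_2$ (East if $a=W$, West if $a=E$); vertical half-strips of direction $b\in\{S,N\}$: $W,E$ sides $\mathcal W_b$, one horizontal side $\mathcal H_1$ (North if $b=S$, South if $b=N$); corners $(\infty_a,\infty_b)$: horizontal side $\mathcal W_a$ (North if $b=S$, South if $b=N$), vertical side $\mathcal W_b$ (East if $a=W$, West if $a=E$); horizontal strip $(\infty_{WE},1)$: $S,N$ sides $\ell^2(\mathbb Z;\mathcal H_1)$; half-planes $(\infty_{WE},\infty_b)$: one side $\ell^2(\mathbb Z;\mathcal H_1)$; similarly $(1,\infty_{SN})$ and $(\infty_a,\infty_{SN})$ with $\ell^2(\mathbb Z;\mathcal H_2)$. For each shape $c$, $\mathcal Q_c$ is the set of bounded self-adjoint $M$ on the orthogonal sum of side spaces with $\inf_{x\ne0}\langle x,Mx\rangle/\langle x,x\rangle>0$. Gluing along a common full side with space $V$: add the quadratic forms with a common variable on that side and take the Schur complement with respect to $V$; a half-line concatenated with a unit segment is identified with the half-line by conjugation with $D_1^L$ ($W,S$) or $D_1^R$ ($E,N$); two opposite half-lines are identified with a line by $\ell^2(\mathbb Z_{<0};\mathcal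 H)\oplus\ell^2(\mathbb Z_{\ge0};\mathcal H)=\ell^2(\mathbb Z;\mathcal H)$. Fixed points: the half-strip fixed point $\overline Q^d$, $d\in\{W,E,S,N\}$, is the element of the corresponding $\mathcal Q_c$ unchanged by gluing a face $Q$ along its finite side. The corner fixed point $\overline Q^{ba}\in\mathcal Q_{\infty_a,\infty_b}$ is the element unchanged by gluing $\overline Q^b$ along its vertical side and unchanged by gluing $\overline Q^a$ along its horizontal side. *)

theory Defs
  imports
    "HOL-Analysis.Analysis"
    "Jordan_Normal_Form.Schur_Decomposition"
    "Jordan_Normal_Form.Matrix_Kernel"
begin

unbundle no vec_syntax
unbundle no inner_syntax
hide_const (open) Determinants.det

text \<open>The scalar field is a set \<open>\<K>\<close> of complex numbers, which is either \<open>\<real>\<close> or the whole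
  type; \<open>\<K>\<^sup>n\<close> is the \<open>n\<close>-dimensional Hilbert space over it and \<open>complex vec\<close> its
  complexification. Throughout, \<open>n1 = dim \<H>\<^sub>1\<close> and \<open>n2 = dim \<H>\<^sub>2\<close>.\<close>

definition pos_def :: "complex set \<Rightarrow> nat \<Rightarrow> complex mat \<Rightarrow> bool" where
  "pos_def \<K> n A \<longleftrightarrow> A \<in> carrier_mat n n \<and> elements_mat A \<subseteq> \<K> \<and> mat_adjoint A = A \<and>
     (\<forall>v \<in> carrier_vec n. set\<^sub>v v \<subseteq> \<K> \<and> v \<noteq> 0\<^sub>v n \<longrightarrow> 0 < Re ((A *\<^sub>v v) \<bullet>c v))"

definition face_operator :: "complex set \<Rightarrow> nat \<Rightarrow> nat \<Rightarrow> complex mat \<Rightarrow> bool" where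
  "face_operator \<K> n1 n2 Q \<longleftrightarrow> pos_def \<K> (2 * n1 + 2 * n2) Q"

definition minv :: "complex mat \<Rightarrow> complex mat" where
  "minv A = the (mat_inverse A)"


section \<open>Symbols of a face operator\<close>

text \<open>The edge \<open>Cut\<close> is not a side of any shape: it names the common side while gluing.\<close>

datatype edge = South | North | West | East | Cut

text \<open>A section (offset, length) of the coordinates; those of a face operator are ordered
  South, North, West, East.\<close>

fun sec :: "nat \<Rightarrow> nat \<Rightarrow> edge \<Rightarrow> nat \<times> nat" where
  "sec n1 n2 South = (0, n1)"
| "sec n1 n2 North = (n1, n1)"
| "sec n1 n2 West = (2 * n1, n2)"
| "sec n1 n2 East = (2 * n1 + n2, n2)"
| "sec n1 n2 Cut = (0, 0)"

definition secSN :: "nat \<Rightarrow> nat \<Rightarrow> nat \<times> nat" where "secSN n1 n2 = (0, 2 * n1)"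
definition secWE :: "nat \<Rightarrow> nat \<Rightarrow> nat \<times> nat" where "secWE n1 n2 = (2 * n1, 2 * n2)"

fun sub_block :: "complex mat \<Rightarrow> nat \<times> nat \<Rightarrow> nat \<times> nat \<Rightarrow> complex mat" where
  "sub_block A (r, m) (c, l) = mat m l (\<lambda>(i, j). A $$ (r + i, c + j))"

abbreviation face_block :: "nat \<Rightarrow> nat \<Rightarrow> complex mat \<Rightarrow> edge \<Rightarrow> edge \<Rightarrow> complex mat" where
  "face_block n1 n2 Q a b \<equiv> sub_block Q (sec n1 n2 a) (sec n1 n2 b)"

definition dihedral_invariant :: "complex set \<Rightarrow> nat \<Rightarrow> nat \<Rightarrow> complex mat \<Rightarrow> bool" where
  "dihedral_invariant \<K> n1 n2 Q \<longleftrightarrow> n1 = n2 \<and>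
     (\<exists>T A U. (\<forall>B \<in> {T, A, U}. B \<in> carrier_mat n1 n1 \<and> elements_mat B \<subseteq> \<K> \<and> mat_adjoint B = B) \<and>
        Q = four_block_mat (four_block_mat T A A T) (four_block_mat U U U U)
                           (four_block_mat U U U U) (four_block_mat T A A T))"

definition phi_SN :: "nat \<Rightarrow> nat \<Rightarrow> complex mat \<Rightarrow> complex \<Rightarrow> complex mat" where
  "phi_SN n1 n2 Q w =
     face_block n1 n2 Q South South + face_block n1 n2 Q North North +
     w \<cdot>\<^sub>m face_block n1 n2 Q South North + inverse w \<cdot>\<^sub>m face_block n1 n2 Q North South"

definition phi_WE :: "nat \<Rightarrow> nat \<Rightarrow> complex mat \<Rightarrow> complex \<Rightarrow> complex mat" where
  "phi_WE n1 n2 Q z =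
     face_block n1 n2 Q West West + face_block n1 n2 Q East East +
     z \<cdot>\<^sub>m face_block n1 n2 Q West East + inverse z \<cdot>\<^sub>m face_block n1 n2 Q East West"

definition Psi :: "nat \<Rightarrow> nat \<Rightarrow> complex mat \<Rightarrow> complex \<Rightarrow> complex \<Rightarrow> complex mat" where
  "Psi n1 n2 Q z w = four_block_mat
     (phi_SN n1 n2 Q w)
     (face_block n1 n2 Q South West + z \<cdot>\<^sub>m face_block n1 n2 Q South East +
      inverse w \<cdot>\<^sub>m face_block n1 n2 Q North West +
      (inverse w * z) \<cdot>\<^sub>m face_block n1 n2 Q North East)
     (face_block n1 n2 Q West South + inverse z \<cdot>\<^sub>m face_block n1 n2 Q East South +
      w \<cdot>\<^sub>m face_block n1 n2 Q West North +
      (w * inverse z) \<cdot>\<^sub>m face_block n1 n2 Q East North)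
     (phi_WE n1 n2 Q z)"

definition simple_zeros :: "(complex \<Rightarrow> complex) \<Rightarrow> bool" where
  "simple_zeros f \<longleftrightarrow> (\<forall>a. a \<noteq> 0 \<and> f a = 0 \<longrightarrow> deriv f a \<noteq> 0)"

text \<open>Multiplicity one of a zero of the function \<open>det \<Psi>\<^sub>Q\<close> of two variables means that its
  differential does not vanish there; simplicity of the zeroes of the partial functions with
  one variable frozen on the unit circle is required in addition.\<close>

definition two_D_simple :: "nat \<Rightarrow> nat \<Rightarrow> complex mat \<Rightarrow> bool" where
  "two_D_simple n1 n2 Q \<longleftrightarrow>
     simple_zeros (\<lambda>w. det (phi_SN n1 n2 Q w)) \<and>
     (\<forall>w. w \<noteq> 0 \<and> det (phi_SN n1 n2 Q w) = 0 \<longrightarrow> kernel_dim (phi_SN n1 n2 Q w) = 1) \<and>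
     simple_zeros (\<lambda>z. det (phi_WE n1 n2 Q z)) \<and>
     (\<forall>z. z \<noteq> 0 \<and> det (phi_WE n1 n2 Q z) = 0 \<longrightarrow> kernel_dim (phi_WE n1 n2 Q z) = 1) \<and>
     (\<forall>z w. z \<noteq> 0 \<and> w \<noteq> 0 \<and> det (Psi n1 n2 Q z w) = 0 \<longrightarrow>
        (deriv (\<lambda>z'. det (Psi n1 n2 Q z' w)) z \<noteq> 0 \<or> deriv (\<lambda>w'. det (Psi n1 n2 Q z w')) w \<noteq> 0) \<and>
        kernel_dim (Psi n1 n2 Q z w) = 1 \<and>
        \<not> (cmod z = 1 \<and> cmod w = 1)) \<and>
     (\<forall>u. cmod u = 1 \<longrightarrow>
        simple_zeros (\<lambda>w. det (Psi n1 n2 Q u w)) \<and> simple_zeros (\<lambda>z. det (Psi n1 n2 Q z u)))"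

definition strip_WE :: "nat \<Rightarrow> nat \<Rightarrow> complex mat \<Rightarrow> complex \<Rightarrow> complex mat" where
  "strip_WE n1 n2 Q z = (let SN = secSN n1 n2; W = sec n1 n2 West; E = sec n1 n2 East in
     sub_block Q SN SN -
       (sub_block Q SN W + z \<cdot>\<^sub>m sub_block Q SN E) * minv (phi_WE n1 n2 Q z) *
       (sub_block Q W SN + inverse z \<cdot>\<^sub>m sub_block Q E SN))"

definition strip_SN :: "nat \<Rightarrow> nat \<Rightarrow> complex mat \<Rightarrow> complex \<Rightarrow> complex mat" where
  "strip_SN n1 n2 Q w = (let WE = secWE n1 n2; S = sec n1 n2 South; N = sec n1 n2 North in
     sub_block Q WE WE -
       (sub_block Q WE S + inverse w \<cdot>\<^sub>m sub_block Q WE N) * minv (phi_SN n1 n2 Q w) *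
       (sub_block Q S WE + w \<cdot>\<^sub>m sub_block Q N WE))"


section \<open>The operators \<open>G\<^sub>L\<close> and \<open>G\<^sub>R\<close>\<close>

text \<open>Here \<open>K\<close> is a \<open>2n \<times> 2n\<close> matrix whose first \<open>n\<close> coordinates are \<open>L\<close> and last \<open>n\<close> are \<open>R\<close>.\<close>

definition blkLL :: "nat \<Rightarrow> complex mat \<Rightarrow> complex mat" where "blkLL n K = sub_block K (0, n) (0, n)"
definition blkLR :: "nat \<Rightarrow> complex mat \<Rightarrow> complex mat" where "blkLR n K = sub_block K (0, n) (n, n)"
definition blkRL :: "nat \<Rightarrow> complex mat \<Rightarrow> complex mat" where "blkRL n K = sub_block K (n, n) (0, n)"
definition blkRR :: "nat \<Rightarrow> complex mat \<Rightarrow> complex mat" where "blkRR n K = sub_block K (n, n) (n, n)"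

definition phi :: "nat \<Rightarrow> complex mat \<Rightarrow> complex \<Rightarrow> complex mat" where
  "phi n K z = blkLL n K + blkRR n K + z \<cdot>\<^sub>m blkLR n K + inverse z \<cdot>\<^sub>m blkRL n K"

definition is_WL :: "nat \<Rightarrow> complex mat \<Rightarrow> complex mat \<Rightarrow> bool" where
  "is_WL n K W \<longleftrightarrow> W \<in> carrier_mat n n \<and>
     (\<forall>z. 1 < cmod z \<longrightarrow> (\<forall>v \<in> mat_kernel (phi n K z). W *\<^sub>v v = inverse z \<cdot>\<^sub>v v)) \<and>
     (\<forall>v \<in> mat_kernel (blkLR n K). W *\<^sub>v v = 0\<^sub>v n)"

definition is_WR :: "nat \<Rightarrow> complex mat \<Rightarrow> complex mat \<Rightarrow> bool" where
  "is_WR n K W \<longleftrightarrow> W \<in> carrier_mat n n \<and>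
     (\<forall>z. z \<noteq> 0 \<and> cmod z < 1 \<longrightarrow> (\<forall>v \<in> mat_kernel (phi n K z). W *\<^sub>v v = z \<cdot>\<^sub>v v)) \<and>
     (\<forall>v \<in> mat_kernel (blkRL n K). W *\<^sub>v v = 0\<^sub>v n)"

definition riccati_L :: "nat \<Rightarrow> complex mat \<Rightarrow> complex mat \<Rightarrow> bool" where
  "riccati_L n K G \<longleftrightarrow> pos_def UNIV n G \<and>
     G = blkRR n K - blkRL n K * minv (G + blkLL n K) * blkLR n K"

definition riccati_R :: "nat \<Rightarrow> complex mat \<Rightarrow> complex mat \<Rightarrow> bool" where
  "riccati_R n K G \<longleftrightarrow> pos_def UNIV n G \<and>
     G = blkLL n K - blkLR n K * minv (G + blkRR n K) * blkRL n K"

text \<open>The conditions on \<open>W\<close> determine it exactly when the kernels involved span the whole space.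
  This can fail although the non-zero roots of \<open>det (z \<phi>\<^sub>K(z))\<close> are simple, when \<open>z \<phi>\<^sub>K(z)\<close> has a
  nontrivial Jordan chain at \<open>0\<close> (e.g. \<open>n = 2\<close>, \<open>K\<^sub>L\<^sub>L\<close> and \<open>K\<^sub>R\<^sub>R\<close> diagonal, \<open>K\<^sub>L\<^sub>R\<close> a multiple
  of the matrix unit \<open>E\<^sub>2\<^sub>1\<close>). In that degenerate case the positive definite solution of the
  fixed point equation is taken.\<close>

definition G_L :: "nat \<Rightarrow> complex mat \<Rightarrow> complex mat" where
  "G_L n K = (if \<exists>!W. is_WL n K W then blkRR n K + blkRL n K * (THE W. is_WL n K W)
              else (THE G. riccati_L n K G))"

definition G_R :: "nat \<Rightarrow> complex mat \<Rightarrow> complex mat" where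
  "G_R n K = (if \<exists>!W. is_WR n K W then blkLL n K + blkLR n K * (THE W. is_WR n K W)
              else (THE G. riccati_R n K G))"

definition G_inf_S :: "nat \<Rightarrow> nat \<Rightarrow> complex mat \<Rightarrow> complex \<Rightarrow> complex mat" where
  "G_inf_S n1 n2 Q u = G_L n1 (strip_WE n1 n2 Q u)"
definition G_inf_N :: "nat \<Rightarrow> nat \<Rightarrow> complex mat \<Rightarrow> complex \<Rightarrow> complex mat" where
  "G_inf_N n1 n2 Q u = G_R n1 (strip_WE n1 n2 Q u)"
definition G_inf_W :: "nat \<Rightarrow> nat \<Rightarrow> complex mat \<Rightarrow> complex \<Rightarrow> complex mat" where
  "G_inf_W n1 n2 Q u = G_L n2 (strip_SN n1 n2 Q u)"
definition G_inf_E :: "nat \<Rightarrow> nat \<Rightarrow> complex mat \<Rightarrow> complex \<Rightarrow> complex mat" where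
  "G_inf_E n1 n2 Q u = G_R n2 (strip_SN n1 n2 Q u)"


section \<open>Square-summable families and their operators\<close>

text \<open>\<open>l2_space \<K> I\<close> is \<open>\<ell>\<^sup>2(I; \<K>)\<close>, extended by zero outside \<open>I\<close>. Operators on it are total
  functions which vanish outside \<open>l2_space \<K> I\<close>, so that equality of operators is equality of
  functions.\<close>

definition l2_space :: "complex set \<Rightarrow> 'i set \<Rightarrow> ('i \<Rightarrow> complex) set" where
  "l2_space \<K> I = {x. (\<forall>i\<in>I. x i \<in> \<K>) \<and> (\<forall>i. i \<notin> I \<longrightarrow> x i = 0) \<and> (\<lambda>i. (cmod (x i))\<^sup>2) summable_on I}"

definition l2_inner :: "('i \<Rightarrow> complex) \<Rightarrow> ('i \<Rightarrow> complex) \<Rightarrow> complex" where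
  "l2_inner x y = (\<Sum>\<^sub>\<infinity>i. cnj (x i) * y i)"

definition l2_norm :: "('i \<Rightarrow> complex) \<Rightarrow> real" where
  "l2_norm x = sqrt (\<Sum>\<^sub>\<infinity>i. (cmod (x i))\<^sup>2)"

type_synonym 'i l2_op = "('i \<Rightarrow> complex) \<Rightarrow> ('i \<Rightarrow> complex)"

definition on_l2 :: "complex set \<Rightarrow> 'i set \<Rightarrow> 'i l2_op \<Rightarrow> 'i l2_op" where
  "on_l2 \<K> I M x = (if x \<in> l2_space \<K> I then M x else (\<lambda>_. 0))"

text \<open>Bounded self-adjoint operators \<open>M\<close> with positive infimum of
  \<open>\<langle>x, M x\<rangle> / \<langle>x, x\<rangle>\<close> over \<open>x \<noteq> 0\<close>.\<close>

definition coercive_ops :: "complex set \<Rightarrow> 'i set \<Rightarrow> 'i l2_op set" where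
  "coercive_ops \<K> I = {M.
     (\<forall>x. x \<notin> l2_space \<K> I \<longrightarrow> M x = (\<lambda>_. 0)) \<and>
     (\<forall>x \<in> l2_space \<K> I. M x \<in> l2_space \<K> I) \<and>
     (\<forall>x \<in> l2_space \<K> I. \<forall>y \<in> l2_space \<K> I. M (\<lambda>i. x i + y i) = (\<lambda>i. M x i + M y i)) \<and>
     (\<forall>c \<in> \<K>. \<forall>x \<in> l2_space \<K> I. M (\<lambda>i. c * x i) = (\<lambda>i. c * M x i)) \<and>
     (\<exists>B. \<forall>x \<in> l2_space \<K> I. l2_norm (M x) \<le> B * l2_norm x) \<and>
     (\<forall>x \<in> l2_space \<K> I. \<forall>y \<in> l2_space \<K> I. l2_inner x (M y) = l2_inner (M x) y) \<and>
     (\<exists>c>0. \<forall>x \<in> l2_space \<K> I. c * Re (l2_inner x x) \<le> Re (l2_inner x (M x)))}"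

definition restr :: "'i set \<Rightarrow> ('i \<Rightarrow> complex) \<Rightarrow> ('i \<Rightarrow> complex)" where
  "restr I x i = (if i \<in> I then x i else 0)"

text \<open>\<open>M\<^sub>1\<^sub>1 - M\<^sub>1\<^sub>2 M\<^sub>2\<^sub>2\<^sup>-\<^sup>1 M\<^sub>2\<^sub>1\<close>, where \<open>M\<close> acts on \<open>l2_space \<K> (I \<union> V)\<close>, the index 2 refers
  to \<open>V\<close> and the index 1 to \<open>I\<close>.\<close>

definition schur :: "complex set \<Rightarrow> 'i set \<Rightarrow> 'i set \<Rightarrow> 'i l2_op \<Rightarrow> 'i l2_op" where
  "schur \<K> I V M = on_l2 \<K> I (\<lambda>x. let y = the_inv_into (l2_space \<K> V) (\<lambda>y. restr V (M y)) (restr V (M x))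
     in restr I (\<lambda>i. M x i - M y i))"

text \<open>Conjugation of \<open>M\<close> by the unitary map induced by a relabelling \<open>\<pi>\<close> of the indices, injective
  on \<open>I\<close>, followed by extension by zero.\<close>

definition relabel :: "('i \<Rightarrow> 'i) \<Rightarrow> 'i set \<Rightarrow> 'i l2_op \<Rightarrow> 'i l2_op" where
  "relabel \<pi> I M x = (let y = M (restr I (\<lambda>i. x (\<pi> i)))
     in (\<lambda>i. if i \<in> \<pi> ` I then y (the_inv_into I \<pi> i) else 0))"


section \<open>Shapes\<close>

text \<open>Horizontal or vertical extent of a shape: a unit segment, a half-line towards West or South
  (\<open>Neg\<close>), a half-line towards East or North (\<open>Pos\<close>), or a line. A shape is given by its
  horizontal and its vertical extent; it has, for instance, a South side iff its vertical extent
  is bounded below. The label \<open>(e, k, j)\<close> is the \<open>j\<close>-th coordinate on the \<open>k\<close>-th unit segment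
  of the side \<open>e\<close>.\<close>

datatype extent = Unit | Neg | Pos | Line

fun positions :: "extent \<Rightarrow> int set" where
  "positions Unit = {0}"
| "positions Neg = {..<0}"
| "positions Pos = {0..}"
| "positions Line = UNIV"

type_synonym label = "edge \<times> int \<times> nat"

fun sides :: "extent \<Rightarrow> extent \<Rightarrow> edge set" where
  "sides h v = (if v \<in> {Unit, Pos} then {South} else {}) \<union> (if v \<in> {Unit, Neg} then {North} else {}) \<union>
               (if h \<in> {Unit, Pos} then {West} else {}) \<union> (if h \<in> {Unit, Neg} then {East} else {})"

definition shape :: "nat \<Rightarrow> nat \<Rightarrow> extent \<Rightarrow> extent \<Rightarrow> label set" where
  "shape n1 n2 h v =
     (sides h v \<inter> {South, North}) \<times> positions h \<times> {..<n1} \<union>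
     (sides h v \<inter> {West, East}) \<times> positions v \<times> {..<n2}"

abbreviation shape_ops :: "complex set \<Rightarrow> nat \<Rightarrow> nat \<Rightarrow> extent \<Rightarrow> extent \<Rightarrow> label l2_op set" where
  "shape_ops \<K> n1 n2 h v \<equiv> coercive_ops \<K> (shape n1 n2 h v)"

definition face_op :: "complex set \<Rightarrow> nat \<Rightarrow> nat \<Rightarrow> complex mat \<Rightarrow> label l2_op" where
  "face_op \<K> n1 n2 Q = (let I = shape n1 n2 Unit Unit; ix = (\<lambda>(e, k, j). fst (sec n1 n2 e) + j) in
     on_l2 \<K> I (\<lambda>x. restr I (\<lambda>a. \<Sum>b\<in>I. Q $$ (ix a, ix b) * x b)))"


section \<open>Gluing\<close>

text \<open>Translations of the two pieces, given by their extents in the direction of gluing. A unit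
  segment appended to the half-line \<open>Neg\<close> takes position \<open>-1\<close> and one prepended to \<open>Pos\<close> takes
  position \<open>0\<close>, the half-line being pushed away by one step, so that the result is again indexed
  by the same half-line. Two opposite half-lines are not translated and form a line.\<close>

fun shifts :: "extent \<Rightarrow> extent \<Rightarrow> int \<times> int" where
  "shifts Neg Unit = (-1, -1)"
| "shifts Unit Pos = (0, 1)"
| "shifts _ _ = (0, 0)"

text \<open>\<open>hplace c d\<close> translates a shape horizontally by \<open>d\<close> and renames its side \<open>c\<close> to \<open>Cut\<close>;
  \<open>vplace\<close> does the same vertically.\<close>

fun hplace :: "edge \<Rightarrow> int \<Rightarrow> label \<Rightarrow> label" where
  "hplace c d (e, k, j) = (if e = c then (Cut, k, j)
     else if e \<in> {South, North} then (e, k + d, j) else (e, k, j))"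

fun vplace :: "edge \<Rightarrow> int \<Rightarrow> label \<Rightarrow> label" where
  "vplace c d (e, k, j) = (if e = c then (Cut, k, j)
     else if e \<in> {West, East} then (e, k + d, j) else (e, k, j))"

definition glue :: "complex set \<Rightarrow> (label \<Rightarrow> label) \<Rightarrow> label set \<Rightarrow> label l2_op \<Rightarrow>
    (label \<Rightarrow> label) \<Rightarrow> label set \<Rightarrow> label l2_op \<Rightarrow> label l2_op" where
  "glue \<K> \<pi> I M \<pi>' I' M' = (let J = \<pi> ` I \<union> \<pi>' ` I'; V = {a \<in> J. fst a = Cut} in
     schur \<K> (J - V) V (\<lambda>x i. relabel \<pi> I M x i + relabel \<pi>' I' M' x i))"

text \<open>\<open>hglue \<K> n1 n2 v h M h' M'\<close> glues the East side of \<open>M\<close>, of horizontal extent \<open>h\<close>, to the West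
  side of \<open>M'\<close>, of horizontal extent \<open>h'\<close>, the vertical extent of both being \<open>v\<close>. Likewise
  \<open>vglue\<close> glues the North side of \<open>M\<close> to the South side of \<open>M'\<close>.\<close>

definition hglue :: "complex set \<Rightarrow> nat \<Rightarrow> nat \<Rightarrow> extent \<Rightarrow> extent \<Rightarrow> label l2_op \<Rightarrow>
    extent \<Rightarrow> label l2_op \<Rightarrow> label l2_op" where
  "hglue \<K> n1 n2 v h M h' M' = (let (d, d') = shifts h h' in
     glue \<K> (hplace East d) (shape n1 n2 h v) M (hplace West d') (shape n1 n2 h' v) M')"

definition vglue :: "complex set \<Rightarrow> nat \<Rightarrow> nat \<Rightarrow> extent \<Rightarrow> extent \<Rightarrow> label l2_op \<Rightarrow>
    extent \<Rightarrow> label l2_op \<Rightarrow> label l2_op" where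
  "vglue \<K> n1 n2 h v M v' M' = (let (d, d') = shifts v v' in
     glue \<K> (vplace North d) (shape n1 n2 h v) M (vplace South d') (shape n1 n2 h v') M')"


section \<open>Fixed points\<close>

definition fix_W :: "complex set \<Rightarrow> nat \<Rightarrow> nat \<Rightarrow> complex mat \<Rightarrow> label l2_op" where
  "fix_W \<K> n1 n2 Q = (THE M. M \<in> shape_ops \<K> n1 n2 Neg Unit \<and>
     hglue \<K> n1 n2 Unit Neg M Unit (face_op \<K> n1 n2 Q) = M)"

definition fix_E :: "complex set \<Rightarrow> nat \<Rightarrow> nat \<Rightarrow> complex mat \<Rightarrow> label l2_op" where
  "fix_E \<K> n1 n2 Q = (THE M. M \<in> shape_ops \<K> n1 n2 Pos Unit \<and>
     hglue \<K> n1 n2 Unit Unit (face_op \<K> n1 n2 Q) Pos M = M)"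

definition fix_S :: "complex set \<Rightarrow> nat \<Rightarrow> nat \<Rightarrow> complex mat \<Rightarrow> label l2_op" where
  "fix_S \<K> n1 n2 Q = (THE M. M \<in> shape_ops \<K> n1 n2 Unit Neg \<and>
     vglue \<K> n1 n2 Unit Neg M Unit (face_op \<K> n1 n2 Q) = M)"

definition fix_N :: "complex set \<Rightarrow> nat \<Rightarrow> nat \<Rightarrow> complex mat \<Rightarrow> label l2_op" where
  "fix_N \<K> n1 n2 Q = (THE M. M \<in> shape_ops \<K> n1 n2 Unit Pos \<and>
     vglue \<K> n1 n2 Unit Unit (face_op \<K> n1 n2 Q) Pos M = M)"

definition fix_SW :: "complex set \<Rightarrow> nat \<Rightarrow> nat \<Rightarrow> complex mat \<Rightarrow> label l2_op" where
  "fix_SW \<K> n1 n2 Q = (THE M. M \<in> shape_ops \<K> n1 n2 Neg Neg \<and>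
     hglue \<K> n1 n2 Neg Neg M Unit (fix_S \<K> n1 n2 Q) = M \<and>
     vglue \<K> n1 n2 Neg Neg M Unit (fix_W \<K> n1 n2 Q) = M)"

definition fix_SE :: "complex set \<Rightarrow> nat \<Rightarrow> nat \<Rightarrow> complex mat \<Rightarrow> label l2_op" where
  "fix_SE \<K> n1 n2 Q = (THE M. M \<in> shape_ops \<K> n1 n2 Pos Neg \<and>
     hglue \<K> n1 n2 Neg Unit (fix_S \<K> n1 n2 Q) Pos M = M \<and>
     vglue \<K> n1 n2 Pos Neg M Unit (fix_E \<K> n1 n2 Q) = M)"

definition fix_NW :: "complex set \<Rightarrow> nat \<Rightarrow> nat \<Rightarrow> complex mat \<Rightarrow> label l2_op" where
  "fix_NW \<K> n1 n2 Q = (THE M. M \<in> shape_ops \<K> n1 n2 Neg Pos \<and>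
     hglue \<K> n1 n2 Pos Neg M Unit (fix_N \<K> n1 n2 Q) = M \<and>
     vglue \<K> n1 n2 Neg Unit (fix_W \<K> n1 n2 Q) Pos M = M)"

definition fix_NE :: "complex set \<Rightarrow> nat \<Rightarrow> nat \<Rightarrow> complex mat \<Rightarrow> label l2_op" where
  "fix_NE \<K> n1 n2 Q = (THE M. M \<in> shape_ops \<K> n1 n2 Pos Pos \<and>
     hglue \<K> n1 n2 Pos Unit (fix_N \<K> n1 n2 Q) Pos M = M \<and>
     vglue \<K> n1 n2 Pos Unit (fix_E \<K> n1 n2 Q) Pos M = M)"


section \<open>Fourier multipliers\<close>

text \<open>\<open>f\<close> is, as a function of the angle \<open>\<theta>\<close>, the square-integrable function on the circle with
  Fourier series \<open>\<Sum>\<^sub>k a(k) e\<^sup>i\<^sup>k\<^sup>\<theta>\<close>, convergent in \<open>L\<^sup>2\<close>.\<close>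

definition fourier_L2 :: "(int \<Rightarrow> complex) \<Rightarrow> (real \<Rightarrow> complex) \<Rightarrow> bool" where
  "fourier_L2 a f \<longleftrightarrow>
     f \<in> borel_measurable (lebesgue_on {-pi..pi}) \<and>
     integrable (lebesgue_on {-pi..pi}) (\<lambda>\<theta>. (cmod (f \<theta>))\<^sup>2) \<and>
     (\<lambda>N::nat. LINT \<theta>|lebesgue_on {-pi..pi}.
        (cmod (f \<theta> - (\<Sum>k\<in>{- int N..int N}. a k * cis (of_int k * \<theta>))))\<^sup>2) \<longlonglongrightarrow> 0"

text \<open>The \<open>p\<close>-th edge of the list \<open>es\<close> carries the coordinates \<open>p * n, \<dots>, p * n + n - 1\<close> of the
  symbol \<open>F\<close>, a function on the unit circle.\<close>

definition multiplier :: "complex set \<Rightarrow> edge list \<Rightarrow> nat \<Rightarrow> (complex \<Rightarrow> complex mat) \<Rightarrow> label l2_op" where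
  "multiplier \<K> es n F = (let I = set es \<times> UNIV \<times> {..<n} in on_l2 \<K> I (\<lambda>f.
     THE g. g \<in> l2_space \<K> I \<and>
       (\<exists>f'::real \<Rightarrow> complex vec.
          (\<forall>\<theta>. f' \<theta> \<in> carrier_vec (length es * n)) \<and>
          (\<forall>p < length es. \<forall>j < n.
             fourier_L2 (\<lambda>k. f (es ! p, k, j)) (\<lambda>\<theta>. f' \<theta> $ (p * n + j)) \<and>
             fourier_L2 (\<lambda>k. g (es ! p, k, j)) (\<lambda>\<theta>. (F (cis \<theta>) *\<^sub>v f' \<theta>) $ (p * n + j))))))"

text \<open>The half-plane extending to the South has a North side only, and so on.\<close>

definition Q_infWE :: "complex set \<Rightarrow> nat \<Rightarrow> nat \<Rightarrow> complex mat \<Rightarrow> label l2_op" where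
  "Q_infWE \<K> n1 n2 Q = multiplier \<K> [South, North] n1 (strip_WE n1 n2 Q)"
definition Q_infWE_infS :: "complex set \<Rightarrow> nat \<Rightarrow> nat \<Rightarrow> complex mat \<Rightarrow> label l2_op" where
  "Q_infWE_infS \<K> n1 n2 Q = multiplier \<K> [North] n1 (G_inf_S n1 n2 Q)"
definition Q_infWE_infN :: "complex set \<Rightarrow> nat \<Rightarrow> nat \<Rightarrow> complex mat \<Rightarrow> label l2_op" where
  "Q_infWE_infN \<K> n1 n2 Q = multiplier \<K> [South] n1 (G_inf_N n1 n2 Q)"
definition Q_infSN :: "complex set \<Rightarrow> nat \<Rightarrow> nat \<Rightarrow> complex mat \<Rightarrow> label l2_op" where
  "Q_infSN \<K> n1 n2 Q = multiplier \<K> [West, East] n2 (strip_SN n1 n2 Q)"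
definition Q_infW_infSN :: "complex set \<Rightarrow> nat \<Rightarrow> nat \<Rightarrow> complex mat \<Rightarrow> label l2_op" where
  "Q_infW_infSN \<K> n1 n2 Q = multiplier \<K> [East] n2 (G_inf_W n1 n2 Q)"
definition Q_infE_infSN :: "complex set \<Rightarrow> nat \<Rightarrow> nat \<Rightarrow> complex mat \<Rightarrow> label l2_op" where
  "Q_infE_infSN \<K> n1 n2 Q = multiplier \<K> [West] n2 (G_inf_E n1 n2 Q)"

end

theory Submission
  imports Defs
begin

text \<open>All operators of the theorem are Dirichlet-to-Neumann operators of a single quadratic form, the
  sum of the face forms over a region of the square lattice. Gluing two regions along a cut yields
  the Dirichlet-to-Neumann operator of their union, so those of the half-strips and of the quarter
  planes solve the fixed point equations; the solutions are unique, because iterating such an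
  equation spreads a finite energy over infinitely many cuts. Hence the right-hand sides are the
  operators of strips and half-planes. A Fourier transform along the strip turns the
  equilibrium equations into linear relations at almost every angle: eliminating the edges inside a row
  gives the strip function, and the successive rows of a half-plane form a square summable, hence
  decaying, chain, which forces the positive definite solution of the Riccati equation. The
  orientation of the Fourier series exchanges West and East, which is harmless for coercivity and
  invisible under dihedral invariance.\<close>

section \<open>Square-summable families\<close>

text \<open>The multipliers are never analysed as functions of the angle. Coercivity, boundedness
  and, for real scalars, reality are established for the lattice operators, which are then shown to
  satisfy the description that defines a multiplier; measurability is inherited, by equality almost
  everywhere, from the transform of an output that exists already. All work on \<open>G_L\<close>
  thus happens at one angle, and the delicate point is its definition by cases. Any positive
  definite solution of the Riccati equation yields a matrix with the properties required of W, and a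
  discrete Wronskian shows that such a solution is unique, so both branches give the same matrix.
  Its existence comes from the lattice itself, through a face operator without vertical coordinates.
  The same Wronskian, for operators in place of matrices, gives uniqueness of the fixed points.
  Equilibrium is used in weak form, tested against all square-summable fields, because sesquilinear
  forms add over disjoint sets of faces whereas forces on shared edges have to be matched.\<close>

abbreviation l2 :: "('i \<Rightarrow> complex) \<Rightarrow> bool" where
  "l2 x \<equiv> (\<lambda>i. (cmod (x i))\<^sup>2) summable_on UNIV"

text \<open>Families vanish outside the index set, so square summability may be tested over the
  whole type. Later estimates then carry no index set, and \<open>l2_inner\<close> and
  \<open>l2_norm\<close>, which sum over the type, apply directly.\<close>

lemma l2_space_iff:
  "x \<in> l2_space \<K> I \<longleftrightarrow> (\<forall>i\<in>I. x i \<in> \<K>) \<and> (\<forall>i. i \<notin> I \<longrightarrow> x i = 0) \<and> l2 x"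
proof -
  have "(\<lambda>i. (cmod (x i))\<^sup>2) summable_on I \<longleftrightarrow> l2 x" if "\<forall>i. i \<notin> I \<longrightarrow> x i = 0"
    using that by (intro summable_on_cong_neutral) auto
  then show ?thesis by (auto simp: l2_space_def)
qed

lemma l2_comparison:
  assumes "l2 x" "\<And>i. cmod (y i) \<le> c * cmod (x i)"
  shows "l2 y"
proof (rule summable_on_comparison_test[where f = "\<lambda>i. c\<^sup>2 * (cmod (x i))\<^sup>2"])
  show "(\<lambda>i. c\<^sup>2 * (cmod (x i))\<^sup>2) summable_on UNIV"
    using assms(1) by (rule summable_on_cmult_right)
  show "(cmod (y i))\<^sup>2 \<le> c\<^sup>2 * (cmod (x i))\<^sup>2" for i
    using power_mono[OF assms(2), of i 2] by (simp add: power_mult_distrib)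
qed auto

lemma l2_zero [simp]: "l2 (\<lambda>_. 0)"
  by simp

lemma l2_add: assumes "l2 x" "l2 y" shows "l2 (\<lambda>i. x i + y i)"
proof (rule summable_on_comparison_test[where f = "\<lambda>i. 2 * (cmod (x i))\<^sup>2 + 2 * (cmod (y i))\<^sup>2"])
  show "(\<lambda>i. 2 * (cmod (x i))\<^sup>2 + 2 * (cmod (y i))\<^sup>2) summable_on UNIV"
    using assms by (intro summable_on_add summable_on_cmult_right)
  show "(cmod (x i + y i))\<^sup>2 \<le> 2 * (cmod (x i))\<^sup>2 + 2 * (cmod (y i))\<^sup>2" for i
  proof -
    have "(cmod (x i + y i))\<^sup>2 \<le> (cmod (x i) + cmod (y i))\<^sup>2"
      by (intro power_mono norm_triangle_ineq) auto
    also have "\<dots> \<le> 2 * (cmod (x i))\<^sup>2 + 2 * (cmod (y i))\<^sup>2"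
      using sum_squares_bound[of "cmod (x i)" "cmod (y i)"] by (simp add: power2_sum)
    finally show ?thesis .
  qed
qed auto

lemma l2_cmult: "l2 x \<Longrightarrow> l2 (\<lambda>i. c * x i)"
  by (rule l2_comparison[where c = "cmod c"]) (auto simp: norm_mult)

lemma l2_uminus: "l2 x \<Longrightarrow> l2 (\<lambda>i. - x i)"
  by simp

lemma l2_diff: assumes "l2 x" "l2 y" shows "l2 (\<lambda>i. x i - y i)"
  using l2_add[OF assms(1) l2_uminus[OF assms(2)]] by simp

lemma l2_sum: "finite A \<Longrightarrow> (\<And>a. a \<in> A \<Longrightarrow> l2 (x a)) \<Longrightarrow> l2 (\<lambda>i. \<Sum>a\<in>A. x a i)"
  by (induction A rule: finite_induct) (auto intro: l2_add)

lemma l2_restr: "l2 x \<Longrightarrow> l2 (restr I x)"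
  by (rule l2_comparison[where c = 1]) (auto simp: restr_def)

lemma l2_finite_support: "finite A \<Longrightarrow> (\<And>i. i \<notin> A \<Longrightarrow> x i = 0) \<Longrightarrow> l2 x"
  by (rule finite_nonzero_values_imp_summable_on, rule finite_subset[of _ A]) auto

lemma l2_reindex: assumes "l2 x" "inj_on g I" shows "l2 (restr I (\<lambda>i. x (g i)))"
proof -
  have "(\<lambda>i. (cmod (x i))\<^sup>2) summable_on g ` I"
    using assms(1) summable_on_subset_banach by blast
  then have "(\<lambda>i. (cmod (x (g i)))\<^sup>2) summable_on I"
    using assms(2) by (simp add: summable_on_reindex o_def)
  moreover have "l2 (restr I (\<lambda>i. x (g i))) \<longleftrightarrow> (\<lambda>i. (cmod (x (g i)))\<^sup>2) summable_on I"
    by (rule summable_on_cong_neutral) (auto simp: restr_def)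
  ultimately show ?thesis by simp
qed

lemma l2_mult_summable:
  assumes "l2 x" "l2 y" shows "(\<lambda>i. cnj (x i) * y i) summable_on UNIV"
proof -
  have "(\<lambda>i. cmod (cnj (x i) * y i)) summable_on UNIV"
    by (rule abs_summable_product) (use assms in \<open>auto simp: norm_mult power2_eq_square\<close>)
  then show ?thesis by (rule abs_summable_summable)
qed

lemma l2_inner_cong: "(\<And>i. cnj (x i) * y i = cnj (x' i) * y' i) \<Longrightarrow> l2_inner x y = l2_inner x' y'"
  unfolding l2_inner_def by (rule infsum_cong) auto

lemma l2_inner_add_right: "l2 x \<Longrightarrow> l2 y \<Longrightarrow> l2 z \<Longrightarrow>
    l2_inner x (\<lambda>i. y i + z i) = l2_inner x y + l2_inner x z"
  unfolding l2_inner_def by (simp add: distrib_left infsum_add l2_mult_summable)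

lemma l2_inner_add_left: "l2 x \<Longrightarrow> l2 y \<Longrightarrow> l2 z \<Longrightarrow>
    l2_inner (\<lambda>i. x i + y i) z = l2_inner x z + l2_inner y z"
  unfolding l2_inner_def by (simp add: distrib_right infsum_add l2_mult_summable)

lemma l2_inner_cmult_right: "l2_inner x (\<lambda>i. c * y i) = c * l2_inner x y"
  unfolding l2_inner_def by (simp add: mult.left_commute infsum_cmult_right')

lemma l2_inner_uminus_right: "l2_inner x (\<lambda>i. - y i) = - l2_inner x y"
  using l2_inner_cmult_right[of x "-1" y] by simp

lemma l2_inner_diff_right: "l2 x \<Longrightarrow> l2 y \<Longrightarrow> l2 z \<Longrightarrow>
    l2_inner x (\<lambda>i. y i - z i) = l2_inner x y - l2_inner x z"
  using l2_inner_add_right[OF _ _ l2_uminus[of z], of x y] by (simp add: l2_inner_uminus_right)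

lemma l2_inner_commute: "l2_inner y x = cnj (l2_inner x y)"
  unfolding l2_inner_def by (subst infsum_cnj[symmetric]) (simp add: mult.commute)

lemma l2_inner_zero [simp]: "l2_inner (\<lambda>_. 0) y = 0" "l2_inner x (\<lambda>_. 0) = 0"
  by (auto simp: l2_inner_def)

lemma l2_norm_nonneg [simp]: "0 \<le> l2_norm x"
  by (auto simp: l2_norm_def infsum_nonneg)

lemma l2_norm_power2: "(l2_norm x)\<^sup>2 = (\<Sum>\<^sub>\<infinity>i. (cmod (x i))\<^sup>2)"
  by (simp add: l2_norm_def infsum_nonneg)

lemma l2_inner_self: "l2 x \<Longrightarrow> l2_inner x x = complex_of_real ((l2_norm x)\<^sup>2)"
  unfolding l2_inner_def l2_norm_power2
proof (rule infsumI)
  assume "l2 x"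
  then have "((\<lambda>i. (cmod (x i))\<^sup>2) has_sum (\<Sum>\<^sub>\<infinity>i. (cmod (x i))\<^sup>2)) UNIV" by simp
  then have "((\<lambda>i. complex_of_real ((cmod (x i))\<^sup>2)) has_sum complex_of_real (\<Sum>\<^sub>\<infinity>i. (cmod (x i))\<^sup>2)) UNIV"
    by (rule has_sum_of_real)
  then show "((\<lambda>i. cnj (x i) * x i) has_sum complex_of_real (\<Sum>\<^sub>\<infinity>i. (cmod (x i))\<^sup>2)) UNIV"
    by (simp only: complex_norm_square mult.commute[of "cnj _"])
qed

lemma Re_l2_inner_self: "l2 x \<Longrightarrow> Re (l2_inner x x) = (l2_norm x)\<^sup>2"
  by (simp add: l2_inner_self)

lemma L2_set_le_l2_norm: assumes "l2 x" shows "L2_set (\<lambda>i. cmod (x i)) F \<le> l2_norm x"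
proof (cases "finite F")
  case True
  then show ?thesis unfolding L2_set_def l2_norm_def
    by (intro real_sqrt_le_mono finite_sum_le_infsum) (use assms in auto)
qed simp

lemma norm_le_l2_norm: "l2 x \<Longrightarrow> cmod (x i) \<le> l2_norm x"
  using L2_set_le_l2_norm[of x "{i}"] by (simp add: L2_set_def)

lemma l2_norm_eq_0: "l2 x \<Longrightarrow> l2_norm x = 0 \<Longrightarrow> x = (\<lambda>_. 0)"
  using norm_le_l2_norm[of x] by fastforce

lemma l2_norm_zero [simp]: "l2_norm (\<lambda>_. 0) = 0"
  by (simp add: l2_norm_def)

text \<open>Finite sections decide both membership and the norm, so inequalities proved for
  \<open>L2_set\<close> pass to families; the triangle inequality and the limit lemma below rest on
  this.\<close>

lemma l2_norm_leI:
  assumes "0 \<le> B" "\<And>F. finite F \<Longrightarrow> L2_set (\<lambda>i. cmod (x i)) F \<le> B"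
  shows "l2 x" "l2_norm x \<le> B"
proof -
  have *: "(\<Sum>i\<in>F. (cmod (x i))\<^sup>2) \<le> B\<^sup>2" if "finite F" for F
    using assms(2)[OF that] assms(1) by (simp add: L2_set_def real_sqrt_le_iff' sum_nonneg)
  show "l2 x"
    by (rule nonneg_bdd_above_summable_on) (auto intro!: bdd_aboveI2 *)
  then have "(\<Sum>\<^sub>\<infinity>i. (cmod (x i))\<^sup>2) \<le> B\<^sup>2"
    by (intro infsum_le_finite_sums *)
  then show "l2_norm x \<le> B"
    using assms(1) by (simp add: l2_norm_def real_le_lsqrt)
qed

lemma l2_Cauchy_Schwarz:
  assumes "l2 x" "l2 y" shows "cmod (l2_inner x y) \<le> l2_norm x * l2_norm y"
proof -
  have abs: "(\<lambda>i. cmod (cnj (x i) * y i)) summable_on UNIV"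
    by (rule abs_summable_product) (use assms in \<open>auto simp: norm_mult power2_eq_square\<close>)
  have "cmod (l2_inner x y) \<le> (\<Sum>\<^sub>\<infinity>i. cmod (cnj (x i) * y i))"
    unfolding l2_inner_def by (rule norm_infsum_bound[OF abs])
  also have "\<dots> \<le> l2_norm x * l2_norm y"
  proof (rule infsum_le_finite_sums[OF abs])
    fix F :: "'a set"
    have "(\<Sum>i\<in>F. cmod (cnj (x i) * y i)) \<le> L2_set (\<lambda>i. cmod (x i)) F * L2_set (\<lambda>i. cmod (y i)) F"
      using L2_set_mult_ineq[of "\<lambda>i. cmod (x i)" "\<lambda>i. cmod (y i)" F] by (simp add: norm_mult)
    also have "\<dots> \<le> l2_norm x * l2_norm y"
      by (intro mult_mono L2_set_le_l2_norm assms) auto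
    finally show "(\<Sum>i\<in>F. cmod (cnj (x i) * y i)) \<le> l2_norm x * l2_norm y" .
  qed
  finally show ?thesis .
qed

lemma l2_norm_triangle: assumes "l2 x" "l2 y"
  shows "l2_norm (\<lambda>i. x i + y i) \<le> l2_norm x + l2_norm y"
proof (rule l2_norm_leI)
  fix F :: "'a set" assume "finite F"
  have "L2_set (\<lambda>i. cmod (x i + y i)) F \<le> L2_set (\<lambda>i. cmod (x i) + cmod (y i)) F"
    by (rule L2_set_mono) (auto intro: norm_triangle_ineq)
  also have "\<dots> \<le> L2_set (\<lambda>i. cmod (x i)) F + L2_set (\<lambda>i. cmod (y i)) F"
    by (rule L2_set_triangle_ineq)
  also have "\<dots> \<le> l2_norm x + l2_norm y"
    by (intro add_mono L2_set_le_l2_norm assms)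
  finally show "L2_set (\<lambda>i. cmod (x i + y i)) F \<le> l2_norm x + l2_norm y" .
qed auto

lemma l2_norm_cmult: "l2_norm (\<lambda>i. c * x i) = cmod c * l2_norm x"
  by (simp add: l2_norm_def norm_mult power_mult_distrib infsum_cmult_right' real_sqrt_mult)

lemma l2_norm_uminus: "l2_norm (\<lambda>i. - x i) = l2_norm x"
  by (simp add: l2_norm_def)

lemma l2_norm_mono: "l2 y \<Longrightarrow> (\<And>i. cmod (x i) \<le> cmod (y i)) \<Longrightarrow> l2_norm x \<le> l2_norm y"
  unfolding l2_norm_def
  by (intro real_sqrt_le_mono infsum_mono l2_comparison[where x = y and y = x and c = 1] power_mono) auto

section \<open>Completeness under geometric convergence\<close>

text \<open>A form of Fatou's lemma: for fixed n the bound survives the limit in m on each finite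
  section, where only finitely many coordinates move, and only afterwards on the whole
  family.\<close>

lemma l2_limit_pointwise:
  assumes X: "\<And>n. l2 (X n)" and "\<And>i. (\<lambda>n. X n i) \<longlonglongrightarrow> x i"
    and r: "\<And>n m. n \<le> m \<Longrightarrow> l2_norm (\<lambda>i. X m i - X n i) \<le> r n"
  shows "l2 (\<lambda>i. x i - X n i)" "l2_norm (\<lambda>i. x i - X n i) \<le> r n"
proof -
  have L: "L2_set (\<lambda>i. cmod (x i - X n i)) F \<le> r n" if "finite F" for F
  proof (rule LIMSEQ_le_const2)
    show "(\<lambda>m. L2_set (\<lambda>i. cmod (X m i - X n i)) F) \<longlonglongrightarrow> L2_set (\<lambda>i. cmod (x i - X n i)) F"
      unfolding L2_set_def by (intro tendsto_intros assms(2))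
    have "L2_set (\<lambda>i. cmod (X m i - X n i)) F \<le> r n" if "n \<le> m" for m
      using r[OF that] L2_set_le_l2_norm[of "\<lambda>i. X m i - X n i" F] l2_diff[OF X X, of m n] by linarith
    then show "\<exists>N. \<forall>m\<ge>N. L2_set (\<lambda>i. cmod (X m i - X n i)) F \<le> r n" by blast
  qed
  have "0 \<le> r n" using order_trans[OF l2_norm_nonneg r[of n n]] by simp
  from l2_norm_leI[OF this L]
  show "l2 (\<lambda>i. x i - X n i)" "l2_norm (\<lambda>i. x i - X n i) \<le> r n" by simp_all
qed

text \<open>Each coordinate is dominated by the norm, so the coordinate differences are summable and
  a pointwise limit exists; geometric decay of the steps supplies the Cauchy bound
  \<open>C * q ^ n / (1 - q)\<close> that upgrades it to a limit in norm.\<close>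

lemma l2_complete_geometric:
  assumes X: "\<And>n. l2 (X n)" and d: "\<And>n. l2_norm (\<lambda>i. X (Suc n) i - X n i) \<le> C * q ^ n"
    and q: "0 \<le> q" "q < 1"
  obtains x where "l2 x" "\<And>i. (\<lambda>n. X n i) \<longlonglongrightarrow> x i" "(\<lambda>n. l2_norm (\<lambda>i. x i - X n i)) \<longlonglongrightarrow> 0"
proof -
  define x where "x i = lim (\<lambda>n. X n i)" for i
  have C: "0 \<le> C" using order_trans[OF l2_norm_nonneg d[of 0]] by simp
  have geo: "l2_norm (\<lambda>i. X (n + k) i - X n i) \<le> C * q ^ n * (1 - q ^ k) / (1 - q)" for n k
  proof (induction k)
    case (Suc k)
    have "l2_norm (\<lambda>i. X (n + Suc k) i - X n i)
        = l2_norm (\<lambda>i. (X (Suc (n + k)) i - X (n + k) i) + (X (n + k) i - X n i))" by simp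
    also have "\<dots> \<le> C * q ^ (n + k) + C * q ^ n * (1 - q ^ k) / (1 - q)"
      by (rule order_trans[OF l2_norm_triangle[OF l2_diff[OF X X] l2_diff[OF X X]] add_mono[OF d Suc]])
    also have "\<dots> = C * q ^ n * (1 - q ^ Suc k) / (1 - q)"
      using q by (simp add: field_simps power_add)
    finally show ?case .
  qed simp
  have r: "l2_norm (\<lambda>i. X m i - X n i) \<le> C * q ^ n / (1 - q)" if that_le: "n \<le> m" for n m :: nat
  proof -
    obtain k where m: "m = n + k" using le_Suc_ex[OF that_le] by blast
    have "C * q ^ n * (1 - q ^ k) / (1 - q) \<le> C * q ^ n * 1 / (1 - q)"
      using q C by (intro divide_right_mono mult_left_mono) auto
    then show ?thesis using geo[of n k] m by simp
  qed
  have lim: "(\<lambda>n. X n i) \<longlonglongrightarrow> x i" for i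
  proof -
    have "summable (\<lambda>n. X (Suc n) i - X n i)"
    proof (rule summable_comparison_test')
      show "summable (\<lambda>n. C * q ^ n)" using q by (intro summable_mult summable_geometric) auto
      show "norm (X (Suc n) i - X n i) \<le> C * q ^ n" if "0 \<le> n" for n
        using norm_le_l2_norm[OF l2_diff[OF X[of "Suc n"] X[of n]], of i] d[of n] by linarith
    qed
    then have "convergent (\<lambda>n. (\<Sum>k<n. X (Suc k) i - X k i))"
      by (simp add: summable_iff_convergent)
    then have "convergent (\<lambda>n. (X n i - X 0 i) + X 0 i)"
      by (intro convergent_add convergent_const) (simp only: sum_lessThan_telescope[of "\<lambda>n. X n i"])
    then show ?thesis by (simp add: x_def convergent_LIMSEQ_iff)
  qed
  note lp = l2_limit_pointwise[where X = X and x = x and r = "\<lambda>n. C * q ^ n / (1 - q)", OF X lim r]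
  show thesis
  proof
    show "l2 x" using l2_add[OF lp(1)[of 0] X[of 0]] by simp
    have "(\<lambda>n. C * q ^ n / (1 - q)) \<longlonglongrightarrow> 0"
      using q by (intro tendsto_divide_zero tendsto_mult_right_zero LIMSEQ_realpow_zero)
    then show "(\<lambda>n. l2_norm (\<lambda>i. x i - X n i)) \<longlonglongrightarrow> 0"
      by (rule Lim_null_comparison[rotated]) (use lp(2) in auto)
  qed (rule lim)
qed

section \<open>Coercive operators and Schur complements\<close>

text \<open>\<open>coercive_ops\<close> without the convention that the operator vanishes outside
  its space. Compressions, sums of relabelled pieces and conjugates satisfy this version as they
  stand.\<close>

definition coer :: "complex set \<Rightarrow> 'i set \<Rightarrow> 'i l2_op \<Rightarrow> bool" where
  "coer \<K> I M \<longleftrightarrow>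
     (\<forall>x \<in> l2_space \<K> I. M x \<in> l2_space \<K> I) \<and>
     (\<forall>x \<in> l2_space \<K> I. \<forall>y \<in> l2_space \<K> I. M (\<lambda>i. x i + y i) = (\<lambda>i. M x i + M y i)) \<and>
     (\<forall>c \<in> \<K>. \<forall>x \<in> l2_space \<K> I. M (\<lambda>i. c * x i) = (\<lambda>i. c * M x i)) \<and>
     (\<exists>B. \<forall>x \<in> l2_space \<K> I. l2_norm (M x) \<le> B * l2_norm x) \<and>
     (\<forall>x \<in> l2_space \<K> I. \<forall>y \<in> l2_space \<K> I. l2_inner x (M y) = l2_inner (M x) y) \<and>
     (\<exists>c>0. \<forall>x \<in> l2_space \<K> I. c * Re (l2_inner x x) \<le> Re (l2_inner x (M x)))"

lemma coercive_ops_iff: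
  "M \<in> coercive_ops \<K> I \<longleftrightarrow> coer \<K> I M \<and> (\<forall>x. x \<notin> l2_space \<K> I \<longrightarrow> M x = (\<lambda>_. 0))"
  by (auto simp: coercive_ops_def coer_def)

lemma l2_spaceD: "x \<in> l2_space \<K> I \<Longrightarrow> l2 x"
  by (simp add: l2_space_iff)

lemma coer_inner_pos:
  assumes "coer \<K> I M"
  obtains c where "c > 0" "\<And>x. x \<in> l2_space \<K> I \<Longrightarrow> c * (l2_norm x)\<^sup>2 \<le> Re (l2_inner x (M x))"
proof -
  obtain c where "c > 0" "\<forall>x \<in> l2_space \<K> I. c * Re (l2_inner x x) \<le> Re (l2_inner x (M x))"
    using assms unfolding coer_def by blast
  then show thesis by (intro that[of c]) (auto simp: Re_l2_inner_self l2_spaceD)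
qed

lemma coer_bounded:
  assumes "coer \<K> I M"
  obtains B where "B > 0" "\<And>x. x \<in> l2_space \<K> I \<Longrightarrow> l2_norm (M x) \<le> B * l2_norm x"
proof -
  obtain B where B: "\<And>x. x \<in> l2_space \<K> I \<Longrightarrow> l2_norm (M x) \<le> B * l2_norm x"
    using assms unfolding coer_def by blast
  show thesis
  proof (rule that[of "max B 1"])
    fix x assume "x \<in> l2_space \<K> I"
    then show "l2_norm (M x) \<le> max B 1 * l2_norm x"
      by (rule order_trans[OF B]) (intro mult_right_mono, auto)
  qed auto
qed

lemma
  assumes "coer \<K> I M"
  shows coer_closed: "x \<in> l2_space \<K> I \<Longrightarrow> M x \<in> l2_space \<K> I"
    and coer_add: "x \<in> l2_space \<K> I \<Longrightarrow> y \<in> l2_space \<K> I \<Longrightarrow> M (\<lambda>i. x i + y i) = (\<lambda>i. M x i + M y i)"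
    and coer_cmult: "c \<in> \<K> \<Longrightarrow> x \<in> l2_space \<K> I \<Longrightarrow> M (\<lambda>i. c * x i) = (\<lambda>i. c * M x i)"
    and coer_sym: "x \<in> l2_space \<K> I \<Longrightarrow> y \<in> l2_space \<K> I \<Longrightarrow> l2_inner x (M y) = l2_inner (M x) y"
  using assms unfolding coer_def by blast+

lemma coerI:
  assumes "\<And>x. x \<in> l2_space \<K> I \<Longrightarrow> M x \<in> l2_space \<K> I"
    and "\<And>x y. x \<in> l2_space \<K> I \<Longrightarrow> y \<in> l2_space \<K> I \<Longrightarrow> M (\<lambda>i. x i + y i) = (\<lambda>i. M x i + M y i)"
    and "\<And>c x. c \<in> \<K> \<Longrightarrow> x \<in> l2_space \<K> I \<Longrightarrow> M (\<lambda>i. c * x i) = (\<lambda>i. c * M x i)"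
    and "\<And>x. x \<in> l2_space \<K> I \<Longrightarrow> l2_norm (M x) \<le> B * l2_norm x"
    and "\<And>x y. x \<in> l2_space \<K> I \<Longrightarrow> y \<in> l2_space \<K> I \<Longrightarrow> l2_inner x (M y) = l2_inner (M x) y"
    and "c > 0" "\<And>x. x \<in> l2_space \<K> I \<Longrightarrow> c * (l2_norm x)\<^sup>2 \<le> Re (l2_inner x (M x))"
  shows "coer \<K> I M"
proof -
  have "c * Re (l2_inner x x) \<le> Re (l2_inner x (M x))" if "x \<in> l2_space \<K> I" for x
    using assms(7)[OF that] that by (simp add: Re_l2_inner_self l2_spaceD)
  then show ?thesis unfolding coer_def using assms(1-6) by blast
qed

lemma l2_norm_add_power2:
  assumes "l2 x" "l2 y"
  shows "(l2_norm (\<lambda>i. x i + y i))\<^sup>2 = (l2_norm x)\<^sup>2 + 2 * Re (l2_inner x y) + (l2_norm y)\<^sup>2"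
proof -
  have "Re (l2_inner y x) = Re (l2_inner x y)"
    by (subst l2_inner_commute) simp
  then have "Re (l2_inner (\<lambda>i. x i + y i) (\<lambda>i. x i + y i))
      = Re (l2_inner x x) + 2 * Re (l2_inner x y) + Re (l2_inner y y)"
    using assms by (simp add: l2_inner_add_left l2_inner_add_right l2_add)
  then show ?thesis
    using assms by (simp only: Re_l2_inner_self l2_add)
qed

locale scalars =
  fixes \<K> :: "complex set"
  assumes scalars: "\<K> = \<real> \<or> \<K> = UNIV"
begin

lemma K_closed [simp]:
  "0 \<in> \<K>" "1 \<in> \<K>" "complex_of_real r \<in> \<K>"
  "x \<in> \<K> \<Longrightarrow> - x \<in> \<K>" "x \<in> \<K> \<Longrightarrow> cnj x \<in> \<K>"
  "x \<in> \<K> \<Longrightarrow> y \<in> \<K> \<Longrightarrow> x + y \<in> \<K>" "x \<in> \<K> \<Longrightarrow> y \<in> \<K> \<Longrightarrow> x - y \<in> \<K>"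
  "x \<in> \<K> \<Longrightarrow> y \<in> \<K> \<Longrightarrow> x * y \<in> \<K>"
  using scalars by (auto simp: Reals_cnj_iff)

lemma K_sum [simp]: "(\<And>a. a \<in> A \<Longrightarrow> f a \<in> \<K>) \<Longrightarrow> sum f A \<in> \<K>"
  using scalars by (auto intro: sum_in_Reals)

lemma K_lim: "X \<longlonglongrightarrow> x \<Longrightarrow> (\<And>n. X n \<in> \<K>) \<Longrightarrow> x \<in> \<K>"
  using scalars closed_sequentially[OF closed_complex_Reals, of X x] by auto

abbreviation \<L> where "\<L> \<equiv> l2_space \<K>"

lemma L_zero [simp]: "(\<lambda>_. 0) \<in> \<L> I"
  by (auto simp: l2_space_iff)

lemma L_add: "x \<in> \<L> I \<Longrightarrow> y \<in> \<L> I \<Longrightarrow> (\<lambda>i. x i + y i) \<in> \<L> I"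
  and L_diff: "x \<in> \<L> I \<Longrightarrow> y \<in> \<L> I \<Longrightarrow> (\<lambda>i. x i - y i) \<in> \<L> I"
  and L_cmult: "c \<in> \<K> \<Longrightarrow> x \<in> \<L> I \<Longrightarrow> (\<lambda>i. c * x i) \<in> \<L> I"
  by (auto simp: l2_space_iff intro: l2_add l2_diff l2_cmult)

lemma L_restr: "x \<in> \<L> J \<Longrightarrow> restr I x \<in> \<L> (I \<inter> J)"
  by (auto simp: l2_space_iff l2_restr) (auto simp: restr_def)

lemma L_mono: "x \<in> \<L> I \<Longrightarrow> I \<subseteq> J \<Longrightarrow> x \<in> \<L> J"
  by (auto simp: l2_space_iff)

lemma coer_diff:
  assumes "coer \<K> I M" "x \<in> \<L> I" "y \<in> \<L> I"
  shows "M (\<lambda>i. x i - y i) = (\<lambda>i. M x i - M y i)"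
proof -
  have "M (\<lambda>i. x i + (-1) * y i) = (\<lambda>i. M x i + (-1) * M y i)"
    using coer_add[OF assms(1,2) L_cmult[of "-1" y I]] coer_cmult[OF assms(1), of "-1" y] assms(3) by simp
  then show ?thesis by simp
qed

lemma coer_zero: "coer \<K> I M \<Longrightarrow> M (\<lambda>_. 0) = (\<lambda>_. 0)"
  using coer_cmult[of \<K> I M 0 "\<lambda>_. 0"] by simp

lemma coer_inj:
  assumes M: "coer \<K> I M" and x: "x \<in> \<L> I" "x' \<in> \<L> I" and eq: "M x = M x'"
  shows "x = x'"
proof -
  let ?d = "\<lambda>i. x i - x' i"
  have d: "?d \<in> \<L> I" using x by (rule L_diff)
  obtain c where c: "c > 0" "\<And>x. x \<in> \<L> I \<Longrightarrow> c * (l2_norm x)\<^sup>2 \<le> Re (l2_inner x (M x))"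
    using coer_inner_pos[OF M] by metis
  have "M ?d = (\<lambda>_. 0)" using coer_diff[OF M x] eq by simp
  then have "c * (l2_norm ?d)\<^sup>2 \<le> 0" using c(2)[OF d] by simp
  then have "l2_norm ?d = 0"
    using c(1) by (simp add: mult_le_0_iff)
  then have "?d = (\<lambda>_. 0)" using l2_norm_eq_0[of ?d] l2_spaceD[OF d] by simp
  then show ?thesis by (metis eq_iff_diff_eq_0 ext)
qed

text \<open>For small \<open>t\<close> the map \<open>x \<mapsto> x - t (M x - y)\<close> is a contraction, with the solution as fixed point.\<close>

lemma coer_surj:
  assumes M: "coer \<K> I M" and y: "y \<in> \<L> I"
  obtains x where "x \<in> \<L> I" "M x = y"
proof -
  obtain c where c: "c > 0" "\<And>x. x \<in> \<L> I \<Longrightarrow> c * (l2_norm x)\<^sup>2 \<le> Re (l2_inner x (M x))"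
    using coer_inner_pos[OF M] by metis
  obtain B0 where B0: "B0 > 0" "\<And>x. x \<in> \<L> I \<Longrightarrow> l2_norm (M x) \<le> B0 * l2_norm x"
    using coer_bounded[OF M] by metis
  \<comment> \<open>Enlarging the bound to at least \<open>c\<close> keeps 1 - c^2 / B^2
    nonnegative, so that \<open>q\<close> is a genuine square root.\<close>
  define B where "B = max B0 c"
  have Bpos: "B > 0" and cB: "c \<le> B" using c(1) by (auto simp: B_def)
  have B: "l2_norm (M x) \<le> B * l2_norm x" if "x \<in> \<L> I" for x
    by (rule order_trans[OF B0(2)[OF that]]) (auto simp: B_def intro: mult_right_mono)
  \<comment> \<open>This choice minimises 1 - 2 t c + t^2 B^2, the factor that appears in
    \<open>contr\<close>; the minimum is the square of \<open>q\<close>.\<close>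
  define t where "t = c / B\<^sup>2"
  define q where "q = sqrt (1 - c\<^sup>2 / B\<^sup>2)"
  have "c\<^sup>2 \<le> B\<^sup>2" using cB c(1) by (intro power_mono) auto
  then have q2: "q\<^sup>2 = 1 - c\<^sup>2 / B\<^sup>2" using Bpos by (simp add: q_def)
  have q: "0 \<le> q" "q < 1" using c(1) Bpos by (auto simp: q_def)
    (use \<open>c\<^sup>2 \<le> B\<^sup>2\<close> in \<open>simp add: field_simps\<close>)
  have tpos: "t > 0" using c(1) Bpos by (simp add: t_def)
  have contr: "l2_norm (\<lambda>i. x i - of_real t * M x i) \<le> q * l2_norm x" if x: "x \<in> \<L> I" for x
  proof (rule power2_le_imp_le)
    have Mx: "M x \<in> \<L> I" using coer_closed[OF M x] .
    have "(l2_norm (\<lambda>i. x i - of_real t * M x i))\<^sup>2 = (l2_norm (\<lambda>i. x i + (- of_real t) * M x i))\<^sup>2" by simp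
    also have "\<dots> = (l2_norm x)\<^sup>2 - 2 * t * Re (l2_inner x (M x)) + t\<^sup>2 * (l2_norm (M x))\<^sup>2"
      using x Mx tpos by (subst l2_norm_add_power2)
        (auto intro: l2_spaceD l2_cmult simp: l2_inner_cmult_right l2_norm_cmult power_mult_distrib l2_inner_uminus_right l2_norm_uminus l2_norm_cmult
          simp del: mult_minus_left)
    also have "\<dots> \<le> (l2_norm x)\<^sup>2 - 2 * t * (c * (l2_norm x)\<^sup>2) + t\<^sup>2 * (B * l2_norm x)\<^sup>2"
      using tpos c(2)[OF x] B[OF x]
      by (intro add_mono diff_mono mult_left_mono power_mono order_refl) auto
    also have "\<dots> = (1 - 2 * t * c + t\<^sup>2 * B\<^sup>2) * (l2_norm x)\<^sup>2"
      by (simp add: algebra_simps power_mult_distrib)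
    also have "1 - 2 * t * c + t\<^sup>2 * B\<^sup>2 = q\<^sup>2"
      unfolding q2 using Bpos by (simp add: t_def field_simps power2_eq_square)
    finally show "(l2_norm (\<lambda>i. x i - of_real t * M x i))\<^sup>2 \<le> (q * l2_norm x)\<^sup>2"
      by (simp add: power_mult_distrib)
  qed (use q in auto)
  define X where "X n = ((\<lambda>x i. x i - of_real t * (M x i - y i)) ^^ n) (\<lambda>_. 0)" for n
  have XS: "X (Suc n) = (\<lambda>i. X n i - of_real t * (M (X n) i - y i))" for n
    by (simp add: X_def)
  have XL: "X n \<in> \<L> I" for n
    by (induction n) (auto simp: XS X_def[of 0] intro!: L_diff L_cmult coer_closed[OF M] y)
  have alg: "a - b = (b - c) - s * (p - r)" if "a = b - s * (p - z)" "b = c - s * (r - z)"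
    for a b c p r s z :: complex
  proof -
    have "a - b = - (s * (p - z))" "b - c = - (s * (r - z))"
      by (simp add: that(1), simp add: that(2))
    then show ?thesis by (simp only:) (simp add: algebra_simps)
  qed
  define C where "C = l2_norm (\<lambda>i. X 1 i - X 0 i)"
  have d: "l2_norm (\<lambda>i. X (Suc n) i - X n i) \<le> C * q ^ n" for n
  proof (induction n)
    case (Suc n)
    let ?d = "\<lambda>i. X (Suc n) i - X n i"
    have "M ?d = (\<lambda>i. M (X (Suc n)) i - M (X n) i)" by (rule coer_diff[OF M XL XL])
    moreover have "X (Suc (Suc n)) i - X (Suc n) i = ?d i - of_real t * (M (X (Suc n)) i - M (X n) i)" for i
      by (rule alg[OF fun_cong[OF XS[of "Suc n"], of i] fun_cong[OF XS[of n], of i]])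
    ultimately have "(\<lambda>i. X (Suc (Suc n)) i - X (Suc n) i) = (\<lambda>i. ?d i - of_real t * M ?d i)"
      by (simp only:)
    then have "l2_norm (\<lambda>i. X (Suc (Suc n)) i - X (Suc n) i) \<le> q * l2_norm ?d"
      using contr[OF L_diff[OF XL XL]] by simp
    also have "\<dots> \<le> q * (C * q ^ n)" using Suc q by (intro mult_left_mono) auto
    finally show ?case by (simp add: mult_ac)
  qed (simp add: C_def)
  obtain x where x: "l2 x" "\<And>i. (\<lambda>n. X n i) \<longlonglongrightarrow> x i" "(\<lambda>n. l2_norm (\<lambda>i. x i - X n i)) \<longlonglongrightarrow> 0"
    using l2_complete_geometric[of X, OF l2_spaceD[OF XL] d q] by metis
  have xL: "x \<in> \<L> I"
    unfolding l2_space_iff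
  proof (intro conjI ballI allI impI x(1))
    show "x i \<in> \<K>" if "i \<in> I" for i
      using XL that by (intro K_lim[OF x(2)]) (auto simp: l2_space_iff)
    show "x i = 0" if "i \<notin> I" for i
      using XL that x(2)[of i] LIMSEQ_unique[OF _ tendsto_const] by (auto simp: l2_space_iff)
  qed
  \<comment> \<open>The iteration expresses \<open>M (X n)\<close> as y plus a multiple of the step
    from X n to X (n + 1), which tends to y at each coordinate; boundedness of \<open>M\<close>
    identifies the same limit as \<open>M x\<close>.\<close>
  have "M x i = y i" for i
  proof (rule LIMSEQ_unique)
    have "(\<lambda>n. M (X n) i) = (\<lambda>n. y i + (X n i - X (Suc n) i) / of_real t)"
      using tpos by (auto simp: XS field_simps)
    moreover have "\<dots> \<longlonglongrightarrow> y i + (x i - x i) / of_real t"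
      by (intro tendsto_intros x(2) LIMSEQ_Suc) (use tpos in auto)
    ultimately show "(\<lambda>n. M (X n) i) \<longlonglongrightarrow> y i" by simp
    have "(\<lambda>n. M x i - M (X n) i) \<longlonglongrightarrow> 0"
    proof (rule Lim_null_comparison)
      show "(\<lambda>n. B * l2_norm (\<lambda>i. x i - X n i)) \<longlonglongrightarrow> 0"
        using tendsto_mult_left[OF x(3), of B] by simp
      have "cmod (M x i - M (X n) i) \<le> B * l2_norm (\<lambda>i. x i - X n i)" for n
        using norm_le_l2_norm[OF l2_spaceD[OF coer_closed[OF M L_diff[OF xL XL]]], of n i]
          B[OF L_diff[OF xL XL], of n] coer_diff[OF M xL XL, of n] by simp
      then show "\<forall>\<^sub>F n in sequentially. norm (M x i - M (X n) i) \<le> B * l2_norm (\<lambda>i. x i - X n i)"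
        by simp
    qed
    then show "(\<lambda>n. M (X n) i) \<longlonglongrightarrow> M x i"
      using tendsto_diff[OF tendsto_const[of "M x i"]] by fastforce
  qed
  then show thesis using that[OF xL] by blast
qed

end

section \<open>Compressions and Schur complements\<close>

context scalars
begin

lemma l2_inner_restr: "(\<And>i. i \<notin> V \<Longrightarrow> x i = 0) \<Longrightarrow> l2_inner x (restr V z) = l2_inner x z"
  by (rule l2_inner_cong) (auto simp: restr_def)

lemma l2_norm_restr_le: "l2 x \<Longrightarrow> l2_norm (restr V x) \<le> l2_norm x"
  by (rule l2_norm_mono) (auto simp: restr_def)

lemma restr_eq_L: "x \<in> \<L> I \<Longrightarrow> I \<subseteq> V \<Longrightarrow> restr V x = x"
  by (auto simp: restr_def l2_space_iff fun_eq_iff)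

lemma restr_L: "x \<in> \<L> J \<Longrightarrow> restr V x \<in> \<L> V"
  using L_mono[OF L_restr] by blast

text \<open>For families supported in V, restricting the output does not change inner products, so
  the form and its lower bound are inherited. In a Schur complement this makes the block of the
  eliminated variables invertible.\<close>

lemma coer_compress:
  assumes N: "coer \<K> J N" and V: "V \<subseteq> J"
  shows "coer \<K> V (\<lambda>y. restr V (N y))"
proof -
  obtain c where c: "c > 0" "\<And>x. x \<in> \<L> J \<Longrightarrow> c * (l2_norm x)\<^sup>2 \<le> Re (l2_inner x (N x))"
    using coer_inner_pos[OF N] by metis
  obtain B where B: "B > 0" "\<And>x. x \<in> \<L> J \<Longrightarrow> l2_norm (N x) \<le> B * l2_norm x"
    using coer_bounded[OF N] by metis
  have LJ: "x \<in> \<L> J" if "x \<in> \<L> V" for x using L_mono[OF that V] .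
  have zero: "x i = 0" if "x \<in> \<L> V" "i \<notin> V" for x i using that by (simp add: l2_space_iff)
  have inner: "l2_inner x (restr V z) = l2_inner x z" if "x \<in> \<L> V" for x z
    by (rule l2_inner_restr) (rule zero[OF that])
  show ?thesis
  proof (rule coerI[OF _ _ _ _ _ c(1), where B = B])
    fix x y assume xy: "x \<in> \<L> V" "y \<in> \<L> V"
    show "l2_inner x (restr V (N y)) = l2_inner (restr V (N x)) y"
      using coer_sym[OF N LJ LJ, OF xy] inner[OF xy(1)] inner[OF xy(2), of "N x"]
        l2_inner_commute[of "restr V (N x)" y] l2_inner_commute[of "N x" y] by simp
    show "restr V (N (\<lambda>i. x i + y i)) = (\<lambda>i. restr V (N x) i + restr V (N y) i)"
      by (simp add: coer_add[OF N LJ LJ, OF xy] restr_def fun_eq_iff)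
  next
    fix x assume x: "x \<in> \<L> V"
    show "restr V (N x) \<in> \<L> V" by (rule restr_L[OF coer_closed[OF N LJ[OF x]]])
    show "l2_norm (restr V (N x)) \<le> B * l2_norm x"
      using B(2)[OF LJ[OF x]] l2_norm_restr_le[OF l2_spaceD[OF coer_closed[OF N LJ[OF x]]], of V] by simp
    show "c * (l2_norm x)\<^sup>2 \<le> Re (l2_inner x (restr V (N x)))"
      using c(2)[OF LJ[OF x]] by (simp add: inner[OF x])
    show "restr V (N (\<lambda>i. a * x i)) = (\<lambda>i. a * restr V (N x) i)" if "a \<in> \<K>" for a
      by (simp add: coer_cmult[OF N that LJ[OF x]] restr_def fun_eq_iff)
  qed
qed

lemma coer_subI: "coer \<K> J N \<Longrightarrow> y \<in> \<L> J \<Longrightarrow> (\<And>i. i \<in> J - I \<Longrightarrow> y i = 0) \<Longrightarrow> y \<in> \<L> I"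
  by (auto simp: l2_space_iff)

text \<open>The Schur complement at x is the output of \<open>N\<close> at the extension x + v whose
  output vanishes on V. Here v is the negative of the element that the definition inverts, hence the
  sign changes in the proof.\<close>

lemma schur_eqI:
  assumes N: "coer \<K> (I \<union> V) N" and IV: "I \<inter> V = {}"
    and x: "x \<in> \<L> I" and v: "v \<in> \<L> V" and y: "y \<in> \<L> I" and eq: "N (\<lambda>i. x i + v i) = y"
  shows "schur \<K> I V N x = y"
proof -
  have comp: "coer \<K> V (\<lambda>y. restr V (N y))" using coer_compress[OF N] by simp
  have xJ: "x \<in> \<L> (I \<union> V)" and vJ: "v \<in> \<L> (I \<union> V)" using x v by (auto intro: L_mono)
  have v': "(\<lambda>i. - v i) \<in> \<L> V" using L_cmult[of "-1", OF _ v] by simp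
  have Nv: "N (\<lambda>i. - v i) = (\<lambda>i. - N v i)" using coer_cmult[OF N _ vJ, of "-1"] by simp
  have sum: "N x i + N v i = y i" for i
    using coer_add[OF N xJ vJ] eq by metis
  have "restr V (N (\<lambda>i. - v i)) = restr V (N x)"
  proof
    fix i show "restr V (N (\<lambda>i. - v i)) i = restr V (N x) i"
      using sum[of i] y IV by (auto simp: restr_def Nv l2_space_iff) (metis add.inverse_unique add.commute disjoint_iff)
  qed
  moreover have "inj_on (\<lambda>y. restr V (N y)) (\<L> V)"
    using coer_inj[OF comp] by (auto simp: inj_on_def)
  ultimately have "the_inv_into (\<L> V) (\<lambda>y. restr V (N y)) (restr V (N x)) = (\<lambda>i. - v i)"
    using v' by (intro the_inv_into_f_eq) auto
  then have "schur \<K> I V N x = restr I (\<lambda>i. N x i + N v i)"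
    using x by (simp add: schur_def on_l2_def Nv)
  also have "\<dots> = y"
    using restr_eq_L[OF y, of I] by (simp add: sum)
  finally show ?thesis .
qed

lemma schur_ex:
  assumes N: "coer \<K> (I \<union> V) N" and IV: "I \<inter> V = {}" and x: "x \<in> \<L> I"
  obtains v where "v \<in> \<L> V" "N (\<lambda>i. x i + v i) = schur \<K> I V N x" "schur \<K> I V N x \<in> \<L> I"
proof -
  have comp: "coer \<K> V (\<lambda>y. restr V (N y))" using coer_compress[OF N] by simp
  have xJ: "x \<in> \<L> (I \<union> V)" using x by (auto intro: L_mono)
  have "(\<lambda>i. - restr V (N x) i) \<in> \<L> V"
    using L_cmult[of "-1", OF _ restr_L[OF coer_closed[OF N xJ]]] by simp
  then obtain v where v: "v \<in> \<L> V" "restr V (N v) = (\<lambda>i. - restr V (N x) i)"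
    using coer_surj[OF comp] by metis
  have vJ: "v \<in> \<L> (I \<union> V)" using v by (auto intro: L_mono)
  have eq: "N (\<lambda>i. x i + v i) = (\<lambda>i. N x i + N v i)" by (rule coer_add[OF N xJ vJ])
  have "N (\<lambda>i. x i + v i) \<in> \<L> I"
  proof (rule coer_subI[OF N])
    show "N (\<lambda>i. x i + v i) \<in> \<L> (I \<union> V)" by (intro coer_closed[OF N] L_add xJ vJ)
    fix i assume "i \<in> I \<union> V - I"
    then show "N (\<lambda>i. x i + v i) i = 0"
      using fun_cong[OF v(2), of i] by (auto simp: eq restr_def)
  qed
  from schur_eqI[OF N IV x v(1) this refl] this that[OF v(1)] show thesis by simp
qed

lemma L_inner_disjoint:
  assumes "v \<in> \<L> V" "y \<in> \<L> I" "I \<inter> V = {}" shows "l2_inner v y = 0"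
proof -
  have "cnj (v i) * y i = 0" for i using assms by (cases "i \<in> V") (auto simp: l2_space_iff)
  then show ?thesis by (simp only: l2_inner_def infsum_0_simp)
qed

text \<open>Since \<open>N\<close> at the extension x + v has no component on V, the energy of x
  equals the energy of x + v under \<open>N\<close>, and x + v is at least as long as x by
  orthogonality: the lower constant \<open>c\<close> is inherited. Symmetry follows by extending
  both arguments.\<close>

lemma schur_coercive:
  assumes N: "coer \<K> (I \<union> V) N" and IV: "I \<inter> V = {}"
  shows "schur \<K> I V N \<in> coercive_ops \<K> I"
proof -
  obtain c where c: "c > 0" "\<And>x. x \<in> \<L> (I \<union> V) \<Longrightarrow> c * (l2_norm x)\<^sup>2 \<le> Re (l2_inner x (N x))"
    using coer_inner_pos[OF N] by metis
  obtain B where B: "B > 0" "\<And>x. x \<in> \<L> (I \<union> V) \<Longrightarrow> l2_norm (N x) \<le> B * l2_norm x"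
    using coer_bounded[OF N] by metis
  let ?S = "schur \<K> I V N"
  have ex: "\<exists>v. v \<in> \<L> V \<and> N (\<lambda>i. x i + v i) = ?S x \<and> ?S x \<in> \<L> I \<and> (\<lambda>i. x i + v i) \<in> \<L> (I \<union> V)"
    if x: "x \<in> \<L> I" for x
  proof -
    obtain v where "v \<in> \<L> V" "N (\<lambda>i. x i + v i) = ?S x" "?S x \<in> \<L> I"
      using schur_ex[OF N IV x] by metis
    moreover have "x \<in> \<L> (I \<union> V)" "v \<in> \<L> (I \<union> V)" using x calculation by (auto intro: L_mono)
    ultimately show ?thesis using L_add by blast
  qed
  have inner: "l2_inner (\<lambda>i. x i + v i) y = l2_inner x y" if "x \<in> \<L> I" "v \<in> \<L> V" "y \<in> \<L> I" for x v y
    using that by (simp add: l2_inner_add_left l2_spaceD L_inner_disjoint[OF _ _ IV])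
  have "coer \<K> I ?S"
  proof (rule coerI[OF _ _ _ _ _ c(1)])
    fix x assume x: "x \<in> \<L> I"
    then obtain v where v: "v \<in> \<L> V" "N (\<lambda>i. x i + v i) = ?S x" "?S x \<in> \<L> I" "(\<lambda>i. x i + v i) \<in> \<L> (I \<union> V)"
      using ex by blast
    show "?S x \<in> \<L> I" by fact
    have nrm: "(l2_norm (\<lambda>i. x i + v i))\<^sup>2 = (l2_norm x)\<^sup>2 + (l2_norm v)\<^sup>2"
    proof -
      have "l2_inner x v = 0" using L_inner_disjoint[OF x v(1)] IV by (simp add: Int_commute)
      then show ?thesis using x v by (simp add: l2_norm_add_power2 l2_spaceD)
    qed
    have en: "c * (l2_norm (\<lambda>i. x i + v i))\<^sup>2 \<le> Re (l2_inner x (?S x))"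
      using c(2)[OF v(4)] inner[OF x v(1,3)] v(2) by simp
    have "c * (l2_norm x)\<^sup>2 \<le> c * (l2_norm (\<lambda>i. x i + v i))\<^sup>2"
      unfolding nrm using c(1) by (intro mult_left_mono) auto
    with en show "c * (l2_norm x)\<^sup>2 \<le> Re (l2_inner x (?S x))" by simp
    have S: "l2_norm (?S x) \<le> B * l2_norm (\<lambda>i. x i + v i)" using B(2)[OF v(4)] v(2) by simp
    \<comment> \<open>Coercivity bounds the extension by its own energy, and Cauchy-Schwarz bounds
      that energy through x: the extension has norm at most B / c times that of x. This is where the
      bound B (B / c) of the complement comes from.\<close>
    let ?n = "l2_norm (\<lambda>i. x i + v i)"
    have "c * ?n\<^sup>2 \<le> l2_norm x * l2_norm (?S x)"
      using en l2_Cauchy_Schwarz[OF l2_spaceD[OF x] l2_spaceD[OF v(3)]] complex_Re_le_cmod[of "l2_inner x (?S x)"]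
      by linarith
    also have "\<dots> \<le> l2_norm x * (B * ?n)" using S by (intro mult_left_mono) auto
    finally have "?n * (c * ?n) \<le> ?n * (B * l2_norm x)" by (simp add: power2_eq_square mult_ac)
    then have "c * ?n \<le> B * l2_norm x"
      using B(1) by (cases "?n = 0") (auto simp: order_less_le)
    then have "?n \<le> B / c * l2_norm x" using c(1) by (simp add: field_simps)
    then have "B * ?n \<le> B * (B / c * l2_norm x)" using B(1) by (intro mult_left_mono) auto
    with S show "l2_norm (?S x) \<le> (B * (B / c)) * l2_norm x" by (simp add: mult.assoc)
    show "?S (\<lambda>i. a * x i) = (\<lambda>i. a * ?S x i)" if a: "a \<in> \<K>" for a
    proof (rule schur_eqI[OF N IV L_cmult[OF a x] L_cmult[OF a v(1)] L_cmult[OF a v(3)]])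
      show "N (\<lambda>i. a * x i + a * v i) = (\<lambda>i. a * ?S x i)"
        using coer_cmult[OF N a v(4)] v(2) by (simp add: distrib_left)
    qed
  next
    fix x y assume x: "x \<in> \<L> I" and y: "y \<in> \<L> I"
    from x obtain v where v: "v \<in> \<L> V" "N (\<lambda>i. x i + v i) = ?S x" "?S x \<in> \<L> I" "(\<lambda>i. x i + v i) \<in> \<L> (I \<union> V)"
      using ex by blast
    from y obtain w where w: "w \<in> \<L> V" "N (\<lambda>i. y i + w i) = ?S y" "?S y \<in> \<L> I" "(\<lambda>i. y i + w i) \<in> \<L> (I \<union> V)"
      using ex by blast
    have "l2_inner x (?S y) = l2_inner (\<lambda>i. x i + v i) (N (\<lambda>i. y i + w i))"
      by (simp add: inner[OF x v(1) w(3)] w(2))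
    also have "\<dots> = l2_inner (?S x) (\<lambda>i. y i + w i)"
      using coer_sym[OF N v(4) w(4)] v(2) by simp
    also have "\<dots> = l2_inner (?S x) y"
      by (metis inner[OF y w(1) v(3)] l2_inner_commute)
    finally show "l2_inner x (?S y) = l2_inner (?S x) y" .
    have [simp]: "(x i + y i) + (v i + w i) = (x i + v i) + (y i + w i)" for i by (simp add: algebra_simps)
    show "?S (\<lambda>i. x i + y i) = (\<lambda>i. ?S x i + ?S y i)"
      by (rule schur_eqI[OF N IV L_add[OF x y] L_add[OF v(1) w(1)] L_add[OF v(3) w(3)]])
        (simp add: coer_add[OF N v(4) w(4)] v(2) w(2))
  qed
  then show ?thesis using assms by (auto simp: coercive_ops_iff schur_def on_l2_def)
qed

text \<open>Weak form of the Schur complement: only the sesquilinear form of \<open>N\<close>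
  against arbitrary Z occurs. Forms add when pieces are glued, which is why the gluing arguments use
  this version.\<close>

lemma schur_weakE:
  assumes N: "coer \<K> (I \<union> V) N" and IV: "I \<inter> V = {}" and x: "x \<in> \<L> I"
  obtains X where "X \<in> \<L> (I \<union> V)" "\<And>i. i \<in> I \<Longrightarrow> X i = x i" "schur \<K> I V N x \<in> \<L> I"
    "\<And>Z. Z \<in> \<L> (I \<union> V) \<Longrightarrow> l2_inner Z (N X) = l2_inner Z (schur \<K> I V N x)"
proof -
  obtain v where v: "v \<in> \<L> V" "N (\<lambda>i. x i + v i) = schur \<K> I V N x" "schur \<K> I V N x \<in> \<L> I"
    using schur_ex[OF N IV x] by metis
  have "(\<lambda>i. x i + v i) \<in> \<L> (I \<union> V)"
    by (intro L_add L_mono[OF x] L_mono[OF v(1)]) auto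
  moreover have "x i + v i = x i" if "i \<in> I" for i
    using v(1) IV that by (auto simp: l2_space_iff)
  ultimately show thesis using that v by metis
qed

lemma schur_weakI:
  assumes N: "coer \<K> (I \<union> V) N" and IV: "I \<inter> V = {}" and x: "x \<in> \<L> I"
    and X: "X \<in> \<L> (I \<union> V)" "\<And>i. i \<in> I \<Longrightarrow> X i = x i" and y: "y \<in> \<L> I"
    and w: "\<And>Z. Z \<in> \<L> (I \<union> V) \<Longrightarrow> l2_inner Z (N X) = l2_inner Z y"
  shows "schur \<K> I V N x = y"
proof (rule schur_eqI[OF N IV x restr_L[OF X(1)] y])
  have "x i + restr V X i = X i" for i
    using X x IV by (cases "i \<in> I"; cases "i \<in> V") (auto simp: restr_def l2_space_iff)
  then have eq: "(\<lambda>i. x i + restr V X i) = X" by blast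
  \<comment> \<open>The defect is itself an admissible test family; tested on it, the weak identity
    says that its norm is zero.\<close>
  let ?d = "\<lambda>i. N X i - y i"
  have NX: "N X \<in> \<L> (I \<union> V)" and yJ: "y \<in> \<L> (I \<union> V)"
    using coer_closed[OF N X(1)] L_mono[OF y] by auto
  have d: "?d \<in> \<L> (I \<union> V)" by (rule L_diff[OF NX yJ])
  have "l2_inner ?d ?d = 0"
    using w[OF d] by (simp add: l2_inner_diff_right[of ?d] l2_spaceD[OF d] l2_spaceD[OF NX] l2_spaceD[OF yJ])
  then have "l2_norm ?d = 0" using l2_inner_self[OF l2_spaceD[OF d]] by simp
  then have "?d = (\<lambda>_. 0)" using l2_norm_eq_0[OF l2_spaceD[OF d]] by simp
  then show "N (\<lambda>i. x i + restr V X i) = y" unfolding eq by (metis eq_iff_diff_eq_0 ext)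
qed

end

section \<open>Relabelling and gluing\<close>

definition pull :: "('j \<Rightarrow> 'i) \<Rightarrow> 'j set \<Rightarrow> ('i \<Rightarrow> complex) \<Rightarrow> 'j \<Rightarrow> complex" where
  "pull g I x = restr I (\<lambda>i. x (g i))"

definition push :: "('j \<Rightarrow> 'i) \<Rightarrow> 'j set \<Rightarrow> ('j \<Rightarrow> complex) \<Rightarrow> 'i \<Rightarrow> complex" where
  "push g I y = (\<lambda>i. if i \<in> g ` I then y (the_inv_into I g i) else 0)"

text \<open>Labels that lie in both images are identified, so this is the sum of two quadratic forms
  with common variables, the first half of gluing. It also adds up the faces of the lattice.\<close>

definition assembly :: "('j \<Rightarrow> 'i) \<Rightarrow> 'j set \<Rightarrow> 'j l2_op \<Rightarrow> ('k \<Rightarrow> 'i) \<Rightarrow> 'k set \<Rightarrow> 'k l2_op \<Rightarrow> 'i l2_op" where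
  "assembly g I M g' I' M' X =
     (\<lambda>i. push g I (M (pull g I X)) i + push g' I' (M' (pull g' I' X)) i)"

lemma glue_eq_schur_assembly:
  "glue \<K> \<pi> I M \<pi>' I' M' = (let J = \<pi> ` I \<union> \<pi>' ` I'; V = {a \<in> J. fst a = Cut} in
     schur \<K> (J - V) V (assembly \<pi> I M \<pi>' I' M'))"
proof -
  have "(\<lambda>x i. relabel \<pi> I M x i + relabel \<pi>' I' M' x i) = assembly \<pi> I M \<pi>' I' M'"
    by (intro ext) (simp add: relabel_def assembly_def push_def pull_def Let_def)
  then show ?thesis by (simp only: glue_def)
qed

lemma pull_simps: "i \<in> I \<Longrightarrow> pull g I x i = x (g i)" "i \<notin> I \<Longrightarrow> pull g I x i = 0"
  by (auto simp: pull_def restr_def)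

lemma pull_add: "pull g I (\<lambda>i. x i + y i) = (\<lambda>i. pull g I x i + pull g I y i)"
  and pull_cmult: "pull g I (\<lambda>i. c * x i) = (\<lambda>i. c * pull g I x i)"
  by (auto simp: pull_def restr_def)

lemma push_add: "push g I (\<lambda>i. x i + y i) = (\<lambda>i. push g I x i + push g I y i)"
  and push_cmult: "push g I (\<lambda>i. c * x i) = (\<lambda>i. c * push g I x i)"
  by (auto simp: push_def)

lemma l2_inner_push:
  assumes "inj_on g I" "\<And>i. i \<notin> I \<Longrightarrow> y i = 0"
  shows "l2_inner x (push g I y) = l2_inner (pull g I x) y"
proof -
  have "l2_inner x (push g I y) = (\<Sum>\<^sub>\<infinity>i\<in>g ` I. cnj (x i) * push g I y i)"
    unfolding l2_inner_def by (rule infsum_cong_neutral) (auto simp: push_def)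
  also have "\<dots> = (\<Sum>\<^sub>\<infinity>i\<in>I. cnj (x (g i)) * push g I y (g i))"
    by (simp add: infsum_reindex assms(1) o_def)
  also have "\<dots> = l2_inner (pull g I x) y"
    unfolding l2_inner_def
    by (rule infsum_cong_neutral) (auto simp: pull_def restr_def push_def the_inv_into_f_f[OF assms(1)])
  finally show ?thesis .
qed

lemma l2_norm_push:
  assumes "inj_on g I" "\<And>i. i \<notin> I \<Longrightarrow> y i = 0"
  shows "l2_norm (push g I y) = l2_norm y"
proof -
  have "(\<Sum>\<^sub>\<infinity>i. (cmod (push g I y i))\<^sup>2) = (\<Sum>\<^sub>\<infinity>i\<in>g ` I. (cmod (push g I y i))\<^sup>2)"
    by (rule infsum_cong_neutral) (auto simp: push_def)
  also have "\<dots> = (\<Sum>\<^sub>\<infinity>i\<in>I. (cmod (push g I y (g i)))\<^sup>2)"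
    by (simp add: infsum_reindex assms(1) o_def)
  also have "\<dots> = (\<Sum>\<^sub>\<infinity>i. (cmod (y i))\<^sup>2)"
    by (rule infsum_cong_neutral) (auto simp: assms(2) push_def the_inv_into_f_f[OF assms(1)])
  finally show ?thesis by (simp add: l2_norm_def)
qed

lemma l2_norm_pull:
  assumes "inj_on g I"
  shows "l2_norm (pull g I x) = l2_norm (restr (g ` I) x)"
proof -
  have "(\<Sum>\<^sub>\<infinity>i. (cmod (restr (g ` I) x i))\<^sup>2) = (\<Sum>\<^sub>\<infinity>i\<in>g ` I. (cmod (x i))\<^sup>2)"
    by (rule infsum_cong_neutral) (auto simp: restr_def)
  also have "\<dots> = (\<Sum>\<^sub>\<infinity>i\<in>I. (cmod (x (g i)))\<^sup>2)"
    by (simp add: infsum_reindex assms(1) o_def)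
  also have "\<dots> = (\<Sum>\<^sub>\<infinity>i. (cmod (pull g I x i))\<^sup>2)"
    by (rule infsum_cong_neutral) (auto simp: pull_def restr_def)
  finally show ?thesis by (simp add: l2_norm_def)
qed

text \<open>Only an inequality, since A and B may overlap, as the images of two pieces do on their
  cut.\<close>

lemma l2_norm_le_restr_Un:
  assumes "l2 x" "\<And>i. i \<notin> A \<union> B \<Longrightarrow> x i = 0"
  shows "(l2_norm x)\<^sup>2 \<le> (l2_norm (restr A x))\<^sup>2 + (l2_norm (restr B x))\<^sup>2"
proof -
  have s: "l2 (restr A x)" "l2 (restr B x)" using l2_restr[OF assms(1)] by auto
  have "(\<Sum>\<^sub>\<infinity>i. (cmod (x i))\<^sup>2) \<le> (\<Sum>\<^sub>\<infinity>i. (cmod (restr A x i))\<^sup>2 + (cmod (restr B x i))\<^sup>2)"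
    by (rule infsum_mono[OF assms(1) summable_on_add[OF s]]) (use assms(2) in \<open>auto simp: restr_def\<close>)
  also have "\<dots> = (\<Sum>\<^sub>\<infinity>i. (cmod (restr A x i))\<^sup>2) + (\<Sum>\<^sub>\<infinity>i. (cmod (restr B x i))\<^sup>2)"
    by (rule infsum_add[OF s])
  finally show ?thesis by (simp only: l2_norm_power2)
qed

context scalars
begin

lemma pull_L: "inj_on g I \<Longrightarrow> x \<in> \<L> J \<Longrightarrow> pull g I x \<in> \<L> I"
  unfolding pull_def l2_space_iff using l2_reindex[of x g I]
  by (auto simp: restr_def)

lemma push_L:
  assumes "inj_on g I" "y \<in> \<L> I" shows "push g I y \<in> \<L> (g ` I)"
proof -
  have inj: "inj_on (the_inv_into I g) (g ` I)" using inj_on_the_inv_into[OF assms(1)] .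
  have "push g I y = restr (g ` I) (\<lambda>i. y (the_inv_into I g i))" by (auto simp: push_def restr_def)
  then show ?thesis
    using l2_reindex[OF l2_spaceD[OF assms(2)] inj] assms
    by (auto simp: l2_space_iff restr_def the_inv_into_f_f)
qed

lemma assembly_inner:
  assumes g: "inj_on g I" "inj_on g' I'" and M: "coer \<K> I M" "coer \<K> I' M'"
    and X: "X \<in> \<L> J" and Z: "Z \<in> \<L> J'"
  shows "l2_inner Z (assembly g I M g' I' M' X) =
    l2_inner (pull g I Z) (M (pull g I X)) + l2_inner (pull g' I' Z) (M' (pull g' I' X))"
proof -
  note a = coer_closed[OF M(1) pull_L[OF g(1) X]] and b = coer_closed[OF M(2) pull_L[OF g(2) X]]
  have "l2_inner Z (assembly g I M g' I' M' X) =
     l2_inner Z (push g I (M (pull g I X))) + l2_inner Z (push g' I' (M' (pull g' I' X)))"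
    unfolding assembly_def
    by (rule l2_inner_add_right[OF l2_spaceD[OF Z] l2_spaceD[OF push_L[OF g(1) a]] l2_spaceD[OF push_L[OF g(2) b]]])
  also have "\<dots> = l2_inner (pull g I Z) (M (pull g I X)) + l2_inner (pull g' I' Z) (M' (pull g' I' X))"
    using a b by (simp add: l2_inner_push g l2_space_iff)
  finally show ?thesis .
qed

text \<open>Each label comes from at least one piece, so the squared norms of the two pulled-back
  families together dominate that of x; the smaller of the two lower constants works.\<close>

lemma assembly_coer:
  assumes g: "inj_on g I" "inj_on g' I'" and M: "coer \<K> I M" "coer \<K> I' M'"
  shows "coer \<K> (g ` I \<union> g' ` I') (assembly g I M g' I' M')"
proof -
  let ?J = "g ` I \<union> g' ` I'" and ?A = "assembly g I M g' I' M'"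
  obtain c where c: "c > 0" "\<And>x. x \<in> \<L> I \<Longrightarrow> c * (l2_norm x)\<^sup>2 \<le> Re (l2_inner x (M x))"
    using coer_inner_pos[OF M(1)] by metis
  obtain c' where c': "c' > 0" "\<And>x. x \<in> \<L> I' \<Longrightarrow> c' * (l2_norm x)\<^sup>2 \<le> Re (l2_inner x (M' x))"
    using coer_inner_pos[OF M(2)] by metis
  obtain B where B: "B > 0" "\<And>x. x \<in> \<L> I \<Longrightarrow> l2_norm (M x) \<le> B * l2_norm x"
    using coer_bounded[OF M(1)] by metis
  obtain B' where B': "B' > 0" "\<And>x. x \<in> \<L> I' \<Longrightarrow> l2_norm (M' x) \<le> B' * l2_norm x"
    using coer_bounded[OF M(2)] by metis
  note p = pull_L[OF g(1), of _ ?J] and p' = pull_L[OF g(2), of _ ?J]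
  note q = push_L[OF g(1) coer_closed[OF M(1) p]] and q' = push_L[OF g(2) coer_closed[OF M(2) p']]
  have "min c c' > 0" using c(1) c'(1) by simp
  then show ?thesis
  proof (rule coerI[rotated 5])
    fix x assume x: "x \<in> \<L> ?J"
    show "?A x \<in> \<L> ?J" unfolding assembly_def
      by (intro L_add L_mono[OF q[OF x]] L_mono[OF q'[OF x]]) auto
    have "l2_norm (?A x) \<le> l2_norm (push g I (M (pull g I x))) + l2_norm (push g' I' (M' (pull g' I' x)))"
      unfolding assembly_def by (intro l2_norm_triangle l2_spaceD[OF q[OF x]] l2_spaceD[OF q'[OF x]])
    also have "\<dots> = l2_norm (M (pull g I x)) + l2_norm (M' (pull g' I' x))"
      using coer_closed[OF M(1) p[OF x]] coer_closed[OF M(2) p'[OF x]]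
      by (simp add: l2_norm_push g l2_space_iff)
    also have "\<dots> \<le> B * l2_norm (pull g I x) + B' * l2_norm (pull g' I' x)"
      by (intro add_mono B(2) B'(2) p p' x)
    also have "\<dots> \<le> B * l2_norm x + B' * l2_norm x"
      unfolding l2_norm_pull[OF g(1)] l2_norm_pull[OF g(2)] using B(1) B'(1)
      by (intro add_mono mult_left_mono l2_norm_restr_le l2_spaceD[OF x]) auto
    finally show "l2_norm (?A x) \<le> (B + B') * l2_norm x" by (simp add: distrib_right)
    show "?A (\<lambda>i. a * x i) = (\<lambda>i. a * ?A x i)" if "a \<in> \<K>" for a
      by (simp add: assembly_def pull_cmult coer_cmult[OF M(1) that p[OF x]] coer_cmult[OF M(2) that p'[OF x]]
          push_cmult distrib_left)
    have "min c c' * (l2_norm x)\<^sup>2 \<le> min c c' * ((l2_norm (pull g I x))\<^sup>2 + (l2_norm (pull g' I' x))\<^sup>2)"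
      unfolding l2_norm_pull[OF g(1)] l2_norm_pull[OF g(2)] using c(1) c'(1) x
      by (intro mult_left_mono l2_norm_le_restr_Un) (auto simp: l2_space_iff)
    also have "\<dots> \<le> c * (l2_norm (pull g I x))\<^sup>2 + c' * (l2_norm (pull g' I' x))\<^sup>2"
      unfolding distrib_left by (intro add_mono mult_right_mono) auto
    also have "\<dots> \<le> Re (l2_inner x (?A x))"
      using c(2)[OF p[OF x]] c'(2)[OF p'[OF x]] by (simp add: assembly_inner[OF g M x x])
    finally show "min c c' * (l2_norm x)\<^sup>2 \<le> Re (l2_inner x (?A x))" .
  next
    fix x y assume x: "x \<in> \<L> ?J" and y: "y \<in> \<L> ?J"
    show "?A (\<lambda>i. x i + y i) = (\<lambda>i. ?A x i + ?A y i)"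
      by (simp add: assembly_def pull_add coer_add[OF M(1) p[OF x] p[OF y]]
          coer_add[OF M(2) p'[OF x] p'[OF y]] push_add algebra_simps)
    have "l2_inner (?A x) y = cnj (l2_inner y (?A x))" by (rule l2_inner_commute)
    also have "\<dots> = l2_inner (M (pull g I x)) (pull g I y) + l2_inner (M' (pull g' I' x)) (pull g' I' y)"
      by (simp add: assembly_inner[OF g M x y] l2_inner_commute[symmetric])
    also have "\<dots> = l2_inner x (?A y)"
      by (simp add: assembly_inner[OF g M y x] coer_sym[OF M(1) p p, OF x y] coer_sym[OF M(2) p' p', OF x y])
    finally show "l2_inner x (?A y) = l2_inner (?A x) y" by simp
  qed
qed

lemma glue_weakE:
  assumes g: "inj_on \<pi> I" "inj_on \<pi>' I'" and M: "coer \<K> I M" "coer \<K> I' M'"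
    and J: "J = \<pi> ` I \<union> \<pi>' ` I'" and V: "V = {a \<in> J. fst a = Cut}" and x: "x \<in> \<L> (J - V)"
  obtains X where "X \<in> \<L> J" "\<And>i. i \<in> J - V \<Longrightarrow> X i = x i" "glue \<K> \<pi> I M \<pi>' I' M' x \<in> \<L> (J - V)"
    "\<And>Z. Z \<in> \<L> J \<Longrightarrow> l2_inner Z (glue \<K> \<pi> I M \<pi>' I' M' x) =
       l2_inner (pull \<pi> I Z) (M (pull \<pi> I X)) + l2_inner (pull \<pi>' I' Z) (M' (pull \<pi>' I' X))"
proof -
  have JV: "J - V \<union> V = J" using V by auto
  have N: "coer \<K> (J - V \<union> V) (assembly \<pi> I M \<pi>' I' M')"
    unfolding JV unfolding J by (rule assembly_coer[OF g M])
  have eq: "glue \<K> \<pi> I M \<pi>' I' M' = schur \<K> (J - V) V (assembly \<pi> I M \<pi>' I' M')"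
    by (simp add: glue_eq_schur_assembly Let_def J V)
  obtain X where X: "X \<in> \<L> (J - V \<union> V)" "\<And>i. i \<in> J - V \<Longrightarrow> X i = x i"
      "glue \<K> \<pi> I M \<pi>' I' M' x \<in> \<L> (J - V)"
      "\<And>Z. Z \<in> \<L> (J - V \<union> V) \<Longrightarrow> l2_inner Z (assembly \<pi> I M \<pi>' I' M' X) = l2_inner Z (glue \<K> \<pi> I M \<pi>' I' M' x)"
    using schur_weakE[OF N _ x] unfolding eq by auto
  show thesis
    by (rule that[of X]) (use X[unfolded JV] in \<open>auto simp: assembly_inner[OF g M, symmetric]\<close>)
qed

lemma glue_coercive:
  assumes g: "inj_on \<pi> I" "inj_on \<pi>' I'" and M: "coer \<K> I M" "coer \<K> I' M'"
    and J: "J = \<pi> ` I \<union> \<pi>' ` I'" and V: "V = {a \<in> J. fst a = Cut}"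
  shows "glue \<K> \<pi> I M \<pi>' I' M' \<in> coercive_ops \<K> (J - V)"
proof -
  have JV: "J - V \<union> V = J" using V by auto
  have N: "coer \<K> (J - V \<union> V) (assembly \<pi> I M \<pi>' I' M')"
    unfolding JV unfolding J by (rule assembly_coer[OF g M])
  have "schur \<K> (J - V) V (assembly \<pi> I M \<pi>' I' M') \<in> coercive_ops \<K> (J - V)"
    by (rule schur_coercive[OF N]) auto
  then show ?thesis by (simp add: glue_eq_schur_assembly Let_def J V)
qed

text \<open>Allows the infinite piece to be listed first, so that one uniqueness argument covers
  half-lines in both directions.\<close>

lemma glue_commute: "glue \<K> \<pi> I M \<pi>' I' M' = glue \<K> \<pi>' I' M' \<pi> I M"
  unfolding glue_eq_schur_assembly assembly_def by (simp add: Un_commute add.commute)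

end

section \<open>Uniqueness of fixed points of gluing\<close>

text \<open>A finite set carries all but a small part of the sum, and the decreasing sets
  \<open>B n\<close> miss each of its finitely many elements from some index on.\<close>

lemma l2_norm_restr_tendsto_0:
  fixes x :: "'i \<Rightarrow> complex" and B :: "nat \<Rightarrow> 'i set"
  assumes x: "l2 x" and dec: "\<And>m n. m \<le> n \<Longrightarrow> B n \<subseteq> B m" and esc: "\<And>a. \<exists>n. a \<notin> B n"
  shows "(\<lambda>n. l2_norm (restr (B n) x)) \<longlonglongrightarrow> 0"
proof -
  let ?f = "\<lambda>i. (cmod (x i))\<^sup>2"
  have sub: "?f summable_on A" for A using summable_on_subset_banach[OF x] by blast
  have nrm: "(l2_norm (restr A x))\<^sup>2 = infsum ?f A" for A
    unfolding l2_norm_power2 by (rule infsum_cong_neutral) (auto simp: restr_def)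
  have "(\<lambda>n. (l2_norm (restr (B n) x))\<^sup>2) \<longlonglongrightarrow> 0"
  proof (rule LIMSEQ_I)
    fix e :: real assume e: "e > 0"
    obtain F where F: "finite F" "dist (sum ?f F) (infsum ?f UNIV) \<le> e / 2"
      using infsum_finite_approximation[OF x, of "e / 2"] e by auto
    have "\<exists>N. \<forall>n\<ge>N. a \<notin> B n" for a using esc[of a] dec by blast
    then obtain N where N: "\<And>a n. n \<ge> N a \<Longrightarrow> a \<notin> B n" by metis
    have "norm ((l2_norm (restr (B n) x))\<^sup>2 - 0) < e" if n: "n \<ge> Max (insert 0 (N ` F))" for n
    proof -
      have "B n \<inter> F = {}" using N n F(1) by fastforce
      then have "infsum ?f (B n) + sum ?f F = infsum ?f (B n \<union> F)"
        using F(1) sub by (simp add: infsum_Un_disjoint)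
      also have "\<dots> \<le> infsum ?f UNIV" by (rule infsum_mono2) (use sub in auto)
      finally have "infsum ?f (B n) \<le> e / 2" using F(2) unfolding dist_real_def by linarith
      then show ?thesis using e by (simp add: nrm infsum_nonneg)
    qed
    then show "\<exists>no. \<forall>n\<ge>no. norm ((l2_norm (restr (B n) x))\<^sup>2 - 0) < e" by blast
  qed
  from tendsto_real_sqrt[OF this] show ?thesis by simp
qed

context scalars
begin

lemma L_ext_inner:
  assumes "z \<in> \<L> I" "\<And>i. i \<in> I \<Longrightarrow> X i = x i"
  shows "l2_inner X z = l2_inner x z"
  using assms by (intro l2_inner_cong) (metis l2_space_iff mult_zero_right)

lemma L_eqI:
  assumes "y \<in> \<L> I" "y' \<in> \<L> I" "\<And>z. z \<in> \<L> I \<Longrightarrow> l2_inner z y = l2_inner z y'"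
  shows "y = y'"
proof -
  let ?d = "\<lambda>i. y i - y' i"
  have d: "?d \<in> \<L> I" by (rule L_diff[OF assms(1,2)])
  have "l2_inner ?d ?d = 0"
    using assms(3)[OF d] by (simp add: l2_inner_diff_right[of ?d] l2_spaceD[OF d] l2_spaceD[OF assms(1)] l2_spaceD[OF assms(2)])
  then have "l2_norm ?d = 0" using l2_inner_self[OF l2_spaceD[OF d]] by simp
  then have "?d = (\<lambda>_. 0)" using l2_norm_eq_0[OF l2_spaceD[OF d]] by simp
  then show ?thesis by (metis eq_iff_diff_eq_0 ext)
qed

text \<open>Applying the fixed point equation again and again transports a boundary value \<open>x\<close> to infinity.
  The values on the successive cuts have finite total energy, so the transported boundary values
  tend to zero.\<close>

lemma glue_fixed_orbit:
  assumes g: "inj_on \<pi> I" "inj_on \<pi>' I'" and M: "coer \<K> I M" and P: "coer \<K> I' P"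
    and J: "J = \<pi> ` I \<union> \<pi>' ` I'" and V: "V = {a \<in> J. fst a = Cut}" and JV: "J - V = I"
    and fixed: "\<And>x. x \<in> \<L> I \<Longrightarrow> glue \<K> \<pi> I M \<pi>' I' P x = M x"
    and VI': "V \<subseteq> \<pi>' ` I'" and A: "A = {a \<in> I. \<pi> a \<notin> V}" "\<pi> ` A \<subseteq> A"
    and esc: "\<And>a. \<exists>n. a \<notin> (\<pi> ^^ n) ` A"
    and x: "x \<in> \<L> I"
  obtains X :: "nat \<Rightarrow> label \<Rightarrow> complex" and xs :: "nat \<Rightarrow> label \<Rightarrow> complex" where
    "xs 0 = x" "\<And>n. xs n \<in> \<L> I" "\<And>n. X n \<in> \<L> J" "\<And>n i. i \<in> I \<Longrightarrow> X n i = xs n i"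
    "\<And>n. xs (Suc n) = pull \<pi> I (X n)"
    "\<And>n Z. Z \<in> \<L> J \<Longrightarrow> l2_inner Z (M (xs n)) =
       l2_inner (pull \<pi> I Z) (M (xs (Suc n))) + l2_inner (pull \<pi>' I' Z) (P (pull \<pi>' I' (X n)))"
    "(\<lambda>n. l2_norm (xs n)) \<longlonglongrightarrow> 0"
proof -
  have "\<exists>X. X \<in> \<L> J \<and> (\<forall>i\<in>I. X i = x i) \<and> (\<forall>Z\<in>\<L> J. l2_inner Z (M x) =
       l2_inner (pull \<pi> I Z) (M (pull \<pi> I X)) + l2_inner (pull \<pi>' I' Z) (P (pull \<pi>' I' X)))"
    if x: "x \<in> \<L> I" for x
    by (rule glue_weakE[OF g M P J V, unfolded JV, OF x]) (auto simp: fixed[OF x])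
  \<comment> \<open>\<open>S\<close> selects, for every boundary value, its equilibrium extension
    across one copy of the glued piece \<open>P\<close>.\<close>
  then obtain S where S: "\<And>x. x \<in> \<L> I \<Longrightarrow> S x \<in> \<L> J" "\<And>x i. x \<in> \<L> I \<Longrightarrow> i \<in> I \<Longrightarrow> S x i = x i"
    "\<And>x Z. x \<in> \<L> I \<Longrightarrow> Z \<in> \<L> J \<Longrightarrow> l2_inner Z (M x) =
       l2_inner (pull \<pi> I Z) (M (pull \<pi> I (S x))) + l2_inner (pull \<pi>' I' Z) (P (pull \<pi>' I' (S x)))"
    by metis
  define xs where "xs n = ((\<lambda>x. pull \<pi> I (S x)) ^^ n) x" for n
  define X where "X n = S (xs n)" for n
  have xs0: "xs 0 = x" and xsS: "xs (Suc n) = pull \<pi> I (X n)" for n by (auto simp: xs_def X_def)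
  have xsL: "xs n \<in> \<L> I" for n
    by (induction n) (auto simp: xs0 x xsS X_def intro!: pull_L[OF g(1) S(1)])
  have XL: "X n \<in> \<L> J" and Xx: "i \<in> I \<Longrightarrow> X n i = xs n i" for n i
    using S(1,2)[OF xsL] by (auto simp: X_def)
  have eq: "l2_inner Z (M (xs n)) =
       l2_inner (pull \<pi> I Z) (M (xs (Suc n))) + l2_inner (pull \<pi>' I' Z) (P (pull \<pi>' I' (X n)))"
    if "Z \<in> \<L> J" for Z n using S(3)[OF xsL that] by (simp add: xsS X_def)
  obtain c where c: "c > 0" "\<And>x. x \<in> \<L> I' \<Longrightarrow> c * (l2_norm x)\<^sup>2 \<le> Re (l2_inner x (P x))"
    using coer_inner_pos[OF P] by metis
  obtain cM where cM: "cM > 0" "\<And>x. x \<in> \<L> I \<Longrightarrow> cM * (l2_norm x)\<^sup>2 \<le> Re (l2_inner x (M x))"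
    using coer_inner_pos[OF M] by metis
  define e where "e n = Re (l2_inner (xs n) (M (xs n)))" for n
  have e0: "0 \<le> e n" for n
    using cM(1) order_trans[OF _ cM(2)[OF xsL[of n]]] by (simp add: e_def)
  \<comment> \<open>The identity is tested on the equilibrium field itself: one step loses exactly
    the energy stored in the copy of \<open>P\<close>, and this dominates the squared values on the
    cut because the cut lies in the image of \<open>\<pi>'\<close>.\<close>
  have e_step: "c * (l2_norm (restr V (X n)))\<^sup>2 \<le> e n - e (Suc n)" for n
  proof -
    have "l2_inner (xs n) (M (xs n)) = l2_inner (X n) (M (xs n))"
      by (rule L_ext_inner[symmetric, OF coer_closed[OF M xsL]]) (rule Xx)
    then have "e n = e (Suc n) + Re (l2_inner (pull \<pi>' I' (X n)) (P (pull \<pi>' I' (X n))))"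
      using eq[OF XL, of n n] by (simp add: e_def xsS)
    moreover have "c * (l2_norm (pull \<pi>' I' (X n)))\<^sup>2 \<le> Re (l2_inner (pull \<pi>' I' (X n)) (P (pull \<pi>' I' (X n))))"
      by (rule c(2)[OF pull_L[OF g(2) XL]])
    moreover have "l2_norm (restr V (X n)) \<le> l2_norm (pull \<pi>' I' (X n))"
      unfolding l2_norm_pull[OF g(2)] using VI'
      by (intro l2_norm_mono l2_restr l2_spaceD[OF XL]) (auto simp: restr_def)
    then have "c * (l2_norm (restr V (X n)))\<^sup>2 \<le> c * (l2_norm (pull \<pi>' I' (X n)))\<^sup>2"
      using c(1) by (intro mult_left_mono power_mono) auto
    ultimately show ?thesis by linarith
  qed
  have "e (Suc n) \<le> e n" for n
    using order_trans[OF mult_nonneg_nonneg e_step[of n]] c(1) by simp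
  then have "decseq e" by (simp add: decseq_Suc_iff)
  then obtain l where "e \<longlonglongrightarrow> l" using decseq_convergent[of e 0] e0 by metis
  then have "(\<lambda>n. e n - e (Suc n)) \<longlonglongrightarrow> l - l" by (intro tendsto_diff LIMSEQ_Suc)
  then have "(\<lambda>n. (e n - e (Suc n)) / c) \<longlonglongrightarrow> 0"
    using tendsto_divide_zero by force
  then have cut: "(\<lambda>n. (l2_norm (restr V (X n)))\<^sup>2) \<longlonglongrightarrow> 0"
    by (rule Lim_null_comparison[rotated]) (use e_step c(1) in \<open>auto simp: field_simps\<close>)
  have A_I: "A \<subseteq> I" using A(1) by auto
  have pow_A: "(\<pi> ^^ n) ` A \<subseteq> A" for n
  proof (induction n)
    case (Suc n)
    have "(\<pi> ^^ Suc n) ` A = (\<pi> ^^ n) ` (\<pi> ` A)" by (simp only: funpow_Suc_right image_comp)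
    then show ?case using Suc A(2) by blast
  qed simp
  have inj_pow: "inj_on (\<pi> ^^ n) A" for n
  proof (induction n)
    case (Suc n)
    have "inj_on (\<pi> \<circ> \<pi> ^^ n) A"
      by (rule comp_inj_on[OF Suc]) (rule inj_on_subset[OF g(1)], use pow_A A_I in blast)
    then show ?case by (simp add: o_def)
  qed simp
  \<comment> \<open>Away from the cut the boundary values are merely transported by
    \<open>\<pi>\<close>, so after n steps only a tail of the original family is left there.\<close>
  have orbit: "xs n a = x ((\<pi> ^^ n) a)" if "a \<in> A" for n a
    using that
  proof (induction n arbitrary: a)
    case (Suc n)
    have "\<pi> a \<in> A" using Suc.prems A(2) by blast
    moreover have "xs (Suc n) a = xs n (\<pi> a)"
      using subsetD[OF A_I Suc.prems] subsetD[OF A_I \<open>\<pi> a \<in> A\<close>] Xx[of "\<pi> a" n] by (simp add: xsS pull_simps)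
    ultimately show ?case using Suc.IH by (simp only: funpow_Suc_right o_apply)
  qed (simp add: xs0)
  have tail_eq: "l2_norm (restr A (xs n)) = l2_norm (restr ((\<pi> ^^ n) ` A) x)" for n
  proof -
    have "l2_norm (restr A (xs n)) = l2_norm (pull (\<pi> ^^ n) A x)"
      by (rule arg_cong[where f = l2_norm]) (auto simp: pull_def restr_def orbit)
    then show ?thesis by (simp add: l2_norm_pull[OF inj_pow])
  qed
  have tail: "(\<lambda>n. l2_norm (restr A (xs n))) \<longlonglongrightarrow> 0"
    unfolding tail_eq
  proof (rule l2_norm_restr_tendsto_0[OF l2_spaceD[OF x] _ esc])
    fix m n :: nat assume "m \<le> n"
    then obtain k where "n = m + k" using le_Suc_ex by blast
    then have "(\<pi> ^^ n) ` A = (\<pi> ^^ m) ` ((\<pi> ^^ k) ` A)" by (simp only: funpow_add image_comp)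
    then show "(\<pi> ^^ n) ` A \<subseteq> (\<pi> ^^ m) ` A" using pow_A by blast
  qed
  \<comment> \<open>The next boundary value consists of the current cut values and of a shifted part
    of the current boundary value; both tend to zero.\<close>
  have step: "(l2_norm (xs (Suc n)))\<^sup>2 \<le> (l2_norm (restr V (X n)))\<^sup>2 + (l2_norm (restr A (xs n)))\<^sup>2" for n
  proof -
    let ?y = "restr (\<pi> ` I) (X n)"
    have y: "l2 ?y" by (rule l2_restr[OF l2_spaceD[OF XL]])
    have "(l2_norm (xs (Suc n)))\<^sup>2 = (l2_norm ?y)\<^sup>2" by (simp add: xsS l2_norm_pull[OF g(1)])
    also have "\<dots> \<le> (l2_norm (restr V ?y))\<^sup>2 + (l2_norm (restr (\<pi> ` A) ?y))\<^sup>2"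
      by (rule l2_norm_le_restr_Un[OF y]) (auto simp: restr_def A(1))
    also have "\<dots> \<le> (l2_norm (restr V (X n)))\<^sup>2 + (l2_norm (restr A (xs n)))\<^sup>2"
    proof (intro add_mono power_mono l2_norm_mono l2_restr l2_spaceD[OF XL] l2_spaceD[OF xsL])
      show "cmod (restr (\<pi> ` A) ?y i) \<le> cmod (restr A (xs n) i)" for i
        using A(2) A_I Xx[of i n] by (auto simp: restr_def)
    qed (auto simp: restr_def)
    finally show ?thesis .
  qed
  have "(\<lambda>n. (l2_norm (xs (Suc n)))\<^sup>2) \<longlonglongrightarrow> 0"
  proof (rule Lim_null_comparison)
    show "(\<lambda>n. (l2_norm (restr V (X n)))\<^sup>2 + (l2_norm (restr A (xs n)))\<^sup>2) \<longlonglongrightarrow> 0"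
      using tendsto_add[OF cut tendsto_power[OF tail, of 2]] by simp
  qed (use step in auto)
  from tendsto_real_sqrt[OF this] have "(\<lambda>n. l2_norm (xs (Suc n))) \<longlonglongrightarrow> 0" by simp
  then have lim: "(\<lambda>n. l2_norm (xs n)) \<longlonglongrightarrow> 0" by (rule LIMSEQ_imp_Suc)
  show thesis
    by (rule that[of xs X]; fact xs0 xsL XL Xx xsS eq lim)
qed

text \<open>A discrete Wronskian. When an orbit for \<open>M\<close> is paired with one for
  \<open>M2\<close>, the contributions of \<open>P\<close> cancel by symmetry, so the pairing is
  constant, and it tends to zero with the orbits. At the start this compares the forms of
  \<open>M\<close> and \<open>M2\<close>.\<close>

lemma glue_fixed_unique:
  assumes g: "inj_on \<pi> I" "inj_on \<pi>' I'" and M: "coer \<K> I M" "coer \<K> I M2" and P: "coer \<K> I' P"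
    and J: "J = \<pi> ` I \<union> \<pi>' ` I'" and V: "V = {a \<in> J. fst a = Cut}" and JV: "J - V = I"
    and fixed: "\<And>x. x \<in> \<L> I \<Longrightarrow> glue \<K> \<pi> I M \<pi>' I' P x = M x"
      "\<And>x. x \<in> \<L> I \<Longrightarrow> glue \<K> \<pi> I M2 \<pi>' I' P x = M2 x"
    and VI': "V \<subseteq> \<pi>' ` I'" and A: "A = {a \<in> I. \<pi> a \<notin> V}" "\<pi> ` A \<subseteq> A"
    and esc: "\<And>a. \<exists>n. a \<notin> (\<pi> ^^ n) ` A"
    and x: "x \<in> \<L> I"
  shows "M x = M2 x"
proof (rule L_eqI[OF coer_closed[OF M(1) x] coer_closed[OF M(2) x]])
  fix z assume z: "z \<in> \<L> I"
  obtain xs X where X: "xs 0 = x" "\<And>n. xs n \<in> \<L> I" "\<And>n. X n \<in> \<L> J" "\<And>n i. i \<in> I \<Longrightarrow> X n i = xs n i"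
    "\<And>n. xs (Suc n) = pull \<pi> I (X n)"
    "\<And>n Z. Z \<in> \<L> J \<Longrightarrow> l2_inner Z (M (xs n)) =
       l2_inner (pull \<pi> I Z) (M (xs (Suc n))) + l2_inner (pull \<pi>' I' Z) (P (pull \<pi>' I' (X n)))"
    "(\<lambda>n. l2_norm (xs n)) \<longlonglongrightarrow> 0"
    by (rule glue_fixed_orbit[OF g M(1) P J V JV fixed(1) VI' A esc x]; (assumption | (rule that; assumption)))
  obtain zs Z where Z: "zs 0 = z" "\<And>n. zs n \<in> \<L> I" "\<And>n. Z n \<in> \<L> J" "\<And>n i. i \<in> I \<Longrightarrow> Z n i = zs n i"
    "\<And>n. zs (Suc n) = pull \<pi> I (Z n)"
    "\<And>n X. X \<in> \<L> J \<Longrightarrow> l2_inner X (M2 (zs n)) =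
       l2_inner (pull \<pi> I X) (M2 (zs (Suc n))) + l2_inner (pull \<pi>' I' X) (P (pull \<pi>' I' (Z n)))"
    "(\<lambda>n. l2_norm (zs n)) \<longlonglongrightarrow> 0"
    by (rule glue_fixed_orbit[OF g M(2) P J V JV fixed(2) VI' A esc z]; (assumption | (rule that; assumption)))
  define \<omega> where "\<omega> n = l2_inner (zs n) (M (xs n)) - cnj (l2_inner (xs n) (M2 (zs n)))" for n
  have \<omega>_step: "\<omega> n = \<omega> (Suc n)" for n
  proof -
    have "l2_inner (zs n) (M (xs n)) = l2_inner (Z n) (M (xs n))"
      by (rule L_ext_inner[symmetric, OF coer_closed[OF M(1) X(2)]]) (rule Z(4))
    also have "\<dots> = l2_inner (zs (Suc n)) (M (xs (Suc n))) + l2_inner (pull \<pi>' I' (Z n)) (P (pull \<pi>' I' (X n)))"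
      by (simp add: X(6)[OF Z(3)] Z(5))
    finally have 1: "l2_inner (zs n) (M (xs n)) = \<dots>" .
    have "l2_inner (xs n) (M2 (zs n)) = l2_inner (X n) (M2 (zs n))"
      by (rule L_ext_inner[symmetric, OF coer_closed[OF M(2) Z(2)]]) (rule X(4))
    also have "\<dots> = l2_inner (xs (Suc n)) (M2 (zs (Suc n))) + l2_inner (pull \<pi>' I' (X n)) (P (pull \<pi>' I' (Z n)))"
      by (simp add: Z(6)[OF X(3)] X(5))
    finally have 2: "l2_inner (xs n) (M2 (zs n)) = \<dots>" .
    have "l2_inner (pull \<pi>' I' (Z n)) (P (pull \<pi>' I' (X n))) = cnj (l2_inner (pull \<pi>' I' (X n)) (P (pull \<pi>' I' (Z n))))"
      using coer_sym[OF P pull_L[OF g(2) Z(3)] pull_L[OF g(2) X(3)], of n n]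
      by (simp add: l2_inner_commute[symmetric])
    then show ?thesis unfolding \<omega>_def 1 2 by simp
  qed
  have const: "\<omega> n = \<omega> 0" for n by (induction n) (simp_all add: \<omega>_step[symmetric])
  obtain B where B: "B > 0" "\<And>x. x \<in> \<L> I \<Longrightarrow> l2_norm (M x) \<le> B * l2_norm x"
    using coer_bounded[OF M(1)] by metis
  obtain B2 where B2: "B2 > 0" "\<And>x. x \<in> \<L> I \<Longrightarrow> l2_norm (M2 x) \<le> B2 * l2_norm x"
    using coer_bounded[OF M(2)] by metis
  have "\<omega> \<longlonglongrightarrow> 0"
  proof (rule Lim_null_comparison)
    show "(\<lambda>n. l2_norm (zs n) * (B * l2_norm (xs n)) + l2_norm (xs n) * (B2 * l2_norm (zs n))) \<longlonglongrightarrow> 0"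
      by (rule tendsto_eq_intros X(7) Z(7) refl | simp)+
    have "cmod (\<omega> n) \<le> l2_norm (zs n) * (B * l2_norm (xs n)) + l2_norm (xs n) * (B2 * l2_norm (zs n))" for n
    proof -
      have "cmod (\<omega> n) \<le> cmod (l2_inner (zs n) (M (xs n))) + cmod (l2_inner (xs n) (M2 (zs n)))"
        unfolding \<omega>_def by (rule order_trans[OF norm_triangle_ineq4]) simp
      also have "\<dots> \<le> l2_norm (zs n) * l2_norm (M (xs n)) + l2_norm (xs n) * l2_norm (M2 (zs n))"
        by (intro add_mono l2_Cauchy_Schwarz l2_spaceD[OF X(2)] l2_spaceD[OF Z(2)]
            l2_spaceD[OF coer_closed[OF M(1) X(2)]] l2_spaceD[OF coer_closed[OF M(2) Z(2)]])
      also have "\<dots> \<le> l2_norm (zs n) * (B * l2_norm (xs n)) + l2_norm (xs n) * (B2 * l2_norm (zs n))"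
        by (intro add_mono mult_left_mono B(2) B2(2) X(2) Z(2)) auto
      finally show ?thesis .
    qed
    then show "\<forall>\<^sub>F n in sequentially. norm (\<omega> n) \<le> l2_norm (zs n) * (B * l2_norm (xs n)) + l2_norm (xs n) * (B2 * l2_norm (zs n))"
      by simp
  qed
  moreover have "\<omega> \<longlonglongrightarrow> \<omega> 0"
    by (rule tendsto_eventually, rule always_eventually, rule allI, rule const)
  ultimately have "\<omega> 0 = 0" using LIMSEQ_unique by blast
  then have "l2_inner z (M x) = cnj (l2_inner x (M2 z))" by (simp add: \<omega>_def X(1) Z(1))
  also have "\<dots> = l2_inner z (M2 x)"
    using coer_sym[OF M(2) z x] by (simp add: l2_inner_commute[symmetric])
  finally show "l2_inner z (M x) = l2_inner z (M2 x)" .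
qed

end

section \<open>The lattice\<close>

text \<open>By compactness of the unit sphere.\<close>

lemma (in scalars) finite_form_coercive:
  fixes q :: "'a \<Rightarrow> 'a \<Rightarrow> complex"
  assumes L: "finite L"
    and pos: "\<And>y. (\<And>a. a \<in> L \<Longrightarrow> y a \<in> \<K>) \<Longrightarrow> (\<exists>a\<in>L. y a \<noteq> 0) \<Longrightarrow>
      0 < Re (\<Sum>a\<in>L. \<Sum>b\<in>L. cnj (y a) * q a b * y b)"
  obtains c where "c > 0" "\<And>y. (\<And>a. a \<in> L \<Longrightarrow> y a \<in> \<K>) \<Longrightarrow>
      c * (\<Sum>a\<in>L. (cmod (y a))\<^sup>2) \<le> Re (\<Sum>a\<in>L. \<Sum>b\<in>L. cnj (y a) * q a b * y b)"
proof -
  define f where "f y = Re (\<Sum>a\<in>L. \<Sum>b\<in>L. cnj (y a) * q a b * y b)" for y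
  define N where "N y = (\<Sum>a\<in>L. (cmod (y a))\<^sup>2)" for y :: "'a \<Rightarrow> complex"
  \<comment> \<open>Coordinates outside \<open>L\<close> are pinned to 0 so that the sphere lies in
    a product of compact sets. For empty \<open>L\<close> the sphere is empty, which is treated as a
    separate case below.\<close>
  define S where "S = Pi\<^sub>E UNIV (\<lambda>a. if a \<in> L then \<K> \<inter> cball 0 1 else {0}) \<inter> {y. N y = 1}"
  have K: "closed \<K>" using scalars closed_complex_Reals by auto
  have "compact (if a \<in> L then \<K> \<inter> cball 0 1 else {0::complex})" for a
    using closed_Int_compact[OF K compact_cball] by auto
  then have "compactin (product_topology (\<lambda>_. euclidean) UNIV) (Pi\<^sub>E UNIV (\<lambda>a. if a \<in> L then \<K> \<inter> cball 0 1 else {0::complex}))"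
    unfolding compactin_PiE by (simp add: compactin_euclidean_iff)
  then have box: "compact (Pi\<^sub>E UNIV (\<lambda>a. if a \<in> L then \<K> \<inter> cball 0 1 else {0::complex}))"
    by (simp add: euclidean_product_topology compactin_euclidean_iff)
  have "continuous_on UNIV N" unfolding N_def
    by (intro continuous_intros) (auto intro: continuous_on_product_coordinates)
  then have "closed {y. N y = 1}" by (intro closed_Collect_eq) auto
  then have S: "compact S" unfolding S_def by (intro compact_Int_closed box)
  have f: "continuous_on S f" unfolding f_def
    by (intro continuous_intros) (auto intro: continuous_on_subset[OF continuous_on_product_coordinates])
  have fpos: "0 < f y" if "y \<in> S" for y
  proof -
    have "N y = 1" using that by (simp add: S_def)
    then have "\<exists>a\<in>L. y a \<noteq> 0" unfolding N_def by (rule contrapos_pp) simp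
    moreover have "y a \<in> \<K>" if "a \<in> L" for a
      using \<open>y \<in> S\<close> that by (auto simp: S_def PiE_iff split: if_splits dest!: spec[of _ a])
    ultimately show ?thesis unfolding f_def by (intro pos)
  qed
  obtain c where c: "c > 0" "\<And>y. y \<in> S \<Longrightarrow> c \<le> f y"
  proof (cases "S = {}")
    case True then show ?thesis using that[of 1] by auto
  next
    case False
    then obtain y where "y \<in> S" "\<forall>z\<in>S. f y \<le> f z" using continuous_attains_inf[OF S False f] by auto
    then show ?thesis using that[of "f y"] fpos by auto
  qed
  show thesis
  proof (rule that[OF c(1)])
    fix y assume y: "\<And>a. a \<in> L \<Longrightarrow> y a \<in> \<K>"
    show "c * (\<Sum>a\<in>L. (cmod (y a))\<^sup>2) \<le> Re (\<Sum>a\<in>L. \<Sum>b\<in>L. cnj (y a) * q a b * y b)"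
    proof (cases "N y = 0")
      case True
      then have "\<And>a. a \<in> L \<Longrightarrow> y a = 0" using L by (auto simp: N_def sum_nonneg_eq_0_iff)
      then show ?thesis by (simp)
    next
      case False
      then have Npos: "N y > 0" unfolding N_def by (metis less_eq_real_def sum_nonneg zero_le_power2)
      \<comment> \<open>Both sides are homogeneous of degree 2, so the estimate scales from the unit
        sphere.\<close>
      define r where "r = 1 / sqrt (N y)"
      have r: "r > 0" "r\<^sup>2 * N y = 1" using Npos by (auto simp: r_def power_divide)
      define z where "z a = (if a \<in> L then of_real r * y a else 0)" for a
      have "N z = (\<Sum>a\<in>L. r\<^sup>2 * (cmod (y a))\<^sup>2)"
        unfolding N_def by (rule sum.cong) (auto simp: z_def norm_mult power_mult_distrib)
      then have Nz: "N z = 1" using r(2) by (simp add: N_def sum_distrib_left)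
      have "cmod (z a) \<le> 1" if "a \<in> L" for a
      proof -
        have "(cmod (z a))\<^sup>2 \<le> N z" unfolding N_def using L that by (intro member_le_sum) auto
        then show ?thesis using Nz by (simp add: abs_square_le_1)
      qed
      then have "z \<in> S" using Nz y by (auto simp: S_def PiE_iff z_def)
      then have "c \<le> f z" by (rule c(2))
      also have "f z = Re (\<Sum>a\<in>L. \<Sum>b\<in>L. of_real (r\<^sup>2) * (cnj (y a) * q a b * y b))"
        unfolding f_def by (intro arg_cong[where f = Re] sum.cong refl) (simp add: z_def power2_eq_square)
      also have "\<dots> = r\<^sup>2 * f y"
        unfolding f_def sum_distrib_left[symmetric] by simp
      finally have "c * N y \<le> r\<^sup>2 * f y * N y" using Npos by (intro mult_right_mono) auto
      also have "\<dots> = f y" using r(2) by (metis mult.assoc mult.commute mult_1)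
      finally show ?thesis by (simp add: f_def N_def)
    qed
  qed
qed

lemma (in scalars) L_K: "x \<in> \<L> I \<Longrightarrow> x i \<in> \<K>"
  by (cases "i \<in> I") (simp_all add: l2_space_iff)

lemma (in scalars) L_0: "x \<in> \<L> I \<Longrightarrow> i \<notin> I \<Longrightarrow> x i = 0"
  by (simp add: l2_space_iff)

type_synonym lattice_edge = "bool \<times> int \<times> int \<times> nat"

text \<open>\<open>(True, k, l, j)\<close> is the \<open>j\<close>-th coordinate of the horizontal edge from \<open>(k, l)\<close> to
  \<open>(k + 1, l)\<close>, and \<open>(False, k, l, j)\<close> that of the vertical edge from \<open>(k, l)\<close> to \<open>(k, l + 1)\<close>;
  \<open>side_edge (k, l)\<close> are the sides of the face with South-West corner \<open>(k, l)\<close>.\<close>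

fun side_edge :: "int \<times> int \<Rightarrow> edge \<times> nat \<Rightarrow> lattice_edge" where
  "side_edge (k, l) (South, j) = (True, k, l, j)"
| "side_edge (k, l) (North, j) = (True, k, l + 1, j)"
| "side_edge (k, l) (West, j) = (False, k, l, j)"
| "side_edge (k, l) (East, j) = (False, k + 1, l, j)"
| "side_edge (k, l) (Cut, j) = (True, k, l, j)"

abbreviation side :: "(int \<times> int) \<times> edge \<times> nat \<Rightarrow> lattice_edge" where
  "side p \<equiv> side_edge (fst p) (snd p)"

section \<open>Quadratic forms on sets of faces\<close>

text \<open>A face operator enters only through its entries \<open>q\<close>, a Hermitian positive
  kernel on the labels of one face. The mirrored kernel, and a matrix without vertical coordinates,
  are then instances too.\<close>

locale lattice = scalars +
  fixes n1 n2 :: nat and q :: "edge \<times> nat \<Rightarrow> edge \<times> nat \<Rightarrow> complex"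
  fixes loc :: "(edge \<times> nat) set"
  defines "loc \<equiv> {South, North} \<times> {..<n1} \<union> {West, East} \<times> {..<n2}"
  assumes q_K: "a \<in> loc \<Longrightarrow> b \<in> loc \<Longrightarrow> q a b \<in> \<K>"
    and q_sym: "a \<in> loc \<Longrightarrow> b \<in> loc \<Longrightarrow> q b a = cnj (q a b)"
    and q_pos: "(\<And>a. a \<in> loc \<Longrightarrow> y a \<in> \<K>) \<Longrightarrow> (\<exists>a\<in>loc. y a \<noteq> 0) \<Longrightarrow>
      0 < Re (\<Sum>a\<in>loc. \<Sum>b\<in>loc. cnj (y a) * q a b * y b)"
begin

lemma finite_loc [simp]: "finite loc"
  by (simp add: loc_def)

lemma loc_iff: "(e, j) \<in> loc \<longleftrightarrow> (if e \<in> {South, North} then j < n1 else e \<in> {West, East} \<and> j < n2)"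
  by (auto simp: loc_def)

definition edges :: "(int \<times> int) set \<Rightarrow> lattice_edge set" where
  "edges F = side ` (F \<times> loc)"

definition faces_op :: "(int \<times> int) set \<Rightarrow> ((int \<times> int) \<times> edge \<times> nat) l2_op" where
  "faces_op F Y p = (if p \<in> F \<times> loc then \<Sum>b\<in>loc. q (snd p) b * Y (fst p, b) else 0)"

definition face_form :: "int \<times> int \<Rightarrow> (lattice_edge \<Rightarrow> complex) \<Rightarrow> (lattice_edge \<Rightarrow> complex) \<Rightarrow> complex" where
  "face_form \<phi> Z X = (\<Sum>a\<in>loc. \<Sum>b\<in>loc. cnj (Z (side_edge \<phi> a)) * q a b * X (side_edge \<phi> b))"

definition form :: "(int \<times> int) set \<Rightarrow> (lattice_edge \<Rightarrow> complex) \<Rightarrow> (lattice_edge \<Rightarrow> complex) \<Rightarrow> complex" where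
  "form F Z X = (\<Sum>\<^sub>\<infinity>\<phi>\<in>F. face_form \<phi> Z X)"

lemma infsum_faces:
  fixes f :: "(int \<times> int) \<times> edge \<times> nat \<Rightarrow> complex"
  assumes "f summable_on UNIV" "\<And>p. p \<notin> F \<times> loc \<Longrightarrow> f p = 0"
  shows "infsum f UNIV = (\<Sum>\<^sub>\<infinity>\<phi>\<in>F. \<Sum>a\<in>loc. f (\<phi>, a))" "(\<lambda>\<phi>. \<Sum>a\<in>loc. f (\<phi>, a)) summable_on F"
proof -
  have s: "f summable_on F \<times> loc" using summable_on_subset_banach[OF assms(1)] by blast
  have "infsum f UNIV = infsum f (F \<times> loc)"
    by (rule infsum_cong_neutral) (use assms(2) in auto)
  then show "infsum f UNIV = (\<Sum>\<^sub>\<infinity>\<phi>\<in>F. \<Sum>a\<in>loc. f (\<phi>, a))"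
    using infsum_Sigma_banach[OF s] by simp
  show "(\<lambda>\<phi>. \<Sum>a\<in>loc. f (\<phi>, a)) summable_on F"
    using summable_on_Sigma_banach[of "\<lambda>\<phi> a. f (\<phi>, a)" F "\<lambda>_. loc"] s by simp
qed

lemma infsum_faces_real:
  fixes f :: "(int \<times> int) \<times> edge \<times> nat \<Rightarrow> real"
  assumes "f summable_on UNIV" "\<And>p. p \<notin> F \<times> loc \<Longrightarrow> f p = 0"
  shows "infsum f UNIV = (\<Sum>\<^sub>\<infinity>\<phi>\<in>F. \<Sum>a\<in>loc. f (\<phi>, a))" "(\<lambda>\<phi>. \<Sum>a\<in>loc. f (\<phi>, a)) summable_on F"
proof -
  have s: "f summable_on F \<times> loc" using summable_on_subset_banach[OF assms(1)] by blast
  have "infsum f UNIV = infsum f (F \<times> loc)"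
    by (rule infsum_cong_neutral) (use assms(2) in auto)
  then show "infsum f UNIV = (\<Sum>\<^sub>\<infinity>\<phi>\<in>F. \<Sum>a\<in>loc. f (\<phi>, a))"
    using infsum_Sigma_banach[OF s] by simp
  show "(\<lambda>\<phi>. \<Sum>a\<in>loc. f (\<phi>, a)) summable_on F"
    using summable_on_Sigma_banach[of "\<lambda>\<phi> a. f (\<phi>, a)" F "\<lambda>_. loc"] s by simp
qed

lemma q_bound:
  obtains C where "C \<ge> 0" "\<And>a b. a \<in> loc \<Longrightarrow> b \<in> loc \<Longrightarrow> cmod (q a b) \<le> C"
proof (rule that[of "\<Sum>a\<in>loc. \<Sum>b\<in>loc. cmod (q a b)"])
  fix a b assume ab: "a \<in> loc" "b \<in> loc"
  have "cmod (q a b) \<le> (\<Sum>b\<in>loc. cmod (q a b))" using ab by (intro member_le_sum) auto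
  also have "\<dots> \<le> (\<Sum>a\<in>loc. \<Sum>b\<in>loc. cmod (q a b))"
    using ab by (intro member_le_sum[of a loc "\<lambda>a. \<Sum>b\<in>loc. cmod (q a b)"]) (auto intro: sum_nonneg)
  finally show "cmod (q a b) \<le> (\<Sum>a\<in>loc. \<Sum>b\<in>loc. cmod (q a b))" .
qed (intro sum_nonneg norm_ge_zero)

lemma faces_op_bound:
  obtains B where "\<And>F Y. Y \<in> \<L> (F \<times> loc) \<Longrightarrow> l2 (faces_op F Y) \<and> l2_norm (faces_op F Y) \<le> B * l2_norm Y"
proof -
  obtain C where C: "C \<ge> 0" "\<And>a b. a \<in> loc \<Longrightarrow> b \<in> loc \<Longrightarrow> cmod (q a b) \<le> C" using q_bound by blast
  define m where "m = real (card loc)"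
  show thesis
  proof (rule that[of "m * C"])
    fix F :: "(int \<times> int) set" and Y assume Y: "Y \<in> \<L> (F \<times> loc)"
    have pt: "L2_set (\<lambda>a. cmod (faces_op F Y (\<phi>, a))) loc \<le> m * C * L2_set (\<lambda>a. cmod (Y (\<phi>, a))) loc" for \<phi>
    proof (cases "\<phi> \<in> F")
      case True
      let ?n = "L2_set (\<lambda>a. cmod (Y (\<phi>, a))) loc"
      have one: "cmod (faces_op F Y (\<phi>, a)) \<le> C * (\<Sum>b\<in>loc. cmod (Y (\<phi>, b)))" if "a \<in> loc" for a
      proof -
        have "cmod (faces_op F Y (\<phi>, a)) \<le> (\<Sum>b\<in>loc. cmod (q a b * Y (\<phi>, b)))"
          using True that by (auto simp: faces_op_def norm_sum)
        also have "\<dots> \<le> (\<Sum>b\<in>loc. C * cmod (Y (\<phi>, b)))"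
          unfolding norm_mult by (intro sum_mono mult_right_mono C(2) that) auto
        finally show ?thesis by (simp add: sum_distrib_left)
      qed
      \<comment> \<open>Cauchy-Schwarz against the constant 1 costs a square root of
        \<open>m\<close>; a second one appears when the same bound is summed over the labels, whence
        \<open>m * C\<close>.\<close>
      have S: "(\<Sum>b\<in>loc. cmod (Y (\<phi>, b))) \<le> sqrt m * ?n"
        using L2_set_mult_ineq[of "\<lambda>_. 1" "\<lambda>b. cmod (Y (\<phi>, b))" loc] by (simp add: L2_set_constant m_def)
      have "L2_set (\<lambda>a. cmod (faces_op F Y (\<phi>, a))) loc \<le> L2_set (\<lambda>a. C * (sqrt m * ?n)) loc"
        using one mult_left_mono[OF S C(1)] by (intro L2_set_mono) (auto intro: order_trans)
      also have "\<dots> = m * C * ?n" using C(1)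
        by (simp add: L2_set_constant m_def[symmetric]) (simp add: m_def)
      finally show ?thesis .
    next
      case False
      then have "L2_set (\<lambda>a. cmod (faces_op F Y (\<phi>, a))) loc = 0" by (intro L2_set_0') (auto simp: faces_op_def)
      then show ?thesis using C(1) by (simp add: m_def)
    qed
    have sq: "(\<Sum>a\<in>loc. (cmod (faces_op F Y (\<phi>, a)))\<^sup>2) \<le> (m * C)\<^sup>2 * (\<Sum>a\<in>loc. (cmod (Y (\<phi>, a)))\<^sup>2)" for \<phi>
      using power_mono[OF pt, of \<phi> 2] by (simp add: power_mult_distrib L2_set_def sum_nonneg)
    have mC: "m * C \<ge> 0" using C(1) by (simp add: m_def)
    have fin: "L2_set (\<lambda>p. cmod (faces_op F Y p)) G \<le> m * C * l2_norm Y" if G: "finite G" for G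
    proof -
      have "(\<Sum>p\<in>G. (cmod (faces_op F Y p))\<^sup>2) = (\<Sum>p\<in>G \<inter> F \<times> loc. (cmod (faces_op F Y p))\<^sup>2)"
        by (rule sum.mono_neutral_right) (use G in \<open>auto simp: faces_op_def\<close>)
      also have "\<dots> \<le> (\<Sum>p\<in>fst ` G \<times> loc. (cmod (faces_op F Y p))\<^sup>2)"
        by (rule sum_mono2) (use G in force)+
      also have "\<dots> = (\<Sum>\<phi>\<in>fst ` G. \<Sum>a\<in>loc. (cmod (faces_op F Y (\<phi>, a)))\<^sup>2)"
        by (simp add: sum.cartesian_product)
      also have "\<dots> \<le> (\<Sum>\<phi>\<in>fst ` G. (m * C)\<^sup>2 * (\<Sum>a\<in>loc. (cmod (Y (\<phi>, a)))\<^sup>2))"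
        by (rule sum_mono) (rule sq)
      also have "\<dots> = (m * C)\<^sup>2 * (\<Sum>p\<in>fst ` G \<times> loc. (cmod (Y p))\<^sup>2)"
        by (simp add: sum.cartesian_product sum_distrib_left)
      also have "\<dots> \<le> (m * C)\<^sup>2 * (l2_norm Y)\<^sup>2"
        unfolding l2_norm_power2 using l2_spaceD[OF Y] G
        by (intro mult_left_mono finite_sum_le_infsum) auto
      finally show ?thesis using mC
        by (simp add: L2_set_def real_le_lsqrt power_mult_distrib)
    qed
    from l2_norm_leI[OF _ fin] mC show "l2 (faces_op F Y) \<and> l2_norm (faces_op F Y) \<le> m * C * l2_norm Y" by simp
  qed
qed

text \<open>Before edges are identified the operator is block diagonal with one and the same finite
  block per face, so the constants of a single face serve for every set \<open>F\<close>.\<close>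

lemma faces_op_coer: "coer \<K> (F \<times> loc) (faces_op F)"
proof -
  obtain c where c: "c > 0" "\<And>y. (\<And>a. a \<in> loc \<Longrightarrow> y a \<in> \<K>) \<Longrightarrow>
      c * (\<Sum>a\<in>loc. (cmod (y a))\<^sup>2) \<le> Re (\<Sum>a\<in>loc. \<Sum>b\<in>loc. cnj (y a) * q a b * y b)"
    using finite_form_coercive[OF finite_loc, of q] q_pos by blast
  obtain B where B: "\<And>F Y. Y \<in> \<L> (F \<times> loc) \<Longrightarrow> l2 (faces_op F Y) \<and> l2_norm (faces_op F Y) \<le> B * l2_norm Y"
    using faces_op_bound by blast
  have opL: "faces_op F Y \<in> \<L> (F \<times> loc)" if Y: "Y \<in> \<L> (F \<times> loc)" for Y
    unfolding l2_space_iff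
  proof (intro conjI ballI allI impI)
    show "l2 (faces_op F Y)" using B[OF Y] by blast
    show "faces_op F Y p \<in> \<K>" if "p \<in> F \<times> loc" for p
      using that Y by (auto simp: faces_op_def l2_space_iff intro!: K_sum K_closed(8) q_K)
  qed (auto simp: faces_op_def)
  have inner: "l2_inner Z (faces_op F Y) = (\<Sum>\<^sub>\<infinity>\<phi>\<in>F. \<Sum>a\<in>loc. \<Sum>b\<in>loc. cnj (Z (\<phi>, a)) * q a b * Y (\<phi>, b))"
    "(\<lambda>\<phi>. \<Sum>a\<in>loc. \<Sum>b\<in>loc. cnj (Z (\<phi>, a)) * q a b * Y (\<phi>, b)) summable_on F"
    if Z: "Z \<in> \<L> (F \<times> loc)" and Y: "Y \<in> \<L> (F \<times> loc)" for Z Y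
  proof -
    have s: "(\<lambda>p. cnj (Z p) * faces_op F Y p) summable_on UNIV"
      by (rule l2_mult_summable[OF l2_spaceD[OF Z] l2_spaceD[OF opL[OF Y]]])
    have eq: "(\<Sum>a\<in>loc. cnj (Z (\<phi>, a)) * faces_op F Y (\<phi>, a)) =
      (\<Sum>a\<in>loc. \<Sum>b\<in>loc. cnj (Z (\<phi>, a)) * q a b * Y (\<phi>, b))" if "\<phi> \<in> F" for \<phi>
      using that by (auto simp: faces_op_def sum_distrib_left mult.assoc)
    have z: "cnj (Z p) * faces_op F Y p = 0" if "p \<notin> F \<times> loc" for p using that by (simp add: faces_op_def)
    have *: "(\<Sum>\<^sub>\<infinity>p. cnj (Z p) * faces_op F Y p) = (\<Sum>\<^sub>\<infinity>\<phi>\<in>F. \<Sum>a\<in>loc. cnj (Z (\<phi>, a)) * faces_op F Y (\<phi>, a))"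
      "(\<lambda>\<phi>. \<Sum>a\<in>loc. cnj (Z (\<phi>, a)) * faces_op F Y (\<phi>, a)) summable_on F"
      by (rule infsum_faces[OF s z], assumption)+
    show "l2_inner Z (faces_op F Y) = (\<Sum>\<^sub>\<infinity>\<phi>\<in>F. \<Sum>a\<in>loc. \<Sum>b\<in>loc. cnj (Z (\<phi>, a)) * q a b * Y (\<phi>, b))"
      unfolding l2_inner_def *(1) by (intro infsum_cong eq)
    show "(\<lambda>\<phi>. \<Sum>a\<in>loc. \<Sum>b\<in>loc. cnj (Z (\<phi>, a)) * q a b * Y (\<phi>, b)) summable_on F"
      using *(2) by (subst summable_on_cong[OF eq[symmetric]])
  qed
  show ?thesis
  proof (rule coerI[OF opL _ _ _ _ c(1)])
    fix x y assume x: "x \<in> \<L> (F \<times> loc)" and y: "y \<in> \<L> (F \<times> loc)"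
    show "faces_op F (\<lambda>i. x i + y i) = (\<lambda>i. faces_op F x i + faces_op F y i)"
      by (auto simp: faces_op_def sum.distrib distrib_left)
    have "l2_inner (faces_op F x) y = cnj (l2_inner y (faces_op F x))" by (rule l2_inner_commute)
    also have "\<dots> = (\<Sum>\<^sub>\<infinity>\<phi>\<in>F. cnj (\<Sum>a\<in>loc. \<Sum>b\<in>loc. cnj (y (\<phi>, a)) * q a b * x (\<phi>, b)))"
      by (simp only: inner(1)[OF y x] infsum_cnj)
    also have "\<dots> = (\<Sum>\<^sub>\<infinity>\<phi>\<in>F. \<Sum>a\<in>loc. \<Sum>b\<in>loc. cnj (x (\<phi>, a)) * q a b * y (\<phi>, b))"
    proof (rule infsum_cong)
      fix \<phi>
      have "cnj (\<Sum>a\<in>loc. \<Sum>b\<in>loc. cnj (y (\<phi>, a)) * q a b * x (\<phi>, b))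
          = (\<Sum>a\<in>loc. \<Sum>b\<in>loc. cnj (x (\<phi>, b)) * q b a * y (\<phi>, a))"
        by (auto intro!: sum.cong simp: q_sym[symmetric])
      also have "\<dots> = (\<Sum>a\<in>loc. \<Sum>b\<in>loc. cnj (x (\<phi>, a)) * q a b * y (\<phi>, b))" by (rule sum.swap)
      finally show "cnj (\<Sum>a\<in>loc. \<Sum>b\<in>loc. cnj (y (\<phi>, a)) * q a b * x (\<phi>, b)) = \<dots>" .
    qed
    also have "\<dots> = l2_inner x (faces_op F y)" by (simp add: inner(1)[OF x y])
    finally show "l2_inner x (faces_op F y) = l2_inner (faces_op F x) y" by simp
  next
    fix x assume x: "x \<in> \<L> (F \<times> loc)"
    show "faces_op F (\<lambda>i. a * x i) = (\<lambda>i. a * faces_op F x i)" for a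
      by (auto simp: faces_op_def sum_distrib_left mult_ac)
    show "l2_norm (faces_op F x) \<le> B * l2_norm x" using B[OF x] by blast
    have xK: "x p \<in> \<K>" for p by (rule L_K[OF x])
    have z: "(cmod (x p))\<^sup>2 = 0" if "p \<notin> F \<times> loc" for p using L_0[OF x that] by simp
    have n: "(\<Sum>\<^sub>\<infinity>p. (cmod (x p))\<^sup>2) = (\<Sum>\<^sub>\<infinity>\<phi>\<in>F. \<Sum>a\<in>loc. (cmod (x (\<phi>, a)))\<^sup>2)"
      "(\<lambda>\<phi>. \<Sum>a\<in>loc. (cmod (x (\<phi>, a)))\<^sup>2) summable_on F"
      by (rule infsum_faces_real[OF l2_spaceD[OF x] z], assumption)+
    have "c * (l2_norm x)\<^sup>2 = (\<Sum>\<^sub>\<infinity>\<phi>\<in>F. c * (\<Sum>a\<in>loc. (cmod (x (\<phi>, a)))\<^sup>2))"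
      by (simp add: l2_norm_power2 n(1) infsum_cmult_right')
    also have "\<dots> \<le> (\<Sum>\<^sub>\<infinity>\<phi>\<in>F. Re (\<Sum>a\<in>loc. \<Sum>b\<in>loc. cnj (x (\<phi>, a)) * q a b * x (\<phi>, b)))"
      by (intro infsum_mono summable_on_cmult_right n(2) summable_on_Re inner(2) x c(2) xK)
    also have "\<dots> = Re (l2_inner x (faces_op F x))"
      using infsum_Re[OF inner(2)[OF x x]] by (simp add: inner(1)[OF x x])
    finally show "c * (l2_norm x)\<^sup>2 \<le> Re (l2_inner x (faces_op F x))" .
  qed
qed

end

section \<open>Energy of a region and its translates\<close>

fun translate :: "int \<times> int \<Rightarrow> lattice_edge \<Rightarrow> lattice_edge" where
  "translate (s, t) (h, k, l, j) = (h, k + s, l + t, j)"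

lemma inj_translate: "inj_on (translate \<tau>) A"
  by (cases \<tau>) (auto simp: inj_on_def)

lemma side_edge_translate: "side_edge (fst \<phi> + fst \<tau>, snd \<phi> + snd \<tau>) a = translate \<tau> (side_edge \<phi> a)"
  by (cases \<phi>; cases \<tau>; cases a; cases "fst a") auto

text \<open>Distinct faces with a common edge are neighbours, hence of opposite colour on the
  checkerboard.\<close>

lemma side_edge_inj_parity:
  assumes "side_edge (k, l) (e, j) = side_edge (k', l') (e', j')" "even (k + l) = even (k' + l')"
    "e \<noteq> Cut" "e' \<noteq> Cut"
  shows "k = k' \<and> l = l' \<and> e = e' \<and> j = j'"
  using assms by (cases e; cases e') auto

context lattice
begin

lemma inj_side:
  assumes "\<And>k l k' l'. (k, l) \<in> F \<Longrightarrow> (k', l') \<in> F \<Longrightarrow> even (k + l) = even (k' + l')"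
  shows "inj_on side (F \<times> loc)"
proof (rule inj_onI)
  fix p p' assume p: "p \<in> F \<times> loc" "p' \<in> F \<times> loc" "side p = side p'"
  obtain k l e j k' l' e' j' where eq: "p = ((k, l), e, j)" "p' = ((k', l'), e', j')"
    by (metis surj_pair)
  have "e \<noteq> Cut" "e' \<noteq> Cut" using p eq by (auto simp: loc_def)
  with side_edge_inj_parity[of k l e j k' l' e' j'] assms[of k l k' l'] p eq
  show "p = p'" by simp
qed

text \<open>An edge inside a region belongs to two faces, so \<open>side\<close> is not injective
  there. On each colour of the checkerboard it is, and the two colours are added by the same
  assembly that describes gluing.\<close>

definition energy :: "(int \<times> int) set \<Rightarrow> lattice_edge l2_op" where
  "energy F = assembly side ({\<phi> \<in> F. even (fst \<phi> + snd \<phi>)} \<times> loc) (faces_op {\<phi> \<in> F. even (fst \<phi> + snd \<phi>)})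
     side ({\<phi> \<in> F. odd (fst \<phi> + snd \<phi>)} \<times> loc) (faces_op {\<phi> \<in> F. odd (fst \<phi> + snd \<phi>)})"

lemma inj_even: "inj_on side ({\<phi> \<in> F. even (fst \<phi> + snd \<phi>)} \<times> loc)"
  and inj_odd: "inj_on side ({\<phi> \<in> F. odd (fst \<phi> + snd \<phi>)} \<times> loc)"
  by (rule inj_side; simp)+

lemma energy_coer: "coer \<K> (edges F) (energy F)"
proof -
  have eq: "edges F = side ` ({\<phi> \<in> F. even (fst \<phi> + snd \<phi>)} \<times> loc) \<union> side ` ({\<phi> \<in> F. odd (fst \<phi> + snd \<phi>)} \<times> loc)"
    unfolding edges_def image_Un[symmetric] by (rule arg_cong[where f = "image side"]) auto
  show ?thesis unfolding eq energy_def
    by (rule assembly_coer[OF inj_even inj_odd faces_op_coer faces_op_coer])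
qed

lemma form_inj:
  assumes inj: "inj_on side (F \<times> loc)" and Z: "Z \<in> \<L> A" and X: "X \<in> \<L> B"
  shows "l2_inner (pull side (F \<times> loc) Z) (faces_op F (pull side (F \<times> loc) X)) = form F Z X"
    and "(\<lambda>\<phi>. face_form \<phi> Z X) summable_on F"
proof -
  let ?Z = "pull side (F \<times> loc) Z" and ?X = "pull side (F \<times> loc) X"
  have Z': "?Z \<in> \<L> (F \<times> loc)" and X': "?X \<in> \<L> (F \<times> loc)"
    using pull_L[OF inj] Z X by auto
  have s: "(\<lambda>p. cnj (?Z p) * faces_op F ?X p) summable_on UNIV"
    by (rule l2_mult_summable[OF l2_spaceD[OF Z'] l2_spaceD[OF coer_closed[OF faces_op_coer X']]])
  have eq: "(\<Sum>a\<in>loc. cnj (?Z (\<phi>, a)) * faces_op F ?X (\<phi>, a)) = face_form \<phi> Z X" if "\<phi> \<in> F" for \<phi>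
    using that by (auto simp: faces_op_def face_form_def sum_distrib_left mult.assoc pull_simps)
  have z: "cnj (?Z p) * faces_op F ?X p = 0" if "p \<notin> F \<times> loc" for p
    using that by (simp add: faces_op_def)
  have *: "(\<Sum>\<^sub>\<infinity>p. cnj (?Z p) * faces_op F ?X p) = (\<Sum>\<^sub>\<infinity>\<phi>\<in>F. \<Sum>a\<in>loc. cnj (?Z (\<phi>, a)) * faces_op F ?X (\<phi>, a))"
    "(\<lambda>\<phi>. \<Sum>a\<in>loc. cnj (?Z (\<phi>, a)) * faces_op F ?X (\<phi>, a)) summable_on F"
    by (rule infsum_faces[OF s z], assumption)+
  show "l2_inner ?Z (faces_op F ?X) = form F Z X"
    unfolding l2_inner_def *(1) form_def by (intro infsum_cong eq)
  show "(\<lambda>\<phi>. face_form \<phi> Z X) summable_on F"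
    using *(2) by (subst summable_on_cong[OF eq[symmetric]])
qed

lemma face_form_summable:
  assumes Z: "Z \<in> \<L> A" and X: "X \<in> \<L> B"
  shows "(\<lambda>\<phi>. face_form \<phi> Z X) summable_on F"
proof -
  have "(\<lambda>\<phi>. face_form \<phi> Z X) summable_on {\<phi> \<in> UNIV. even (fst \<phi> + snd \<phi>)} \<union> {\<phi> \<in> UNIV. odd (fst \<phi> + snd \<phi>)}"
    by (rule summable_on_Un_disjoint[OF form_inj(2)[OF inj_even Z X] form_inj(2)[OF inj_odd Z X]]) auto
  then show ?thesis by (rule summable_on_subset_banach) auto
qed

lemma form_Un_disjoint:
  assumes "Z \<in> \<L> A" "X \<in> \<L> B" "F \<inter> F' = {}"
  shows "form (F \<union> F') Z X = form F Z X + form F' Z X"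
  unfolding form_def by (rule infsum_Un_disjoint) (use assms face_form_summable in auto)

lemma energy_inner:
  assumes Z: "Z \<in> \<L> (edges F)" and X: "X \<in> \<L> (edges F)"
  shows "l2_inner Z (energy F X) = form F Z X"
proof -
  let ?e = "{\<phi> \<in> F. even (fst \<phi> + snd \<phi>)}" and ?o = "{\<phi> \<in> F. odd (fst \<phi> + snd \<phi>)}"
  have "l2_inner Z (energy F X) = form ?e Z X + form ?o Z X"
    unfolding energy_def
    by (simp only: assembly_inner[OF inj_even inj_odd faces_op_coer faces_op_coer X Z]
        form_inj(1)[OF inj_even Z X] form_inj(1)[OF inj_odd Z X])
  also have "\<dots> = form (?e \<union> ?o) Z X" by (rule form_Un_disjoint[symmetric, OF Z X]) auto
  also have "?e \<union> ?o = F" by auto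
  finally show ?thesis .
qed

lemma form_cong:
  assumes "\<And>e. e \<in> edges F \<Longrightarrow> Z e = Z' e" "\<And>e. e \<in> edges F \<Longrightarrow> X e = X' e"
  shows "form F Z X = form F Z' X'"
proof -
  have "side_edge \<phi> a \<in> edges F" if "\<phi> \<in> F" "a \<in> loc" for \<phi> a
    using that by (force simp: edges_def)
  then show ?thesis unfolding form_def face_form_def
    by (intro infsum_cong sum.cong refl) (simp add: assms)
qed

lemma form_translate:
  "form ((\<lambda>\<phi>. (fst \<phi> + fst \<tau>, snd \<phi> + snd \<tau>)) ` F) Z X = form F (\<lambda>e. Z (translate \<tau> e)) (\<lambda>e. X (translate \<tau> e))"
proof -
  have "inj_on (\<lambda>\<phi>. (fst \<phi> + fst \<tau>, snd \<phi> + snd \<tau>)) F" by (auto simp: inj_on_def prod_eq_iff)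
  then show ?thesis unfolding form_def
    by (simp add: infsum_reindex o_def face_form_def side_edge_translate)
qed

lemma edges_translate:
  "edges ((\<lambda>\<phi>. (fst \<phi> + fst \<tau>, snd \<phi> + snd \<tau>)) ` F) = translate \<tau> ` edges F"
proof -
  let ?t = "\<lambda>\<phi>. (fst \<phi> + fst \<tau>, snd \<phi> + snd \<tau>)"
  have "?t ` F \<times> loc = (\<lambda>p. (?t (fst p), snd p)) ` (F \<times> loc)" by (force simp: image_iff)
  then show ?thesis unfolding edges_def by (simp add: image_image side_edge_translate)
qed

lemma edges_Un: "edges (F \<union> F') = edges F \<union> edges F'"
  by (auto simp: edges_def)

end

section \<open>Dirichlet-to-Neumann operators\<close>

text \<open>Half-lines begin at 0, so that quarter planes have their corner at the origin and two
  opposite half-lines meet there without translation. The clause for \<open>Cut\<close> is a default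
  value, as no shape has that side.\<close>

fun embed :: "extent \<Rightarrow> extent \<Rightarrow> label \<Rightarrow> lattice_edge" where
  "embed h v (South, k, j) = (True, k, 0, j)"
| "embed h v (North, k, j) = (True, k, if v = Unit then 1 else 0, j)"
| "embed h v (West, k, j) = (False, 0, k, j)"
| "embed h v (East, k, j) = (False, if h = Unit then 1 else 0, k, j)"
| "embed h v (Cut, k, j) = (True, k, 0, j)"

lemma shape_iff:
  "(e, k, j) \<in> shape n1 n2 h v \<longleftrightarrow> e \<in> sides h v \<and>
     (if e \<in> {South, North} then k \<in> positions h \<and> j < n1 else e \<in> {West, East} \<and> k \<in> positions v \<and> j < n2)"
  by (cases e) (auto simp: shape_def)

lemma inj_embed: "inj_on (embed h v) (shape n1 n2 h v)"
proof (rule inj_onI)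
  fix x y assume *: "x \<in> shape n1 n2 h v" "y \<in> shape n1 n2 h v" "embed h v x = embed h v y"
  obtain e k j e' k' j' where "x = (e, k, j)" "y = (e', k', j')" by (metis surj_pair)
  with * show "x = y"
    by (cases e; cases e') (auto simp: shape_iff split: if_splits)
qed

abbreviation region :: "extent \<Rightarrow> extent \<Rightarrow> (int \<times> int) set" where
  "region h v \<equiv> positions h \<times> positions v"

lemma l2_inner_pull_eq:
  assumes "inj_on g I"
  shows "l2_inner z (pull g I y) = l2_inner (push g I z) y"
proof -
  have "l2_inner (push g I z) y = cnj (l2_inner y (push g I z))" by (rule l2_inner_commute)
  also have e: "push g I z = push g I (restr I z)"
    by (rule ext) (auto simp: push_def restr_def the_inv_into_f_f[OF assms])
  also have "l2_inner y (push g I (restr I z)) = l2_inner (pull g I y) (restr I z)"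
    by (rule l2_inner_push[OF assms]) (simp add: restr_def)
  also have "\<dots> = cnj (l2_inner (restr I z) (pull g I y))" by (rule l2_inner_commute)
  also have "l2_inner (restr I z) (pull g I y) = l2_inner z (pull g I y)"
    by (rule l2_inner_cong) (auto simp: pull_def restr_def)
  finally show ?thesis by (simp flip: e)
qed

lemma push_simp: "inj_on g I \<Longrightarrow> i \<in> I \<Longrightarrow> push g I x (g i) = x i"
  by (auto simp: push_def the_inv_into_f_f)

lemma (in scalars) coer_cong:
  assumes "coer \<K> I M" "\<And>x. x \<in> \<L> I \<Longrightarrow> M' x = M x"
  shows "coer \<K> I M'"
proof -
  obtain c where c: "c > 0" "\<And>x. x \<in> \<L> I \<Longrightarrow> c * (l2_norm x)\<^sup>2 \<le> Re (l2_inner x (M x))"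
    using coer_inner_pos[OF assms(1)] by metis
  obtain B where B: "B > 0" "\<And>x. x \<in> \<L> I \<Longrightarrow> l2_norm (M x) \<le> B * l2_norm x"
    using coer_bounded[OF assms(1)] by metis
  note [simp] = assms(2)
  show ?thesis
    by (rule coerI[OF _ _ _ _ _ c(1), where B = B])
      (simp_all add: c(2) B(2) L_add L_cmult coer_closed[OF assms(1)] coer_add[OF assms(1)]
        coer_cmult[OF assms(1)] coer_sym[OF assms(1), symmetric])
qed

lemma (in scalars) coer_conjugate:
  assumes g: "inj_on g I" and S: "coer \<K> (g ` I) S"
  shows "coer \<K> I (\<lambda>x. pull g I (S (push g I x)))"
proof -
  obtain c where c: "c > 0" "\<And>x. x \<in> \<L> (g ` I) \<Longrightarrow> c * (l2_norm x)\<^sup>2 \<le> Re (l2_inner x (S x))"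
    using coer_inner_pos[OF S] by metis
  obtain B where B: "B > 0" "\<And>x. x \<in> \<L> (g ` I) \<Longrightarrow> l2_norm (S x) \<le> B * l2_norm x"
    using coer_bounded[OF S] by metis
  note p = push_L[OF g]
  have n: "l2_norm (push g I x) = l2_norm x" if "x \<in> \<L> I" for x
    by (rule l2_norm_push[OF g]) (use that in \<open>auto simp: l2_space_iff\<close>)
  show ?thesis
  proof (rule coerI[OF _ _ _ _ _ c(1)])
    fix x assume x: "x \<in> \<L> I"
    show "pull g I (S (push g I x)) \<in> \<L> I" by (rule pull_L[OF g coer_closed[OF S p[OF x]]])
    show "pull g I (S (push g I (\<lambda>i. a * x i))) = (\<lambda>i. a * pull g I (S (push g I x)) i)" if "a \<in> \<K>" for a
      by (simp add: push_cmult coer_cmult[OF S that p[OF x]] pull_cmult)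
    show "l2_norm (pull g I (S (push g I x))) \<le> B * l2_norm x"
      unfolding l2_norm_pull[OF g]
      by (rule order_trans[OF l2_norm_restr_le[OF l2_spaceD[OF coer_closed[OF S p[OF x]]]]])
        (use B(2)[OF p[OF x]] n[OF x] in simp)
    show "c * (l2_norm x)\<^sup>2 \<le> Re (l2_inner x (pull g I (S (push g I x))))"
      using c(2)[OF p[OF x]] by (simp add: l2_inner_pull_eq[OF g] n[OF x])
  next
    fix x y assume x: "x \<in> \<L> I" and y: "y \<in> \<L> I"
    show "pull g I (S (push g I (\<lambda>i. x i + y i))) = (\<lambda>i. pull g I (S (push g I x)) i + pull g I (S (push g I y)) i)"
      by (simp add: push_add coer_add[OF S p[OF x] p[OF y]] pull_add)
    show "l2_inner x (pull g I (S (push g I y))) = l2_inner (pull g I (S (push g I x))) y"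
      by (metis l2_inner_pull_eq[OF g] l2_inner_commute coer_sym[OF S p[OF x] p[OF y]])
  qed
qed

context lattice
begin

lemma embed_edges: "embed h v ` shape n1 n2 h v \<subseteq> edges (region h v)"
proof
  fix e assume "e \<in> embed h v ` shape n1 n2 h v"
  then obtain d k j where d: "(d, k, j) \<in> shape n1 n2 h v" "e = embed h v (d, k, j)" by force
  have "\<exists>\<phi>\<in>region h v. (d, j) \<in> loc \<and> e = side_edge \<phi> (d, j)"
  proof (cases "d = South \<or> d = North")
    case True
    \<comment> \<open>The face behind a North side of vertical extent \<open>Neg\<close> lies in row
      -1; in the other cases the adjacent face lies in row 0.\<close>
    then show ?thesis using d
      by (intro bexI[of _ "(k, if v = Neg then -1 else 0)"]; cases v) (auto simp: shape_iff loc_iff split: if_splits)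
  next
    case False
    then show ?thesis using d
      by (intro bexI[of _ "(if h = Neg then -1 else 0, k)"]; cases h) (auto simp: shape_iff loc_iff split: if_splits)
  qed
  then show "e \<in> edges (region h v)" by (force simp: edges_def)
qed

text \<open>The Dirichlet-to-Neumann operator: eliminating all edges off the boundary leaves the
  forces that hold a boundary value in equilibrium. On unbounded regions square summability takes
  the place of a condition at infinity.\<close>

definition dtn :: "extent \<Rightarrow> extent \<Rightarrow> label l2_op" where
  "dtn h v = (let I = shape n1 n2 h v; B = embed h v ` I; E = edges (region h v) in
     on_l2 \<K> I (\<lambda>x. pull (embed h v) I (schur \<K> B (E - B) (energy (region h v)) (push (embed h v) I x))))"

lemma boundary_Un: "embed h v ` shape n1 n2 h v \<union> (edges (region h v) - embed h v ` shape n1 n2 h v) = edges (region h v)"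
  using embed_edges by blast

lemma dtn_coercive: "dtn h v \<in> coercive_ops \<K> (shape n1 n2 h v)"
proof -
  let ?I = "shape n1 n2 h v" and ?B = "embed h v ` shape n1 n2 h v" and ?E = "edges (region h v)"
  let ?D = "\<lambda>x. pull (embed h v) ?I (schur \<K> ?B (?E - ?B) (energy (region h v)) (push (embed h v) ?I x))"
  have "coer \<K> (?B \<union> (?E - ?B)) (energy (region h v))" unfolding boundary_Un by (rule energy_coer)
  then have "coer \<K> ?B (schur \<K> ?B (?E - ?B) (energy (region h v)))"
    using schur_coercive coercive_ops_iff by (metis Diff_disjoint)
  then have "coer \<K> ?I ?D" by (rule coer_conjugate[OF inj_embed])
  moreover have "dtn h v x = ?D x" if "x \<in> \<L> ?I" for x using that by (simp add: dtn_def on_l2_def Let_def)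
  ultimately have "coer \<K> ?I (dtn h v)"
    by (rule coer_cong)
  then show ?thesis by (simp add: coercive_ops_iff dtn_def on_l2_def Let_def)
qed

lemma dtn_coer: "coer \<K> (shape n1 n2 h v) (dtn h v)"
  using dtn_coercive coercive_ops_iff by blast

text \<open>\<open>X\<close> is the equilibrium field with boundary value x: a test field sees its
  forces only through the values on the boundary.\<close>

lemma dtn_weakE:
  assumes x: "x \<in> \<L> (shape n1 n2 h v)"
  obtains X where "X \<in> \<L> (edges (region h v))" "\<And>a. a \<in> shape n1 n2 h v \<Longrightarrow> X (embed h v a) = x a"
    "\<And>Z. Z \<in> \<L> (edges (region h v)) \<Longrightarrow>
       form (region h v) Z X = l2_inner (pull (embed h v) (shape n1 n2 h v) Z) (dtn h v x)"
proof -
  let ?I = "shape n1 n2 h v" and ?B = "embed h v ` shape n1 n2 h v" and ?E = "edges (region h v)"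
  let ?S = "schur \<K> ?B (?E - ?B) (energy (region h v))"
  have N: "coer \<K> (?B \<union> (?E - ?B)) (energy (region h v))" unfolding boundary_Un by (rule energy_coer)
  have px: "push (embed h v) ?I x \<in> \<L> ?B" by (rule push_L[OF inj_embed x])
  obtain X where X: "X \<in> \<L> (?B \<union> (?E - ?B))" "\<And>i. i \<in> ?B \<Longrightarrow> X i = push (embed h v) ?I x i"
    "?S (push (embed h v) ?I x) \<in> \<L> ?B"
    "\<And>Z. Z \<in> \<L> (?B \<union> (?E - ?B)) \<Longrightarrow> l2_inner Z (energy (region h v) X) = l2_inner Z (?S (push (embed h v) ?I x))"
    by (rule schur_weakE[OF N _ px]; auto)
  note X = X[unfolded boundary_Un]
  show thesis
  proof (rule that[OF X(1)])
    fix a assume "a \<in> ?I"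
    then show "X (embed h v a) = x a" by (simp add: X(2) push_simp[OF inj_embed])
  next
    fix Z assume Z: "Z \<in> \<L> ?E"
    have "form (region h v) Z X = l2_inner Z (?S (push (embed h v) ?I x))"
      by (simp add: energy_inner[OF Z X(1), symmetric] X(4)[OF Z])
    also have "\<dots> = l2_inner (push (embed h v) ?I (pull (embed h v) ?I Z)) (?S (push (embed h v) ?I x))"
      by (rule L_ext_inner[OF X(3)]) (auto simp: push_simp[OF inj_embed] pull_simps)
    also have "\<dots> = l2_inner (pull (embed h v) ?I Z) (dtn h v x)"
      by (simp add: l2_inner_pull_eq[OF inj_embed] dtn_def on_l2_def Let_def x)
    finally show "form (region h v) Z X = l2_inner (pull (embed h v) ?I Z) (dtn h v x)" .
  qed
qed

lemma dtn_weakI: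
  assumes X: "X \<in> \<L> (edges (region h v))" "\<And>a. a \<in> shape n1 n2 h v \<Longrightarrow> X (embed h v a) = x a"
    and x: "x \<in> \<L> (shape n1 n2 h v)" and y: "y \<in> \<L> (shape n1 n2 h v)"
    and w: "\<And>Z. Z \<in> \<L> (edges (region h v)) \<Longrightarrow>
       form (region h v) Z X = l2_inner (pull (embed h v) (shape n1 n2 h v) Z) y"
  shows "dtn h v x = y"
proof -
  let ?I = "shape n1 n2 h v" and ?B = "embed h v ` shape n1 n2 h v" and ?E = "edges (region h v)"
  let ?S = "schur \<K> ?B (?E - ?B) (energy (region h v))"
  have N: "coer \<K> (?B \<union> (?E - ?B)) (energy (region h v))" unfolding boundary_Un by (rule energy_coer)
  have px: "push (embed h v) ?I x \<in> \<L> ?B" by (rule push_L[OF inj_embed x])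
  have py: "push (embed h v) ?I y \<in> \<L> ?B" by (rule push_L[OF inj_embed y])
  have "?S (push (embed h v) ?I x) = push (embed h v) ?I y"
  proof (rule schur_weakI[OF N _ px _ _ py, where X = X])
    show "X i = push (embed h v) ?I x i" if "i \<in> ?B" for i
      using that X(2) by (auto simp: push_simp[OF inj_embed])
    fix Z assume "Z \<in> \<L> (?B \<union> (?E - ?B))"
    then have Z: "Z \<in> \<L> ?E" unfolding boundary_Un .
    have "l2_inner (pull (embed h v) ?I Z) y = l2_inner Z (push (embed h v) ?I y)"
      using y by (intro l2_inner_push[symmetric, OF inj_embed]) (auto simp: l2_space_iff)
    then show "l2_inner Z (energy (region h v) X) = l2_inner Z (push (embed h v) ?I y)"
      using w[OF Z] by (simp add: energy_inner[OF Z X(1)])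
  qed (use X(1) boundary_Un in auto)
  moreover have "pull (embed h v) ?I (push (embed h v) ?I y) = y"
    using y by (auto simp: pull_def restr_def push_simp[OF inj_embed] l2_space_iff fun_eq_iff)
  ultimately show ?thesis using x by (simp add: dtn_def on_l2_def Let_def)
qed

end

section \<open>Placing labels and gluing regions\<close>

lemma translate_image_iff: "(b, k, l, j) \<in> translate (s, t) ` E \<longleftrightarrow> (b, k - s, l - t, j) \<in> E"
  by (force simp: image_iff)

lemma hplace_image_iff:
  assumes "c \<in> {West, East}"
  shows "(e, k, j) \<in> hplace c d ` shape n1 n2 h v \<longleftrightarrow>
    (if e = Cut then (c, k, j) \<in> shape n1 n2 h v
     else e \<noteq> c \<and> (e, if e \<in> {South, North} then k - d else k, j) \<in> shape n1 n2 h v)"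
proof
  assume "(e, k, j) \<in> hplace c d ` shape n1 n2 h v"
  then obtain e' k' j' where "(e, k, j) = hplace c d (e', k', j')" "(e', k', j') \<in> shape n1 n2 h v" by force
  then show "if e = Cut then (c, k, j) \<in> shape n1 n2 h v
     else e \<noteq> c \<and> (e, if e \<in> {South, North} then k - d else k, j) \<in> shape n1 n2 h v"
    using assms by (auto simp: shape_iff split: if_splits)
next
  assume "if e = Cut then (c, k, j) \<in> shape n1 n2 h v
     else e \<noteq> c \<and> (e, if e \<in> {South, North} then k - d else k, j) \<in> shape n1 n2 h v"
  then show "(e, k, j) \<in> hplace c d ` shape n1 n2 h v"
    using assms by (intro image_eqI[of _ _ "(if e = Cut then c else e, if e \<in> {South, North} then k - d else k, j)"])
      (auto split: if_splits)
qed

lemma vplace_image_iff: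
  assumes "c \<in> {South, North}"
  shows "(e, k, j) \<in> vplace c d ` shape n1 n2 h v \<longleftrightarrow>
    (if e = Cut then (c, k, j) \<in> shape n1 n2 h v
     else e \<noteq> c \<and> (e, if e \<in> {West, East} then k - d else k, j) \<in> shape n1 n2 h v)"
proof
  assume "(e, k, j) \<in> vplace c d ` shape n1 n2 h v"
  then obtain e' k' j' where "(e, k, j) = vplace c d (e', k', j')" "(e', k', j') \<in> shape n1 n2 h v" by force
  then show "if e = Cut then (c, k, j) \<in> shape n1 n2 h v
     else e \<noteq> c \<and> (e, if e \<in> {West, East} then k - d else k, j) \<in> shape n1 n2 h v"
    using assms by (auto simp: shape_iff split: if_splits)
next
  assume "if e = Cut then (c, k, j) \<in> shape n1 n2 h v
     else e \<noteq> c \<and> (e, if e \<in> {West, East} then k - d else k, j) \<in> shape n1 n2 h v"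
  then show "(e, k, j) \<in> vplace c d ` shape n1 n2 h v"
    using assms by (intro image_eqI[of _ _ "(if e = Cut then c else e, if e \<in> {West, East} then k - d else k, j)"])
      (auto split: if_splits)
qed

lemma Cut_notin_shape: "(Cut, k, j) \<notin> shape n1 n2 h v"
  by (simp add: shape_iff)

lemma inj_hplace: "inj_on (hplace c d) (shape n1 n2 h v)"
proof (rule inj_onI)
  fix x y assume *: "x \<in> shape n1 n2 h v" "y \<in> shape n1 n2 h v" "hplace c d x = hplace c d y"
  obtain e k j e' k' j' where eq: "x = (e, k, j)" "y = (e', k', j')" by (metis surj_pair)
  have "e \<noteq> Cut" "e' \<noteq> Cut" using * eq by (auto simp: shape_iff)
  then show "x = y" using *(3) unfolding eq by (auto split: if_splits)
qed

lemma inj_vplace: "inj_on (vplace c d) (shape n1 n2 h v)"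
proof (rule inj_onI)
  fix x y assume *: "x \<in> shape n1 n2 h v" "y \<in> shape n1 n2 h v" "vplace c d x = vplace c d y"
  obtain e k j e' k' j' where eq: "x = (e, k, j)" "y = (e', k', j')" by (metis surj_pair)
  have "e \<noteq> Cut" "e' \<noteq> Cut" using * eq by (auto simp: shape_iff)
  then show "x = y" using *(3) unfolding eq by (auto split: if_splits)
qed

lemma coercive_ops_eqI:
  assumes "M \<in> coercive_ops \<K> I" "M' \<in> coercive_ops \<K> I" "\<And>x. x \<in> l2_space \<K> I \<Longrightarrow> M x = M' x"
  shows "M = M'"
  using assms by (metis coercive_ops_iff ext)

context lattice
begin

lemma edges_iff:
  "(True, k, l, j) \<in> edges (region h v) \<longleftrightarrow> j < n1 \<and> k \<in> positions h \<and> (l \<in> positions v \<or> l - 1 \<in> positions v)"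
  "(False, k, l, j) \<in> edges (region h v) \<longleftrightarrow> j < n2 \<and> l \<in> positions v \<and> (k \<in> positions h \<or> k - 1 \<in> positions h)"
proof -
  have mem: "side_edge \<phi> a \<in> edges (region h v)" if "\<phi> \<in> region h v" "a \<in> loc" for \<phi> a
    using that by (force simp: edges_def)
  show "(True, k, l, j) \<in> edges (region h v) \<longleftrightarrow> j < n1 \<and> k \<in> positions h \<and> (l \<in> positions v \<or> l - 1 \<in> positions v)"
  proof
    assume "(True, k, l, j) \<in> edges (region h v)"
    then obtain k' l' e j' where "(True, k, l, j) = side_edge (k', l') (e, j')" "k' \<in> positions h" "l' \<in> positions v" "(e, j') \<in> loc"
      by (auto simp: edges_def)
    then show "j < n1 \<and> k \<in> positions h \<and> (l \<in> positions v \<or> l - 1 \<in> positions v)"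
      by (cases e) (auto simp: loc_iff)
  next
    assume "j < n1 \<and> k \<in> positions h \<and> (l \<in> positions v \<or> l - 1 \<in> positions v)"
    then show "(True, k, l, j) \<in> edges (region h v)"
      using mem[of "(k, l)" "(South, j)"] mem[of "(k, l - 1)" "(North, j)"] by (auto simp: loc_iff)
  qed
  show "(False, k, l, j) \<in> edges (region h v) \<longleftrightarrow> j < n2 \<and> l \<in> positions v \<and> (k \<in> positions h \<or> k - 1 \<in> positions h)"
  proof
    assume "(False, k, l, j) \<in> edges (region h v)"
    then obtain k' l' e j' where "(False, k, l, j) = side_edge (k', l') (e, j')" "k' \<in> positions h" "l' \<in> positions v" "(e, j') \<in> loc"
      by (auto simp: edges_def)
    then show "j < n2 \<and> l \<in> positions v \<and> (k \<in> positions h \<or> k - 1 \<in> positions h)"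
      by (cases e) (auto simp: loc_iff)
  next
    assume "j < n2 \<and> l \<in> positions v \<and> (k \<in> positions h \<or> k - 1 \<in> positions h)"
    then show "(False, k, l, j) \<in> edges (region h v)"
      using mem[of "(k, l)" "(West, j)"] mem[of "(k - 1, l)" "(East, j)"] by (auto simp: loc_iff)
  qed
qed

text \<open>The equilibrium fields of the two pieces agree on the cut, and the forces there cancel, so
  they combine to an equilibrium field of the union. The map \<open>\<epsilon>\<close> places all labels, including
  those of the cut, on the lattice.\<close>

lemma glue_dtn:
  assumes g: "inj_on \<pi>1 (shape n1 n2 h1 v1)" "inj_on \<pi>2 (shape n1 n2 h2 v2)"
    and J: "J = \<pi>1 ` shape n1 n2 h1 v1 \<union> \<pi>2 ` shape n1 n2 h2 v2" and V: "V = {a \<in> J. fst a = Cut}"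
    and JV: "J - V = shape n1 n2 h v"
    and V2: "V \<subseteq> \<pi>1 ` shape n1 n2 h1 v1" "V \<subseteq> \<pi>2 ` shape n1 n2 h2 v2"
    and inj: "inj_on \<epsilon> J"
    and \<epsilon>1: "\<And>a. a \<in> shape n1 n2 h1 v1 \<Longrightarrow> \<epsilon> (\<pi>1 a) = translate \<sigma> (embed h1 v1 a)"
    and \<epsilon>2: "\<And>a. a \<in> shape n1 n2 h2 v2 \<Longrightarrow> \<epsilon> (\<pi>2 a) = translate \<tau> (embed h2 v2 a)"
    and \<epsilon>: "\<And>a. a \<in> shape n1 n2 h v \<Longrightarrow> \<epsilon> a = embed h v a"
    and reg: "region h v = (\<lambda>\<phi>. (fst \<phi> + fst \<sigma>, snd \<phi> + snd \<sigma>)) ` region h1 v1 \<union>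
      (\<lambda>\<phi>. (fst \<phi> + fst \<tau>, snd \<phi> + snd \<tau>)) ` region h2 v2"
    and disj: "(\<lambda>\<phi>. (fst \<phi> + fst \<sigma>, snd \<phi> + snd \<sigma>)) ` region h1 v1 \<inter>
      (\<lambda>\<phi>. (fst \<phi> + fst \<tau>, snd \<phi> + snd \<tau>)) ` region h2 v2 = {}"
    and ov: "translate \<sigma> ` edges (region h1 v1) \<inter> translate \<tau> ` edges (region h2 v2) \<subseteq> \<epsilon> ` V"
  shows "glue \<K> \<pi>1 (shape n1 n2 h1 v1) (dtn h1 v1) \<pi>2 (shape n1 n2 h2 v2) (dtn h2 v2) = dtn h v"
proof (rule coercive_ops_eqI[of _ \<K> "shape n1 n2 h v"])
  let ?I1 = "shape n1 n2 h1 v1" and ?I2 = "shape n1 n2 h2 v2" and ?I = "shape n1 n2 h v"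
  let ?G = "glue \<K> \<pi>1 ?I1 (dtn h1 v1) \<pi>2 ?I2 (dtn h2 v2)"
  let ?E1 = "edges (region h1 v1)" and ?E2 = "edges (region h2 v2)" and ?E = "edges (region h v)"
  let ?F1 = "(\<lambda>\<phi>. (fst \<phi> + fst \<sigma>, snd \<phi> + snd \<sigma>)) ` region h1 v1"
  let ?F2 = "(\<lambda>\<phi>. (fst \<phi> + fst \<tau>, snd \<phi> + snd \<tau>)) ` region h2 v2"
  show "?G \<in> coercive_ops \<K> ?I"
    using glue_coercive[OF g dtn_coer dtn_coer J V] JV by simp
  show "dtn h v \<in> coercive_ops \<K> ?I" by (rule dtn_coercive)
  fix x assume x: "x \<in> \<L> ?I"
  obtain X where X: "X \<in> \<L> J" "\<And>i. i \<in> ?I \<Longrightarrow> X i = x i" "?G x \<in> \<L> ?I"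
    "\<And>Z. Z \<in> \<L> J \<Longrightarrow> l2_inner Z (?G x) =
       l2_inner (pull \<pi>1 ?I1 Z) (dtn h1 v1 (pull \<pi>1 ?I1 X)) + l2_inner (pull \<pi>2 ?I2 Z) (dtn h2 v2 (pull \<pi>2 ?I2 X))"
    using glue_weakE[OF g dtn_coer dtn_coer J V, unfolded JV, OF x] by blast
  obtain X1 where X1: "X1 \<in> \<L> ?E1" "\<And>a. a \<in> ?I1 \<Longrightarrow> X1 (embed h1 v1 a) = X (\<pi>1 a)"
    "\<And>Z. Z \<in> \<L> ?E1 \<Longrightarrow> form (region h1 v1) Z X1 = l2_inner (pull (embed h1 v1) ?I1 Z) (dtn h1 v1 (pull \<pi>1 ?I1 X))"
    by (rule dtn_weakE[OF pull_L[OF g(1) X(1)]]) (auto simp: pull_simps)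
  obtain X2 where X2: "X2 \<in> \<L> ?E2" "\<And>a. a \<in> ?I2 \<Longrightarrow> X2 (embed h2 v2 a) = X (\<pi>2 a)"
    "\<And>Z. Z \<in> \<L> ?E2 \<Longrightarrow> form (region h2 v2) Z X2 = l2_inner (pull (embed h2 v2) ?I2 Z) (dtn h2 v2 (pull \<pi>2 ?I2 X))"
    by (rule dtn_weakE[OF pull_L[OF g(2) X(1)]]) (auto simp: pull_simps)
  have E: "?E = translate \<sigma> ` ?E1 \<union> translate \<tau> ` ?E2"
    unfolding reg edges_Un edges_translate ..
  have mem1: "embed h1 v1 b \<in> ?E1" if "b \<in> ?I1" for b using embed_edges[of h1 v1] that by blast
  have mem2: "embed h2 v2 b \<in> ?E2" if "b \<in> ?I2" for b using embed_edges[of h2 v2] that by blast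
  have mem1: "embed h1 v1 b \<in> ?E1" if "b \<in> ?I1" for b using embed_edges[of h1 v1] that by blast
  have mem2: "embed h2 v2 b \<in> ?E2" if "b \<in> ?I2" for b using embed_edges[of h2 v2] that by blast
  \<comment> \<open>On edges common to both pieces the first field takes precedence; the two turn
    out to agree there.\<close>
  define Y where "Y e = push (translate \<sigma>) ?E1 X1 e + restr (- (translate \<sigma> ` ?E1)) (push (translate \<tau>) ?E2 X2) e" for e
  note p1 = push_L[OF inj_translate X1(1)] and p2 = push_L[OF inj_translate X2(1)]
  have Y: "Y \<in> \<L> ?E"
    unfolding Y_def E
    by (intro L_add L_mono[OF p1] L_mono[OF L_restr[OF p2]]) auto
  have Y1: "Y (translate \<sigma> e) = X1 e" if "e \<in> ?E1" for e
    using that by (simp add: Y_def push_simp[OF inj_translate] restr_def)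
  have Y2: "Y (translate \<tau> e) = X2 e" if e: "e \<in> ?E2" for e
  proof (cases "translate \<tau> e \<in> translate \<sigma> ` ?E1")
    case False
    then have "push (translate \<sigma>) ?E1 X1 (translate \<tau> e) = 0" by (simp add: push_def)
    then show ?thesis using False e by (simp add: Y_def push_simp[OF inj_translate] restr_def)
  next
    case True
    \<comment> \<open>A common edge is the image of a cut label, which both pieces place at the same
      edge, and both fields extend the same value of \<open>X\<close> there.\<close>
    then obtain a where a: "a \<in> V" "translate \<tau> e = \<epsilon> a" using ov e by blast
    obtain b where b: "b \<in> ?I1" "a = \<pi>1 b" using V2(1) a(1) by blast
    obtain b' where b': "b' \<in> ?I2" "a = \<pi>2 b'" using V2(2) a(1) by blast
    have "translate \<tau> e = translate \<sigma> (embed h1 v1 b)" using a b \<epsilon>1 by simp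
    then have "Y (translate \<tau> e) = X a" using Y1[OF mem1[OF b(1)]] X1(2)[OF b(1)] b by simp
    moreover have "e = embed h2 v2 b'"
      using a b' \<epsilon>2[OF b'(1)] inj_translate[of \<tau> UNIV] by (auto dest: injD)
    then have "X2 e = X a" using X2(2)[OF b'(1)] b' by simp
    ultimately show ?thesis by simp
  qed
  have "dtn h v x = ?G x"
  proof (rule dtn_weakI[OF Y _ x X(3)])
    fix a assume a: "a \<in> ?I"
    then have "a \<in> J" using JV by blast
    then consider b where "b \<in> ?I1" "a = \<pi>1 b" | b where "b \<in> ?I2" "a = \<pi>2 b" using J by blast
    then show "Y (embed h v a) = x a"
    proof cases
      case 1
      then have "Y (embed h v a) = X1 (embed h1 v1 b)"
        using \<epsilon>[OF a] \<epsilon>1[OF 1(1)] Y1[OF mem1[OF 1(1)]] 1(2) by simp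
      then show ?thesis using X1(2)[OF 1(1)] 1(2) X(2)[OF a] by simp
    next
      case 2
      then have "Y (embed h v a) = X2 (embed h2 v2 b)"
        using \<epsilon>[OF a] \<epsilon>2[OF 2(1)] Y2[OF mem2[OF 2(1)]] 2(2) by simp
      then show ?thesis using X2(2)[OF 2(1)] 2(2) X(2)[OF a] by simp
    qed
  next
    fix Z assume Z: "Z \<in> \<L> ?E"
    let ?Z1 = "pull (translate \<sigma>) ?E1 Z" and ?Z2 = "pull (translate \<tau>) ?E2 Z"
    have Z1: "?Z1 \<in> \<L> ?E1" and Z2: "?Z2 \<in> \<L> ?E2" using pull_L[OF inj_translate Z] by auto
    have ZJ: "pull \<epsilon> J Z \<in> \<L> J" by (rule pull_L[OF inj Z])
    \<comment> \<open>The test field is split along the two disjoint sets of faces. On the cut both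
      pieces receive the same test values, so the weak gluing identity applies to the sum of their
      forces.\<close>
    have "form (region h v) Z Y = form ?F1 Z Y + form ?F2 Z Y"
      unfolding reg by (rule form_Un_disjoint[OF Z Y disj])
    also have "form ?F1 Z Y = form (region h1 v1) ?Z1 X1"
      unfolding form_translate by (rule form_cong) (auto simp: pull_simps Y1)
    also have "form ?F2 Z Y = form (region h2 v2) ?Z2 X2"
      unfolding form_translate by (rule form_cong) (auto simp: pull_simps Y2)
    also have "form (region h1 v1) ?Z1 X1 + form (region h2 v2) ?Z2 X2 =
        l2_inner (pull (embed h1 v1) ?I1 ?Z1) (dtn h1 v1 (pull \<pi>1 ?I1 X)) +
        l2_inner (pull (embed h2 v2) ?I2 ?Z2) (dtn h2 v2 (pull \<pi>2 ?I2 X))"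
      by (simp only: X1(3)[OF Z1] X2(3)[OF Z2])
    also have "pull (embed h1 v1) ?I1 ?Z1 = pull \<pi>1 ?I1 (pull \<epsilon> J Z)"
    proof
      fix a show "pull (embed h1 v1) ?I1 ?Z1 a = pull \<pi>1 ?I1 (pull \<epsilon> J Z) a"
      proof (cases "a \<in> ?I1")
        case True
        then have "\<pi>1 a \<in> J" "embed h1 v1 a \<in> ?E1" using J mem1[OF True] True by auto
        then show ?thesis using True \<epsilon>1[OF True] by (simp add: pull_simps)
      qed (simp add: pull_simps)
    qed
    also have "pull (embed h2 v2) ?I2 ?Z2 = pull \<pi>2 ?I2 (pull \<epsilon> J Z)"
    proof
      fix a show "pull (embed h2 v2) ?I2 ?Z2 a = pull \<pi>2 ?I2 (pull \<epsilon> J Z) a"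
      proof (cases "a \<in> ?I2")
        case True
        then have "\<pi>2 a \<in> J" "embed h2 v2 a \<in> ?E2" using J mem2[OF True] True by auto
        then show ?thesis using True \<epsilon>2[OF True] by (simp add: pull_simps)
      qed (simp add: pull_simps)
    qed
    also have "l2_inner (pull \<pi>1 ?I1 (pull \<epsilon> J Z)) (dtn h1 v1 (pull \<pi>1 ?I1 X)) +
        l2_inner (pull \<pi>2 ?I2 (pull \<epsilon> J Z)) (dtn h2 v2 (pull \<pi>2 ?I2 X)) = l2_inner (pull \<epsilon> J Z) (?G x)"
      by (rule X(4)[OF ZJ, symmetric])
    also have "\<dots> = l2_inner (pull (embed h v) ?I Z) (?G x)"
    proof (rule L_ext_inner[OF X(3)])
      fix i assume i: "i \<in> ?I"
      then have "i \<in> J" using JV by blast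
      then show "pull \<epsilon> J Z i = pull (embed h v) ?I Z i" using i \<epsilon>[OF i] by (simp add: pull_simps)
    qed
    finally show "form (region h v) Z Y = l2_inner (pull (embed h v) ?I Z) (?G x)" .
  qed
  then show "?G x = dtn h v x" by simp
qed

end

text \<open>Places the cut as well, on the vertical line at abscissa c, so that one injective map
  covers all labels of a gluing.\<close>

fun hembed :: "extent \<Rightarrow> extent \<Rightarrow> int \<Rightarrow> label \<Rightarrow> lattice_edge" where
  "hembed h v c (e, k, j) = (if e = Cut then (False, c, k, j) else embed h v (e, k, j))"

fun vembed :: "extent \<Rightarrow> extent \<Rightarrow> int \<Rightarrow> label \<Rightarrow> lattice_edge" where
  "vembed h v c (e, k, j) = (if e = Cut then (True, k, c, j) else embed h v (e, k, j))"

context lattice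
begin

text \<open>The tuples are the three gluings in use: a unit appended to \<open>Neg\<close>, a unit
  prepended to \<open>Pos\<close>, and two opposite half-lines. The entries d1 and d2 are the
  translations of the pieces and c is the resulting abscissa of the cut.\<close>

lemma hglue_labels:
  assumes cs: "(h1, h2, h, d1, d2, c) \<in> {(Neg, Unit, Neg, -1, -1, -1), (Unit, Pos, Pos, 0, 1, 1), (Neg, Pos, Line, 0, 0, 0)}"
    and J: "J = hplace East d1 ` shape n1 n2 h1 v \<union> hplace West d2 ` shape n1 n2 h2 v"
    and V: "V = {a \<in> J. fst a = Cut}"
  shows "J - V = shape n1 n2 h v" "V = {Cut} \<times> positions v \<times> {..<n2}"
    "V \<subseteq> hplace East d1 ` shape n1 n2 h1 v" "V \<subseteq> hplace West d2 ` shape n1 n2 h2 v"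
proof -
  have mem: "(e, k, j) \<in> J \<longleftrightarrow> (e, k, j) \<in> shape n1 n2 h v \<or> e = Cut \<and> k \<in> positions v \<and> j < n2" for e k j
    unfolding J using cs by (cases e) (auto simp: hplace_image_iff shape_iff split: if_splits)
  show "J - V = shape n1 n2 h v" unfolding V using mem Cut_notin_shape by auto
  show V': "V = {Cut} \<times> positions v \<times> {..<n2}" unfolding V using mem Cut_notin_shape by auto
  show "V \<subseteq> hplace East d1 ` shape n1 n2 h1 v" "V \<subseteq> hplace West d2 ` shape n1 n2 h2 v"
    unfolding V' using cs by (auto simp: hplace_image_iff shape_iff)
qed

lemma vglue_labels:
  assumes cs: "(v1, v2, v, d1, d2, c) \<in> {(Neg, Unit, Neg, -1, -1, -1), (Unit, Pos, Pos, 0, 1, 1), (Neg, Pos, Line, 0, 0, 0)}"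
    and J: "J = vplace North d1 ` shape n1 n2 h v1 \<union> vplace South d2 ` shape n1 n2 h v2"
    and V: "V = {a \<in> J. fst a = Cut}"
  shows "J - V = shape n1 n2 h v" "V = {Cut} \<times> positions h \<times> {..<n1}"
    "V \<subseteq> vplace North d1 ` shape n1 n2 h v1" "V \<subseteq> vplace South d2 ` shape n1 n2 h v2"
proof -
  have mem: "(e, k, j) \<in> J \<longleftrightarrow> (e, k, j) \<in> shape n1 n2 h v \<or> e = Cut \<and> k \<in> positions h \<and> j < n1" for e k j
    unfolding J using cs by (cases e) (auto simp: vplace_image_iff shape_iff split: if_splits)
  show "J - V = shape n1 n2 h v" unfolding V using mem Cut_notin_shape by auto
  show V': "V = {Cut} \<times> positions h \<times> {..<n1}" unfolding V using mem Cut_notin_shape by auto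
  show "V \<subseteq> vplace North d1 ` shape n1 n2 h v1" "V \<subseteq> vplace South d2 ` shape n1 n2 h v2"
    unfolding V' using cs by (auto simp: vplace_image_iff shape_iff)
qed

end

section \<open>Gluing identities and uniqueness for lattice operators\<close>

context lattice
begin

text \<open>The first two cases are fixed point equations for half-strips and corners, the third is
  the decomposition of strips and half-planes at the base point; the vertical extent is free in all
  of them.\<close>

lemma hglue_dtn:
  assumes cs: "(h1, h2, h, d1 :: int, d2 :: int, c :: int) \<in> {(Neg, Unit, Neg, -1, -1, -1), (Unit, Pos, Pos, 0, 1, 1), (Neg, Pos, Line, 0, 0, 0)}"
  shows "hglue \<K> n1 n2 v h1 (dtn h1 v) h2 (dtn h2 v) = dtn h v"
proof -
  define J where "J = hplace East d1 ` shape n1 n2 h1 v \<union> hplace West d2 ` shape n1 n2 h2 v"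
  define V where "V = {a \<in> J. fst a = Cut}"
  note lab = hglue_labels[OF cs J_def V_def]
  have sh: "shifts h1 h2 = (d1, d2)" using cs by auto
  have J': "J = shape n1 n2 h v \<union> {Cut} \<times> positions v \<times> {..<n2}" using lab(1,2) V_def by blast
  have "glue \<K> (hplace East d1) (shape n1 n2 h1 v) (dtn h1 v) (hplace West d2) (shape n1 n2 h2 v) (dtn h2 v) = dtn h v"
  proof (rule glue_dtn[OF inj_hplace inj_hplace J_def V_def lab(1,3,4), where \<epsilon> = "hembed h v c"
        and \<sigma> = "(d1, 0)" and \<tau> = "(d2, 0)"])
    show "inj_on (hembed h v c) J"
    proof (rule inj_onI)
      fix x y assume *: "x \<in> J" "y \<in> J" "hembed h v c x = hembed h v c y"
      obtain e k j e' k' j' where "x = (e, k, j)" "y = (e', k', j')" by (metis surj_pair)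
      with * cs show "x = y" unfolding J'
        by (cases e; cases e') (auto simp: shape_iff split: if_splits)
    qed
    show "hembed h v c (hplace East d1 a) = translate (d1, 0) (embed h1 v a)" if "a \<in> shape n1 n2 h1 v" for a
      using that cs by (cases a; cases "fst a") (auto simp: shape_iff split: if_splits)
    show "hembed h v c (hplace West d2 a) = translate (d2, 0) (embed h2 v a)" if "a \<in> shape n1 n2 h2 v" for a
      using that cs by (cases a; cases "fst a") (auto simp: shape_iff split: if_splits)
    show "hembed h v c a = embed h v a" if "a \<in> shape n1 n2 h v" for a
      using that Cut_notin_shape by (cases a) auto
    have img: "(\<lambda>\<phi>. (fst \<phi> + fst (d, 0), snd \<phi> + snd (d, 0))) ` region h' v = {k. k - d \<in> positions h'} \<times> positions v"
      for d :: int and h' by (force simp: image_iff)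
    show "region h v = (\<lambda>\<phi>. (fst \<phi> + fst (d1, 0), snd \<phi> + snd (d1, 0))) ` region h1 v \<union>
        (\<lambda>\<phi>. (fst \<phi> + fst (d2, 0), snd \<phi> + snd (d2, 0))) ` region h2 v"
      unfolding img using cs by auto
    show "(\<lambda>\<phi>. (fst \<phi> + fst (d1, 0), snd \<phi> + snd (d1, 0))) ` region h1 v \<inter>
        (\<lambda>\<phi>. (fst \<phi> + fst (d2, 0), snd \<phi> + snd (d2, 0))) ` region h2 v = {}"
      unfolding img using cs by auto
    show "translate (d1, 0) ` edges (region h1 v) \<inter> translate (d2, 0) ` edges (region h2 v) \<subseteq> hembed h v c ` V"
    proof
      fix e assume e: "e \<in> translate (d1, 0) ` edges (region h1 v) \<inter> translate (d2, 0) ` edges (region h2 v)"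
      obtain b k l j where b: "e = (b, k, l, j)" by (metis surj_pair)
      have "\<not> b \<and> k = c \<and> l \<in> positions v \<and> j < n2"
        using e cs unfolding b by (cases b) (auto simp: translate_image_iff edges_iff)
      then have "e = hembed h v c (Cut, l, j)" "(Cut, l, j) \<in> V" using b lab(2) by auto
      then show "e \<in> hembed h v c ` V" by blast
    qed
  qed
  then show ?thesis by (simp add: hglue_def sh)
qed

text \<open>With the vertical extent as a parameter, a half-strip glued to a face and a corner glued
  to a vertical half-strip are the same situation.\<close>

lemma hfix_unique:
  assumes cs: "(h, e, d :: int) = (Neg, East, -1) \<or> (h, e, d) = (Pos, West, 1)"
    and M: "M \<in> coercive_ops \<K> (shape n1 n2 h v)"
    and fixed: "(if h = Neg then hglue \<K> n1 n2 v Neg M Unit (dtn Unit v) else hglue \<K> n1 n2 v Unit (dtn Unit v) Pos M) = M"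
  shows "M = dtn h v"
proof (rule coercive_ops_eqI[OF M dtn_coercive])
  fix x assume x: "x \<in> \<L> (shape n1 n2 h v)"
  define e' d' where "e' = (if h = Neg then West else East)" and "d' = (if h = Neg then -1 else 0 :: int)"
  define J where "J = hplace e d ` shape n1 n2 h v \<union> hplace e' d' ` shape n1 n2 Unit v"
  define V where "V = {a \<in> J. fst a = Cut}"
  define A where "A = {a \<in> shape n1 n2 h v. hplace e d a \<notin> V}"
  let ?G = "\<lambda>M. glue \<K> (hplace e d) (shape n1 n2 h v) M (hplace e' d') (shape n1 n2 Unit v) (dtn Unit v)"
  have G: "?G M = (if h = Neg then hglue \<K> n1 n2 v Neg M Unit (dtn Unit v) else hglue \<K> n1 n2 v Unit (dtn Unit v) Pos M)" for M
    using cs by (auto simp: e'_def d'_def hglue_def glue_commute[where \<pi> = "hplace West 1"])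
  have "J - V = shape n1 n2 h v \<and> V = {Cut} \<times> positions v \<times> {..<n2} \<and> V \<subseteq> hplace e' d' ` shape n1 n2 Unit v"
    using cs
  proof
    assume a: "(h, e, d) = (Neg, East, -1)"
    then have J: "J = hplace East (-1) ` shape n1 n2 Neg v \<union> hplace West (-1) ` shape n1 n2 Unit v"
      by (simp add: J_def e'_def d'_def)
    show ?thesis using hglue_labels[where h = Neg and c = "-1", OF _ J V_def] a by (simp add: e'_def d'_def)
  next
    assume a: "(h, e, d) = (Pos, West, 1)"
    then have J: "J = hplace East 0 ` shape n1 n2 Unit v \<union> hplace West 1 ` shape n1 n2 Pos v"
      by (simp add: J_def e'_def d'_def Un_commute)
    show ?thesis using hglue_labels[where h = Pos and c = 1, OF _ J V_def] a by (simp add: e'_def d'_def)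
  qed
  then have lab: "J - V = shape n1 n2 h v" "V = {Cut} \<times> positions v \<times> {..<n2}"
    "V \<subseteq> hplace e' d' ` shape n1 n2 Unit v" by auto
  have A: "a \<in> A \<longleftrightarrow> fst a \<in> {South, North} \<and> a \<in> shape n1 n2 h v" for a
  proof -
    obtain f k j where "a = (f, k, j)" by (metis surj_pair)
    then show ?thesis using cs unfolding A_def lab(2) by (cases f) (auto simp: shape_iff)
  qed
  have pow: "((hplace e d) ^^ n) (f, k, j) = (f, k + int n * d, j)" if "f \<in> {South, North}" for n f k j
    using cs that by (induction n) (auto simp: algebra_simps)
  show "M x = dtn h v x"
  proof (rule glue_fixed_unique[OF inj_hplace inj_hplace _ dtn_coer dtn_coer J_def V_def lab(1) _ _ lab(3) A_def _ _ x])
    show "coer \<K> (shape n1 n2 h v) M" using M by (simp add: coercive_ops_iff)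
    show "?G M y = M y" for y using fixed unfolding G by simp
    show "?G (dtn h v) y = dtn h v y" for y
      using cs hglue_dtn[of Neg Unit Neg "-1" "-1" "-1" v] hglue_dtn[of Unit Pos Pos 0 1 1 v] unfolding G by auto
    show "hplace e d ` A \<subseteq> A"
    proof
      fix b assume "b \<in> hplace e d ` A"
      then obtain f k j where a: "(f, k, j) \<in> A" "b = hplace e d (f, k, j)" by force
      then show "b \<in> A" using cs unfolding A by (auto simp: shape_iff)
    qed
    fix a :: label
    obtain f k j where a: "a = (f, k, j)" by (metis surj_pair)
    \<comment> \<open>More translations than the distance of k from 0 carry every label of the
      half-line beyond position k.\<close>
    define m where "m = nat \<bar>k\<bar> + 1"
    have m: "int m = \<bar>k\<bar> + 1" by (simp add: m_def)
    have "a \<notin> (hplace e d ^^ m) ` A"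
    proof
      assume "a \<in> (hplace e d ^^ m) ` A"
      then obtain f' k' j' where a': "(f', k', j') \<in> A" "a = (hplace e d ^^ m) (f', k', j')" by force
      then have f': "f' \<in> {South, North}" "k' \<in> positions h" unfolding A by (auto simp: shape_iff)
      then have "k = k' + int m * d" using pow[OF f'(1), of m k' j'] a a'(2) by simp
      then show False using cs f'(2) m by auto
    qed
    then show "\<exists>n. a \<notin> (hplace e d ^^ n) ` A" by blast
  qed
qed

lemma vglue_dtn:
  assumes cs: "(v1, v2, v, d1 :: int, d2 :: int, c :: int) \<in> {(Neg, Unit, Neg, -1, -1, -1), (Unit, Pos, Pos, 0, 1, 1), (Neg, Pos, Line, 0, 0, 0)}"
  shows "vglue \<K> n1 n2 h v1 (dtn h v1) v2 (dtn h v2) = dtn h v"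
proof -
  define J where "J = vplace North d1 ` shape n1 n2 h v1 \<union> vplace South d2 ` shape n1 n2 h v2"
  define V where "V = {a \<in> J. fst a = Cut}"
  note lab = vglue_labels[OF cs J_def V_def]
  have sh: "shifts v1 v2 = (d1, d2)" using cs by auto
  have J': "J = shape n1 n2 h v \<union> {Cut} \<times> positions h \<times> {..<n1}" using lab(1,2) V_def by blast
  have "glue \<K> (vplace North d1) (shape n1 n2 h v1) (dtn h v1) (vplace South d2) (shape n1 n2 h v2) (dtn h v2) = dtn h v"
  proof (rule glue_dtn[OF inj_vplace inj_vplace J_def V_def lab(1,3,4), where \<epsilon> = "vembed h v c"
        and \<sigma> = "(0, d1)" and \<tau> = "(0, d2)"])
    show "inj_on (vembed h v c) J"
    proof (rule inj_onI)
      fix x y assume *: "x \<in> J" "y \<in> J" "vembed h v c x = vembed h v c y"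
      obtain e k j e' k' j' where "x = (e, k, j)" "y = (e', k', j')" by (metis surj_pair)
      with * cs show "x = y" unfolding J'
        by (cases e; cases e') (auto simp: shape_iff split: if_splits)
    qed
    show "vembed h v c (vplace North d1 a) = translate (0, d1) (embed h v1 a)" if "a \<in> shape n1 n2 h v1" for a
      using that cs by (cases a; cases "fst a") (auto simp: shape_iff split: if_splits)
    show "vembed h v c (vplace South d2 a) = translate (0, d2) (embed h v2 a)" if "a \<in> shape n1 n2 h v2" for a
      using that cs by (cases a; cases "fst a") (auto simp: shape_iff split: if_splits)
    show "vembed h v c a = embed h v a" if "a \<in> shape n1 n2 h v" for a
      using that Cut_notin_shape by (cases a) auto
    have img: "(\<lambda>\<phi>. (fst \<phi> + fst (0, d), snd \<phi> + snd (0, d))) ` region h v' = positions h \<times> {k. k - d \<in> positions v'}"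
      for d :: int and v' by (force simp: image_iff)
    show "region h v = (\<lambda>\<phi>. (fst \<phi> + fst (0, d1), snd \<phi> + snd (0, d1))) ` region h v1 \<union>
        (\<lambda>\<phi>. (fst \<phi> + fst (0, d2), snd \<phi> + snd (0, d2))) ` region h v2"
      unfolding img using cs by auto
    show "(\<lambda>\<phi>. (fst \<phi> + fst (0, d1), snd \<phi> + snd (0, d1))) ` region h v1 \<inter>
        (\<lambda>\<phi>. (fst \<phi> + fst (0, d2), snd \<phi> + snd (0, d2))) ` region h v2 = {}"
      unfolding img using cs by auto
    show "translate (0, d1) ` edges (region h v1) \<inter> translate (0, d2) ` edges (region h v2) \<subseteq> vembed h v c ` V"
    proof
      fix e assume e: "e \<in> translate (0, d1) ` edges (region h v1) \<inter> translate (0, d2) ` edges (region h v2)"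
      obtain b k l j where b: "e = (b, k, l, j)" by (metis surj_pair)
      have "b \<and> l = c \<and> k \<in> positions h \<and> j < n1"
        using e cs unfolding b by (cases b) (auto simp: translate_image_iff edges_iff)
      then have "e = vembed h v c (Cut, k, j)" "(Cut, k, j) \<in> V" using b lab(2) by auto
      then show "e \<in> vembed h v c ` V" by blast
    qed
  qed
  then show ?thesis by (simp add: vglue_def sh)
qed

lemma vfix_unique:
  assumes cs: "(v, e, d :: int) = (Neg, North, -1) \<or> (v, e, d) = (Pos, South, 1)"
    and M: "M \<in> coercive_ops \<K> (shape n1 n2 h v)"
    and fixed: "(if v = Neg then vglue \<K> n1 n2 h Neg M Unit (dtn h Unit) else vglue \<K> n1 n2 h Unit (dtn h Unit) Pos M) = M"
  shows "M = dtn h v"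
proof (rule coercive_ops_eqI[OF M dtn_coercive])
  fix x assume x: "x \<in> \<L> (shape n1 n2 h v)"
  define e' d' where "e' = (if v = Neg then South else North)" and "d' = (if v = Neg then -1 else 0 :: int)"
  define J where "J = vplace e d ` shape n1 n2 h v \<union> vplace e' d' ` shape n1 n2 h Unit"
  define V where "V = {a \<in> J. fst a = Cut}"
  define A where "A = {a \<in> shape n1 n2 h v. vplace e d a \<notin> V}"
  let ?G = "\<lambda>M. glue \<K> (vplace e d) (shape n1 n2 h v) M (vplace e' d') (shape n1 n2 h Unit) (dtn h Unit)"
  have G: "?G M = (if v = Neg then vglue \<K> n1 n2 h Neg M Unit (dtn h Unit) else vglue \<K> n1 n2 h Unit (dtn h Unit) Pos M)" for M
    using cs by (auto simp: e'_def d'_def vglue_def glue_commute[where \<pi> = "vplace South 1"])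
  have "J - V = shape n1 n2 h v \<and> V = {Cut} \<times> positions h \<times> {..<n1} \<and> V \<subseteq> vplace e' d' ` shape n1 n2 h Unit"
    using cs
  proof
    assume a: "(v, e, d) = (Neg, North, -1)"
    then have J: "J = vplace North (-1) ` shape n1 n2 h Neg \<union> vplace South (-1) ` shape n1 n2 h Unit"
      by (simp add: J_def e'_def d'_def)
    show ?thesis using vglue_labels[where v = Neg and c = "-1", OF _ J V_def] a by (simp add: e'_def d'_def)
  next
    assume a: "(v, e, d) = (Pos, South, 1)"
    then have J: "J = vplace North 0 ` shape n1 n2 h Unit \<union> vplace South 1 ` shape n1 n2 h Pos"
      by (simp add: J_def e'_def d'_def Un_commute)
    show ?thesis using vglue_labels[where v = Pos and c = 1, OF _ J V_def] a by (simp add: e'_def d'_def)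
  qed
  then have lab: "J - V = shape n1 n2 h v" "V = {Cut} \<times> positions h \<times> {..<n1}"
    "V \<subseteq> vplace e' d' ` shape n1 n2 h Unit" by auto
  have A: "a \<in> A \<longleftrightarrow> fst a \<in> {West, East} \<and> a \<in> shape n1 n2 h v" for a
  proof -
    obtain f k j where "a = (f, k, j)" by (metis surj_pair)
    then show ?thesis using cs unfolding A_def lab(2) by (cases f) (auto simp: shape_iff)
  qed
  have pow: "((vplace e d) ^^ n) (f, k, j) = (f, k + int n * d, j)" if "f \<in> {West, East}" for n f k j
    using cs that by (induction n) (auto simp: algebra_simps)
  show "M x = dtn h v x"
  proof (rule glue_fixed_unique[OF inj_vplace inj_vplace _ dtn_coer dtn_coer J_def V_def lab(1) _ _ lab(3) A_def _ _ x])
    show "coer \<K> (shape n1 n2 h v) M" using M by (simp add: coercive_ops_iff)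
    show "?G M y = M y" for y using fixed unfolding G by simp
    show "?G (dtn h v) y = dtn h v y" for y
      using cs vglue_dtn[of Neg Unit Neg "-1" "-1" "-1" h] vglue_dtn[of Unit Pos Pos 0 1 1 h] unfolding G by auto
    show "vplace e d ` A \<subseteq> A"
    proof
      fix b assume "b \<in> vplace e d ` A"
      then obtain f k j where a: "(f, k, j) \<in> A" "b = vplace e d (f, k, j)" by force
      then show "b \<in> A" using cs unfolding A by (auto simp: shape_iff)
    qed
    fix a :: label
    obtain f k j where a: "a = (f, k, j)" by (metis surj_pair)
    define m where "m = nat \<bar>k\<bar> + 1"
    have m: "int m = \<bar>k\<bar> + 1" by (simp add: m_def)
    have "a \<notin> (vplace e d ^^ m) ` A"
    proof
      assume "a \<in> (vplace e d ^^ m) ` A"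
      then obtain f' k' j' where a': "(f', k', j') \<in> A" "a = (vplace e d ^^ m) (f', k', j')" by force
      then have f': "f' \<in> {West, East}" "k' \<in> positions v" unfolding A by (auto simp: shape_iff)
      then have "k = k' + int m * d" using pow[OF f'(1), of m k' j'] a a'(2) by simp
      then show False using cs f'(2) m by auto
    qed
    then show "\<exists>n. a \<notin> (vplace e d ^^ n) ` A" by blast
  qed
qed

end

section \<open>The fixed points of a face operator\<close>

definition face_index :: "nat \<Rightarrow> nat \<Rightarrow> edge \<times> nat \<Rightarrow> nat" where
  "face_index n1 n2 = (\<lambda>(e, j). fst (sec n1 n2 e) + j)"

definition face_kernel :: "nat \<Rightarrow> nat \<Rightarrow> complex mat \<Rightarrow> edge \<times> nat \<Rightarrow> edge \<times> nat \<Rightarrow> complex" where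
  "face_kernel n1 n2 Q a b = Q $$ (face_index n1 n2 a, face_index n1 n2 b)"

abbreviation face_labels :: "nat \<Rightarrow> nat \<Rightarrow> (edge \<times> nat) set" where
  "face_labels n1 n2 \<equiv> {South, North} \<times> {..<n1} \<union> {West, East} \<times> {..<n2}"

lemma face_index_bij: "bij_betw (face_index n1 n2) (face_labels n1 n2) {..<2 * n1 + 2 * n2}"
proof (rule bij_betwI')
  fix a b assume "a \<in> face_labels n1 n2" "b \<in> face_labels n1 n2"
  then show "(face_index n1 n2 a = face_index n1 n2 b) = (a = b)"
    by (auto simp: face_index_def)
next
  fix a assume "a \<in> face_labels n1 n2"
  then show "face_index n1 n2 a \<in> {..<2 * n1 + 2 * n2}" by (auto simp: face_index_def)
next
  fix i assume i: "i \<in> {..<2 * n1 + 2 * n2}"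
  consider "i < n1" | "n1 \<le> i" "i < 2 * n1" | "2 * n1 \<le> i" "i < 2 * n1 + n2" | "2 * n1 + n2 \<le> i" by linarith
  then show "\<exists>a\<in>face_labels n1 n2. i = face_index n1 n2 a"
  proof cases
    case 1 then show ?thesis by (intro bexI[of _ "(South, i)"]) (auto simp: face_index_def)
  next
    case 2 then show ?thesis by (intro bexI[of _ "(North, i - n1)"]) (auto simp: face_index_def)
  next
    case 3 then show ?thesis by (intro bexI[of _ "(West, i - 2 * n1)"]) (auto simp: face_index_def)
  next
    case 4 then show ?thesis using i by (intro bexI[of _ "(East, i - 2 * n1 - n2)"]) (auto simp: face_index_def)
  qed
qed

lemma pos_def_form:
  assumes A: "A \<in> carrier_mat n n" and v: "v \<in> carrier_vec n"
  shows "(A *\<^sub>v v) \<bullet>c v = (\<Sum>i<n. \<Sum>j<n. cnj (v $ i) * A $$ (i, j) * v $ j)"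
proof -
  have "(A *\<^sub>v v) \<bullet>c v = (\<Sum>i<n. (\<Sum>j<n. A $$ (i, j) * v $ j) * cnj (v $ i))"
    using A v by (simp add: scalar_prod_def lessThan_atLeast0 conjugate_complex_def)
  then show ?thesis by (simp add: sum_distrib_left sum_distrib_right mult_ac)
qed

lemma hermitian_entries:
  assumes A: "A \<in> carrier_mat n n" and adj: "mat_adjoint A = A" and ij: "i < n" "j < n"
  shows "A $$ (j, i) = cnj (A $$ (i, j))"
proof -
  have "A $$ (j, i) = mat_adjoint A $$ (j, i)" by (simp add: adj)
  also have "\<dots> = cnj (A $$ (i, j))"
    using A ij by (simp add: mat_adjoint_def conjugate_complex_def mat_of_rows_def)
  finally show ?thesis .
qed

lemma elements_matD: "elements_mat A \<subseteq> K \<Longrightarrow> i < dim_row A \<Longrightarrow> j < dim_col A \<Longrightarrow> A $$ (i, j) \<in> K"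
  by (force simp: elements_mat_def)

lemma lattice_face_operator:
  assumes \<K>: "\<K> = \<real> \<or> \<K> = UNIV" and Q: "face_operator \<K> n1 n2 Q"
  shows "lattice \<K> n1 n2 (face_kernel n1 n2 Q)"
proof -
  interpret scalars \<K> by (rule scalars.intro[OF \<K>])
  let ?N = "2 * n1 + 2 * n2" and ?ix = "face_index n1 n2" and ?L = "face_labels n1 n2"
  have Q': "Q \<in> carrier_mat ?N ?N" "elements_mat Q \<subseteq> \<K>" "mat_adjoint Q = Q"
    "\<And>v. v \<in> carrier_vec ?N \<Longrightarrow> set\<^sub>v v \<subseteq> \<K> \<Longrightarrow> v \<noteq> 0\<^sub>v ?N \<Longrightarrow> 0 < Re ((Q *\<^sub>v v) \<bullet>c v)"
    using Q by (auto simp: face_operator_def pos_def_def)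
  have ix: "?ix a < ?N" if "a \<in> ?L" for a
    using bij_betwE[OF face_index_bij[of n1 n2]] that by blast
  show ?thesis
  proof (unfold_locales)
    fix a b assume ab: "a \<in> ?L" "b \<in> ?L"
    show "face_kernel n1 n2 Q a b \<in> \<K>"
      using elements_matD[OF Q'(2)] Q'(1) ix ab by (simp add: face_kernel_def)
    show "face_kernel n1 n2 Q b a = cnj (face_kernel n1 n2 Q a b)"
      unfolding face_kernel_def by (rule hermitian_entries[OF Q'(1,3) ix[OF ab(1)] ix[OF ab(2)]])
  next
    fix y :: "edge \<times> nat \<Rightarrow> complex"
    assume y: "\<And>a. a \<in> ?L \<Longrightarrow> y a \<in> \<K>" and nz: "\<exists>a\<in>?L. y a \<noteq> 0"
    define v where "v = vec ?N (\<lambda>i. y (the_inv_into ?L ?ix i))"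
    have inv: "the_inv_into ?L ?ix (?ix a) = a" if "a \<in> ?L" for a
      using face_index_bij[of n1 n2] that by (intro the_inv_into_f_f) (auto simp: bij_betw_def)
    have vix: "v $ ?ix a = y a" if "a \<in> ?L" for a
      using ix[OF that] inv[OF that] by (simp add: v_def)
    have v: "v \<in> carrier_vec ?N" by (simp add: v_def)
    have "v $ i \<in> \<K>" if i: "i < ?N" for i
    proof -
      have "i \<in> ?ix ` ?L" using face_index_bij[of n1 n2] i by (auto simp: bij_betw_def)
      then show ?thesis using vix y by auto
    qed
    then have "set\<^sub>v v \<subseteq> \<K>" using v by (auto simp: vec_set_def)
    moreover have "v \<noteq> 0\<^sub>v ?N"
    proof
      assume v0: "v = 0\<^sub>v ?N"
      obtain a where "a \<in> ?L" "y a \<noteq> 0" using nz by blast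
      then show False using vix[of a] ix[of a] by (simp add: v0)
    qed
    ultimately have "0 < Re ((Q *\<^sub>v v) \<bullet>c v)" using Q'(4) v by blast
    also have "(Q *\<^sub>v v) \<bullet>c v = (\<Sum>i<?N. \<Sum>j<?N. cnj (v $ i) * Q $$ (i, j) * v $ j)"
      by (rule pos_def_form[OF Q'(1) v])
    also have "\<dots> = (\<Sum>a\<in>?L. \<Sum>j<?N. cnj (v $ ?ix a) * Q $$ (?ix a, j) * v $ j)"
      by (rule sum.reindex_bij_betw[OF face_index_bij, symmetric])
    also have "\<dots> = (\<Sum>a\<in>?L. \<Sum>b\<in>?L. cnj (v $ ?ix a) * Q $$ (?ix a, ?ix b) * v $ ?ix b)"
      by (intro sum.cong refl sum.reindex_bij_betw[OF face_index_bij, symmetric])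
    also have "\<dots> = (\<Sum>a\<in>?L. \<Sum>b\<in>?L. cnj (y a) * face_kernel n1 n2 Q a b * y b)"
      by (intro sum.cong refl) (simp add: vix face_kernel_def)
    finally show "0 < Re (\<Sum>a\<in>?L. \<Sum>b\<in>?L. cnj (y a) * face_kernel n1 n2 Q a b * y b)" .
  qed
qed

lemma shape_Unit: "shape n1 n2 Unit Unit = (\<lambda>(e, j). (e, 0, j)) ` face_labels n1 n2"
  by (auto simp: shape_def)

text \<open>All edges of a single face lie on its boundary, so nothing is eliminated.\<close>

lemma (in lattice) face_op_eq_dtn:
  assumes q: "q = face_kernel n1 n2 Q"
  shows "face_op \<K> n1 n2 Q = dtn Unit Unit"
proof
  fix x
  let ?I = "shape n1 n2 Unit Unit" and ?f = "\<lambda>(e, j). (e, 0 :: int, j) :: label"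
  have I: "?I = ?f ` loc" unfolding shape_Unit loc_def ..
  have inj: "inj_on ?f loc" by (auto simp: inj_on_def)
  define y where "y = restr ?I (\<lambda>a. \<Sum>b\<in>?I. Q $$ ((\<lambda>(e, k, j). fst (sec n1 n2 e) + j) a, (\<lambda>(e, k, j). fst (sec n1 n2 e) + j) b) * x b)"
  have face: "face_op \<K> n1 n2 Q x = (if x \<in> \<L> ?I then y else (\<lambda>_. 0))"
    unfolding face_op_def on_l2_def Let_def y_def ..
  have yf: "y (?f a) = (\<Sum>b\<in>loc. q a b * x (?f b))" if "a \<in> loc" for a
  proof -
    have "?f a \<in> ?I" using that I by blast
    then have "y (?f a) = (\<Sum>b\<in>?I. Q $$ ((\<lambda>(e, k, j). fst (sec n1 n2 e) + j) (?f a), (\<lambda>(e, k, j). fst (sec n1 n2 e) + j) b) * x b)"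
      by (simp add: y_def restr_def)
    also have "\<dots> = (\<Sum>b\<in>loc. q a b * x (?f b))"
      unfolding I sum.reindex[OF inj] o_def
      by (intro sum.cong refl) (auto simp: q face_kernel_def face_index_def split: prod.splits)
    finally show ?thesis .
  qed
  show "face_op \<K> n1 n2 Q x = dtn Unit Unit x"
  proof (cases "x \<in> \<L> ?I")
    case True
    have fin: "finite ?I" unfolding I by simp
    have yL: "y \<in> \<L> ?I"
      unfolding l2_space_iff
    proof (intro conjI ballI allI impI)
      show "y i = 0" if "i \<notin> ?I" for i using that by (simp add: y_def restr_def)
      then show "l2 y" by (rule l2_finite_support[OF fin])
      fix i assume "i \<in> ?I"
      then obtain a where a: "a \<in> loc" "i = ?f a" using I by blast
      show "y i \<in> \<K>" unfolding a(2) yf[OF a(1)] using a(1)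
        by (intro K_sum K_closed(8) q_K L_K[OF True])
    qed
    have emb: "embed Unit Unit (?f a) = side_edge (0, 0) a" if "a \<in> loc" for a
      using that by (cases a; cases "fst a") (auto simp: loc_iff)
    have "dtn Unit Unit x = y"
    proof (rule dtn_weakI[OF _ _ True yL])
      let ?X = "push (embed Unit Unit) ?I x"
      show "?X \<in> \<L> (edges (region Unit Unit))"
        by (rule L_mono[OF push_L[OF inj_embed True] embed_edges])
      show X: "?X (embed Unit Unit a) = x a" if "a \<in> ?I" for a by (rule push_simp[OF inj_embed that])
      fix Z assume Z: "Z \<in> \<L> (edges (region Unit Unit))"
      have "form (region Unit Unit) Z ?X = face_form (0, 0) Z ?X" by (simp add: form_def)
      also have "\<dots> = (\<Sum>a\<in>loc. cnj (Z (embed Unit Unit (?f a))) * y (?f a))"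
        unfolding face_form_def
      proof (intro sum.cong refl)
        fix a assume a: "a \<in> loc"
        have "?X (side_edge (0, 0) b) = x (?f b)" if "b \<in> loc" for b
          using X[of "?f b"] emb[OF that] that I by auto
        then show "(\<Sum>b\<in>loc. cnj (Z (side_edge (0, 0) a)) * q a b * ?X (side_edge (0, 0) b)) =
            cnj (Z (embed Unit Unit (?f a))) * y (?f a)"
          by (simp add: yf[OF a] emb[OF a] sum_distrib_left mult.assoc)
      qed
      also have "\<dots> = (\<Sum>i\<in>?I. cnj (Z (embed Unit Unit i)) * y i)"
        unfolding I sum.reindex[OF inj] o_def ..
      also have "\<dots> = l2_inner (pull (embed Unit Unit) ?I Z) y"
      proof -
        have "l2_inner (pull (embed Unit Unit) ?I Z) y = (\<Sum>\<^sub>\<infinity>i\<in>?I. cnj (Z (embed Unit Unit i)) * y i)"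
          unfolding l2_inner_def by (rule infsum_cong_neutral) (auto simp: pull_simps)
        then show ?thesis using fin by simp
      qed
      finally show "form (region Unit Unit) Z ?X = l2_inner (pull (embed Unit Unit) ?I Z) y" .
    qed
    then show ?thesis using True by (simp add: face)
  next
    case False
    then show ?thesis by (simp add: face dtn_def on_l2_def Let_def)
  qed
qed

context lattice
begin

context
  fixes Q assumes q: "q = face_kernel n1 n2 Q"
begin

lemma fix_half_strips:
  "fix_W \<K> n1 n2 Q = dtn Neg Unit" "fix_E \<K> n1 n2 Q = dtn Pos Unit"
  "fix_S \<K> n1 n2 Q = dtn Unit Neg" "fix_N \<K> n1 n2 Q = dtn Unit Pos"
proof -
  note face = face_op_eq_dtn[OF q]
  show "fix_W \<K> n1 n2 Q = dtn Neg Unit" unfolding fix_W_def face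
    by (rule the_equality) (auto simp: dtn_coercive hglue_dtn intro!: hfix_unique)
  show "fix_E \<K> n1 n2 Q = dtn Pos Unit" unfolding fix_E_def face
    by (rule the_equality) (auto simp: dtn_coercive hglue_dtn intro!: hfix_unique)
  show "fix_S \<K> n1 n2 Q = dtn Unit Neg" unfolding fix_S_def face
    by (rule the_equality) (auto simp: dtn_coercive vglue_dtn intro!: vfix_unique)
  show "fix_N \<K> n1 n2 Q = dtn Unit Pos" unfolding fix_N_def face
    by (rule the_equality) (auto simp: dtn_coercive vglue_dtn intro!: vfix_unique)
qed

text \<open>Once the half-strips are known to be lattice operators, both equations of a corner are
  gluings of regions.\<close>

lemma fix_corners:
  "fix_SW \<K> n1 n2 Q = dtn Neg Neg" "fix_SE \<K> n1 n2 Q = dtn Pos Neg"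
  "fix_NW \<K> n1 n2 Q = dtn Neg Pos" "fix_NE \<K> n1 n2 Q = dtn Pos Pos"
proof -
  show "fix_SW \<K> n1 n2 Q = dtn Neg Neg" unfolding fix_SW_def fix_half_strips
    by (rule the_equality) (auto simp: dtn_coercive hglue_dtn vglue_dtn intro!: hfix_unique)
  show "fix_SE \<K> n1 n2 Q = dtn Pos Neg" unfolding fix_SE_def fix_half_strips
    by (rule the_equality) (auto simp: dtn_coercive hglue_dtn vglue_dtn intro!: hfix_unique)
  show "fix_NW \<K> n1 n2 Q = dtn Neg Pos" unfolding fix_NW_def fix_half_strips
    by (rule the_equality) (auto simp: dtn_coercive hglue_dtn vglue_dtn intro!: hfix_unique)
  show "fix_NE \<K> n1 n2 Q = dtn Pos Pos" unfolding fix_NE_def fix_half_strips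
    by (rule the_equality) (auto simp: dtn_coercive hglue_dtn vglue_dtn intro!: hfix_unique)
qed

end

end

section \<open>Fourier series\<close>

abbreviation circ :: "real measure" where "circ \<equiv> lebesgue_on {-pi..pi}"

definition sq_integrable :: "(real \<Rightarrow> complex) \<Rightarrow> bool" where
  "sq_integrable f \<longleftrightarrow> f \<in> borel_measurable circ \<and> integrable circ (\<lambda>\<theta>. (cmod (f \<theta>))\<^sup>2)"

definition trig :: "(int \<Rightarrow> complex) \<Rightarrow> int set \<Rightarrow> real \<Rightarrow> complex" where
  "trig a A \<theta> = (\<Sum>k\<in>A. a k * cis (of_int k * \<theta>))"

abbreviation sym :: "nat \<Rightarrow> int set" where "sym N \<equiv> {- int N..int N}"

lemma fourier_L2_iff:
  "fourier_L2 a f \<longleftrightarrow> sq_integrable f \<and>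
     (\<lambda>N. LINT \<theta>|circ. (cmod (f \<theta> - trig a (sym N) \<theta>))\<^sup>2) \<longlonglongrightarrow> 0"
  by (auto simp: fourier_L2_def sq_integrable_def trig_def)

lemma finite_measure_circ: "emeasure circ (space circ) < \<infinity>"
  by (simp add: emeasure_restrict_space)

lemma norm_add_power2_le: "(norm (x + y :: complex))\<^sup>2 \<le> 2 * (norm x)\<^sup>2 + 2 * (norm y)\<^sup>2"
proof -
  have "(norm (x + y))\<^sup>2 \<le> (norm x + norm y)\<^sup>2" by (intro power_mono norm_triangle_ineq) auto
  also have "\<dots> \<le> 2 * (norm x)\<^sup>2 + 2 * (norm y)\<^sup>2"
    using sum_squares_bound[of "norm x" "norm y"] by (simp add: power2_sum)
  finally show ?thesis .
qed

text \<open>The crude factor 2 is harmless: such integrals are only compared with zero in a limit or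
  tested for summability.\<close>

lemma sq_integrable_add:
  assumes "sq_integrable f" "sq_integrable g" shows "sq_integrable (\<lambda>\<theta>. f \<theta> + g \<theta>)"
    and "(LINT \<theta>|circ. (cmod (f \<theta> + g \<theta>))\<^sup>2) \<le> 2 * (LINT \<theta>|circ. (cmod (f \<theta>))\<^sup>2) + 2 * (LINT \<theta>|circ. (cmod (g \<theta>))\<^sup>2)"
proof -
  have [measurable]: "f \<in> borel_measurable circ" "g \<in> borel_measurable circ"
    using assms by (auto simp: sq_integrable_def)
  have int: "integrable circ (\<lambda>\<theta>. 2 * (cmod (f \<theta>))\<^sup>2 + 2 * (cmod (g \<theta>))\<^sup>2)"
    using assms by (auto simp: sq_integrable_def)
  have i: "integrable circ (\<lambda>\<theta>. (cmod (f \<theta> + g \<theta>))\<^sup>2)"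
    by (rule Bochner_Integration.integrable_bound[OF int]) (auto intro!: norm_add_power2_le)
  then show "sq_integrable (\<lambda>\<theta>. f \<theta> + g \<theta>)" by (simp add: sq_integrable_def)
  have "(LINT \<theta>|circ. (cmod (f \<theta> + g \<theta>))\<^sup>2) \<le> (LINT \<theta>|circ. 2 * (cmod (f \<theta>))\<^sup>2 + 2 * (cmod (g \<theta>))\<^sup>2)"
    by (rule integral_mono[OF i int]) (rule norm_add_power2_le)
  also have "\<dots> = 2 * (LINT \<theta>|circ. (cmod (f \<theta>))\<^sup>2) + 2 * (LINT \<theta>|circ. (cmod (g \<theta>))\<^sup>2)"
    using assms by (simp add: sq_integrable_def)
  finally show "(LINT \<theta>|circ. (cmod (f \<theta> + g \<theta>))\<^sup>2) \<le> 2 * (LINT \<theta>|circ. (cmod (f \<theta>))\<^sup>2) + 2 * (LINT \<theta>|circ. (cmod (g \<theta>))\<^sup>2)" .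
qed

lemma sq_integrable_mult:
  assumes f: "sq_integrable f" and g: "g \<in> borel_measurable circ" and B: "\<And>\<theta>. cmod (g \<theta>) \<le> B"
  shows "sq_integrable (\<lambda>\<theta>. g \<theta> * f \<theta>)"
    and "(LINT \<theta>|circ. (cmod (g \<theta> * f \<theta>))\<^sup>2) \<le> B\<^sup>2 * (LINT \<theta>|circ. (cmod (f \<theta>))\<^sup>2)"
proof -
  have [measurable]: "f \<in> borel_measurable circ" "g \<in> borel_measurable circ"
    using f g by (auto simp: sq_integrable_def)
  have int: "integrable circ (\<lambda>\<theta>. B\<^sup>2 * (cmod (f \<theta>))\<^sup>2)"
    using f by (auto simp: sq_integrable_def)
  have le: "(cmod (g \<theta> * f \<theta>))\<^sup>2 \<le> B\<^sup>2 * (cmod (f \<theta>))\<^sup>2" for \<theta>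
    using power_mono[OF B norm_ge_zero, of \<theta> 2] by (simp add: norm_mult power_mult_distrib mult_right_mono)
  have i: "integrable circ (\<lambda>\<theta>. (cmod (g \<theta> * f \<theta>))\<^sup>2)"
    by (rule Bochner_Integration.integrable_bound[OF int]) (use le in auto)
  then show "sq_integrable (\<lambda>\<theta>. g \<theta> * f \<theta>)" by (simp add: sq_integrable_def)
  have "(LINT \<theta>|circ. (cmod (g \<theta> * f \<theta>))\<^sup>2) \<le> (LINT \<theta>|circ. B\<^sup>2 * (cmod (f \<theta>))\<^sup>2)"
    by (rule integral_mono[OF i int]) (rule le)
  then show "(LINT \<theta>|circ. (cmod (g \<theta> * f \<theta>))\<^sup>2) \<le> B\<^sup>2 * (LINT \<theta>|circ. (cmod (f \<theta>))\<^sup>2)" by simp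
qed

lemma sq_integrable_cmult: "sq_integrable f \<Longrightarrow> sq_integrable (\<lambda>\<theta>. c * f \<theta>)"
  using sq_integrable_mult(1)[of f "\<lambda>_. c" "cmod c"] by simp

lemma sq_integrable_diff: "sq_integrable f \<Longrightarrow> sq_integrable g \<Longrightarrow> sq_integrable (\<lambda>\<theta>. f \<theta> - g \<theta>)"
  using sq_integrable_add(1)[of f "\<lambda>\<theta>. - 1 * g \<theta>"] sq_integrable_cmult[of g "-1"] by simp

lemma cis_measurable [measurable]: "(\<lambda>\<theta>. cis (c * \<theta>)) \<in> borel_measurable circ"
  by (intro continuous_imp_measurable_on_sets_lebesgue continuous_intros) auto

lemma sq_integrable_cis: "sq_integrable (\<lambda>\<theta>. cis (c * \<theta>))"
  unfolding sq_integrable_def using finite_measure_circ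
  by (auto simp: integrable_iff_bounded ennreal_mult_less_top)

lemma sq_integrable_zero: "sq_integrable (\<lambda>_. 0)"
  by (simp add: sq_integrable_def)

lemma sq_integrable_sum:
  "finite A \<Longrightarrow> (\<And>a. a \<in> A \<Longrightarrow> sq_integrable (f a)) \<Longrightarrow> sq_integrable (\<lambda>\<theta>. \<Sum>a\<in>A. f a \<theta>)"
  by (induction A rule: finite_induct) (auto intro: sq_integrable_add sq_integrable_zero)

lemma sq_integrable_trig: "finite A \<Longrightarrow> sq_integrable (trig a A)"
  unfolding trig_def[abs_def] by (intro sq_integrable_sum sq_integrable_cmult sq_integrable_cis)

lemma integrable_cis: "integrable circ (\<lambda>\<theta>. cis (c * \<theta>))"
proof -
  have "continuous_on (cbox (- pi) pi) (\<lambda>\<theta>. cis (c * \<theta>))" by (intro continuous_intros)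
  from continuous_imp_integrable[OF this] show ?thesis by simp
qed

lemma integral_cis: "(LINT \<theta>|circ. cis (of_int m * \<theta>)) = (if m = 0 then 2 * pi else 0)"
proof (cases "m = 0")
  case True
  then show ?thesis by (simp add: measure_restrict_space scaleR_conv_of_real)
next
  case False
  define F where "F z = exp (\<i> * of_int m * z) / (\<i> * of_int m)" for z :: complex
  have F: "(F has_field_derivative exp (\<i> * of_int m * z)) (at z)" for z
    unfolding F_def by (auto intro!: derivative_eq_intros simp: False)
  have eq: "exp (\<i> * of_int m * of_real \<theta>) = cis (of_int m * \<theta>)" for \<theta>
    by (simp add: cis_conv_exp mult.assoc)
  have "((\<lambda>\<theta>. F (of_real \<theta>)) has_vector_derivative cis (of_int m * \<theta>)) (at \<theta> within {-pi..pi})" for \<theta>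
    using has_vector_derivative_real_field[OF F[of "of_real \<theta>"]] by (simp add: eq)
  then have "((\<lambda>\<theta>. cis (of_int m * \<theta>)) has_integral (F (of_real pi) - F (of_real (- pi)))) {-pi..pi}"
    by (intro fundamental_theorem_of_calculus) auto
  moreover have "F (of_real pi) = F (of_real (- pi))"
  proof -
    have "cis (of_int m * pi) = cis (of_int m * (- pi)) * cis (2 * pi * of_int m)" by (simp add: cis_mult algebra_simps)
    also have "cis (2 * pi * of_int m) = 1" by (rule cis_multiple_2pi) auto
    finally show ?thesis unfolding F_def eq by simp
  qed
  ultimately have "integral {-pi..pi} (\<lambda>\<theta>. cis (of_int m * \<theta>)) = 0" by (simp add: integral_unique)
  then show ?thesis
    using lebesgue_integral_eq_integral[OF integrable_cis, of "of_int m"] False by simp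
qed

lemma parseval_finite:
  assumes "finite A" shows "(LINT \<theta>|circ. (cmod (trig a A \<theta>))\<^sup>2) = 2 * pi * (\<Sum>k\<in>A. (cmod (a k))\<^sup>2)"
proof -
  have sq: "complex_of_real ((cmod (trig a A \<theta>))\<^sup>2) = (\<Sum>k\<in>A. \<Sum>l\<in>A. a k * cnj (a l) * cis (of_int (k - l) * \<theta>))" for \<theta>
    unfolding complex_norm_square trig_def
    by (simp add: sum_product cis_cnj cis_mult[symmetric] left_diff_distrib cis_divide[symmetric] mult_ac)
      (simp add: cis_mult cis_divide algebra_simps)
  have "complex_of_real (LINT \<theta>|circ. (cmod (trig a A \<theta>))\<^sup>2) = (LINT \<theta>|circ. complex_of_real ((cmod (trig a A \<theta>))\<^sup>2))"
    by (rule integral_complex_of_real[symmetric])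
  also have "\<dots> = (\<Sum>k\<in>A. \<Sum>l\<in>A. a k * cnj (a l) * (LINT \<theta>|circ. cis (of_int (k - l) * \<theta>)))"
    unfolding sq by (simp only: Bochner_Integration.integral_sum integrable_cis integral_mult_right_zero
        Bochner_Integration.integrable_sum integrable_mult_right)
  also have "\<dots> = (\<Sum>k\<in>A. a k * cnj (a k) * (2 * pi))"
    unfolding integral_cis using assms by (intro sum.cong refl) (simp add: if_distrib cong: if_cong)
  also have "\<dots> = complex_of_real (2 * pi * (\<Sum>k\<in>A. (cmod (a k))\<^sup>2))"
    by (simp add: complex_norm_square[symmetric] sum_distrib_left mult.commute)
  finally show ?thesis by (simp only: of_real_eq_iff)
qed

lemma trig_diff: "trig a A \<theta> - trig b A \<theta> = trig (\<lambda>k. a k - b k) A \<theta>"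
  by (simp add: trig_def left_diff_distrib sum_subtractf)

lemma fourier_L2_sq: "fourier_L2 a f \<Longrightarrow> sq_integrable f"
  by (simp add: fourier_L2_iff)

lemma fourier_L2_add:
  assumes "fourier_L2 a f" "fourier_L2 b g" shows "fourier_L2 (\<lambda>k. a k + b k) (\<lambda>\<theta>. f \<theta> + g \<theta>)"
  unfolding fourier_L2_iff
proof
  note f = assms[unfolded fourier_L2_iff]
  show "sq_integrable (\<lambda>\<theta>. f \<theta> + g \<theta>)" using f by (intro sq_integrable_add) auto
  let ?d = "\<lambda>a f N. LINT \<theta>|circ. (cmod (f \<theta> - trig a (sym N) \<theta>))\<^sup>2"
  show "?d (\<lambda>k. a k + b k) (\<lambda>\<theta>. f \<theta> + g \<theta>) \<longlonglongrightarrow> 0"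
  proof (rule Lim_null_comparison)
    show "(\<lambda>N. 2 * ?d a f N + 2 * ?d b g N) \<longlonglongrightarrow> 0"
      using f by (auto intro!: tendsto_eq_intros)
    have "?d (\<lambda>k. a k + b k) (\<lambda>\<theta>. f \<theta> + g \<theta>) N \<le> 2 * ?d a f N + 2 * ?d b g N" for N
    proof -
      have "f \<theta> + g \<theta> - trig (\<lambda>k. a k + b k) (sym N) \<theta> =
          (f \<theta> - trig a (sym N) \<theta>) + (g \<theta> - trig b (sym N) \<theta>)" for \<theta>
        by (simp add: trig_def distrib_right sum.distrib)
      then show ?thesis using f
        by (simp only:) (intro sq_integrable_add(2) sq_integrable_diff sq_integrable_trig; simp)
    qed
    then show "\<forall>\<^sub>F N in sequentially. norm (?d (\<lambda>k. a k + b k) (\<lambda>\<theta>. f \<theta> + g \<theta>) N) \<le> 2 * ?d a f N + 2 * ?d b g N"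
      by simp
  qed
qed

lemma fourier_L2_cmult:
  assumes "fourier_L2 a f" shows "fourier_L2 (\<lambda>k. c * a k) (\<lambda>\<theta>. c * f \<theta>)"
  unfolding fourier_L2_iff
proof
  note f = assms[unfolded fourier_L2_iff]
  show "sq_integrable (\<lambda>\<theta>. c * f \<theta>)" using f by (intro sq_integrable_cmult) auto
  have "(cmod (c * f \<theta> - trig (\<lambda>k. c * a k) (sym N) \<theta>))\<^sup>2 = (cmod c)\<^sup>2 * (cmod (f \<theta> - trig a (sym N) \<theta>))\<^sup>2" for N \<theta>
    by (simp add: trig_def mult.assoc sum_distrib_left[symmetric] right_diff_distrib[symmetric] norm_mult power_mult_distrib)
  then show "(\<lambda>N. LINT \<theta>|circ. (cmod (c * f \<theta> - trig (\<lambda>k. c * a k) (sym N) \<theta>))\<^sup>2) \<longlonglongrightarrow> 0"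
    using tendsto_mult_left[OF conjunct2[OF f], of "(cmod c)\<^sup>2"] by simp
qed

lemma fourier_L2_zero: "fourier_L2 (\<lambda>_. 0) (\<lambda>_. 0)"
  by (simp add: fourier_L2_iff sq_integrable_zero trig_def)

lemma fourier_L2_sum:
  "finite A \<Longrightarrow> (\<And>i. i \<in> A \<Longrightarrow> fourier_L2 (a i) (f i)) \<Longrightarrow> fourier_L2 (\<lambda>k. \<Sum>i\<in>A. a i k) (\<lambda>\<theta>. \<Sum>i\<in>A. f i \<theta>)"
  by (induction A rule: finite_induct) (auto intro: fourier_L2_add fourier_L2_zero)

text \<open>By Parseval, the difference of the two partial sums of order N controls every single
  coefficient difference inside the window, and both partial sums approach f.\<close>

lemma fourier_L2_coeff_unique:
  assumes "fourier_L2 a f" "fourier_L2 b f" shows "a = b"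
proof
  fix k
  note f = assms[unfolded fourier_L2_iff]
  let ?d = "\<lambda>a N. LINT \<theta>|circ. (cmod (f \<theta> - trig a (sym N) \<theta>))\<^sup>2"
  have le: "2 * pi * (cmod (a k - b k))\<^sup>2 \<le> 2 * ?d a N + 2 * ?d b N" if N: "N \<ge> nat \<bar>k\<bar>" for N
  proof -
    have k: "k \<in> sym N" using N by auto
    have "2 * pi * (cmod (a k - b k))\<^sup>2 \<le> 2 * pi * (\<Sum>k\<in>sym N. (cmod (a k - b k))\<^sup>2)"
      using k by (intro mult_left_mono member_le_sum[of k "sym N" "\<lambda>k. (cmod (a k - b k))\<^sup>2"]) auto
    also have "\<dots> = (LINT \<theta>|circ. (cmod (trig (\<lambda>k. a k - b k) (sym N) \<theta>))\<^sup>2)"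
      by (rule parseval_finite[symmetric]) simp
    also have "\<dots> = (LINT \<theta>|circ. (cmod ((- 1) * (f \<theta> - trig a (sym N) \<theta>) + (f \<theta> - trig b (sym N) \<theta>)))\<^sup>2)"
      by (simp add: trig_diff[symmetric])
    also have "\<dots> \<le> 2 * (LINT \<theta>|circ. (cmod ((- 1) * (f \<theta> - trig a (sym N) \<theta>)))\<^sup>2) + 2 * ?d b N"
      using f by (intro sq_integrable_add(2) sq_integrable_cmult sq_integrable_diff sq_integrable_trig) auto
    finally show ?thesis by (simp add: norm_minus_commute)
  qed
  have "2 * pi * (cmod (a k - b k))\<^sup>2 \<le> 0"
  proof (rule LIMSEQ_le_const)
    show "(\<lambda>N. 2 * ?d a N + 2 * ?d b N) \<longlonglongrightarrow> 0" using f by (auto intro!: tendsto_eq_intros)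
    show "\<exists>N. \<forall>n\<ge>N. 2 * pi * (cmod (a k - b k))\<^sup>2 \<le> 2 * ?d a n + 2 * ?d b n" using le by blast
  qed
  moreover have "0 \<le> 2 * pi * (cmod (a k - b k))\<^sup>2" by simp
  ultimately have "2 * pi * (cmod (a k - b k))\<^sup>2 = 0" by linarith
  then show "a k = b k" by simp
qed

lemma fourier_L2_unique:
  assumes "fourier_L2 a f" "fourier_L2 a g" shows "AE \<theta> in circ. f \<theta> = g \<theta>"
proof -
  note f = assms[unfolded fourier_L2_iff]
  let ?d = "\<lambda>f N. LINT \<theta>|circ. (cmod (f \<theta> - trig a (sym N) \<theta>))\<^sup>2"
  have sq: "sq_integrable (\<lambda>\<theta>. f \<theta> - g \<theta>)" using f by (intro sq_integrable_diff) auto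
  have le: "(LINT \<theta>|circ. (cmod (f \<theta> - g \<theta>))\<^sup>2) \<le> 2 * ?d f N + 2 * ?d g N" for N
  proof -
    have "(LINT \<theta>|circ. (cmod (f \<theta> - g \<theta>))\<^sup>2) =
        (LINT \<theta>|circ. (cmod ((f \<theta> - trig a (sym N) \<theta>) + (- 1) * (g \<theta> - trig a (sym N) \<theta>)))\<^sup>2)" by simp
    also have "\<dots> \<le> 2 * ?d f N + 2 * (LINT \<theta>|circ. (cmod ((- 1) * (g \<theta> - trig a (sym N) \<theta>)))\<^sup>2)"
      using f by (intro sq_integrable_add(2) sq_integrable_cmult sq_integrable_diff sq_integrable_trig) auto
    finally show ?thesis by (simp add: norm_minus_commute)
  qed
  have "(LINT \<theta>|circ. (cmod (f \<theta> - g \<theta>))\<^sup>2) \<le> 0"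
  proof (rule LIMSEQ_le_const)
    show "(\<lambda>N. 2 * ?d f N + 2 * ?d g N) \<longlonglongrightarrow> 0" using f by (auto intro!: tendsto_eq_intros)
  qed (use le in auto)
  moreover have "0 \<le> (LINT \<theta>|circ. (cmod (f \<theta> - g \<theta>))\<^sup>2)" by (rule integral_nonneg_AE) simp
  ultimately have "(LINT \<theta>|circ. (cmod (f \<theta> - g \<theta>))\<^sup>2) = 0" by linarith
  then have "AE \<theta> in circ. (cmod (f \<theta> - g \<theta>))\<^sup>2 = 0"
    using sq by (subst (asm) integral_nonneg_eq_0_iff_AE) (auto simp: sq_integrable_def)
  then show ?thesis by simp
qed

text \<open>Completeness of Lebesgue measure. Through it the image of a transform under a symbol
  inherits measurability from a function with which it agrees almost everywhere.\<close>

lemma circ_measurable_AE: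
  fixes f g :: "real \<Rightarrow> complex"
  assumes f: "f \<in> borel_measurable circ" and ae: "AE \<theta> in circ. f \<theta> = g \<theta>"
  shows "g \<in> borel_measurable circ"
proof -
  let ?h = "\<lambda>f \<theta>. indicator {-pi..pi} \<theta> *\<^sub>R (f \<theta> :: complex)"
  have iff: "f \<in> borel_measurable circ \<longleftrightarrow> ?h f \<in> borel_measurable lebesgue" for f :: "real \<Rightarrow> complex"
    by (rule borel_measurable_restrict_space_iff) auto
  have "AE \<theta> in lebesgue. ?h f \<theta> = ?h g \<theta>"
    using ae by (subst (asm) AE_restrict_space_iff) (auto simp: indicator_def)
  with f show ?thesis unfolding iff by (rule borel_measurable_AE)
qed

lemma fourier_L2_AE:
  assumes f: "fourier_L2 a f" and ae: "AE \<theta> in circ. f \<theta> = g \<theta>"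
  shows "fourier_L2 a g"
proof -
  have m: "f \<in> borel_measurable circ" using f by (simp add: fourier_L2_def)
  have g: "g \<in> borel_measurable circ" by (rule circ_measurable_AE[OF m ae])
  note [measurable] = m g
  have s: "trig a (sym N) \<in> borel_measurable circ" for N
    using sq_integrable_trig by (simp add: sq_integrable_def)
  note [measurable] = s
  have "integrable circ (\<lambda>\<theta>. (cmod (g \<theta>))\<^sup>2)"
    using f ae by (subst integrable_cong_AE[where g = "\<lambda>\<theta>. (cmod (f \<theta>))\<^sup>2"]) (auto simp: fourier_L2_def)
  moreover have "(LINT \<theta>|circ. (cmod (g \<theta> - trig a (sym N) \<theta>))\<^sup>2) = (LINT \<theta>|circ. (cmod (f \<theta> - trig a (sym N) \<theta>))\<^sup>2)" for N
    using ae by (intro integral_cong_AE) auto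
  ultimately show ?thesis using f g by (simp add: fourier_L2_iff sq_integrable_def)
qed

text \<open>The constant is the 2 pi of Parseval's identity times the factor 2 of the quadratic
  triangle inequality.\<close>

lemma fourier_L2_norm_le:
  assumes "fourier_L2 a f" "l2 a"
  shows "(LINT \<theta>|circ. (cmod (f \<theta>))\<^sup>2) \<le> 4 * pi * (l2_norm a)\<^sup>2"
proof -
  note f = assms(1)[unfolded fourier_L2_iff]
  let ?d = "\<lambda>N. LINT \<theta>|circ. (cmod (f \<theta> - trig a (sym N) \<theta>))\<^sup>2"
  have le: "(LINT \<theta>|circ. (cmod (f \<theta>))\<^sup>2) \<le> 2 * ?d N + 4 * pi * (l2_norm a)\<^sup>2" for N
  proof -
    have "(LINT \<theta>|circ. (cmod (f \<theta>))\<^sup>2) = (LINT \<theta>|circ. (cmod ((f \<theta> - trig a (sym N) \<theta>) + trig a (sym N) \<theta>))\<^sup>2)" by simp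
    also have "\<dots> \<le> 2 * ?d N + 2 * (LINT \<theta>|circ. (cmod (trig a (sym N) \<theta>))\<^sup>2)"
      using f by (intro sq_integrable_add(2) sq_integrable_diff sq_integrable_trig) auto
    also have "(LINT \<theta>|circ. (cmod (trig a (sym N) \<theta>))\<^sup>2) = 2 * pi * (\<Sum>k\<in>sym N. (cmod (a k))\<^sup>2)"
      by (rule parseval_finite) simp
    also have "\<dots> \<le> 2 * pi * (l2_norm a)\<^sup>2"
      unfolding l2_norm_power2 using assms(2) by (intro mult_left_mono finite_sum_le_infsum) auto
    finally show ?thesis by simp
  qed
  show ?thesis
  proof (rule LIMSEQ_le_const)
    show "(\<lambda>N. 2 * ?d N + 4 * pi * (l2_norm a)\<^sup>2) \<longlonglongrightarrow> 4 * pi * (l2_norm a)\<^sup>2"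
      using f by (auto intro!: tendsto_eq_intros)
  qed (use le in auto)
qed

lemma l2_tendsto_0_int:
  fixes a :: "int \<Rightarrow> complex"
  assumes "l2 a" shows "(\<lambda>N. l2_norm (restr (- sym N) a)) \<longlonglongrightarrow> 0"
proof (rule l2_norm_restr_tendsto_0[OF assms])
  show "- sym n \<subseteq> - sym m" if "m \<le> n" for m n using that by auto
  show "\<exists>n. k \<notin> - sym n" for k by (intro exI[of _ "nat \<bar>k\<bar>"]) auto
qed

text \<open>Shifting the coefficients moves the symmetric window of the partial sums off centre; the
  few terms by which the windows differ are controlled by the tail of a.\<close>

lemma fourier_L2_shift:
  assumes f: "fourier_L2 a f" and a: "l2 a" and s: "s \<in> {-1, 0, 1 :: int}"
  shows "fourier_L2 (\<lambda>k. a (k + s)) (\<lambda>\<theta>. cis (- of_int s * \<theta>) * f \<theta>)"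
  unfolding fourier_L2_iff
proof
  let ?c = "\<lambda>\<theta>. cis (- of_int s * \<theta>)"
  note ff = f[unfolded fourier_L2_iff]
  show "sq_integrable (\<lambda>\<theta>. ?c \<theta> * f \<theta>)"
    by (rule sq_integrable_mult(1)[where B = 1, OF conjunct1[OF ff] cis_measurable]) simp
  let ?d = "\<lambda>N. LINT \<theta>|circ. (cmod (f \<theta> - trig a (sym N) \<theta>))\<^sup>2"
  let ?t = "\<lambda>N. l2_norm (restr (- sym N) a)"
  \<comment> \<open>The shifted window of order N + 1 still contains the symmetric one of order N,
    because s has absolute value at most 1.\<close>
  define A where "A N = (\<lambda>k. k + s) ` sym (Suc N)" for N
  have fin: "finite (A N)" and sub: "sym N \<subseteq> A N" for N
    using s by (auto simp: A_def image_iff)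
  have shift: "trig (\<lambda>k. a (k + s)) (sym N) \<theta> = ?c \<theta> * trig a ((\<lambda>k. k + s) ` sym N) \<theta>" for N \<theta>
    unfolding trig_def by (subst sum.reindex) (auto simp: sum_distrib_left cis_mult algebra_simps inj_on_def)
  have le: "(LINT \<theta>|circ. (cmod (?c \<theta> * f \<theta> - trig (\<lambda>k. a (k + s)) (sym (Suc N)) \<theta>))\<^sup>2)
      \<le> 2 * ?d N + 4 * pi * (?t N)\<^sup>2" for N
  proof -
    have tr: "trig a (A N) \<theta> = trig a (sym N) \<theta> + trig a (A N - sym N) \<theta>" for \<theta>
      unfolding trig_def using sum.subset_diff[OF sub fin, of "\<lambda>k. a k * cis (of_int k * \<theta>)"] by simp
    have "(cmod (?c \<theta> * f \<theta> - trig (\<lambda>k. a (k + s)) (sym (Suc N)) \<theta>))\<^sup>2 =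
        (cmod ((f \<theta> - trig a (sym N) \<theta>) + (- 1) * trig a (A N - sym N) \<theta>))\<^sup>2" for \<theta>
    proof -
      have "?c \<theta> * f \<theta> - trig (\<lambda>k. a (k + s)) (sym (Suc N)) \<theta> = ?c \<theta> * (f \<theta> - trig a (A N) \<theta>)"
        unfolding shift A_def[symmetric] by (simp add: right_diff_distrib)
      then have "cmod (?c \<theta> * f \<theta> - trig (\<lambda>k. a (k + s)) (sym (Suc N)) \<theta>) = cmod (f \<theta> - trig a (A N) \<theta>)"
        by (simp only: norm_mult norm_cis mult_1_left)
      then show ?thesis by (simp only: tr) (simp add: diff_diff_add)
    qed
    then have "(LINT \<theta>|circ. (cmod (?c \<theta> * f \<theta> - trig (\<lambda>k. a (k + s)) (sym (Suc N)) \<theta>))\<^sup>2) =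
        (LINT \<theta>|circ. (cmod ((f \<theta> - trig a (sym N) \<theta>) + (- 1) * trig a (A N - sym N) \<theta>))\<^sup>2)" by simp
    also have "\<dots> \<le> 2 * ?d N + 2 * (LINT \<theta>|circ. (cmod ((- 1) * trig a (A N - sym N) \<theta>))\<^sup>2)"
      using ff fin by (intro sq_integrable_add(2) sq_integrable_diff sq_integrable_cmult sq_integrable_trig) auto
    also have "(LINT \<theta>|circ. (cmod ((- 1) * trig a (A N - sym N) \<theta>))\<^sup>2) = 2 * pi * (\<Sum>k\<in>A N - sym N. (cmod (a k))\<^sup>2)"
      using parseval_finite[of "A N - sym N" a] fin by simp
    also have "(\<Sum>k\<in>A N - sym N. (cmod (a k))\<^sup>2) = (\<Sum>k\<in>A N - sym N. (cmod (restr (- sym N) a k))\<^sup>2)"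
      by (rule sum.cong) (auto simp: restr_def)
    also have "\<dots> \<le> (?t N)\<^sup>2"
      unfolding l2_norm_power2 using l2_restr[OF a] fin by (intro finite_sum_le_infsum) auto
    finally show ?thesis by simp
  qed
  have "(\<lambda>N. LINT \<theta>|circ. (cmod (?c \<theta> * f \<theta> - trig (\<lambda>k. a (k + s)) (sym (Suc N)) \<theta>))\<^sup>2) \<longlonglongrightarrow> 0"
  proof (rule Lim_null_comparison)
    show "(\<lambda>N. 2 * ?d N + 4 * pi * (?t N)\<^sup>2) \<longlonglongrightarrow> 0"
      using ff l2_tendsto_0_int[OF a] by (auto intro!: tendsto_eq_intros)
  qed (use le in simp)
  then show "(\<lambda>N. LINT \<theta>|circ. (cmod (?c \<theta> * f \<theta> - trig (\<lambda>k. a (k + s)) (sym N) \<theta>))\<^sup>2) \<longlonglongrightarrow> 0"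
    by (rule LIMSEQ_imp_Suc)
qed

text \<open>Riesz--Fischer: a subsequence of the partial sums converges almost everywhere, and by
  Fatou's lemma its limit is also the limit in mean square.\<close>

lemma fourier_L2_exists:
  assumes a: "l2 a" obtains f where "fourier_L2 a f"
proof -
  define t where "t N = (l2_norm (restr (- sym N) a))\<^sup>2" for N
  have t0: "0 \<le> t N" for N by (simp add: t_def)
  have t_lim: "t \<longlonglongrightarrow> 0" unfolding t_def using tendsto_power[OF l2_tendsto_0_int[OF a], of 2] by simp
  have S_meas [measurable]: "trig a (sym N) \<in> borel_measurable circ" for N
    using sq_integrable_trig[of "sym N" a] by (simp add: sq_integrable_def)
  have diff: "trig a (sym M) \<theta> - trig a (sym N) \<theta> = trig a (sym M - sym N) \<theta>" if "N \<le> M" for N M \<theta>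
    unfolding trig_def using that
    by (subst sum.subset_diff[of "sym N" "sym M"]) auto
  have D: "(LINT \<theta>|circ. (cmod (trig a (sym M) \<theta> - trig a (sym N) \<theta>))\<^sup>2) \<le> 2 * pi * t N" if "N \<le> M" for N M
  proof -
    have "(LINT \<theta>|circ. (cmod (trig a (sym M) \<theta> - trig a (sym N) \<theta>))\<^sup>2) = 2 * pi * (\<Sum>k\<in>sym M - sym N. (cmod (a k))\<^sup>2)"
      unfolding diff[OF that] by (rule parseval_finite) simp
    also have "(\<Sum>k\<in>sym M - sym N. (cmod (a k))\<^sup>2) = (\<Sum>k\<in>sym M - sym N. (cmod (restr (- sym N) a k))\<^sup>2)"
      by (rule sum.cong) (auto simp: restr_def)
    also have "\<dots> \<le> t N"
      unfolding t_def l2_norm_power2 using l2_restr[OF a] by (intro finite_sum_le_infsum) auto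
    finally show ?thesis by simp
  qed
  have D_int: "integrable circ (\<lambda>\<theta>. (cmod (trig a (sym M) \<theta> - trig a (sym N) \<theta>))\<^sup>2)" for N M
    using sq_integrable_diff[OF sq_integrable_trig sq_integrable_trig, of "sym M" "sym N" a a] by (simp add: sq_integrable_def)
  have nnD: "(\<integral>\<^sup>+\<theta>. ennreal ((cmod (trig a (sym M) \<theta> - trig a (sym N) \<theta>))\<^sup>2) \<partial>circ) \<le> ennreal (2 * pi * t N)" if "N \<le> M" for N M
    using D[OF that] by (subst nn_integral_eq_integral[OF D_int]) (auto intro: ennreal_leI)
  have "\<exists>N. \<forall>n\<ge>N. t n \<le> (1/4) ^ j" for j :: nat
  proof -
    have "\<forall>\<^sub>F n in sequentially. t n < (1/4) ^ j" using t_lim by (rule order_tendstoD(2)) simp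
    then show ?thesis unfolding eventually_sequentially by (meson less_imp_le)
  qed
  then obtain N0 where N0: "\<And>j n. n \<ge> N0 j \<Longrightarrow> t n \<le> (1/4) ^ j" by metis
  \<comment> \<open>The subsequence is nondecreasing, at least j and at least \<open>N0 j\<close>,
    so the tails along it are at most 4^-j.\<close>
  define n where "n j = j + (\<Sum>i\<le>j. N0 i)" for j
  have n_mono: "n j \<le> n (Suc j)" and n_ge: "j \<le> n j" for j by (auto simp: n_def)
  have "N0 j \<le> (\<Sum>i\<le>j. N0 i)" for j by (rule member_le_sum) auto
  then have tn: "t (n j) \<le> (1/4) ^ j" for j using N0[of j "n j"] by (simp add: n_def trans_le_add2)
  let ?S = "\<lambda>j. trig a (sym (n j))"
  \<comment> \<open>The weight 2^j leaves integrals of order 2^-j, and 2 x \<le> 2^j x^2 + 2^-j then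
    turns summability of the weighted squares into absolute summability of the differences.\<close>
  define h where "h j \<theta> = 2 ^ j * (cmod (?S (Suc j) \<theta> - ?S j \<theta>))\<^sup>2" for j \<theta>
  have h_meas [measurable]: "h j \<in> borel_measurable circ" for j unfolding h_def[abs_def] by measurable
  have h0: "0 \<le> h j \<theta>" for j \<theta> by (simp add: h_def)
  have h_int: "(\<integral>\<^sup>+\<theta>. ennreal (h j \<theta>) \<partial>circ) \<le> ennreal (2 * pi * (1/2) ^ j)" for j
  proof -
    have "(\<integral>\<^sup>+\<theta>. ennreal (h j \<theta>) \<partial>circ) = ennreal (2 ^ j) * (\<integral>\<^sup>+\<theta>. ennreal ((cmod (?S (Suc j) \<theta> - ?S j \<theta>))\<^sup>2) \<partial>circ)"
      unfolding h_def by (subst nn_integral_cmult[symmetric]) (auto simp: ennreal_mult)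
    also have "\<dots> \<le> ennreal (2 ^ j) * ennreal (2 * pi * t (n j))"
      by (intro mult_left_mono nnD n_mono) auto
    also have "\<dots> = ennreal (2 ^ j * (2 * pi * t (n j)))"
      using t0 by (intro ennreal_mult[symmetric]) auto
    also have "\<dots> \<le> ennreal (2 * pi * (1/2) ^ j)"
    proof (rule ennreal_leI)
      have "2 ^ j * (2 * pi * t (n j)) \<le> 2 ^ j * (2 * pi * (1/4) ^ j)"
        by (intro mult_left_mono tn) auto
      also have "\<dots> = 2 * pi * (2 ^ j * (1/4) ^ j)" by simp
      also have "(2::real) ^ j * (1/4) ^ j = (1/2) ^ j" by (simp add: power_mult_distrib[symmetric])
      finally show "2 ^ j * (2 * pi * t (n j)) \<le> 2 * pi * (1/2) ^ j" .
    qed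
    finally show ?thesis .
  qed
  have "(\<integral>\<^sup>+\<theta>. (\<Sum>j. ennreal (h j \<theta>)) \<partial>circ) = (\<Sum>j. \<integral>\<^sup>+\<theta>. ennreal (h j \<theta>) \<partial>circ)"
    by (rule nn_integral_suminf) auto
  also have "\<dots> \<le> (\<Sum>j. ennreal (2 * pi * (1/2) ^ j))"
    by (intro suminf_le h_int summableI)
  also have "\<dots> = ennreal (\<Sum>j. 2 * pi * (1/2) ^ j)"
    by (intro suminf_ennreal2 summable_mult summable_geometric) auto
  finally have "(\<integral>\<^sup>+\<theta>. (\<Sum>j. ennreal (h j \<theta>)) \<partial>circ) \<noteq> \<infinity>"
    by (auto simp: top_unique)
  then have "AE \<theta> in circ. (\<Sum>j. ennreal (h j \<theta>)) \<noteq> \<infinity>"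
    by (intro nn_integral_noteq_infinite) auto
  then have conv: "AE \<theta> in circ. convergent (\<lambda>j. ?S j \<theta>)"
  proof (rule AE_mp, intro AE_I2 impI)
    fix \<theta> assume "(\<Sum>j. ennreal (h j \<theta>)) \<noteq> \<infinity>"
    then have "summable (\<lambda>j. h j \<theta>)" by (intro summable_suminf_not_top h0) simp
    then have "summable (\<lambda>j. (1/2) ^ j + h j \<theta>)" by (intro summable_add summable_geometric) auto
    then have "summable (\<lambda>j. ?S (Suc j) \<theta> - ?S j \<theta>)"
    proof (rule summable_comparison_test'[where N = 0])
      fix j :: nat
      let ?x = "cmod (?S (Suc j) \<theta> - ?S j \<theta>)"
      have "2 * ?x * 1 \<le> 2 ^ j * ?x\<^sup>2 + (1/2) ^ j"
      proof -
        have "0 \<le> 2 ^ j * (?x - (1/2) ^ j)\<^sup>2" by simp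
        also have "\<dots> = 2 ^ j * ?x\<^sup>2 - 2 * ?x * (2 ^ j * (1/2) ^ j) + (2 ^ j * (1/2) ^ j) * (1/2) ^ j"
          by (simp add: power2_eq_square algebra_simps)
        also have "(2::real) ^ j * (1/2) ^ j = 1" by (simp add: power_mult_distrib[symmetric])
        finally show ?thesis by simp
      qed
      moreover have "0 \<le> ?x" by simp
      ultimately show "norm (?S (Suc j) \<theta> - ?S j \<theta>) \<le> (1/2) ^ j + h j \<theta>"
        unfolding h_def by linarith
    qed
    then have "convergent (\<lambda>j. \<Sum>i<j. ?S (Suc i) \<theta> - ?S i \<theta>)" by (simp add: summable_iff_convergent)
    then have "convergent (\<lambda>j. (?S j \<theta> - ?S 0 \<theta>) + ?S 0 \<theta>)"
      by (intro convergent_add convergent_const) (simp only: sum_lessThan_telescope[of "\<lambda>j. ?S j \<theta>"])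
    then show "convergent (\<lambda>j. ?S j \<theta>)" by simp
  qed
  define f where "f \<theta> = lim (\<lambda>j. ?S j \<theta>)" for \<theta>
  have f_meas [measurable]: "f \<in> borel_measurable circ" unfolding f_def[abs_def] by measurable
  \<comment> \<open>With N fixed, Fatou's lemma along the subsequence bounds the distance of f to
    every partial sum, although pointwise convergence is known only along the subsequence.\<close>
  have fatou: "(\<integral>\<^sup>+\<theta>. ennreal ((cmod (f \<theta> - trig a (sym N) \<theta>))\<^sup>2) \<partial>circ) \<le> ennreal (2 * pi * t N)" for N
  proof -
    let ?u = "\<lambda>j \<theta>. ennreal ((cmod (?S j \<theta> - trig a (sym N) \<theta>))\<^sup>2)"
    have "(\<integral>\<^sup>+\<theta>. ennreal ((cmod (f \<theta> - trig a (sym N) \<theta>))\<^sup>2) \<partial>circ) = (\<integral>\<^sup>+\<theta>. liminf (\<lambda>j. ?u j \<theta>) \<partial>circ)"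
    proof (rule nn_integral_cong_AE, rule AE_mp[OF conv], intro AE_I2 impI)
      fix \<theta> assume "convergent (\<lambda>j. ?S j \<theta>)"
      then have "(\<lambda>j. ?S j \<theta>) \<longlonglongrightarrow> f \<theta>" by (simp add: f_def convergent_LIMSEQ_iff)
      then have "(\<lambda>j. ?u j \<theta>) \<longlonglongrightarrow> ennreal ((cmod (f \<theta> - trig a (sym N) \<theta>))\<^sup>2)"
        by (intro tendsto_ennrealI tendsto_intros)
      then show "ennreal ((cmod (f \<theta> - trig a (sym N) \<theta>))\<^sup>2) = liminf (\<lambda>j. ?u j \<theta>)"
        by (intro lim_imp_Liminf[symmetric]) auto
    qed
    also have "\<dots> \<le> liminf (\<lambda>j. \<integral>\<^sup>+\<theta>. ?u j \<theta> \<partial>circ)" by (rule nn_integral_liminf) auto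
    also have "\<dots> \<le> liminf (\<lambda>j. ennreal (2 * pi * t N))"
    proof (rule Liminf_mono)
      have "(\<integral>\<^sup>+\<theta>. ?u j \<theta> \<partial>circ) \<le> ennreal (2 * pi * t N)" if "j \<ge> N" for j
        using nnD[of N "n j"] n_ge[of j] that by simp
      then show "\<forall>\<^sub>F j in sequentially. (\<integral>\<^sup>+\<theta>. ?u j \<theta> \<partial>circ) \<le> ennreal (2 * pi * t N)"
        unfolding eventually_sequentially by blast
    qed
    also have "\<dots> = ennreal (2 * pi * t N)" by (simp add: Liminf_const)
    finally show ?thesis .
  qed
  have int: "integrable circ (\<lambda>\<theta>. (cmod (f \<theta> - trig a (sym N) \<theta>))\<^sup>2)" for N
    by (rule integrableI_nonneg) (use fatou[of N] in \<open>auto simp: less_top[symmetric] top_unique\<close>)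
  have le: "(LINT \<theta>|circ. (cmod (f \<theta> - trig a (sym N) \<theta>))\<^sup>2) \<le> 2 * pi * t N" for N
    using fatou[of N] t0[of N] by (subst (asm) nn_integral_eq_integral[OF int]) auto
  have "sq_integrable (\<lambda>\<theta>. f \<theta> - trig a (sym 0) \<theta>)"
    unfolding sq_integrable_def by (intro conjI int) measurable
  from sq_integrable_add(1)[OF this sq_integrable_trig[of "sym 0" a]] have "sq_integrable f" by simp
  moreover have "(\<lambda>N. LINT \<theta>|circ. (cmod (f \<theta> - trig a (sym N) \<theta>))\<^sup>2) \<longlonglongrightarrow> 0"
  proof (rule Lim_null_comparison)
    show "(\<lambda>N. 2 * pi * t N) \<longlonglongrightarrow> 0" using t_lim by (auto intro!: tendsto_eq_intros)
  qed (use le in simp)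
  ultimately show thesis using that by (simp add: fourier_L2_iff)
qed

section \<open>The discrete Riccati equation\<close>

text \<open>Antilinear in the first argument, as \<open>l2_inner\<close> is, whereas
  \<open>\<bullet>c\<close> conjugates the second.\<close>

definition ip :: "complex vec \<Rightarrow> complex vec \<Rightarrow> complex" where
  "ip v w = (\<Sum>i<dim_vec w. cnj (v $ i) * w $ i)"

lemma ip_add_right: "u \<in> carrier_vec n \<Longrightarrow> v \<in> carrier_vec n \<Longrightarrow> w \<in> carrier_vec n \<Longrightarrow> ip u (v + w) = ip u v + ip u w"
  by (simp add: ip_def distrib_left sum.distrib)

lemma ip_add_left: "u \<in> carrier_vec n \<Longrightarrow> v \<in> carrier_vec n \<Longrightarrow> w \<in> carrier_vec n \<Longrightarrow> ip (u + v) w = ip u w + ip v w"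
  by (simp add: ip_def distrib_right sum.distrib)

lemma ip_uminus: "u \<in> carrier_vec n \<Longrightarrow> v \<in> carrier_vec n \<Longrightarrow> ip u (- v) = - ip u v"
    "u \<in> carrier_vec n \<Longrightarrow> v \<in> carrier_vec n \<Longrightarrow> ip (- u) v = - ip u v"
  by (simp_all add: ip_def sum_negf)

lemma ip_eqI:
  assumes "v \<in> carrier_vec n" "w \<in> carrier_vec n" "\<And>x. x \<in> carrier_vec n \<Longrightarrow> ip x v = ip x w"
  shows "v = w"
proof (rule eq_vecI)
  fix i assume i: "i < dim_vec w"
  then have i: "i < n" using assms(2) by simp
  have "ip (unit_vec n i) u = u $ i" if "u \<in> carrier_vec n" for u
  proof -
    have "cnj (unit_vec n i $ j) * u $ j = (if j = i then u $ j else 0)" if "j < n" for j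
      using that i by simp
    then have "ip (unit_vec n i) u = (\<Sum>j<n. if j = i then u $ j else 0)"
      using that by (simp add: ip_def)
    then show ?thesis using i by simp
  qed
  then show "v $ i = w $ i" using assms unit_vec_carrier[of n i] by metis
qed (use assms in auto)

lemma mult_mat_vec_nth: "A \<in> carrier_mat n m \<Longrightarrow> v \<in> carrier_vec m \<Longrightarrow> i < n \<Longrightarrow> (A *\<^sub>v v) $ i = (\<Sum>j<m. A $$ (i, j) * v $ j)"
  by (simp add: scalar_prod_def lessThan_atLeast0)

lemma ip_adjoint:
  assumes A: "A \<in> carrier_mat n n" "B \<in> carrier_mat n n" "\<And>i j. i < n \<Longrightarrow> j < n \<Longrightarrow> B $$ (j, i) = cnj (A $$ (i, j))"
    and v: "v \<in> carrier_vec n" "w \<in> carrier_vec n"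
  shows "ip v (A *\<^sub>v w) = ip (B *\<^sub>v v) w"
proof -
  have "ip v (A *\<^sub>v w) = (\<Sum>i<n. \<Sum>j<n. cnj (v $ i) * (A $$ (i, j) * w $ j))"
    using A v by (simp add: ip_def mult_mat_vec_nth sum_distrib_left del: index_mult_mat_vec)
  also have "\<dots> = (\<Sum>j<n. \<Sum>i<n. cnj (v $ i) * (A $$ (i, j) * w $ j))" by (rule sum.swap)
  also have "\<dots> = (\<Sum>j<n. cnj (\<Sum>i<n. B $$ (j, i) * v $ i) * w $ j)"
    using A(3) by (intro sum.cong refl) (simp add: sum_distrib_left sum_distrib_right mult_ac)
  also have "\<dots> = ip (B *\<^sub>v v) w"
    using A v by (simp add: ip_def mult_mat_vec_nth del: index_mult_mat_vec)
  finally show ?thesis .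
qed

lemma mat_adjoint_eqI:
  assumes "A \<in> carrier_mat n n" "\<And>i j. i < n \<Longrightarrow> j < n \<Longrightarrow> A $$ (j, i) = cnj (A $$ (i, j))"
  shows "mat_adjoint A = A"
proof (rule eq_matI)
  fix i j assume ij: "i < dim_row A" "j < dim_col A"
  then show "mat_adjoint A $$ (i, j) = A $$ (i, j)"
    using assms(1) assms(2)[of j i] by (simp add: mat_adjoint_def conjugate_complex_def mat_of_rows_def)
qed (use assms in \<open>auto simp: mat_adjoint_def\<close>)

lemma pos_def_UNIV_iff:
  "pos_def UNIV n A \<longleftrightarrow> A \<in> carrier_mat n n \<and> (\<forall>i<n. \<forall>j<n. A $$ (j, i) = cnj (A $$ (i, j))) \<and>
     (\<forall>v\<in>carrier_vec n. v \<noteq> 0\<^sub>v n \<longrightarrow> 0 < Re (ip v (A *\<^sub>v v)))"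
proof (cases "A \<in> carrier_mat n n")
  case True
  have form: "(A *\<^sub>v v) \<bullet>c v = ip v (A *\<^sub>v v)" if "v \<in> carrier_vec n" for v
    using that True by (simp add: ip_def scalar_prod_def lessThan_atLeast0 conjugate_complex_def mult.commute)
  have adj: "mat_adjoint A = A \<longleftrightarrow> (\<forall>i<n. \<forall>j<n. A $$ (j, i) = cnj (A $$ (i, j)))"
  proof
    assume "mat_adjoint A = A"
    then show "\<forall>i<n. \<forall>j<n. A $$ (j, i) = cnj (A $$ (i, j))" using hermitian_entries[OF True] by blast
  next
    assume "\<forall>i<n. \<forall>j<n. A $$ (j, i) = cnj (A $$ (i, j))"
    then show "mat_adjoint A = A" by (intro mat_adjoint_eqI[OF True]) blast
  qed
  show ?thesis unfolding pos_def_def adj using True form by auto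
next
  case False
  then show ?thesis by (simp add: pos_def_def)
qed

lemma minv_inverse:
  assumes A: "A \<in> carrier_mat n n" and ker: "\<And>v. v \<in> carrier_vec n \<Longrightarrow> v \<noteq> 0\<^sub>v n \<Longrightarrow> A *\<^sub>v v \<noteq> 0\<^sub>v n"
  shows "minv A \<in> carrier_mat n n" "minv A * A = 1\<^sub>m n" "A * minv A = 1\<^sub>m n"
proof -
  have "det A \<noteq> 0" using det_0_iff_vec_prod_zero_field[OF A] ker by blast
  then obtain B where B: "mat_inverse A = Some B"
    using mat_inverse(1)[OF A, where b = "()"] det_non_zero_imp_unit[OF A, where b = "()"] by (cases "mat_inverse A") auto
  from mat_inverse(2)[OF A B] B show "minv A \<in> carrier_mat n n" "minv A * A = 1\<^sub>m n" "A * minv A = 1\<^sub>m n"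
    by (auto simp: minv_def)
qed

lemma pos_def_add:
  assumes "pos_def UNIV n A" "pos_def UNIV n B" shows "pos_def UNIV n (A + B)"
proof -
  note A = assms(1)[unfolded pos_def_UNIV_iff] and B = assms(2)[unfolded pos_def_UNIV_iff]
  have c: "A \<in> carrier_mat n n" "B \<in> carrier_mat n n" using A B by blast+
  show ?thesis unfolding pos_def_UNIV_iff
  proof (intro conjI allI ballI impI)
    fix i j assume ij: "i < n" "j < n"
    have "A $$ (j, i) = cnj (A $$ (i, j))" "B $$ (j, i) = cnj (B $$ (i, j))" using A B ij by blast+
    then show "(A + B) $$ (j, i) = cnj ((A + B) $$ (i, j))" using c ij by (simp del: complex_cnj_cnj)
  next
    fix v :: "complex vec" assume v: "v \<in> carrier_vec n" "v \<noteq> 0\<^sub>v n"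
    have "0 < Re (ip v (A *\<^sub>v v))" "0 < Re (ip v (B *\<^sub>v v))" using A B v by blast+
    moreover have "ip v ((A + B) *\<^sub>v v) = ip v (A *\<^sub>v v) + ip v (B *\<^sub>v v)"
      unfolding add_mult_distrib_mat_vec[OF c v(1)]
      by (rule ip_add_right[OF v(1) mult_mat_vec_carrier[OF c(1) v(1)] mult_mat_vec_carrier[OF c(2) v(1)]])
    ultimately show "0 < Re (ip v ((A + B) *\<^sub>v v))" by simp
  qed (use c in simp)
qed

lemma pos_def_kernel:
  assumes "pos_def UNIV n A" "v \<in> carrier_vec n" "v \<noteq> 0\<^sub>v n" shows "A *\<^sub>v v \<noteq> 0\<^sub>v n"
proof
  assume "A *\<^sub>v v = 0\<^sub>v n"
  moreover have "0 < Re (ip v (A *\<^sub>v v))" using assms unfolding pos_def_UNIV_iff by blast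
  ultimately show False by (simp add: ip_def)
qed

lemma mat_eq_multI:
  fixes A B :: "complex mat"
  assumes "A \<in> carrier_mat n m" "B \<in> carrier_mat n m" "\<And>v. v \<in> carrier_vec m \<Longrightarrow> A *\<^sub>v v = B *\<^sub>v v"
  shows "A = B"
proof (rule eq_matI)
  fix i j assume "i < dim_row B" "j < dim_col B"
  then have ij: "i < n" "j < m" using assms(2) by auto
  have "(C *\<^sub>v unit_vec m j) $ i = C $$ (i, j)" if "C \<in> carrier_mat n m" for C :: "complex mat"
  proof -
    have "(C *\<^sub>v unit_vec m j) $ i = (\<Sum>k<m. if k = j then C $$ (i, k) else 0)"
      unfolding mult_mat_vec_nth[OF that unit_vec_carrier ij(1)]
      using ij by (intro sum.cong) auto
    then show ?thesis using ij by simp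
  qed
  then show "A $$ (i, j) = B $$ (i, j)" using assms by (metis unit_vec_carrier)
qed (use assms in auto)

lemma sum_double: "(\<Sum>i<2 * n. f i) = (\<Sum>i<n. f i) + (\<Sum>i<n. f (n + i :: nat) :: complex)"
proof -
  have "(\<Sum>i<2 * n. f i) = (\<Sum>i\<in>{0..<n}. f i) + (\<Sum>i\<in>{n..<n + n}. f i)"
    by (subst sum.atLeastLessThan_concat) (auto simp: lessThan_atLeast0 mult_2)
  also have "(\<Sum>i\<in>{n..<n + n}. f i) = (\<Sum>i\<in>{0..<n}. f (n + i))"
    using sum.shift_bounds_nat_ivl[of f 0 n n] by (simp add: add.commute)
  finally show ?thesis by (simp add: lessThan_atLeast0)
qed

lemma mult_uminus_vec:
  fixes A :: "complex mat"
  assumes "A \<in> carrier_mat m n" "v \<in> carrier_vec n" shows "A *\<^sub>v (- v) = - (A *\<^sub>v v)"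
  using assms by (intro eq_vecI) auto

lemma vec_add_eq_uminus_rotate:
  fixes u v w :: "complex vec"
  assumes "u \<in> carrier_vec n" "v \<in> carrier_vec n" "w \<in> carrier_vec n" "u + v = - w"
  shows "v + w = - u"
proof (rule eq_vecI)
  fix i assume "i < dim_vec (- u)"
  then have i: "i < n" using assms by simp
  have "u $ i + v $ i = - (w $ i)" using arg_cong[OF assms(4), of "\<lambda>x. x $ i"] assms(1-3) i by simp
  then have "v $ i + w $ i = - (u $ i)" by (simp add: eq_neg_iff_add_eq_0 add_ac)
  then show "(v + w) $ i = (- u) $ i" using assms i by simp
qed (use assms in auto)

section \<open>Positive solutions of the Riccati equation and decaying chains\<close>

locale pos_pair =
  fixes n :: nat and K :: "complex mat"
  assumes K: "pos_def UNIV (2 * n) K"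
begin

abbreviation "LL \<equiv> blkLL n K"
abbreviation "LR \<equiv> blkLR n K"
abbreviation "RL \<equiv> blkRL n K"
abbreviation "RR \<equiv> blkRR n K"

lemma blk_carrier [simp]: "LL \<in> carrier_mat n n" "LR \<in> carrier_mat n n" "RL \<in> carrier_mat n n" "RR \<in> carrier_mat n n"
  by (auto simp: blkLL_def blkLR_def blkRL_def blkRR_def)

lemma blk_dim [simp]: "dim_row LL = n" "dim_row LR = n" "dim_row RL = n" "dim_row RR = n"
  by (rule carrier_matD(1), rule blk_carrier)+

lemma blk_nth: "i < n \<Longrightarrow> j < n \<Longrightarrow> LL $$ (i, j) = K $$ (i, j)" "i < n \<Longrightarrow> j < n \<Longrightarrow> LR $$ (i, j) = K $$ (i, n + j)"
    "i < n \<Longrightarrow> j < n \<Longrightarrow> RL $$ (i, j) = K $$ (n + i, j)" "i < n \<Longrightarrow> j < n \<Longrightarrow> RR $$ (i, j) = K $$ (n + i, n + j)"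
  by (auto simp: blkLL_def blkLR_def blkRL_def blkRR_def)

lemma K_herm: "i < 2 * n \<Longrightarrow> j < 2 * n \<Longrightarrow> K $$ (j, i) = cnj (K $$ (i, j))"
  using K unfolding pos_def_UNIV_iff by blast

lemma ip_blk:
  assumes "v \<in> carrier_vec n" "w \<in> carrier_vec n"
  shows "ip v (LL *\<^sub>v w) = ip (LL *\<^sub>v v) w" "ip v (LR *\<^sub>v w) = ip (RL *\<^sub>v v) w"
    "ip v (RL *\<^sub>v w) = ip (LR *\<^sub>v v) w" "ip v (RR *\<^sub>v w) = ip (RR *\<^sub>v v) w"
proof -
  note h = K_herm
  show "ip v (LL *\<^sub>v w) = ip (LL *\<^sub>v v) w"
    by (rule ip_adjoint[of _ n]) (auto simp: assms blk_nth intro!: h)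
  show "ip v (LR *\<^sub>v w) = ip (RL *\<^sub>v v) w"
    by (rule ip_adjoint[of _ n]) (auto simp: assms blk_nth intro!: h)
  show "ip v (RL *\<^sub>v w) = ip (LR *\<^sub>v v) w"
    by (rule ip_adjoint[of _ n]) (auto simp: assms blk_nth intro!: h)
  show "ip v (RR *\<^sub>v w) = ip (RR *\<^sub>v v) w"
    by (rule ip_adjoint[of _ n]) (auto simp: assms blk_nth intro!: h)
qed

definition pair_form :: "complex vec \<Rightarrow> complex vec \<Rightarrow> complex" where
  "pair_form v w = ip v (LL *\<^sub>v v + LR *\<^sub>v w) + ip w (RL *\<^sub>v v + RR *\<^sub>v w)"

lemma pair_form_coercive:
  obtains c where "c > 0" "\<And>v w. v \<in> carrier_vec n \<Longrightarrow> w \<in> carrier_vec n \<Longrightarrow>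
    c * ((\<Sum>i<n. (cmod (v $ i))\<^sup>2) + (\<Sum>i<n. (cmod (w $ i))\<^sup>2)) \<le> Re (pair_form v w)"
proof -
  interpret scalars UNIV by standard simp
  have Kc: "K \<in> carrier_mat (2 * n) (2 * n)" using K unfolding pos_def_UNIV_iff by blast
  have pos: "0 < Re (\<Sum>i<2 * n. \<Sum>j<2 * n. cnj (y i) * K $$ (i, j) * y j)" if "\<exists>i\<in>{..<2 * n}. y i \<noteq> 0" for y
  proof -
    let ?v = "vec (2 * n) y"
    have "?v \<noteq> 0\<^sub>v (2 * n)" using that by (metis index_vec index_zero_vec(1) lessThan_iff)
    then have "0 < Re (ip ?v (K *\<^sub>v ?v))" using K unfolding pos_def_UNIV_iff by (metis vec_carrier)
    also have "ip ?v (K *\<^sub>v ?v) = (\<Sum>i<2 * n. \<Sum>j<2 * n. cnj (y i) * K $$ (i, j) * y j)"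
      using Kc by (simp add: ip_def mult_mat_vec_nth sum_distrib_left mult.assoc del: index_mult_mat_vec)
    finally show ?thesis .
  qed
  obtain c where c: "c > 0" "\<And>y. c * (\<Sum>i<2 * n. (cmod (y i))\<^sup>2) \<le> Re (\<Sum>i<2 * n. \<Sum>j<2 * n. cnj (y i) * K $$ (i, j) * y j)"
    by (rule finite_form_coercive[of "{..<2 * n}" "\<lambda>i j. K $$ (i, j)"]) (use pos in auto)
  show thesis
  proof (rule that[OF c(1)])
    fix v w :: "complex vec" assume vw: "v \<in> carrier_vec n" "w \<in> carrier_vec n"
    let ?y = "\<lambda>i. if i < n then v $ i else w $ (i - n)"
    have sr: "(\<Sum>i<2 * n. (cmod (?y i))\<^sup>2) = (\<Sum>i<n. (cmod (v $ i))\<^sup>2) + (\<Sum>i<n. (cmod (w $ i))\<^sup>2)"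
      using sum_double[of "\<lambda>i. complex_of_real ((cmod (?y i))\<^sup>2)" n]
      by (simp only: of_real_sum[symmetric] of_real_add[symmetric] of_real_eq_iff) simp
    have "(\<Sum>i<2 * n. \<Sum>j<2 * n. cnj (?y i) * K $$ (i, j) * ?y j) = pair_form v w"
      unfolding sum_double pair_form_def using vw
      by (simp add: ip_def mult_mat_vec_nth[of _ n n] blk_nth sum_distrib_left sum.distrib distrib_left mult.assoc
          del: index_mult_mat_vec)
    then show "c * ((\<Sum>i<n. (cmod (v $ i))\<^sup>2) + (\<Sum>i<n. (cmod (w $ i))\<^sup>2)) \<le> Re (pair_form v w)"
      using c(2)[of ?y] by (simp only: sr)
  qed
qed

lemma LL_pos: "pos_def UNIV n LL"
  unfolding pos_def_UNIV_iff
proof (intro conjI allI ballI impI)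
  obtain c where c: "c > 0" "\<And>v w. v \<in> carrier_vec n \<Longrightarrow> w \<in> carrier_vec n \<Longrightarrow>
    c * ((\<Sum>i<n. (cmod (v $ i))\<^sup>2) + (\<Sum>i<n. (cmod (w $ i))\<^sup>2)) \<le> Re (pair_form v w)"
    using pair_form_coercive by blast
  fix v :: "complex vec" assume v: "v \<in> carrier_vec n" "v \<noteq> 0\<^sub>v n"
  then obtain i where i: "i < n" "v $ i \<noteq> 0" by (metis carrier_vecD eq_vecI index_zero_vec)
  have "(cmod (v $ i))\<^sup>2 \<le> (\<Sum>i<n. (cmod (v $ i))\<^sup>2)" using i by (intro member_le_sum) auto
  then have "0 < c * ((\<Sum>i<n. (cmod (v $ i))\<^sup>2) + (\<Sum>i<n. (cmod (0\<^sub>v n $ i))\<^sup>2))"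
    using c(1) i by (intro mult_pos_pos) (auto intro: less_le_trans[of 0 "(cmod (v $ i))\<^sup>2"])
  also have "\<dots> \<le> Re (pair_form v (0\<^sub>v n))" by (rule c(2)[OF v(1)]) auto
  also have "pair_form v (0\<^sub>v n) = ip v (LL *\<^sub>v v)"
    using v by (simp add: pair_form_def ip_def mult_mat_vec_nth[of _ n n] del: index_mult_mat_vec)
  finally show "0 < Re (ip v (LL *\<^sub>v v))" .
next
  fix i j assume ij: "i < n" "j < n"
  have "K $$ (j, i) = cnj (K $$ (i, j))" by (rule K_herm) (use ij in auto)
  then show "LL $$ (j, i) = cnj (LL $$ (i, j))" by (simp only: blk_nth(1)[OF ij] blk_nth(1)[OF ij(2) ij(1)])
qed (rule blk_carrier)

text \<open>The transfer matrix: if the R side of a row has a given value and everything beyond the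
  L side responds by G, equilibrium of the L side forces this value there. It is the candidate for
  the operator W.\<close>

definition step_mat :: "complex mat \<Rightarrow> complex mat" where
  "step_mat G = - (minv (G + LL) * LR)"

context
  fixes G assumes G: "riccati_L n K G"
begin

lemma G_pos: "pos_def UNIV n G"
  using G unfolding riccati_L_def by (rule conjunct1)

lemma G_carrier [simp]: "G \<in> carrier_mat n n"
  using G_pos unfolding pos_def_UNIV_iff by blast

lemma GLL_inv: "minv (G + LL) \<in> carrier_mat n n" "minv (G + LL) * (G + LL) = 1\<^sub>m n" "(G + LL) * minv (G + LL) = 1\<^sub>m n"
proof -
  have c: "G + LL \<in> carrier_mat n n" by simp
  note ker = pos_def_kernel[OF pos_def_add[OF G_pos LL_pos]]
  show "minv (G + LL) \<in> carrier_mat n n" by (rule minv_inverse(1)[OF c ker])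
  show "minv (G + LL) * (G + LL) = 1\<^sub>m n" by (rule minv_inverse(2)[OF c ker])
  show "(G + LL) * minv (G + LL) = 1\<^sub>m n" by (rule minv_inverse(3)[OF c ker])
qed

lemma step_mat_carrier [simp]: "step_mat G \<in> carrier_mat n n"
  unfolding step_mat_def uminus_carrier_iff_mat by (rule mult_carrier_mat[OF GLL_inv(1) blk_carrier(2)])

lemma step_mat_vec:
  assumes v: "v \<in> carrier_vec n"
  shows "step_mat G *\<^sub>v v = - (minv (G + LL) *\<^sub>v (LR *\<^sub>v v))"
proof -
  have "step_mat G *\<^sub>v v = - ((minv (G + LL) * LR) *\<^sub>v v)"
    unfolding step_mat_def
    by (rule uminus_mult_mat_vec) (use carrier_matD(2)[OF blk_carrier(2)] carrier_vecD[OF v] in simp)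
  then show ?thesis by (simp only: assoc_mult_mat_vec[OF GLL_inv(1) blk_carrier(2) v])
qed

lemma step_mat_unique:
  assumes "v \<in> carrier_vec n" "w \<in> carrier_vec n" "(G + LL) *\<^sub>v w = - (LR *\<^sub>v v)"
  shows "w = step_mat G *\<^sub>v v"
proof -
  have "w = (minv (G + LL) * (G + LL)) *\<^sub>v w" using assms by (simp add: GLL_inv)
  also have "\<dots> = minv (G + LL) *\<^sub>v (- (LR *\<^sub>v v))"
    using assms(3) by (simp add: assoc_mult_mat_vec[OF GLL_inv(1) _ assms(2)])
  also have "\<dots> = - (minv (G + LL) *\<^sub>v (LR *\<^sub>v v))"
    by (rule mult_uminus_vec[OF GLL_inv(1) mult_mat_vec_carrier[OF blk_carrier(2) assms(1)]])
  also have "\<dots> = step_mat G *\<^sub>v v" by (rule step_mat_vec[OF assms(1), symmetric])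
  finally show ?thesis .
qed

text \<open>Forces of one row along an orbit: on the L side the equation that defines the step, on
  the R side the Riccati equation.\<close>

lemma step_mat_eq:
  assumes v: "v \<in> carrier_vec n"
  shows "LL *\<^sub>v (step_mat G *\<^sub>v v) + LR *\<^sub>v v = - (G *\<^sub>v (step_mat G *\<^sub>v v))"
    "RL *\<^sub>v (step_mat G *\<^sub>v v) + RR *\<^sub>v v = G *\<^sub>v v"
proof -
  note P = step_mat_vec[OF v]
  note Pv = mult_mat_vec_carrier[OF step_mat_carrier v]
  note LRv = mult_mat_vec_carrier[OF blk_carrier(2) v]
  note mLRv = mult_mat_vec_carrier[OF GLL_inv(1) LRv]
  have GLL: "G + LL \<in> carrier_mat n n" by simp
  have "(G + LL) *\<^sub>v (step_mat G *\<^sub>v v) = - ((G + LL) *\<^sub>v (minv (G + LL) *\<^sub>v (LR *\<^sub>v v)))"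
    unfolding P by (rule mult_uminus_vec[OF GLL mLRv])
  also have "(G + LL) *\<^sub>v (minv (G + LL) *\<^sub>v (LR *\<^sub>v v)) = ((G + LL) * minv (G + LL)) *\<^sub>v (LR *\<^sub>v v)"
    by (rule assoc_mult_mat_vec[OF GLL GLL_inv(1) LRv, symmetric])
  also have "\<dots> = LR *\<^sub>v v" using LRv by (simp add: GLL_inv)
  finally have "G *\<^sub>v (step_mat G *\<^sub>v v) + LL *\<^sub>v (step_mat G *\<^sub>v v) = - (LR *\<^sub>v v)"
    by (simp only: add_mult_distrib_mat_vec[OF G_carrier blk_carrier(1) mult_mat_vec_carrier[OF step_mat_carrier v]])
  then show "LL *\<^sub>v (step_mat G *\<^sub>v v) + LR *\<^sub>v v = - (G *\<^sub>v (step_mat G *\<^sub>v v))"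
    by (rule vec_add_eq_uminus_rotate[OF mult_mat_vec_carrier[OF G_carrier Pv] mult_mat_vec_carrier[OF blk_carrier(1) Pv] LRv])
  have "G = RR - RL * minv (G + LL) * LR" using G unfolding riccati_L_def by blast
  then have "G *\<^sub>v v = (RR - RL * minv (G + LL) * LR) *\<^sub>v v" by (rule arg_cong)
  also have "\<dots> = RR *\<^sub>v v - (RL * minv (G + LL) * LR) *\<^sub>v v"
    by (rule minus_mult_distrib_mat_vec[OF blk_carrier(4) mult_carrier_mat[OF mult_carrier_mat[OF blk_carrier(3) GLL_inv(1)] blk_carrier(2)] v])
  also have "(RL * minv (G + LL) * LR) *\<^sub>v v = RL *\<^sub>v (minv (G + LL) *\<^sub>v (LR *\<^sub>v v))"
    by (simp only: assoc_mult_mat_vec[OF mult_carrier_mat[OF blk_carrier(3) GLL_inv(1)] blk_carrier(2) v]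
        assoc_mult_mat_vec[OF blk_carrier(3) GLL_inv(1) LRv])
  also have "RL *\<^sub>v (minv (G + LL) *\<^sub>v (LR *\<^sub>v v)) = - (RL *\<^sub>v (step_mat G *\<^sub>v v))"
    unfolding P mult_uminus_vec[OF blk_carrier(3) mLRv] by simp
  finally show "RL *\<^sub>v (step_mat G *\<^sub>v v) + RR *\<^sub>v v = G *\<^sub>v v"
    using v mult_mat_vec_carrier[OF step_mat_carrier v]
    by (intro eq_vecI) (auto simp: index_mult_mat_vec simp del: index_mult_mat_vec)
qed

lemma G_sym: "v \<in> carrier_vec n \<Longrightarrow> w \<in> carrier_vec n \<Longrightarrow> ip v (G *\<^sub>v w) = ip (G *\<^sub>v v) w"
  by (rule ip_adjoint[OF G_carrier G_carrier]) (use G_pos[unfolded pos_def_UNIV_iff] in blast)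

definition orbit :: "complex vec \<Rightarrow> nat \<Rightarrow> complex vec" where
  "orbit x m = ((\<lambda>v. step_mat G *\<^sub>v v) ^^ m) x"

lemma orbit_simps: "orbit x 0 = x" "orbit x (Suc m) = step_mat G *\<^sub>v orbit x m"
  by (simp_all add: orbit_def)

lemma orbit_carrier [simp]: "x \<in> carrier_vec n \<Longrightarrow> orbit x m \<in> carrier_vec n"
  by (induction m) (auto simp: orbit_simps intro: mult_mat_vec_carrier[OF step_mat_carrier])

text \<open>The energy of each row equals the loss of G-energy in that step. The G-energy decreases
  and is bounded below, so the losses tend to zero, and coercivity of the row passes this on to the
  vectors.\<close>

lemma orbit_tendsto_0:
  assumes x: "x \<in> carrier_vec n" and i: "i < n"
  shows "(\<lambda>m. orbit x m $ i) \<longlonglongrightarrow> 0"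
proof -
  obtain c where c: "c > 0" "\<And>v w. v \<in> carrier_vec n \<Longrightarrow> w \<in> carrier_vec n \<Longrightarrow>
    c * ((\<Sum>i<n. (cmod (v $ i))\<^sup>2) + (\<Sum>i<n. (cmod (w $ i))\<^sup>2)) \<le> Re (pair_form v w)"
    using pair_form_coercive by blast
  define e where "e m = Re (ip (orbit x m) (G *\<^sub>v orbit x m))" for m
  have e0: "0 \<le> e m" for m
  proof (cases "orbit x m = 0\<^sub>v n")
    case True
    then show ?thesis by (simp add: e_def ip_def carrier_matD(1)[OF G_carrier] del: index_mult_mat_vec)
  next
    case False
    then show ?thesis using G_pos x unfolding pos_def_UNIV_iff e_def by (simp add: less_imp_le)
  qed
  have step: "Re (pair_form (orbit x (Suc m)) (orbit x m)) = e m - e (Suc m)" for m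
  proof -
    have "pair_form (orbit x (Suc m)) (orbit x m) = ip (orbit x (Suc m)) (- (G *\<^sub>v orbit x (Suc m))) + ip (orbit x m) (G *\<^sub>v orbit x m)"
      using step_mat_eq[of "orbit x m"] x by (simp add: pair_form_def orbit_simps)
    also have "ip (orbit x (Suc m)) (- (G *\<^sub>v orbit x (Suc m))) = - ip (orbit x (Suc m)) (G *\<^sub>v orbit x (Suc m))"
      using x by (intro ip_uminus(1)[of _ n]) (auto intro: mult_mat_vec_carrier[OF G_carrier])
    finally show ?thesis by (simp add: e_def)
  qed
  have le: "c * (cmod (orbit x m $ i))\<^sup>2 \<le> e m - e (Suc m)" for m
  proof -
    have "(cmod (orbit x m $ i))\<^sup>2 \<le> (\<Sum>i<n. (cmod (orbit x m $ i))\<^sup>2)" using i by (intro member_le_sum) auto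
    also have "\<dots> \<le> (\<Sum>i<n. (cmod (orbit x (Suc m) $ i))\<^sup>2) + (\<Sum>i<n. (cmod (orbit x m $ i))\<^sup>2)"
      by (simp add: sum_nonneg)
    finally have "c * (cmod (orbit x m $ i))\<^sup>2 \<le> c * ((\<Sum>i<n. (cmod (orbit x (Suc m) $ i))\<^sup>2) + (\<Sum>i<n. (cmod (orbit x m $ i))\<^sup>2))"
      using c(1) by (intro mult_left_mono) auto
    also have "\<dots> \<le> e m - e (Suc m)" using c(2)[of "orbit x (Suc m)" "orbit x m"] x step by simp
    finally show ?thesis .
  qed
  have "e (Suc m) \<le> e m" for m
    using order_trans[OF mult_nonneg_nonneg le[of m]] c(1) by simp
  then have "decseq e" by (simp add: decseq_Suc_iff)
  then obtain l where "e \<longlonglongrightarrow> l" using decseq_convergent[of e 0] e0 by metis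
  then have "(\<lambda>m. e m - e (Suc m)) \<longlonglongrightarrow> l - l" by (intro tendsto_diff LIMSEQ_Suc)
  then have "(\<lambda>m. (e m - e (Suc m)) / c) \<longlonglongrightarrow> 0" using tendsto_divide_zero by force
  then have "(\<lambda>m. (cmod (orbit x m $ i))\<^sup>2) \<longlonglongrightarrow> 0"
    by (rule Lim_null_comparison[rotated]) (use le c(1) in \<open>auto simp: field_simps\<close>)
  from tendsto_real_sqrt[OF this] show ?thesis by (simp add: tendsto_norm_zero_iff)
qed

text \<open>Any solution of the chain equations that decays at infinity has its forces \<open>a\<close> given by \<open>G\<close>:
  the symplectic product with an orbit of \<open>step_mat G\<close> is constant along the chain and tends to zero.\<close>

lemma chain_force:
  assumes H: "\<And>m. H m \<in> carrier_vec n" and a: "\<And>m. a m \<in> carrier_vec n"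
    and top: "\<And>m. LL *\<^sub>v H (Suc m) + LR *\<^sub>v H m = - a (Suc m)"
    and bot: "\<And>m. RL *\<^sub>v H (Suc m) + RR *\<^sub>v H m = a m"
    and lim: "\<And>i. i < n \<Longrightarrow> (\<lambda>m. H m $ i) \<longlonglongrightarrow> 0"
  shows "a 0 = G *\<^sub>v H 0"
proof (rule ip_eqI[OF a])
  show "G *\<^sub>v H 0 \<in> carrier_vec n" by (rule mult_mat_vec_carrier[OF G_carrier H])
  fix x :: "complex vec" assume x: "x \<in> carrier_vec n"
  let ?x = "orbit x"
  note [simp] = H a orbit_carrier[OF x] mult_mat_vec_carrier[of _ n n]
  define \<omega> where "\<omega> m = ip (?x m) (a m) - ip (G *\<^sub>v ?x m) (H m)" for m
  have step: "\<omega> m = \<omega> (Suc m)" for m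
  proof -
    note pe = step_mat_eq[OF orbit_carrier[OF x, of m], folded orbit_simps]
    have "ip (?x (Suc m)) (- a (Suc m)) + ip (?x m) (a m) =
        ip (?x (Suc m)) (LL *\<^sub>v H (Suc m) + LR *\<^sub>v H m) + ip (?x m) (RL *\<^sub>v H (Suc m) + RR *\<^sub>v H m)"
      by (simp only: top bot)
    also have "\<dots> = ip (LL *\<^sub>v ?x (Suc m) + LR *\<^sub>v ?x m) (H (Suc m)) + ip (RL *\<^sub>v ?x (Suc m) + RR *\<^sub>v ?x m) (H m)"
      by (simp add: ip_add_right[of _ n] ip_add_left[of _ n] ip_blk)
    also have "\<dots> = ip (- (G *\<^sub>v ?x (Suc m))) (H (Suc m)) + ip (G *\<^sub>v ?x m) (H m)"
      by (simp only: pe)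
    finally show ?thesis by (simp add: \<omega>_def ip_uminus[of _ n] algebra_simps)
  qed
  have const: "\<omega> m = \<omega> 0" for m by (induction m) (simp_all add: step[symmetric])
  \<comment> \<open>The forces are linear in two consecutive vectors of the chain, so they decay
    with it.\<close>
  have a_lim: "(\<lambda>m. a m $ i) \<longlonglongrightarrow> 0" if i: "i < n" for i
  proof -
    have "a m $ i = (\<Sum>j<n. RL $$ (i, j) * H (Suc m) $ j) + (\<Sum>j<n. RR $$ (i, j) * H m $ j)" for m
      unfolding bot[symmetric] using i by (simp add: mult_mat_vec_nth[of _ n n] del: index_mult_mat_vec)
    moreover have "(\<lambda>m. (\<Sum>j<n. RL $$ (i, j) * H (Suc m) $ j) + (\<Sum>j<n. RR $$ (i, j) * H m $ j)) \<longlonglongrightarrow> 0"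
      by (rule tendsto_eq_intros tendsto_null_sum tendsto_mult_right_zero LIMSEQ_Suc lim refl | simp)+
    ultimately show ?thesis by simp
  qed
  have "\<omega> m = (\<Sum>i<n. cnj (?x m $ i) * a m $ i) - (\<Sum>i<n. cnj (\<Sum>j<n. G $$ (i, j) * ?x m $ j) * H m $ i)" for m
    by (simp add: \<omega>_def ip_def carrier_vecD[OF a] carrier_vecD[OF H] mult_mat_vec_nth[OF G_carrier orbit_carrier[OF x]]
        del: index_mult_mat_vec cnj_sum)
  moreover have "(\<lambda>m. (\<Sum>i<n. cnj (?x m $ i) * a m $ i) - (\<Sum>i<n. cnj (\<Sum>j<n. G $$ (i, j) * ?x m $ j) * H m $ i)) \<longlonglongrightarrow> 0 - 0"
  proof (intro tendsto_diff tendsto_null_sum)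
    fix i assume "i \<in> {..<n}"
    then have i: "i < n" by simp
    have x0: "(\<lambda>m. ?x m $ j) \<longlonglongrightarrow> 0" if "j < n" for j by (rule orbit_tendsto_0[OF x that])
    show "(\<lambda>m. cnj (?x m $ i) * a m $ i) \<longlonglongrightarrow> 0"
      using tendsto_mult[OF tendsto_cnj[OF x0[OF i]] a_lim[OF i]] by simp
    have "(\<lambda>m. \<Sum>j<n. G $$ (i, j) * ?x m $ j) \<longlonglongrightarrow> 0"
      by (rule tendsto_null_sum) (auto intro: tendsto_mult_right_zero x0)
    from tendsto_mult[OF tendsto_cnj[OF this] lim[OF i]]
    show "(\<lambda>m. cnj (\<Sum>j<n. G $$ (i, j) * ?x m $ j) * H m $ i) \<longlonglongrightarrow> 0" by simp
  qed
  ultimately have "(\<lambda>m. \<omega> m) \<longlonglongrightarrow> 0 - 0" by (simp only:)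
  then have "\<omega> \<longlonglongrightarrow> 0" by simp
  moreover have "\<omega> \<longlonglongrightarrow> \<omega> 0"
    by (rule tendsto_eventually, rule always_eventually, rule allI, rule const)
  ultimately have "\<omega> 0 = 0" using LIMSEQ_unique by blast
  then show "ip x (a 0) = ip x (G *\<^sub>v H 0)"
    by (simp add: \<omega>_def orbit_simps G_sym[OF x])
qed

text \<open>A kernel vector at |z| > 1 starts the decaying geometric chain z^-m v. By
  \<open>chain_force\<close> its forces are given by G, and G determines the step. On the kernel of
  \<open>LR\<close> the step equation has the solution 0.\<close>

lemma is_WL_step_mat: "is_WL n K (step_mat G)"
  unfolding is_WL_def
proof (intro conjI allI ballI impI)
  fix z v assume z: "1 < cmod z" and v: "v \<in> mat_kernel (phi n K z)"
  have z0: "z \<noteq> 0" using z by auto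
  have phi: "phi n K z \<in> carrier_mat n n" by (simp add: phi_def)
  then have vc: "v \<in> carrier_vec n" and ker: "phi n K z *\<^sub>v v = 0\<^sub>v n"
    using v by (auto simp: mat_kernel_def)
  note [simp] = vc mult_mat_vec_carrier[of _ n n]
  have ker': "LL *\<^sub>v v + RR *\<^sub>v v + z \<cdot>\<^sub>v (LR *\<^sub>v v) + inverse z \<cdot>\<^sub>v (RL *\<^sub>v v) = 0\<^sub>v n"
  proof (rule eq_vecI)
    fix i assume "i < dim_vec (0\<^sub>v n)"
    then have i: "i < n" by simp
    have "(phi n K z *\<^sub>v v) $ i = (\<Sum>j<n. phi n K z $$ (i, j) * v $ j)" by (rule mult_mat_vec_nth[OF phi vc i])
    also have "\<dots> = (\<Sum>j<n. LL $$ (i, j) * v $ j) + (\<Sum>j<n. RR $$ (i, j) * v $ j) +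
        z * (\<Sum>j<n. LR $$ (i, j) * v $ j) + inverse z * (\<Sum>j<n. RL $$ (i, j) * v $ j)"
      using i carrier_matD[OF blk_carrier(1)] carrier_matD[OF blk_carrier(2)] carrier_matD[OF blk_carrier(3)] carrier_matD[OF blk_carrier(4)]
      by (simp add: phi_def sum.distrib sum_distrib_left distrib_right mult.assoc)
    finally show "(LL *\<^sub>v v + RR *\<^sub>v v + z \<cdot>\<^sub>v (LR *\<^sub>v v) + inverse z \<cdot>\<^sub>v (RL *\<^sub>v v)) $ i = 0\<^sub>v n $ i"
      using i ker by (simp add: mult_mat_vec_nth[OF blk_carrier(1) vc i] mult_mat_vec_nth[OF blk_carrier(2) vc i]
          mult_mat_vec_nth[OF blk_carrier(3) vc i] mult_mat_vec_nth[OF blk_carrier(4) vc i] del: index_mult_mat_vec)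
  qed simp
  define H where "H m = inverse z ^ m \<cdot>\<^sub>v v" for m :: nat
  define a where "a m = RL *\<^sub>v H (Suc m) + RR *\<^sub>v H m" for m
  have Hc: "H m \<in> carrier_vec n" for m by (simp add: H_def)
  have mH: "A *\<^sub>v H m = inverse z ^ m \<cdot>\<^sub>v (A *\<^sub>v v)" if "A \<in> carrier_mat n n" for A m
    unfolding H_def using that by (simp add: mult_mat_vec[of _ n n])
  have top: "LL *\<^sub>v H (Suc m) + LR *\<^sub>v H m = - a (Suc m)" for m
  proof (rule eq_vecI)
    fix i assume i: "i < dim_vec (- a (Suc m))"
    then have i: "i < n" by (simp add: a_def)
    \<comment> \<open>The four block values at coordinate i. Multiplying the kernel equation by
      powers of 1/z gives the balance between consecutive rows.\<close>
    define l r s t where "l = (LL *\<^sub>v v) $ i" and "r = (RR *\<^sub>v v) $ i" and "s = (LR *\<^sub>v v) $ i" and "t = (RL *\<^sub>v v) $ i"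
    have "l + r + z * s + inverse z * t = 0"
      using arg_cong[OF ker', of "\<lambda>u. u $ i"] i unfolding l_def r_def s_def t_def
      by (simp del: index_mult_mat_vec)
    then have "inverse z * (l + r + z * s + inverse z * t) = 0" by simp
    moreover have "inverse z * (z * s) = s" using z0 by simp
    ultimately have "inverse z * l + inverse z * r + s + inverse z * (inverse z * t) = 0"
      by (simp only: distrib_left)
    then have "inverse z ^ m * (inverse z * l + inverse z * r + s + inverse z * (inverse z * t)) = 0" by simp
    then show "(LL *\<^sub>v H (Suc m) + LR *\<^sub>v H m) $ i = (- a (Suc m)) $ i"
      using i z0 unfolding a_def mH[OF blk_carrier(1)] mH[OF blk_carrier(2)] mH[OF blk_carrier(3)] mH[OF blk_carrier(4)]
      by (simp add: l_def[symmetric] r_def[symmetric] s_def[symmetric] t_def[symmetric] algebra_simps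
          eq_neg_iff_add_eq_0 del: index_mult_mat_vec)
  qed (simp add: a_def)
  have ac: "a m \<in> carrier_vec n" for m by (simp add: a_def Hc)
  have lim: "(\<lambda>m. H m $ i) \<longlonglongrightarrow> 0" if "i < n" for i
  proof -
    have "(\<lambda>m. inverse z ^ m) \<longlonglongrightarrow> 0"
      by (rule LIMSEQ_power_zero) (use z in \<open>simp add: norm_inverse inverse_less_1_iff\<close>)
    from tendsto_mult_left_zero[OF this, of "v $ i"] show ?thesis
      unfolding H_def by (subst index_smult_vec(1)) (simp_all only: carrier_vecD[OF vc] that)
  qed
  \<comment> \<open>The chain is started one row later, so that its first force together with the
    balance at row 0 becomes the step equation for v.\<close>
  have "a (Suc 0) = G *\<^sub>v H (Suc 0)"
    by (rule chain_force[of "\<lambda>m. H (Suc m)" "\<lambda>m. a (Suc m)", OF Hc ac top a_def[symmetric] lim[THEN LIMSEQ_Suc]])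
  then have "a 1 = G *\<^sub>v H 1" by simp
  moreover have "H 0 = v" by (simp add: H_def)
  ultimately have E: "LL *\<^sub>v H 1 + LR *\<^sub>v v = - (G *\<^sub>v H 1)" using top[of 0] by simp
  note c = mult_mat_vec_carrier[OF blk_carrier(1) Hc[of 1]] mult_mat_vec_carrier[OF blk_carrier(2) vc]
    mult_mat_vec_carrier[OF G_carrier Hc[of 1]]
  from vec_add_eq_uminus_rotate[OF c(2,3,1) vec_add_eq_uminus_rotate[OF c E]]
  have "(G + LL) *\<^sub>v H 1 = - (LR *\<^sub>v v)"
    by (simp only: add_mult_distrib_mat_vec[OF G_carrier blk_carrier(1) Hc])
  from step_mat_unique[OF vc Hc this] show "step_mat G *\<^sub>v v = inverse z \<cdot>\<^sub>v v" by (simp add: H_def)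
next
  fix v :: "complex vec" assume "v \<in> mat_kernel LR"
  then have "v \<in> carrier_vec n" "LR *\<^sub>v v = 0\<^sub>v n" using blk_carrier(2) by (auto simp: mat_kernel_def)
  then have "0\<^sub>v n = step_mat G *\<^sub>v v" by (intro step_mat_unique) auto
  then show "step_mat G *\<^sub>v v = 0\<^sub>v n" by simp
qed simp

end

text \<open>The orbit of one solution is a decaying chain whose forces are given by that solution;
  \<open>chain_force\<close> for the other solution compares the two at the start.\<close>

lemma riccati_L_unique:
  assumes G: "riccati_L n K G" and G': "riccati_L n K G'" shows "G = G'"
proof (rule mat_eq_multI[OF G_carrier[OF G] G_carrier[OF G']])
  fix x :: "complex vec" assume x: "x \<in> carrier_vec n"
  have "G' *\<^sub>v orbit G' x 0 = G *\<^sub>v orbit G' x 0"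
    by (rule chain_force[OF G, where a = "\<lambda>m. G' *\<^sub>v orbit G' x m"])
      (use x in \<open>auto simp: orbit_simps[OF G'] step_mat_eq[OF G'] orbit_carrier[OF G'] intro!: orbit_tendsto_0[OF G']
        mult_mat_vec_carrier[OF G_carrier[OF G']] mult_mat_vec_carrier[OF step_mat_carrier[OF G']]\<close>)
  then show "G *\<^sub>v x = G' *\<^sub>v x" by (simp add: orbit_simps[OF G'])
qed

text \<open>If the conditions determine W, it must be the transfer matrix of G, and the Riccati
  equation returns G; otherwise the description by the Riccati equation singles out G by
  uniqueness.\<close>

lemma G_L_eq:
  assumes G: "riccati_L n K G" shows "G_L n K = G"
proof (cases "\<exists>!W. is_WL n K W")
  case True
  then have "(THE W. is_WL n K W) = step_mat G" using is_WL_step_mat[OF G] by (intro the1_equality)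
  moreover have "RR + RL * step_mat G = G"
  proof (rule mat_eq_multI[of _ n n])
    fix v :: "complex vec" assume v: "v \<in> carrier_vec n"
    have "(RR + RL * step_mat G) *\<^sub>v v = RR *\<^sub>v v + RL *\<^sub>v (step_mat G *\<^sub>v v)"
      by (simp only: add_mult_distrib_mat_vec[OF blk_carrier(4) mult_carrier_mat[OF blk_carrier(3) step_mat_carrier[OF G]] v]
          assoc_mult_mat_vec[OF blk_carrier(3) step_mat_carrier[OF G] v])
    also have "\<dots> = RL *\<^sub>v (step_mat G *\<^sub>v v) + RR *\<^sub>v v"
      by (rule comm_add_vec[OF mult_mat_vec_carrier[OF blk_carrier(4) v]
            mult_mat_vec_carrier[OF blk_carrier(3) mult_mat_vec_carrier[OF step_mat_carrier[OF G] v]]])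
    finally show "(RR + RL * step_mat G) *\<^sub>v v = G *\<^sub>v v" using step_mat_eq(2)[OF G v] by simp
  qed (use step_mat_carrier[OF G] G_carrier[OF G] in auto)
  ultimately show ?thesis using True by (simp add: G_L_def)
next
  case False
  then show ?thesis
    using G riccati_L_unique by (auto simp: G_L_def intro!: the_equality)
qed

end

section \<open>Existence for the Riccati equation\<close>

text \<open>The fixed point equation of the Southern half-strip, kept in weak form with the cut
  variable visible: the Riccati equation is read off by testing on the cut and on the
  boundary.\<close>

lemma (in lattice) dtn_Neg_step:
  assumes q: "q = face_kernel n1 n2 Q" and x: "x \<in> \<L> (shape n1 n2 Unit Neg)"
  obtains X where "X \<in> \<L> (shape n1 n2 Unit Neg \<union> {Cut} \<times> {0} \<times> {..<n1})"
    "\<And>i. i \<in> shape n1 n2 Unit Neg \<Longrightarrow> X i = x i"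
    "\<And>Z. Z \<in> \<L> (shape n1 n2 Unit Neg \<union> {Cut} \<times> {0} \<times> {..<n1}) \<Longrightarrow> l2_inner Z (dtn Unit Neg x) =
       l2_inner (pull (vplace North (-1)) (shape n1 n2 Unit Neg) Z)
         (dtn Unit Neg (pull (vplace North (-1)) (shape n1 n2 Unit Neg) X)) +
       l2_inner (pull (vplace South (-1)) (shape n1 n2 Unit Unit) Z)
         (face_op \<K> n1 n2 Q (pull (vplace South (-1)) (shape n1 n2 Unit Unit) X))"
proof -
  define J where "J = vplace North (-1) ` shape n1 n2 Unit Neg \<union> vplace South (-1) ` shape n1 n2 Unit Unit"
  define V where "V = {a \<in> J. fst a = Cut}"
  have lab: "J - V = shape n1 n2 Unit Neg" "V = {Cut} \<times> positions Unit \<times> {..<n1}"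
    using vglue_labels[where v = Neg and c = "-1", OF _ J_def V_def] by auto
  then have J': "J = shape n1 n2 Unit Neg \<union> {Cut} \<times> {0} \<times> {..<n1}" using V_def by auto
  have G: "glue \<K> (vplace North (-1)) (shape n1 n2 Unit Neg) (dtn Unit Neg) (vplace South (-1)) (shape n1 n2 Unit Unit) (dtn Unit Unit) = dtn Unit Neg"
    using vglue_dtn[of Neg Unit Neg "-1" "-1" "-1" Unit] by (simp add: vglue_def)
  show thesis
    by (rule glue_weakE[OF inj_vplace inj_vplace dtn_coer dtn_coer J_def V_def, unfolded lab(1) G, OF x];
        rule that; simp only: J'[symmetric] face_op_eq_dtn[OF q])
qed

text \<open>A positive definite \<open>2n \<times> 2n\<close> matrix is a face operator with trivial vertical sides; the
  operator of its Southern half-strip solves the Riccati equation.\<close>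

lemma pos_pair_riccati:
  assumes K: "pos_def UNIV (2 * n) K"
  obtains G where "riccati_L n K G"
proof -
  interpret pos_pair n K by standard (rule K)
  have face: "face_operator UNIV n 0 K" using K by (simp add: face_operator_def)
  interpret lattice UNIV n 0 "face_kernel n 0 K" "{South, North} \<times> {..<n} \<union> {West, East} \<times> {..<0}"
    by (rule lattice_face_operator[OF _ face]) simp_all
  let ?S = "shape n 0 Unit Neg" and ?D = "dtn Unit Neg" and ?l = "\<lambda>j. (North, 0, j) :: label"
  have S: "?S = {North} \<times> {0} \<times> {..<n}" by (auto simp: shape_def)
  have finS: "finite ?S" unfolding S by simp
  \<comment> \<open>Vectors of dimension n are the boundary values on the North side, which is the
    whole boundary when there are no vertical coordinates.\<close>
  define bd where "bd v = (\<lambda>(e, k, j). if e = North \<and> k = (0 :: int) \<and> j < n then v $ j else 0 :: complex)" for v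
  have bd_simp: "bd v (?l j) = v $ j" if "j < n" for v j using that by (simp add: bd_def)
  have bd0: "bd v a = 0" if "a \<notin> ?S" for v a using that unfolding S bd_def by (auto split: prod.splits)
  have L: "f \<in> \<L> ?S" if "\<And>a. a \<notin> ?S \<Longrightarrow> f a = 0" for f :: "label \<Rightarrow> complex"
    using that l2_finite_support[OF finS] by (auto simp: l2_space_iff)
  have bdL: "bd v \<in> \<L> ?S" for v by (rule L[OF bd0])
  have inner: "l2_inner f g = (\<Sum>j<n. cnj (f (?l j)) * g (?l j))" if "g \<in> \<L> ?S" for f g
  proof -
    have "l2_inner f g = (\<Sum>\<^sub>\<infinity>a\<in>?S. cnj (f a) * g a)"
      unfolding l2_inner_def by (rule infsum_cong_neutral) (use that in \<open>auto simp: l2_space_iff\<close>)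
    also have "\<dots> = (\<Sum>a\<in>?S. cnj (f a) * g a)" using finS by simp
    also have "?S = ?l ` {..<n}" unfolding S by auto
    finally show ?thesis by (simp add: sum.reindex inj_on_def)
  qed
  define G where "G = mat n n (\<lambda>(i, j). ?D (bd (unit_vec n j)) (?l i))"
  have Gc: "G \<in> carrier_mat n n" by (simp add: G_def)
  have DL: "?D f \<in> \<L> ?S" if "f \<in> \<L> ?S" for f by (rule coer_closed[OF dtn_coer that])
  have D_sum: "?D (\<lambda>a. \<Sum>j\<in>A. c j * f j a) = (\<lambda>a. \<Sum>j\<in>A. c j * ?D (f j) a) \<and> (\<lambda>a. \<Sum>j\<in>A. c j * f j a) \<in> \<L> ?S"
    if "finite A" "\<And>j. f j \<in> \<L> ?S" for A and c :: "nat \<Rightarrow> complex" and f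
    using that(1)
  proof (induction A rule: finite_induct)
    case empty
    then show ?case by (simp add: coer_zero[OF dtn_coer])
  next
    case (insert j A)
    have c: "(\<lambda>a. c j * f j a) \<in> \<L> ?S" by (rule L_cmult[OF _ that(2)]) simp
    show ?case
      using insert coer_add[OF dtn_coer c, of "\<lambda>a. \<Sum>j\<in>A. c j * f j a"] coer_cmult[OF dtn_coer _ that(2), of "c j"]
        L_add[OF c, of "\<lambda>a. \<Sum>j\<in>A. c j * f j a"] by simp
  qed
  have DG: "?D (bd v) (?l i) = (G *\<^sub>v v) $ i" if v: "v \<in> carrier_vec n" and i: "i < n" for v i
  proof -
    have "bd v a = (\<Sum>j<n. v $ j * bd (unit_vec n j) a)" for a
    proof (cases "a \<in> ?S")
      case True
      then obtain k where k: "k < n" "a = ?l k" unfolding S by auto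
      have "(\<Sum>j<n. v $ j * bd (unit_vec n j) a) = (\<Sum>j<n. if j = k then v $ j else 0)"
        using k by (intro sum.cong) (auto simp: bd_simp)
      then show ?thesis using k by (simp add: bd_simp)
    qed (simp add: bd0)
    then have "bd v = (\<lambda>a. \<Sum>j<n. v $ j * bd (unit_vec n j) a)" by blast
    then have "?D (bd v) = (\<lambda>a. \<Sum>j<n. v $ j * ?D (bd (unit_vec n j)) a)"
      using D_sum[of "{..<n}" "\<lambda>j. bd (unit_vec n j)" "\<lambda>j. v $ j"] bdL by simp
    moreover have "G $$ (i, j) = ?D (bd (unit_vec n j)) (?l i)" if "j < n" for j using that i by (simp add: G_def)
    ultimately show ?thesis by (simp add: mult_mat_vec_nth[OF Gc v i] mult.commute)
  qed
  have ipD: "l2_inner (bd v) (?D (bd w)) = ip v (G *\<^sub>v w)" if "v \<in> carrier_vec n" "w \<in> carrier_vec n" for v w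
    unfolding inner[OF DL[OF bdL]] using that Gc by (simp add: ip_def bd_simp DG del: index_mult_mat_vec)
  have Gpos: "pos_def UNIV n G"
    unfolding pos_def_UNIV_iff
  proof (intro conjI allI ballI impI Gc)
    fix i j assume ij: "i < n" "j < n"
    have ent: "l2_inner (bd (unit_vec n a)) (?D (bd (unit_vec n b))) = G $$ (a, b)" if ab: "a < n" "b < n" for a b
    proof -
      have "l2_inner (bd (unit_vec n a)) (?D (bd (unit_vec n b))) = (\<Sum>k<n. if k = a then ?D (bd (unit_vec n b)) (?l k) else 0)"
        unfolding inner[OF DL[OF bdL]] using ab by (intro sum.cong) (auto simp: bd_simp)
      then show ?thesis using ab by (simp add: G_def)
    qed
    have "l2_inner (bd (unit_vec n j)) (?D (bd (unit_vec n i))) = l2_inner (?D (bd (unit_vec n j))) (bd (unit_vec n i))"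
      by (rule coer_sym[OF dtn_coer bdL bdL])
    also have "\<dots> = cnj (l2_inner (bd (unit_vec n i)) (?D (bd (unit_vec n j))))" by (rule l2_inner_commute)
    finally show "G $$ (j, i) = cnj (G $$ (i, j))" using ij by (simp only: ent)
  next
    fix v :: "complex vec" assume v: "v \<in> carrier_vec n" "v \<noteq> 0\<^sub>v n"
    obtain c where c: "c > 0" "\<And>x. x \<in> \<L> ?S \<Longrightarrow> c * (l2_norm x)\<^sup>2 \<le> Re (l2_inner x (?D x))"
      using coer_inner_pos[OF dtn_coer] by blast
    obtain i where i: "i < n" "v $ i \<noteq> 0" using v by (metis carrier_vecD eq_vecI index_zero_vec)
    have "cmod (v $ i) \<le> l2_norm (bd v)"
      using norm_le_l2_norm[OF l2_spaceD[OF bdL], of v "?l i"] bd_simp[OF i(1)] by simp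
    then have "0 < l2_norm (bd v)" using i(2) by (meson less_le_trans zero_less_norm_iff)
    then have "0 < c * (l2_norm (bd v))\<^sup>2" using c(1) by simp
    also have "\<dots> \<le> Re (l2_inner (bd v) (?D (bd v)))" by (rule c(2)[OF bdL])
    finally show "0 < Re (ip v (G *\<^sub>v v))" by (simp only: ipD[OF v(1) v(1)])
  qed
  have GLLc: "G + LL \<in> carrier_mat n n" using Gc by simp
  have GLL: "minv (G + LL) \<in> carrier_mat n n" "minv (G + LL) * (G + LL) = 1\<^sub>m n"
    by (rule minv_inverse[OF GLLc pos_def_kernel[OF pos_def_add[OF Gpos LL_pos]]]; assumption)+
  have step: "\<exists>w \<in> carrier_vec n. (G + LL) *\<^sub>v w = - (LR *\<^sub>v v) \<and> G *\<^sub>v v = RL *\<^sub>v w + RR *\<^sub>v v"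
    if v: "v \<in> carrier_vec n" for v
  proof -
    let ?J = "?S \<union> {Cut} \<times> {0} \<times> {..<n}"
    obtain X where X: "X \<in> \<L> ?J" "\<And>i. i \<in> ?S \<Longrightarrow> X i = bd v i"
      "\<And>Z. Z \<in> \<L> ?J \<Longrightarrow> l2_inner Z (?D (bd v)) =
       l2_inner (pull (vplace North (-1)) ?S Z) (?D (pull (vplace North (-1)) ?S X)) +
       l2_inner (pull (vplace South (-1)) (shape n 0 Unit Unit) Z)
         (face_op UNIV n 0 K (pull (vplace South (-1)) (shape n 0 Unit Unit) X))"
      using dtn_Neg_step[OF refl bdL[of v]] by blast
    \<comment> \<open>The equilibrium value on the cut, which will be the transfer of v.\<close>
    define w where "w = vec n (\<lambda>j. X (Cut, 0, j))"
    have w: "w \<in> carrier_vec n" by (simp add: w_def)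
    let ?U = "shape n 0 Unit Unit"
    have U: "?U = {South, North} \<times> {0} \<times> {..<n}" by (auto simp: shape_def)
    have pN: "pull (vplace North (-1)) ?S X = bd w"
      using bd0 by (auto simp: pull_def restr_def S w_def bd_def fun_eq_iff)
    define Y where "Y = pull (vplace South (-1)) ?U X"
    have YS: "Y (South, 0, j) = w $ j" and YN: "Y (North, 0, j) = v $ j" if "j < n" for j
      using that X(2)[of "?l j"] by (auto simp: Y_def pull_def restr_def U w_def S bd_simp)
    have YL: "Y \<in> \<L> ?U" unfolding Y_def by (rule pull_L[OF inj_vplace X(1)])
    have sumU: "(\<Sum>a\<in>?U. f a) = (\<Sum>j<n. f (South, 0, j)) + (\<Sum>j<n. f (North, 0, j))" for f :: "label \<Rightarrow> complex"
    proof -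
      have "?U = (\<lambda>j. (South, 0, j)) ` {..<n} \<union> (\<lambda>j. (North, 0, j)) ` {..<n}" unfolding U by auto
      then show ?thesis by (simp only:) (subst sum.union_disjoint; auto simp: sum.reindex inj_on_def)
    qed
    have face_val: "face_op UNIV n 0 K Y (South, 0, i) = (LL *\<^sub>v w) $ i + (LR *\<^sub>v v) $ i"
      "face_op UNIV n 0 K Y (North, 0, i) = (RL *\<^sub>v w) $ i + (RR *\<^sub>v v) $ i" if i: "i < n" for i
    proof -
      have e: "face_op UNIV n 0 K Y (e, 0, i) = (\<Sum>b\<in>?U. K $$ (fst (sec n 0 e) + i, (\<lambda>(e, k, j). fst (sec n 0 e) + j) b) * Y b)"
        if "e \<in> {South, North}" for e
        using that i YL by (simp add: face_op_def on_l2_def Let_def restr_def U)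
      show "face_op UNIV n 0 K Y (South, 0, i) = (LL *\<^sub>v w) $ i + (LR *\<^sub>v v) $ i"
        using i by (simp add: e sumU YS YN mult_mat_vec_nth[OF blk_carrier(1) w i] mult_mat_vec_nth[OF blk_carrier(2) v i] blk_nth
            del: index_mult_mat_vec)
      show "face_op UNIV n 0 K Y (North, 0, i) = (RL *\<^sub>v w) $ i + (RR *\<^sub>v v) $ i"
        using i by (simp add: e sumU YS YN mult_mat_vec_nth[OF blk_carrier(3) w i] mult_mat_vec_nth[OF blk_carrier(4) v i] blk_nth
            del: index_mult_mat_vec)
    qed
    have FL: "face_op UNIV n 0 K Y \<in> \<L> ?U"
      unfolding face_op_eq_dtn[OF refl] by (rule coer_closed[OF dtn_coer YL])
    have innerU: "l2_inner f (face_op UNIV n 0 K Y) = (\<Sum>j<n. cnj (f (South, 0, j)) * face_op UNIV n 0 K Y (South, 0, j)) +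
        (\<Sum>j<n. cnj (f (North, 0, j)) * face_op UNIV n 0 K Y (North, 0, j))" for f
    proof -
      have "l2_inner f (face_op UNIV n 0 K Y) = (\<Sum>\<^sub>\<infinity>a\<in>?U. cnj (f a) * face_op UNIV n 0 K Y a)"
        unfolding l2_inner_def by (rule infsum_cong_neutral) (use FL in \<open>auto simp: l2_space_iff\<close>)
      also have "\<dots> = (\<Sum>a\<in>?U. cnj (f a) * face_op UNIV n 0 K Y a)" unfolding U by simp
      finally show ?thesis by (simp only: sumU)
    qed
    have test: "(\<Sum>j<n. cnj (Z (?l j)) * ?D (bd v) (?l j)) =
        (\<Sum>j<n. cnj (Z (Cut, 0, j)) * ?D (bd w) (?l j)) +
        ((\<Sum>j<n. cnj (Z (Cut, 0, j)) * face_op UNIV n 0 K Y (South, 0, j)) +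
         (\<Sum>j<n. cnj (Z (?l j)) * face_op UNIV n 0 K Y (North, 0, j)))" if Z: "Z \<in> \<L> ?J" for Z
    proof -
      have "l2_inner Z (?D (bd v)) = (\<Sum>j<n. cnj (Z (?l j)) * ?D (bd v) (?l j))"
        by (rule inner[OF DL[OF bdL]])
      moreover have "l2_inner (pull (vplace North (-1)) ?S Z) (?D (bd w)) = (\<Sum>j<n. cnj (Z (Cut, 0, j)) * ?D (bd w) (?l j))"
        unfolding inner[OF DL[OF bdL]] by (intro sum.cong refl) (simp add: pull_def restr_def S)
      moreover have "l2_inner (pull (vplace South (-1)) ?U Z) (face_op UNIV n 0 K Y) =
         (\<Sum>j<n. cnj (Z (Cut, 0, j)) * face_op UNIV n 0 K Y (South, 0, j)) +
         (\<Sum>j<n. cnj (Z (?l j)) * face_op UNIV n 0 K Y (North, 0, j))"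
        unfolding innerU by (intro arg_cong2[where f = "(+)"] sum.cong refl) (simp_all add: pull_def restr_def U)
      ultimately show ?thesis using X(3)[OF Z] unfolding pN Y_def[symmetric] by simp
    qed
    \<comment> \<open>Point masses on the cut give the balance there, point masses on the boundary
      give the force; these are the two equations of the claim.\<close>
    have delta: "(\<lambda>a. if a = b then 1 else 0 :: complex) \<in> \<L> ?J" if "b \<in> ?J" for b
    proof -
      have "l2 (\<lambda>a. if a = b then 1 else 0 :: complex)" by (rule l2_finite_support[of "{b}"]) auto
      then show ?thesis using that by (auto simp: l2_space_iff)
    qed
    have "(G + LL) *\<^sub>v w = - (LR *\<^sub>v v)"
    proof (rule eq_vecI)
      fix i assume "i < dim_vec (- (LR *\<^sub>v v))"
      then have i: "i < n" by simp
      have "0 = ?D (bd w) (?l i) + face_op UNIV n 0 K Y (South, 0, i)"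
        using test[OF delta[of "(Cut, 0, i)"]] i by (simp add: if_distrib[of cnj] if_distrib[of "\<lambda>x. x * _"] cong: if_cong)
      then have "(G *\<^sub>v w) $ i + (LL *\<^sub>v w) $ i = - ((LR *\<^sub>v v) $ i)"
        unfolding DG[OF w i] face_val(1)[OF i] by (simp add: eq_neg_iff_add_eq_0 add_ac del: index_mult_mat_vec)
      then show "((G + LL) *\<^sub>v w) $ i = (- (LR *\<^sub>v v)) $ i"
        unfolding add_mult_distrib_mat_vec[OF Gc blk_carrier(1) w] using i Gc by (simp del: index_mult_mat_vec)
    qed (use Gc in simp)
    moreover have "G *\<^sub>v v = RL *\<^sub>v w + RR *\<^sub>v v"
    proof (rule eq_vecI)
      fix i assume "i < dim_vec (RL *\<^sub>v w + RR *\<^sub>v v)"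
      then have i: "i < n" by simp
      have "?D (bd v) (?l i) = face_op UNIV n 0 K Y (North, 0, i)"
        using test[OF delta[of "?l i"]] i by (simp add: S if_distrib[of cnj] if_distrib[of "\<lambda>x. x * _"] cong: if_cong)
      then show "(G *\<^sub>v v) $ i = (RL *\<^sub>v w + RR *\<^sub>v v) $ i"
        unfolding DG[OF v i] face_val(2)[OF i] using i by (simp del: index_mult_mat_vec)
    qed (use Gc in simp)
    ultimately show ?thesis using w by blast
  qed
  have "G = RR - RL * minv (G + LL) * LR"
  proof (rule mat_eq_multI[of _ n n])
    note Rc = mult_carrier_mat[OF mult_carrier_mat[OF blk_carrier(3) GLL(1)] blk_carrier(2)]
    show "RR - RL * minv (G + LL) * LR \<in> carrier_mat n n" by (rule minus_carrier_mat[OF Rc])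
    fix v :: "complex vec" assume v: "v \<in> carrier_vec n"
    obtain w where w: "w \<in> carrier_vec n" "(G + LL) *\<^sub>v w = - (LR *\<^sub>v v)" "G *\<^sub>v v = RL *\<^sub>v w + RR *\<^sub>v v"
      using step[OF v] by blast
    note LRv = mult_mat_vec_carrier[OF blk_carrier(2) v]
    note mLRv = mult_mat_vec_carrier[OF GLL(1) LRv]
    have "w = (minv (G + LL) * (G + LL)) *\<^sub>v w" using w(1) by (simp add: GLL)
    also have "\<dots> = minv (G + LL) *\<^sub>v ((G + LL) *\<^sub>v w)" by (rule assoc_mult_mat_vec[OF GLL(1) GLLc w(1)])
    also have "\<dots> = - (minv (G + LL) *\<^sub>v (LR *\<^sub>v v))"
      unfolding w(2) using GLL(1) LRv by (intro eq_vecI) auto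
    finally have wv: "w = - (minv (G + LL) *\<^sub>v (LR *\<^sub>v v))" .
    have RLw: "RL *\<^sub>v w = - (RL *\<^sub>v (minv (G + LL) *\<^sub>v (LR *\<^sub>v v)))"
      unfolding wv by (rule mult_uminus_vec[OF blk_carrier(3) mLRv])
    have "(RR - RL * minv (G + LL) * LR) *\<^sub>v v = RR *\<^sub>v v - RL *\<^sub>v (minv (G + LL) *\<^sub>v (LR *\<^sub>v v))"
      unfolding minus_mult_distrib_mat_vec[OF blk_carrier(4) Rc v]
        assoc_mult_mat_vec[OF mult_carrier_mat[OF blk_carrier(3) GLL(1)] blk_carrier(2) v]
        assoc_mult_mat_vec[OF blk_carrier(3) GLL(1) LRv] ..
    also have "\<dots> = RL *\<^sub>v w + RR *\<^sub>v v"
      unfolding RLw using v mLRv by (intro eq_vecI) (auto simp del: index_mult_mat_vec)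
    finally show "G *\<^sub>v v = (RR - RL * minv (G + LL) * LR) *\<^sub>v v" using w(3) by simp
  qed (rule Gc)
  then show thesis using that Gpos unfolding riccati_L_def by blast
qed

lemma riccati_G_L:
  assumes "pos_def UNIV (2 * n) K" shows "riccati_L n K (G_L n K)"
proof -
  interpret pos_pair n K by standard (rule assms)
  obtain G where "riccati_L n K G" using pos_pair_riccati[OF assms] by blast
  then show ?thesis using G_L_eq by simp
qed

section \<open>Exchange of the two sides\<close>

definition swap_pair :: "nat \<Rightarrow> complex mat \<Rightarrow> complex mat" where
  "swap_pair n K = four_block_mat (blkRR n K) (blkRL n K) (blkLR n K) (blkLL n K)"

lemma blk_swap_pair:
  "blkLL n (swap_pair n K) = blkRR n K" "blkLR n (swap_pair n K) = blkRL n K"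
  "blkRL n (swap_pair n K) = blkLR n K" "blkRR n (swap_pair n K) = blkLL n K"
  by (rule eq_matI; auto simp: swap_pair_def blkLL_def blkLR_def blkRL_def blkRR_def)+

text \<open>Exchanging the sides replaces z by its inverse in \<open>phi\<close>, so roots inside
  the disc become roots outside and the condition for R becomes the one for L.\<close>

lemma is_WR_swap_pair: "is_WR n K W \<longleftrightarrow> is_WL n (swap_pair n K) W"
proof -
  have phi: "phi n (swap_pair n K) z = phi n K (inverse z)" for z
    unfolding phi_def blk_swap_pair
    by (rule eq_matI) (auto simp: blkLL_def blkLR_def blkRL_def blkRR_def)
  have "(\<forall>z. z \<noteq> 0 \<and> cmod z < 1 \<longrightarrow> (\<forall>v \<in> mat_kernel (phi n K z). W *\<^sub>v v = z \<cdot>\<^sub>v v)) \<longleftrightarrow>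
    (\<forall>z. 1 < cmod z \<longrightarrow> (\<forall>v \<in> mat_kernel (phi n K (inverse z)). W *\<^sub>v v = inverse z \<cdot>\<^sub>v v))" (is "?L \<longleftrightarrow> ?R")
  proof
    assume L: ?L
    show ?R
    proof (intro allI impI)
      fix z assume z: "1 < cmod z"
      then have "z \<noteq> 0" by auto
      moreover have "cmod (inverse z) < 1" using z by (simp add: norm_inverse inverse_less_1_iff)
      ultimately show "\<forall>v \<in> mat_kernel (phi n K (inverse z)). W *\<^sub>v v = inverse z \<cdot>\<^sub>v v" using L by auto
    qed
  next
    assume R: ?R
    show ?L
    proof (intro allI impI)
      fix z assume z: "z \<noteq> 0 \<and> cmod z < 1"
      then have "1 < cmod (inverse z)" by (simp add: norm_inverse one_less_inverse_iff)
      with R have "\<forall>v \<in> mat_kernel (phi n K (inverse (inverse z))). W *\<^sub>v v = inverse (inverse z) \<cdot>\<^sub>v v" by blast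
      then show "\<forall>v \<in> mat_kernel (phi n K z). W *\<^sub>v v = z \<cdot>\<^sub>v v" by simp
    qed
  qed
  then show ?thesis by (simp add: is_WR_def is_WL_def phi blk_swap_pair)
qed

lemma G_R_eq_G_L: "G_R n K = G_L n (swap_pair n K)"
proof -
  have "is_WR n K = is_WL n (swap_pair n K)" by (rule ext) (rule is_WR_swap_pair)
  moreover have "riccati_R n K = riccati_L n (swap_pair n K)"
    by (rule ext) (simp only: riccati_R_def riccati_L_def blk_swap_pair)
  ultimately show ?thesis by (simp only: G_R_def G_L_def blk_swap_pair)
qed

section \<open>Rows of faces with quasi-periodic vertical edges\<close>

text \<open>The strip functions contain an inverse; applied to a vector, it is replaced here by a
  solution v of the eliminated equations.\<close>

lemma schur_mat_vec:
  fixes A B C \<Phi> :: "complex mat"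
  assumes A: "A \<in> carrier_mat m m" and B: "B \<in> carrier_mat m n" and C: "C \<in> carrier_mat n m"
    and \<Phi>: "\<Phi> \<in> carrier_mat n n" "\<And>v. v \<in> carrier_vec n \<Longrightarrow> v \<noteq> 0\<^sub>v n \<Longrightarrow> \<Phi> *\<^sub>v v \<noteq> 0\<^sub>v n"
    and x: "x \<in> carrier_vec m" and v: "v \<in> carrier_vec n" and eq: "\<Phi> *\<^sub>v v = - (C *\<^sub>v x)"
  shows "(A - B * minv \<Phi> * C) *\<^sub>v x = A *\<^sub>v x + B *\<^sub>v v"
proof -
  note inv = minv_inverse[OF \<Phi>(1)]
  have inv: "minv \<Phi> \<in> carrier_mat n n" "minv \<Phi> * \<Phi> = 1\<^sub>m n" by (rule inv, rule \<Phi>(2), assumption+)+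
  note Cx = mult_mat_vec_carrier[OF C x]
  note mCx = mult_mat_vec_carrier[OF inv(1) Cx]
  note Bm = mult_carrier_mat[OF B inv(1)]
  have "v = (minv \<Phi> * \<Phi>) *\<^sub>v v" using v by (simp add: inv)
  also have "\<dots> = minv \<Phi> *\<^sub>v (\<Phi> *\<^sub>v v)" by (rule assoc_mult_mat_vec[OF inv(1) \<Phi>(1) v])
  also have "\<dots> = - (minv \<Phi> *\<^sub>v (C *\<^sub>v x))" unfolding eq by (rule mult_uminus_vec[OF inv(1) Cx])
  finally have "B *\<^sub>v v = B *\<^sub>v - (minv \<Phi> *\<^sub>v (C *\<^sub>v x))" by (rule arg_cong)
  also have "\<dots> = - (B *\<^sub>v (minv \<Phi> *\<^sub>v (C *\<^sub>v x)))" by (rule mult_uminus_vec[OF B mCx])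
  finally have Bv: "B *\<^sub>v v = - (B *\<^sub>v (minv \<Phi> *\<^sub>v (C *\<^sub>v x)))" .
  have "(A - B * minv \<Phi> * C) *\<^sub>v x = A *\<^sub>v x - B *\<^sub>v (minv \<Phi> *\<^sub>v (C *\<^sub>v x))"
    unfolding minus_mult_distrib_mat_vec[OF A mult_carrier_mat[OF Bm C] x] assoc_mult_mat_vec[OF Bm C x]
      assoc_mult_mat_vec[OF B inv(1) Cx] ..
  also have "\<dots> = A *\<^sub>v x + B *\<^sub>v v"
    unfolding Bv using mult_mat_vec_carrier[OF A x] mult_mat_vec_carrier[OF B mCx]
    by (intro eq_vecI) (auto simp del: index_mult_mat_vec)
  finally show ?thesis .
qed

section \<open>One row of faces and its strip function\<close>

context lattice
begin

text \<open>Fourier transforms are complex even for real scalars. For a real kernel the real part of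
  the form splits into the forms of the real and the imaginary part of y, the mixed terms being
  imaginary.\<close>

lemma q_pos_complex:
  assumes nz: "\<exists>a\<in>loc. y a \<noteq> 0"
  shows "0 < Re (\<Sum>a\<in>loc. \<Sum>b\<in>loc. cnj (y a) * q a b * y b)"
proof (cases "\<K> = UNIV")
  case True
  then show ?thesis using q_pos[OF _ nz] by simp
next
  case False
  then have K: "\<K> = \<real>" using scalars by blast
  let ?f = "\<lambda>y. Re (\<Sum>a\<in>loc. \<Sum>b\<in>loc. cnj (y a) * q a b * y b)"
  let ?R = "\<lambda>a. complex_of_real (Re (y a))" and ?I = "\<lambda>a. complex_of_real (Im (y a))"
  have nn: "0 \<le> ?f z" if "\<And>a. z a \<in> \<real>" for z
    using q_pos[of z] that by (cases "\<exists>a\<in>loc. z a \<noteq> 0") (auto simp: K less_imp_le)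
  have "Re (cnj (y a) * q a b * y b) = Re (cnj (?R a) * q a b * ?R b) + Re (cnj (?I a) * q a b * ?I b)"
    if "a \<in> loc" "b \<in> loc" for a b
  proof -
    have "q a b \<in> \<real>" using q_K[OF that] K by simp
    then obtain r where "q a b = of_real r" by (rule Reals_cases)
    then show ?thesis by (simp add: algebra_simps)
  qed
  then have split: "?f y = ?f ?R + ?f ?I" by (simp add: sum.distrib)
  obtain a where a: "a \<in> loc" "y a \<noteq> 0" using nz by blast
  then have "(\<exists>a\<in>loc. ?R a \<noteq> 0) \<or> (\<exists>a\<in>loc. ?I a \<noteq> 0)" by (auto simp: complex_eq_iff)
  then show ?thesis
  proof
    assume "\<exists>a\<in>loc. ?R a \<noteq> 0"
    then have "0 < ?f ?R" by (intro q_pos) (auto simp: K)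
    then show ?thesis using nn[of ?I] unfolding split by simp
  next
    assume "\<exists>a\<in>loc. ?I a \<noteq> 0"
    then have "0 < ?f ?I" by (intro q_pos) (auto simp: K)
    then show ?thesis using nn[of ?R] unfolding split by simp
  qed
qed

definition force :: "(edge \<times> nat \<Rightarrow> complex) \<Rightarrow> edge \<times> nat \<Rightarrow> complex" where
  "force X a = (\<Sum>b\<in>loc. q a b * X b)"

lemma force_sym: "(\<Sum>a\<in>loc. cnj (X a) * force Y a) = cnj (\<Sum>a\<in>loc. cnj (Y a) * force X a)"
proof -
  have "cnj (\<Sum>a\<in>loc. cnj (Y a) * force X a) = (\<Sum>a\<in>loc. \<Sum>b\<in>loc. cnj (X b) * (q b a * Y a))"
    by (auto intro!: sum.cong simp: force_def sum_distrib_left q_sym[symmetric])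
  also have "\<dots> = (\<Sum>a\<in>loc. cnj (X a) * force Y a)"
    by (subst sum.swap) (simp add: force_def sum_distrib_left)
  finally show ?thesis by (rule sym)
qed

text \<open>Lists the horizontal labels of a face in the order of the coordinates of the strip
  function.\<close>

definition sn :: "nat \<Rightarrow> edge \<times> nat" where
  "sn i = (if i < n1 then (South, i) else (North, i - n1))"

lemma sum_loc: "(\<Sum>a\<in>loc. f a) = (\<Sum>i<2 * n1. f (sn i)) + (\<Sum>j<n2. f (West, j)) + (\<Sum>j<n2. f (East, j))"
proof -
  have "loc = sn ` {..<2 * n1} \<union> Pair West ` {..<n2} \<union> Pair East ` {..<n2}"
  proof (intro equalityI subsetI)
    fix a assume a: "a \<in> loc"
    obtain e j where ej: "a = (e, j)" by force
    have "(South, j) = sn j" "(North, j) = sn (n1 + j)" if "j < n1" using that by (auto simp: sn_def)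
    then show "a \<in> sn ` {..<2 * n1} \<union> Pair West ` {..<n2} \<union> Pair East ` {..<n2}"
      using a unfolding ej by (cases e) (auto simp: loc_iff)
  qed (auto simp: loc_iff sn_def)
  then have "(\<Sum>a\<in>loc. f a) = (\<Sum>a\<in>sn ` {..<2 * n1} \<union> Pair West ` {..<n2} \<union> Pair East ` {..<n2}. f a)" by simp
  also have "\<dots> = (\<Sum>a\<in>sn ` {..<2 * n1} \<union> Pair West ` {..<n2}. f a) + (\<Sum>a\<in>Pair East ` {..<n2}. f a)"
    by (rule sum.union_disjoint) (auto simp: sn_def split: if_splits)
  also have "(\<Sum>a\<in>sn ` {..<2 * n1} \<union> Pair West ` {..<n2}. f a) = (\<Sum>a\<in>sn ` {..<2 * n1}. f a) + (\<Sum>a\<in>Pair West ` {..<n2}. f a)"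
    by (rule sum.union_disjoint) (auto simp: sn_def split: if_splits)
  also have "(\<Sum>a\<in>sn ` {..<2 * n1}. f a) = (\<Sum>i<2 * n1. f (sn i))"
    by (rule sum.reindex_cong[OF _ refl refl]) (auto simp: inj_on_def sn_def split: if_splits)
  finally show ?thesis by (simp add: sum.reindex inj_on_def)
qed

text \<open>The values on one face of a field whose vertical edges are multiplied by \<open>\<zeta>\<close> at each step
  towards East.\<close>

definition quasi :: "complex \<Rightarrow> complex vec \<Rightarrow> complex vec \<Rightarrow> edge \<times> nat \<Rightarrow> complex" where
  "quasi \<zeta> x v = (\<lambda>(e, j). if e = South then x $ j else if e = North then x $ (n1 + j)
     else if e = West then v $ j else \<zeta> * v $ j)"

lemma quasi_simps [simp]: "i < 2 * n1 \<Longrightarrow> quasi \<zeta> x v (sn i) = x $ i"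
  "quasi \<zeta> x v (West, j) = v $ j" "quasi \<zeta> x v (East, j) = \<zeta> * v $ j"
  by (auto simp: quasi_def sn_def)

text \<open>Equilibrium of a vertical edge of the row: the face on its West carries the field
  divided by \<open>\<zeta>\<close>, which accounts for the inverse.\<close>

definition balanced :: "complex \<Rightarrow> complex vec \<Rightarrow> complex vec \<Rightarrow> bool" where
  "balanced \<zeta> x v \<longleftrightarrow> (\<forall>j<n2. force (quasi \<zeta> x v) (West, j) + inverse \<zeta> * force (quasi \<zeta> x v) (East, j) = 0)"

text \<open>The Schur complement of a row, described through its solutions instead of an inverse, so
  that both kinds of strip function fall under the same predicate.\<close>

definition is_strip :: "complex \<Rightarrow> complex mat \<Rightarrow> bool" where
  "is_strip \<zeta> K \<longleftrightarrow> K \<in> carrier_mat (2 * n1) (2 * n1) \<and>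
     (\<forall>x\<in>carrier_vec (2 * n1). \<forall>v\<in>carrier_vec n2. balanced \<zeta> x v \<longrightarrow>
        (\<forall>i<2 * n1. (K *\<^sub>v x) $ i = force (quasi \<zeta> x v) (sn i)))"

definition strip_mat :: "complex \<Rightarrow> complex mat" where
  "strip_mat \<zeta> = mat n2 n2 (\<lambda>(i, j). q (West, i) (West, j) + q (East, i) (East, j) +
     \<zeta> * q (West, i) (East, j) + inverse \<zeta> * q (East, i) (West, j))"

definition strip_col :: "complex \<Rightarrow> complex mat" where
  "strip_col \<zeta> = mat n2 (2 * n1) (\<lambda>(i, j). q (West, i) (sn j) + inverse \<zeta> * q (East, i) (sn j))"

lemma strip_carrier [simp]: "strip_mat \<zeta> \<in> carrier_mat n2 n2" "strip_col \<zeta> \<in> carrier_mat n2 (2 * n1)"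
  by (auto simp: strip_mat_def strip_col_def)

lemma force_quasi:
  "force (quasi \<zeta> x v) a = (\<Sum>j<2 * n1. q a (sn j) * x $ j) + (\<Sum>j<n2. (q a (West, j) + \<zeta> * q a (East, j)) * v $ j)"
  by (simp add: force_def sum_loc sum.distrib algebra_simps)

lemma balance_eq:
  assumes "\<zeta> \<noteq> 0" "x \<in> carrier_vec (2 * n1)" "v \<in> carrier_vec n2" "i < n2"
  shows "force (quasi \<zeta> x v) (West, i) + inverse \<zeta> * force (quasi \<zeta> x v) (East, i) =
     (strip_col \<zeta> *\<^sub>v x) $ i + (strip_mat \<zeta> *\<^sub>v v) $ i"
proof -
  have split: "(\<Sum>j<2 * n1. a j) + (\<Sum>j<n2. b j) + inverse \<zeta> * ((\<Sum>j<2 * n1. c j) + (\<Sum>j<n2. d j)) =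
      (\<Sum>j<2 * n1. a j + inverse \<zeta> * c j) + (\<Sum>j<n2. b j + inverse \<zeta> * d j)" for a b c d :: "nat \<Rightarrow> complex"
    by (simp add: sum.distrib sum_distrib_left distrib_left)
  have "q (West, i) (sn j) * x $ j + inverse \<zeta> * (q (East, i) (sn j) * x $ j) = strip_col \<zeta> $$ (i, j) * x $ j"
    if "j < 2 * n1" for j
    using assms(4) that by (simp add: strip_col_def distrib_right)
  moreover have "(q (West, i) (West, j) + \<zeta> * q (West, i) (East, j)) * v $ j +
      inverse \<zeta> * ((q (East, i) (West, j) + \<zeta> * q (East, i) (East, j)) * v $ j) = strip_mat \<zeta> $$ (i, j) * v $ j"
    if "j < n2" for j
  proof -
    have "inverse \<zeta> * (\<zeta> * y) = y" for y using assms(1) by simp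
    then show ?thesis using assms(4) that by (simp add: strip_mat_def distrib_right distrib_left mult.assoc)
  qed
  ultimately show ?thesis
    unfolding mult_mat_vec_nth[OF strip_carrier(1) assms(3,4)] mult_mat_vec_nth[OF strip_carrier(2) assms(2,4)] force_quasi split
    by (intro arg_cong2[where f = "(+)"] sum.cong) auto
qed

lemma balanced_iff:
  assumes "\<zeta> \<noteq> 0" "x \<in> carrier_vec (2 * n1)" "v \<in> carrier_vec n2"
  shows "balanced \<zeta> x v \<longleftrightarrow> strip_mat \<zeta> *\<^sub>v v = - (strip_col \<zeta> *\<^sub>v x)"
proof
  assume b: "balanced \<zeta> x v"
  show "strip_mat \<zeta> *\<^sub>v v = - (strip_col \<zeta> *\<^sub>v x)"
  proof (rule eq_vecI)
    fix i assume "i < dim_vec (- (strip_col \<zeta> *\<^sub>v x))"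
    then have i: "i < n2" by (simp add: strip_col_def)
    then have "(strip_col \<zeta> *\<^sub>v x) $ i + (strip_mat \<zeta> *\<^sub>v v) $ i = 0"
      using b balance_eq[OF assms i] by (simp add: balanced_def)
    then have "(strip_mat \<zeta> *\<^sub>v v) $ i = - ((strip_col \<zeta> *\<^sub>v x) $ i)" by (simp only: eq_neg_iff_add_eq_0 add.commute)
    then show "(strip_mat \<zeta> *\<^sub>v v) $ i = (- (strip_col \<zeta> *\<^sub>v x)) $ i"
      using i by (simp add: strip_col_def del: index_mult_mat_vec)
  qed (simp add: strip_mat_def strip_col_def)
next
  assume e: "strip_mat \<zeta> *\<^sub>v v = - (strip_col \<zeta> *\<^sub>v x)"
  show "balanced \<zeta> x v"
    unfolding balanced_def
  proof (intro allI impI)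
    fix i assume i: "i < n2"
    have "(strip_mat \<zeta> *\<^sub>v v) $ i = - ((strip_col \<zeta> *\<^sub>v x) $ i)"
      unfolding e using i by (simp add: strip_col_def del: index_mult_mat_vec)
    then show "force (quasi \<zeta> x v) (West, i) + inverse \<zeta> * force (quasi \<zeta> x v) (East, i) = 0"
      unfolding balance_eq[OF assms i] by simp
  qed
qed

text \<open>On the unit circle the inverse of \<open>\<zeta>\<close> is its conjugate, so the West
  and East terms combine into the balance condition and vanish.\<close>

lemma inner_quasi:
  assumes "cmod \<zeta> = 1" "balanced \<zeta> x' v'" "x \<in> carrier_vec (2 * n1)" "v \<in> carrier_vec n2"
  shows "(\<Sum>a\<in>loc. cnj (quasi \<zeta> x v a) * force (quasi \<zeta> x' v') a) = (\<Sum>i<2 * n1. cnj (x $ i) * force (quasi \<zeta> x' v') (sn i))"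
proof -
  have "complex_of_real ((cmod \<zeta>)\<^sup>2) = 1" by (simp add: assms(1))
  then have "\<zeta> * cnj \<zeta> = 1" unfolding complex_norm_square .
  then have "inverse \<zeta> = cnj \<zeta>" by (rule inverse_unique)
  then have "cnj (v $ j) * force (quasi \<zeta> x' v') (West, j) + cnj (\<zeta> * v $ j) * force (quasi \<zeta> x' v') (East, j) = 0" if "j < n2" for j
  proof -
    have "cnj (v $ j) * (force (quasi \<zeta> x' v') (West, j) + cnj \<zeta> * force (quasi \<zeta> x' v') (East, j)) = 0"
      using that assms(2) \<open>inverse \<zeta> = cnj \<zeta>\<close> by (simp add: balanced_def)
    then show ?thesis by (simp add: distrib_left mult_ac)
  qed
  then have eq: "(\<Sum>j<n2. cnj (v $ j) * force (quasi \<zeta> x' v') (West, j)) + (\<Sum>j<n2. cnj (\<zeta> * v $ j) * force (quasi \<zeta> x' v') (East, j)) = 0"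
    by (simp only: sum.distrib[symmetric]) simp
  have "(\<Sum>i<2 * n1. cnj (quasi \<zeta> x v (sn i)) * force (quasi \<zeta> x' v') (sn i)) = (\<Sum>i<2 * n1. cnj (x $ i) * force (quasi \<zeta> x' v') (sn i))"
    by (rule sum.cong) simp_all
  with eq show ?thesis unfolding sum_loc quasi_simps(2,3) by (simp only: add.assoc) simp
qed

lemma quasi_pos:
  assumes "x \<in> carrier_vec (2 * n1)" "v \<in> carrier_vec n2" "x \<noteq> 0\<^sub>v (2 * n1) \<or> v \<noteq> 0\<^sub>v n2"
  shows "0 < Re (\<Sum>a\<in>loc. cnj (quasi \<zeta> x v a) * force (quasi \<zeta> x v) a)"
proof -
  have "\<exists>a\<in>loc. quasi \<zeta> x v a \<noteq> 0"
  proof (cases "x = 0\<^sub>v (2 * n1)")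
    case False
    then obtain i where i: "i < 2 * n1" "x $ i \<noteq> 0" using assms(1) by (metis carrier_vecD eq_vecI index_zero_vec)
    then show ?thesis by (intro bexI[of _ "sn i"]) (auto simp: sn_def loc_iff quasi_def)
  next
    case True
    then have "v \<noteq> 0\<^sub>v n2" using assms(3) by blast
    then obtain i where i: "i < n2" "v $ i \<noteq> 0" using assms(2) by (metis carrier_vecD eq_vecI index_zero_vec)
    then show ?thesis by (intro bexI[of _ "(West, i)"]) (auto simp: loc_iff)
  qed
  from q_pos_complex[OF this] show ?thesis by (simp add: force_def sum_distrib_left mult.assoc)
qed

text \<open>A kernel vector would be a balanced field with horizontal values zero, hence of energy
  zero, against positivity of the face.\<close>

lemma strip_mat_kernel:
  assumes \<zeta>: "cmod \<zeta> = 1" and v: "v \<in> carrier_vec n2" "v \<noteq> 0\<^sub>v n2"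
  shows "strip_mat \<zeta> *\<^sub>v v \<noteq> 0\<^sub>v n2"
proof
  assume "strip_mat \<zeta> *\<^sub>v v = 0\<^sub>v n2"
  moreover have "strip_col \<zeta> *\<^sub>v 0\<^sub>v (2 * n1) = 0\<^sub>v n2"
    by (rule eq_vecI) (auto simp: mult_mat_vec_nth[OF strip_carrier(2)] strip_col_def scalar_prod_def)
  ultimately have "strip_mat \<zeta> *\<^sub>v v = - (strip_col \<zeta> *\<^sub>v 0\<^sub>v (2 * n1))" by simp
  then have b: "balanced \<zeta> (0\<^sub>v (2 * n1)) v" using \<zeta> v by (subst balanced_iff) auto
  have "0 < Re (\<Sum>a\<in>loc. cnj (quasi \<zeta> (0\<^sub>v (2 * n1)) v a) * force (quasi \<zeta> (0\<^sub>v (2 * n1)) v) a)"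
    by (rule quasi_pos) (use v in auto)
  then show False using inner_quasi[OF \<zeta> b _ v(1), of "0\<^sub>v (2 * n1)"] by simp
qed

lemma balanced_ex:
  assumes \<zeta>: "cmod \<zeta> = 1" and x: "x \<in> carrier_vec (2 * n1)"
  obtains v where "v \<in> carrier_vec n2" "balanced \<zeta> x v"
proof -
  have inv: "minv (strip_mat \<zeta>) \<in> carrier_mat n2 n2" "strip_mat \<zeta> * minv (strip_mat \<zeta>) = 1\<^sub>m n2"
    by (rule minv_inverse[OF strip_carrier(1) strip_mat_kernel[OF \<zeta>]]; assumption)+
  have c: "- (strip_col \<zeta> *\<^sub>v x) \<in> carrier_vec n2" by (rule uminus_carrier_vec[THEN iffD2, OF mult_mat_vec_carrier[OF strip_carrier(2) x]])
  let ?v = "minv (strip_mat \<zeta>) *\<^sub>v - (strip_col \<zeta> *\<^sub>v x)"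
  have v: "?v \<in> carrier_vec n2" by (rule mult_mat_vec_carrier[OF inv(1) c])
  have "strip_mat \<zeta> *\<^sub>v ?v = (strip_mat \<zeta> * minv (strip_mat \<zeta>)) *\<^sub>v - (strip_col \<zeta> *\<^sub>v x)"
    by (rule assoc_mult_mat_vec[symmetric, OF strip_carrier(1) inv(1) c])
  also have "\<dots> = - (strip_col \<zeta> *\<^sub>v x)" unfolding inv(2) by (rule one_mult_mat_vec[OF c])
  finally have "strip_mat \<zeta> *\<^sub>v ?v = - (strip_col \<zeta> *\<^sub>v x)" .
  moreover have "\<zeta> \<noteq> 0" using \<zeta> by auto
  ultimately have "balanced \<zeta> x ?v" using balanced_iff[OF _ x v] by blast
  then show thesis by (rule that[OF v])
qed

text \<open>The factor \<open>c\<close> accounts for a different choice of the vertical edge on which the field is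
  measured.\<close>

lemma is_stripI:
  assumes \<zeta>: "cmod \<zeta> = 1" and c: "c \<noteq> 0"
    and A: "A \<in> carrier_mat (2 * n1) (2 * n1)" "\<And>i j. i < 2 * n1 \<Longrightarrow> j < 2 * n1 \<Longrightarrow> A $$ (i, j) = q (sn i) (sn j)"
    and B: "B \<in> carrier_mat (2 * n1) n2"
      "\<And>i j. i < 2 * n1 \<Longrightarrow> j < n2 \<Longrightarrow> B $$ (i, j) = c * (q (sn i) (West, j) + \<zeta> * q (sn i) (East, j))"
    and C: "C \<in> carrier_mat n2 (2 * n1)"
      "\<And>i j. i < n2 \<Longrightarrow> j < 2 * n1 \<Longrightarrow> C $$ (i, j) = inverse c * (q (West, i) (sn j) + inverse \<zeta> * q (East, i) (sn j))"
    and \<Phi>: "\<Phi> = strip_mat \<zeta>"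
  shows "is_strip \<zeta> (A - B * minv \<Phi> * C)"
  unfolding is_strip_def
proof (intro conjI ballI impI allI)
  have inv: "minv (strip_mat \<zeta>) \<in> carrier_mat n2 n2"
    by (rule minv_inverse[OF strip_carrier(1) strip_mat_kernel[OF \<zeta>]]; assumption)
  show "A - B * minv \<Phi> * C \<in> carrier_mat (2 * n1) (2 * n1)"
    unfolding \<Phi> by (rule minus_carrier_mat[OF mult_carrier_mat[OF mult_carrier_mat[OF B(1) inv] C(1)]])
  fix x v i assume x: "x \<in> carrier_vec (2 * n1)" and v: "v \<in> carrier_vec n2" and b: "balanced \<zeta> x v" and i: "i < 2 * n1"
  have \<zeta>0: "\<zeta> \<noteq> 0" using \<zeta> by auto
  \<comment> \<open>The factor in \<open>C\<close> is the inverse of the one in \<open>B\<close>: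
    the rescaled field solves the eliminated equation, and \<open>B\<close> restores the original
    forces.\<close>
  let ?w = "inverse c \<cdot>\<^sub>v v"
  have w: "?w \<in> carrier_vec n2" using v by simp
  have "strip_mat \<zeta> *\<^sub>v ?w = - (C *\<^sub>v x)"
  proof (rule eq_vecI)
    fix i assume "i < dim_vec (- (C *\<^sub>v x))"
    then have i: "i < n2" using C(1) by simp
    have "(strip_mat \<zeta> *\<^sub>v v) $ i = - ((strip_col \<zeta> *\<^sub>v x) $ i)"
      using b i unfolding balanced_iff[OF \<zeta>0 x v]
      by (simp add: strip_col_def del: index_mult_mat_vec)
    moreover have "(C *\<^sub>v x) $ i = inverse c * (strip_col \<zeta> *\<^sub>v x) $ i"
      unfolding mult_mat_vec_nth[OF C(1) x i] mult_mat_vec_nth[OF strip_carrier(2) x i]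
      using i by (simp add: C(2) strip_col_def sum_distrib_left mult.assoc)
    moreover have "(strip_mat \<zeta> *\<^sub>v ?w) $ i = inverse c * (strip_mat \<zeta> *\<^sub>v v) $ i"
      unfolding mult_mat_vec_nth[OF strip_carrier(1) w i] mult_mat_vec_nth[OF strip_carrier(1) v i]
      using i v by (simp add: sum_distrib_left mult.left_commute)
    ultimately show "(strip_mat \<zeta> *\<^sub>v ?w) $ i = (- (C *\<^sub>v x)) $ i" using i C(1) by (simp del: index_mult_mat_vec)
  qed (use C(1) in \<open>simp add: strip_mat_def\<close>)
  then have "(A - B * minv \<Phi> * C) *\<^sub>v x = A *\<^sub>v x + B *\<^sub>v ?w"
    unfolding \<Phi> by (rule schur_mat_vec[OF A(1) B(1) C(1) strip_carrier(1) strip_mat_kernel[OF \<zeta>] x w, rotated 2])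
  moreover have "(A *\<^sub>v x + B *\<^sub>v ?w) $ i = (A *\<^sub>v x) $ i + (B *\<^sub>v ?w) $ i"
    using i A(1) B(1) by (simp del: index_mult_mat_vec)
  moreover have "(B *\<^sub>v ?w) $ i = (\<Sum>j<n2. (q (sn i) (West, j) + \<zeta> * q (sn i) (East, j)) * v $ j)"
    unfolding mult_mat_vec_nth[OF B(1) w i] using i v c by (intro sum.cong) (auto simp: B(2))
  moreover have "(A *\<^sub>v x) $ i = (\<Sum>j<2 * n1. q (sn i) (sn j) * x $ j)"
    unfolding mult_mat_vec_nth[OF A(1) x i] using i by (intro sum.cong) (auto simp: A(2))
  ultimately show "((A - B * minv \<Phi> * C) *\<^sub>v x) $ i = force (quasi \<zeta> x v) (sn i)"
    unfolding force_quasi by (simp only:)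
qed

text \<open>The form of K at two vectors is the pairing of the balanced one-face fields that extend
  them, so symmetry and positivity are those of the face.\<close>

lemma is_strip_pos_def:
  assumes \<zeta>: "cmod \<zeta> = 1" and K: "is_strip \<zeta> K"
  shows "pos_def UNIV (2 * n1) K"
proof -
  have Kc: "K \<in> carrier_mat (2 * n1) (2 * n1)" using K by (simp add: is_strip_def)
  have ip: "ip x (K *\<^sub>v y) = (\<Sum>a\<in>loc. cnj (quasi \<zeta> x v a) * force (quasi \<zeta> y w) a)"
    if "x \<in> carrier_vec (2 * n1)" "y \<in> carrier_vec (2 * n1)" "v \<in> carrier_vec n2" "w \<in> carrier_vec n2" "balanced \<zeta> y w" for x y v w
    unfolding inner_quasi[OF \<zeta> that(5,1,3)] using K that Kc
    by (auto simp: ip_def is_strip_def intro!: sum.cong simp del: index_mult_mat_vec)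
  have herm: "ip x (K *\<^sub>v y) = cnj (ip y (K *\<^sub>v x))" if x: "x \<in> carrier_vec (2 * n1)" and y: "y \<in> carrier_vec (2 * n1)" for x y
  proof -
    obtain v where v: "v \<in> carrier_vec n2" "balanced \<zeta> x v" by (rule balanced_ex[OF \<zeta> x])
    obtain w where w: "w \<in> carrier_vec n2" "balanced \<zeta> y w" by (rule balanced_ex[OF \<zeta> y])
    show ?thesis unfolding ip[OF x y v(1) w] ip[OF y x w(1) v] by (rule force_sym)
  qed
  have ent: "ip (unit_vec (2 * n1) i) (K *\<^sub>v unit_vec (2 * n1) j) = K $$ (i, j)" if "i < 2 * n1" "j < 2 * n1" for i j
  proof -
    have "(K *\<^sub>v unit_vec (2 * n1) j) $ k = K $$ (k, j)" if k: "k < 2 * n1" for k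
    proof -
      have "(K *\<^sub>v unit_vec (2 * n1) j) $ k = (\<Sum>l<2 * n1. if l = j then K $$ (k, l) else 0)"
        unfolding mult_mat_vec_nth[OF Kc unit_vec_carrier k] using \<open>j < 2 * n1\<close> by (intro sum.cong) auto
      then show ?thesis using \<open>j < 2 * n1\<close> by simp
    qed
    then have "ip (unit_vec (2 * n1) i) (K *\<^sub>v unit_vec (2 * n1) j) = (\<Sum>k<2 * n1. if k = i then K $$ (k, j) else 0)"
      unfolding ip_def using that Kc by (intro sum.cong) (auto simp del: index_mult_mat_vec)
    then show ?thesis using that by simp
  qed
  show ?thesis unfolding pos_def_UNIV_iff
  proof (intro conjI allI impI ballI Kc)
    fix i j assume ij: "i < 2 * n1" "j < 2 * n1"
    show "K $$ (j, i) = cnj (K $$ (i, j))"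
      using herm[of "unit_vec (2 * n1) j" "unit_vec (2 * n1) i"] unfolding ent[OF ij] ent[OF ij(2,1)] by simp
  next
    fix x :: "complex vec" assume x: "x \<in> carrier_vec (2 * n1)" "x \<noteq> 0\<^sub>v (2 * n1)"
    obtain v where v: "v \<in> carrier_vec n2" "balanced \<zeta> x v" by (rule balanced_ex[OF \<zeta> x(1)])
    show "0 < Re (ip x (K *\<^sub>v x))" unfolding ip[OF x(1,1) v(1) v] by (rule quasi_pos) (use x v in auto)
  qed
qed

end

section \<open>Fourier multipliers\<close>

text \<open>The relation inside the description that defines \<open>multiplier\<close>, asserted of
  the output of \<open>M\<close>; any regularity of \<open>F\<close> is hidden in the existence of
  the transforms.\<close>

definition has_symbol :: "complex set \<Rightarrow> edge list \<Rightarrow> nat \<Rightarrow> (complex \<Rightarrow> complex mat) \<Rightarrow> label l2_op \<Rightarrow> bool" where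
  "has_symbol \<K> es n F M \<longleftrightarrow> (\<forall>x \<in> l2_space \<K> (set es \<times> UNIV \<times> {..<n}). \<exists>f'::real \<Rightarrow> complex vec.
     (\<forall>\<theta>. f' \<theta> \<in> carrier_vec (length es * n)) \<and>
     (\<forall>p < length es. \<forall>j < n.
        fourier_L2 (\<lambda>k. x (es ! p, k, j)) (\<lambda>\<theta>. f' \<theta> $ (p * n + j)) \<and>
        fourier_L2 (\<lambda>k. M x (es ! p, k, j)) (\<lambda>\<theta>. (F (cis \<theta>) *\<^sub>v f' \<theta>) $ (p * n + j))))"

text \<open>Two transforms of one input agree almost everywhere in each of finitely many
  coordinates, so their images under the symbol agree almost everywhere as well, and Fourier
  coefficients are unique.\<close>

lemma multiplier_eqI:
  assumes M: "M \<in> coercive_ops \<K> (set es \<times> UNIV \<times> {..<n})" and s: "has_symbol \<K> es n F M"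
  shows "multiplier \<K> es n F = M"
proof (rule ext)
  fix x :: "label \<Rightarrow> complex"
  let ?I = "set es \<times> (UNIV :: int set) \<times> {..<n}" and ?N = "length es * n"
  define P where "P g f' \<longleftrightarrow> (\<forall>\<theta>. f' \<theta> \<in> carrier_vec ?N) \<and>
     (\<forall>p < length es. \<forall>j < n.
        fourier_L2 (\<lambda>k. x (es ! p, k, j)) (\<lambda>\<theta>. f' \<theta> $ (p * n + j)) \<and>
        fourier_L2 (\<lambda>k. g (es ! p, k, j)) (\<lambda>\<theta>. (F (cis \<theta>) *\<^sub>v f' \<theta>) $ (p * n + j)))"
    for g :: "label \<Rightarrow> complex" and f'
  show "multiplier \<K> es n F x = M x"
  proof (cases "x \<in> l2_space \<K> ?I")
    case False
    then show ?thesis using M by (simp add: multiplier_def on_l2_def Let_def coercive_ops_def)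
  next
    case True
    obtain f' where f': "P (M x) f'" using s True unfolding has_symbol_def P_def by blast
    have MxL: "M x \<in> l2_space \<K> ?I" using M True by (auto simp: coercive_ops_def)
    have uniq: "g = M x" if g: "g \<in> l2_space \<K> ?I" "P g f" for g f
    proof -
      have "AE \<theta> in circ. \<forall>c\<in>{..<length es} \<times> {..<n}. f \<theta> $ (fst c * n + snd c) = f' \<theta> $ (fst c * n + snd c)"
      proof (rule AE_ball_countable')
        fix c assume "c \<in> {..<length es} \<times> {..<n}"
        then have c: "fst c < length es" "snd c < n" by auto
        show "AE \<theta> in circ. f \<theta> $ (fst c * n + snd c) = f' \<theta> $ (fst c * n + snd c)"
          by (rule fourier_L2_unique[where a = "\<lambda>k. x (es ! fst c, k, snd c)"]) (use g(2) f' c in \<open>auto simp: P_def\<close>)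
      qed simp
      then have ae: "AE \<theta> in circ. f \<theta> = f' \<theta>"
      proof (rule AE_mp, intro AE_I2 impI)
        fix \<theta> assume *: "\<forall>c\<in>{..<length es} \<times> {..<n}. f \<theta> $ (fst c * n + snd c) = f' \<theta> $ (fst c * n + snd c)"
        show "f \<theta> = f' \<theta>"
        proof (rule eq_vecI)
          have d: "dim_vec (f \<theta>) = ?N" "dim_vec (f' \<theta>) = ?N" using g(2) f' by (auto simp: P_def)
          then show "dim_vec (f \<theta>) = dim_vec (f' \<theta>)" by simp
          fix i assume "i < dim_vec (f' \<theta>)"
          then have i: "i < length es * n" using d by simp
          \<comment> \<open>Coordinate i belongs to edge number i div n of the list and is
            coordinate i mod n on it.\<close>
          then have "n > 0" by (cases n) auto
          then have "i div n < length es" "i mod n < n" using i by (auto simp: less_mult_imp_div_less)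
          then have "f \<theta> $ (i div n * n + i mod n) = f' \<theta> $ (i div n * n + i mod n)"
            using * by (metis fst_conv snd_conv SigmaI lessThan_iff)
          then show "f \<theta> $ i = f' \<theta> $ i" by simp
        qed
      qed
      have eq: "g (es ! p, k, j) = M x (es ! p, k, j)" if pj: "p < length es" "j < n" for p k j
      proof -
        have "AE \<theta> in circ. (F (cis \<theta>) *\<^sub>v f \<theta>) $ (p * n + j) = (F (cis \<theta>) *\<^sub>v f' \<theta>) $ (p * n + j)"
          by (rule AE_mp[OF ae]) (intro AE_I2 impI, simp only:)
        moreover have "fourier_L2 (\<lambda>k. g (es ! p, k, j)) (\<lambda>\<theta>. (F (cis \<theta>) *\<^sub>v f \<theta>) $ (p * n + j))"
          using g(2) pj by (simp add: P_def)
        ultimately have "fourier_L2 (\<lambda>k. g (es ! p, k, j)) (\<lambda>\<theta>. (F (cis \<theta>) *\<^sub>v f' \<theta>) $ (p * n + j))"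
          by (rule fourier_L2_AE[rotated])
        moreover have "fourier_L2 (\<lambda>k. M x (es ! p, k, j)) (\<lambda>\<theta>. (F (cis \<theta>) *\<^sub>v f' \<theta>) $ (p * n + j))"
          using f' pj by (simp add: P_def)
        ultimately have "(\<lambda>k. g (es ! p, k, j)) = (\<lambda>k. M x (es ! p, k, j))" by (rule fourier_L2_coeff_unique)
        then show ?thesis by (rule fun_cong)
      qed
      show "g = M x"
      proof (rule ext)
        fix a :: label
        show "g a = M x a"
        proof (cases "a \<in> ?I")
          case True
          then obtain p k j where "a = (es ! p, k, j)" "p < length es" "j < n" by (auto simp: in_set_conv_nth)
          then show ?thesis using eq by simp
        next
          case False
          then have "g a = 0" "M x a = 0" using g(1) MxL unfolding l2_space_iff by blast+
          then show ?thesis by simp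
        qed
      qed
    qed
    have "multiplier \<K> es n F x = (THE g. g \<in> l2_space \<K> ?I \<and> (\<exists>f'. P g f'))"
      using True by (simp only: multiplier_def on_l2_def Let_def P_def if_True)
    also have "\<dots> = M x" by (rule the_equality) (use MxL f' uniq in blast)+
    finally show ?thesis .
  qed
qed

section \<open>Equilibrium equations under the Fourier transform\<close>

context lattice
begin

definition delta :: "lattice_edge \<Rightarrow> lattice_edge \<Rightarrow> complex" where
  "delta e = (\<lambda>a. if a = e then 1 else 0)"

definition face_force :: "(lattice_edge \<Rightarrow> complex) \<Rightarrow> int \<times> int \<Rightarrow> edge \<times> nat \<Rightarrow> complex" where
  "face_force X \<phi> = force (\<lambda>b. X (side_edge \<phi> b))"

text \<open>The edge is a side of exactly two faces of the plane, and those of them that lie in F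
  contribute one force each.\<close>

lemma form_delta_two:
  assumes a: "a \<in> loc" "b \<in> loc" and ne: "\<phi>1 \<noteq> \<phi>2"
    and e: "\<And>\<phi> c. c \<in> loc \<Longrightarrow> side_edge \<phi> c = e \<longleftrightarrow> c = a \<and> \<phi> = \<phi>1 \<or> c = b \<and> \<phi> = \<phi>2"
  shows "form F (delta e) X = (if \<phi>1 \<in> F then face_force X \<phi>1 a else 0) + (if \<phi>2 \<in> F then face_force X \<phi>2 b else 0)"
proof -
  have ff: "face_form \<phi> (delta e) X = (if \<phi> = \<phi>1 then face_force X \<phi> a else 0) + (if \<phi> = \<phi>2 then face_force X \<phi> b else 0)" for \<phi>
  proof -
    have "face_form \<phi> (delta e) X = (\<Sum>c\<in>loc. cnj (delta e (side_edge \<phi> c)) * face_force X \<phi> c)"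
      by (simp add: face_form_def face_force_def force_def sum_distrib_left mult.assoc)
    also have "\<dots> = (\<Sum>c\<in>loc. (if c = a then if \<phi> = \<phi>1 then face_force X \<phi> a else 0 else 0) +
        (if c = b then if \<phi> = \<phi>2 then face_force X \<phi> b else 0 else 0))"
      by (rule sum.cong[OF refl]) (use ne in \<open>auto simp: delta_def e\<close>)
    finally show ?thesis using a by (simp add: sum.distrib)
  qed
  have "form F (delta e) X = (\<Sum>\<^sub>\<infinity>\<phi>\<in>F \<inter> {\<phi>1, \<phi>2}. face_form \<phi> (delta e) X)"
    unfolding form_def by (rule infsum_cong_neutral) (auto simp: ff)
  also have "\<dots> = (\<Sum>\<phi>\<in>{\<phi>1, \<phi>2} \<inter> F. face_form \<phi> (delta e) X)" by (simp add: Int_commute)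
  also have "\<dots> = (\<Sum>\<phi>\<in>{\<phi>1, \<phi>2}. if \<phi> \<in> F then face_form \<phi> (delta e) X else 0)" by (rule sum.inter_restrict) simp
  finally show ?thesis using ne by (simp add: ff)
qed

lemma form_delta_horizontal:
  assumes "j < n1"
  shows "form F (delta (True, k, l, j)) X =
    (if (k, l) \<in> F then face_force X (k, l) (South, j) else 0) + (if (k, l - 1) \<in> F then face_force X (k, l - 1) (North, j) else 0)"
proof (rule form_delta_two)
  fix \<phi> :: "int \<times> int" and c assume "c \<in> loc"
  then show "side_edge \<phi> c = (True, k, l, j) \<longleftrightarrow> c = (South, j) \<and> \<phi> = (k, l) \<or> c = (North, j) \<and> \<phi> = (k, l - 1)"
    by (cases \<phi>; cases c; cases "fst c") (auto simp: loc_iff)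
qed (use assms in \<open>auto simp: loc_iff\<close>)

lemma form_delta_vertical:
  assumes "j < n2"
  shows "form F (delta (False, k, l, j)) X =
    (if (k, l) \<in> F then face_force X (k, l) (West, j) else 0) + (if (k - 1, l) \<in> F then face_force X (k - 1, l) (East, j) else 0)"
proof (rule form_delta_two)
  fix \<phi> :: "int \<times> int" and c assume "c \<in> loc"
  then show "side_edge \<phi> c = (False, k, l, j) \<longleftrightarrow> c = (West, j) \<and> \<phi> = (k, l) \<or> c = (East, j) \<and> \<phi> = (k - 1, l)"
    by (cases \<phi>; cases c; cases "fst c") (auto simp: loc_iff)
qed (use assms in \<open>auto simp: loc_iff\<close>)

text \<open>Testing on point masses turns the weak description into a balance at every edge.\<close>

lemma dtn_strongE:
  assumes x: "x \<in> \<L> (shape n1 n2 h v)"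
  obtains X where "X \<in> \<L> (edges (region h v))" "\<And>a. a \<in> shape n1 n2 h v \<Longrightarrow> X (embed h v a) = x a"
    "\<And>a. a \<in> shape n1 n2 h v \<Longrightarrow> form (region h v) (delta (embed h v a)) X = dtn h v x a"
    "\<And>e. e \<in> edges (region h v) \<Longrightarrow> e \<notin> embed h v ` shape n1 n2 h v \<Longrightarrow> form (region h v) (delta e) X = 0"
proof -
  let ?I = "shape n1 n2 h v"
  obtain X where X: "X \<in> \<L> (edges (region h v))" "\<And>a. a \<in> ?I \<Longrightarrow> X (embed h v a) = x a"
    "\<And>Z. Z \<in> \<L> (edges (region h v)) \<Longrightarrow>
       form (region h v) Z X = l2_inner (pull (embed h v) ?I Z) (dtn h v x)"
    using dtn_weakE[OF x] by blast
  have dL: "delta e \<in> \<L> (edges (region h v))" if "e \<in> edges (region h v)" for e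
    using that l2_finite_support[of "{e}" "delta e"] by (auto simp: l2_space_iff delta_def)
  show thesis
  proof (rule that[OF X(1,2)])
    fix a assume a: "a \<in> ?I"
    have "form (region h v) (delta (embed h v a)) X = l2_inner (pull (embed h v) ?I (delta (embed h v a))) (dtn h v x)"
      by (rule X(3)[OF dL]) (use embed_edges[of h v] a in blast)
    also have "\<dots> = (\<Sum>\<^sub>\<infinity>i\<in>{a}. cnj (pull (embed h v) ?I (delta (embed h v a)) i) * dtn h v x i)"
      unfolding l2_inner_def by (rule infsum_cong_neutral)
        (use a inj_embed[of h v n1 n2] in \<open>auto simp: pull_def restr_def delta_def inj_on_def\<close>)
    also have "\<dots> = dtn h v x a" using a by (simp add: pull_def restr_def delta_def)
    finally show "form (region h v) (delta (embed h v a)) X = dtn h v x a" .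
  next
    fix e assume e: "e \<in> edges (region h v)" "e \<notin> embed h v ` ?I"
    have "pull (embed h v) ?I (delta e) = (\<lambda>_. 0)" using e(2) by (auto simp: pull_def restr_def delta_def fun_eq_iff)
    then show "form (region h v) (delta e) X = 0" unfolding X(3)[OF dL[OF e(1)]] by (simp add: l2_inner_def)
  qed
qed

lemma row_l2: "X \<in> \<L> A \<Longrightarrow> l2 (\<lambda>k. X (h, k, l, j))"
  using l2_reindex[OF l2_spaceD, of X \<K> A "\<lambda>k. (h, k, l, j)" UNIV] by (simp add: restr_def inj_on_def)

lemma transforms_ex:
  assumes X: "X \<in> \<L> A"
  obtains F where "\<And>h l j. fourier_L2 (\<lambda>k. X (h, k, l, j)) (F h l j)"
proof -
  have "\<exists>f. fourier_L2 (\<lambda>k. X (h, k, l, j)) f" for h l j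
    by (rule fourier_L2_exists[OF row_l2[OF X]]) blast
  then show thesis using that by metis
qed

text \<open>The horizontal and vertical values of the \<open>l\<close>-th row, at the angle \<open>\<theta>\<close>, of a field with
  Fourier transforms \<open>F\<close>. A translation by one step towards East multiplies a Fourier
  transform by \<open>cis (- \<theta>)\<close>.\<close>

definition hvec :: "(bool \<Rightarrow> int \<Rightarrow> nat \<Rightarrow> real \<Rightarrow> complex) \<Rightarrow> int \<Rightarrow> real \<Rightarrow> complex vec" where
  "hvec F l \<theta> = vec (2 * n1) (\<lambda>i. if i < n1 then F True l i \<theta> else F True (l + 1) (i - n1) \<theta>)"

definition vvec :: "(bool \<Rightarrow> int \<Rightarrow> nat \<Rightarrow> real \<Rightarrow> complex) \<Rightarrow> int \<Rightarrow> real \<Rightarrow> complex vec" where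
  "vvec F l \<theta> = vec n2 (\<lambda>j. F False l j \<theta>)"

definition row_force :: "(bool \<Rightarrow> int \<Rightarrow> nat \<Rightarrow> real \<Rightarrow> complex) \<Rightarrow> int \<Rightarrow> real \<Rightarrow> edge \<times> nat \<Rightarrow> complex" where
  "row_force F l \<theta> = force (quasi (cis (- \<theta>)) (hvec F l \<theta>) (vvec F l \<theta>))"

context
  fixes X :: "lattice_edge \<Rightarrow> complex" and A :: "lattice_edge set" and F
  assumes X: "X \<in> \<L> A" and F: "\<And>h l j. fourier_L2 (\<lambda>k. X (h, k, l, j)) (F h l j)"
begin

text \<open>The East edge is the West edge of the next face, which is the origin of the factor
  \<open>cis (- \<theta>)\<close> in place of \<open>\<zeta>\<close>; the other three sides have the
  position of the face itself.\<close>

lemma fourier_side: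
  assumes "b \<in> loc"
  shows "fourier_L2 (\<lambda>k. X (side_edge (k, l) b)) (\<lambda>\<theta>. quasi (cis (- \<theta>)) (hvec F l \<theta>) (vvec F l \<theta>) b)"
proof -
  obtain e j where b: "b = (e, j)" by force
  consider "e = South" "j < n1" | "e = North" "j < n1" | "e = West" "j < n2" | "e = East" "j < n2"
    using assms unfolding b by (cases e) (auto simp: loc_iff)
  then show ?thesis
  proof cases
    case 4
    then show ?thesis
      using fourier_L2_shift[OF F row_l2[OF X], of 1 False l j] by (simp add: b quasi_def vvec_def)
  qed (use F in \<open>simp_all add: b quasi_def hvec_def vvec_def\<close>)
qed

lemma fourier_force: "fourier_L2 (\<lambda>k. face_force X (k, l) a) (\<lambda>\<theta>. row_force F l \<theta> a)"
  unfolding face_force_def row_force_def force_def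
  by (intro fourier_L2_sum fourier_L2_cmult fourier_side finite_loc)

lemma l2_force: "l2 (\<lambda>k. face_force X (k, l) a)"
proof -
  have "l2 (\<lambda>k. X (side_edge (k, l) b))" for b
  proof -
    have "l2 (restr UNIV (\<lambda>k. X (side_edge (k, l) b)))"
      by (rule l2_reindex[OF l2_spaceD[OF X]]) (cases b; cases "fst b"; auto simp: inj_on_def)
    then show ?thesis by (simp add: restr_def)
  qed
  then show ?thesis unfolding face_force_def force_def by (intro l2_sum l2_cmult finite_loc)
qed

text \<open>The equations for all k form one identity between coefficient sequences, and a function
  with zero coefficients vanishes almost everywhere.\<close>

lemma AE_balanced:
  assumes eq: "\<And>j k. j < n2 \<Longrightarrow> face_force X (k, l) (West, j) + face_force X (k - 1, l) (East, j) = 0"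
  shows "AE \<theta> in circ. balanced (cis (- \<theta>)) (hvec F l \<theta>) (vvec F l \<theta>)"
proof -
  have "AE \<theta> in circ. \<forall>j\<in>{..<n2}. row_force F l \<theta> (West, j) + cis \<theta> * row_force F l \<theta> (East, j) = 0"
  proof (rule AE_ball_countable')
    fix j assume j: "j \<in> {..<n2}"
    \<comment> \<open>The face to the West is reached by the shift -1; its factor
      \<open>cis \<theta>\<close> is the inverse that occurs in \<open>balanced\<close>.\<close>
    have "fourier_L2 (\<lambda>k. face_force X (k, l) (West, j) + face_force X (k + - 1, l) (East, j))
        (\<lambda>\<theta>. row_force F l \<theta> (West, j) + cis (- of_int (- 1) * \<theta>) * row_force F l \<theta> (East, j))"
      by (rule fourier_L2_add[OF fourier_force fourier_L2_shift[OF fourier_force l2_force]]) simp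
    moreover have "(\<lambda>k. face_force X (k, l) (West, j) + face_force X (k + - 1, l) (East, j)) = (\<lambda>_. 0)"
      using eq j by auto
    ultimately have "fourier_L2 (\<lambda>_. 0) (\<lambda>\<theta>. row_force F l \<theta> (West, j) + cis \<theta> * row_force F l \<theta> (East, j))" by simp
    from fourier_L2_unique[OF this fourier_L2_zero]
    show "AE \<theta> in circ. row_force F l \<theta> (West, j) + cis \<theta> * row_force F l \<theta> (East, j) = 0" .
  qed simp
  then show ?thesis by (rule AE_mp) (intro AE_I2 impI; simp add: balanced_def row_force_def cis_inverse)
qed

lemma AE_strip:
  assumes eq: "\<And>j k. j < n2 \<Longrightarrow> face_force X (k, l) (West, j) + face_force X (k - 1, l) (East, j) = 0"
    and S: "\<And>\<theta>. is_strip (cis (- \<theta>)) (S (cis \<theta>))"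
  shows "AE \<theta> in circ. \<forall>i<2 * n1. row_force F l \<theta> (sn i) = (S (cis \<theta>) *\<^sub>v hvec F l \<theta>) $ i"
proof (rule AE_mp[OF AE_balanced[OF eq]])
  have "hvec F l \<theta> \<in> carrier_vec (2 * n1)" "vvec F l \<theta> \<in> carrier_vec n2" for \<theta> by (auto simp: hvec_def vvec_def)
  then show "AE \<theta> in circ. balanced (cis (- \<theta>)) (hvec F l \<theta>) (vvec F l \<theta>) \<longrightarrow>
      (\<forall>i<2 * n1. row_force F l \<theta> (sn i) = (S (cis \<theta>) *\<^sub>v hvec F l \<theta>) $ i)"
    using S unfolding is_strip_def row_force_def by (intro AE_I2 impI allI) (metis (no_types))
qed

lemma AE_rows_balanced:
  assumes eq: "\<And>j k. j < n1 \<Longrightarrow> face_force X (k, l) (South, j) + face_force X (k, l - 1) (North, j) = 0"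
  shows "AE \<theta> in circ. \<forall>j<n1. row_force F l \<theta> (South, j) + row_force F (l - 1) \<theta> (North, j) = 0"
proof -
  have "AE \<theta> in circ. \<forall>j\<in>{..<n1}. row_force F l \<theta> (South, j) + row_force F (l - 1) \<theta> (North, j) = 0"
  proof (rule AE_ball_countable')
    fix j assume j: "j \<in> {..<n1}"
    have "fourier_L2 (\<lambda>k. face_force X (k, l) (South, j) + face_force X (k, l - 1) (North, j))
        (\<lambda>\<theta>. row_force F l \<theta> (South, j) + row_force F (l - 1) \<theta> (North, j))"
      by (rule fourier_L2_add[OF fourier_force fourier_force])
    moreover have "(\<lambda>k. face_force X (k, l) (South, j) + face_force X (k, l - 1) (North, j)) = (\<lambda>_. 0)"
      using eq j by auto
    ultimately have "fourier_L2 (\<lambda>_. 0) (\<lambda>\<theta>. row_force F l \<theta> (South, j) + row_force F (l - 1) \<theta> (North, j))" by simp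
    from fourier_L2_unique[OF this fourier_L2_zero]
    show "AE \<theta> in circ. row_force F l \<theta> (South, j) + row_force F (l - 1) \<theta> (North, j) = 0" .
  qed simp
  then show ?thesis by (simp only: Ball_def lessThan_iff)
qed

text \<open>The \<open>L\<^sup>2\<close> norms of the rows are square summable.\<close>

lemma AE_decay:
  fixes g :: "nat \<Rightarrow> int"
  assumes g: "inj g"
  shows "AE \<theta> in circ. \<forall>j<n1. (\<lambda>m. F True (g m) j \<theta>) \<longlonglongrightarrow> 0"
proof -
  have "AE \<theta> in circ. \<forall>j\<in>{..<n1}. (\<lambda>m. F True (g m) j \<theta>) \<longlonglongrightarrow> 0"
  proof (rule AE_ball_countable')
    fix j
    let ?a = "\<lambda>m k. X (True, k, g m, j)" and ?f = "\<lambda>m. F True (g m) j"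
    have f: "fourier_L2 (?a m) (?f m)" for m by (rule F)
    note sq = fourier_L2_sq[OF f, unfolded sq_integrable_def]
    have [measurable]: "?f m \<in> borel_measurable circ" for m using sq by blast
    have "(\<lambda>e. (cmod (X e))\<^sup>2) summable_on (\<lambda>(m, k). (True, k, g m, j)) ` (UNIV \<times> UNIV)"
      using l2_spaceD[OF X] summable_on_subset_banach by blast
    then have "(\<lambda>(m, k). (cmod (?a m k))\<^sup>2) summable_on (UNIV \<times> UNIV)"
      using g by (subst (asm) summable_on_reindex) (auto simp: inj_on_def o_def case_prod_unfold)
    then have "(\<lambda>m. \<Sum>\<^sub>\<infinity>k. (cmod (?a m k))\<^sup>2) summable_on UNIV"
      by (rule summable_on_Sigma_banach)
    \<comment> \<open>Summable norms make the integral of the series of squares finite; the series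
      then converges almost everywhere, and its terms tend to zero.\<close>
    then have sum: "summable (\<lambda>m. 4 * pi * (l2_norm (?a m))\<^sup>2)"
      by (intro summable_mult summable_on_imp_summable) (simp add: l2_norm_power2)
    have "(\<integral>\<^sup>+\<theta>. (\<Sum>m. ennreal ((cmod (?f m \<theta>))\<^sup>2)) \<partial>circ) = (\<Sum>m. \<integral>\<^sup>+\<theta>. ennreal ((cmod (?f m \<theta>))\<^sup>2) \<partial>circ)"
      by (rule nn_integral_suminf) simp
    also have "\<dots> \<le> (\<Sum>m. ennreal (4 * pi * (l2_norm (?a m))\<^sup>2))"
    proof (intro suminf_le allI)
      fix m
      have "(\<integral>\<^sup>+\<theta>. ennreal ((cmod (?f m \<theta>))\<^sup>2) \<partial>circ) = ennreal (LINT \<theta>|circ. (cmod (?f m \<theta>))\<^sup>2)"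
        using sq by (intro nn_integral_eq_integral) auto
      also have "\<dots> \<le> ennreal (4 * pi * (l2_norm (?a m))\<^sup>2)"
        by (intro ennreal_leI fourier_L2_norm_le[OF f] row_l2[OF X])
      finally show "(\<integral>\<^sup>+\<theta>. ennreal ((cmod (?f m \<theta>))\<^sup>2) \<partial>circ) \<le> ennreal (4 * pi * (l2_norm (?a m))\<^sup>2)" .
    qed simp_all
    also have "\<dots> = ennreal (\<Sum>m. 4 * pi * (l2_norm (?a m))\<^sup>2)" by (rule suminf_ennreal2[OF _ sum]) simp
    finally have "(\<integral>\<^sup>+\<theta>. (\<Sum>m. ennreal ((cmod (?f m \<theta>))\<^sup>2)) \<partial>circ) \<noteq> \<infinity>" by (auto simp: top_unique)
    then have "AE \<theta> in circ. (\<Sum>m. ennreal ((cmod (?f m \<theta>))\<^sup>2)) \<noteq> \<infinity>" by (intro nn_integral_PInf_AE) simp_all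
    then show "AE \<theta> in circ. (\<lambda>m. ?f m \<theta>) \<longlonglongrightarrow> 0"
    proof (rule AE_mp, intro AE_I2 impI)
      fix \<theta> assume "(\<Sum>m. ennreal ((cmod (?f m \<theta>))\<^sup>2)) \<noteq> \<infinity>"
      then have "summable (\<lambda>m. (cmod (?f m \<theta>))\<^sup>2)" by (intro summable_suminf_not_top) auto
      then have "(\<lambda>m. sqrt ((cmod (?f m \<theta>))\<^sup>2)) \<longlonglongrightarrow> sqrt 0" by (intro tendsto_real_sqrt summable_LIMSEQ_zero)
      then show "(\<lambda>m. ?f m \<theta>) \<longlonglongrightarrow> 0" by (simp add: tendsto_norm_zero_iff)
    qed
  qed simp
  then show ?thesis by (simp only: Ball_def lessThan_iff)
qed

end

end

lemma (in pos_pair) mult_blk: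
  assumes x: "x \<in> carrier_vec (2 * n)" and u: "u \<in> carrier_vec n" and w: "w \<in> carrier_vec n"
    and eq: "\<And>i. i < n \<Longrightarrow> x $ i = u $ i" "\<And>i. i < n \<Longrightarrow> x $ (n + i) = w $ i" and i: "i < n"
  shows "(K *\<^sub>v x) $ i = (LL *\<^sub>v u) $ i + (LR *\<^sub>v w) $ i"
    "(K *\<^sub>v x) $ (n + i) = (RL *\<^sub>v u) $ i + (RR *\<^sub>v w) $ i"
proof -
  have Kc: "K \<in> carrier_mat (2 * n) (2 * n)" using K unfolding pos_def_UNIV_iff by blast
  have i': "i < 2 * n" "n + i < 2 * n" using i by auto
  note m = mult_mat_vec_nth[OF Kc x i'(1)] mult_mat_vec_nth[OF Kc x i'(2)]
    mult_mat_vec_nth[OF blk_carrier(1) u i] mult_mat_vec_nth[OF blk_carrier(2) w i]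
    mult_mat_vec_nth[OF blk_carrier(3) u i] mult_mat_vec_nth[OF blk_carrier(4) w i]
  show "(K *\<^sub>v x) $ i = (LL *\<^sub>v u) $ i + (LR *\<^sub>v w) $ i"
    "(K *\<^sub>v x) $ (n + i) = (RL *\<^sub>v u) $ i + (RR *\<^sub>v w) $ i"
    unfolding m sum_double using i by (simp_all add: blk_nth eq)
qed

lemma pos_def_swap_pair:
  assumes K: "pos_def UNIV (2 * n) K" shows "pos_def UNIV (2 * n) (swap_pair n K)"
proof -
  interpret pos_pair n K by standard (rule K)
  let ?K = "swap_pair n K"
  have nth: "?K $$ (i, j) = K $$ (if i < n then n + i else i - n, if j < n then n + j else j - n)"
    if "i < 2 * n" "j < 2 * n" for i j
  proof -
    have d: "dim_col RR = n" "dim_col LL = n" by (rule carrier_matD(2), rule blk_carrier)+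
    have "i < dim_row RR + dim_row LL" "j < dim_col RR + dim_col LL" using that d by auto
    from index_mat_four_block(1)[OF this, of RL LR] show ?thesis
      using that by (auto simp: swap_pair_def d blk_nth)
  qed
  have c: "?K \<in> carrier_mat (2 * n) (2 * n)"
    unfolding swap_pair_def mult_2 by (rule four_block_carrier_mat[OF blk_carrier(4,1)])
  have Kc: "K \<in> carrier_mat (2 * n) (2 * n)" using K unfolding pos_def_UNIV_iff by blast
  show ?thesis unfolding pos_def_UNIV_iff
  proof (intro conjI allI impI ballI c)
    fix i j assume ij: "i < 2 * n" "j < 2 * n"
    show "?K $$ (j, i) = cnj (?K $$ (i, j))"
      unfolding nth[OF ij] nth[OF ij(2,1)] by (rule K_herm) (use ij in auto)
  next
    fix v :: "complex vec" assume v: "v \<in> carrier_vec (2 * n)" "v \<noteq> 0\<^sub>v (2 * n)"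
    define w where "w = vec (2 * n) (\<lambda>i. v $ (if i < n then n + i else i - n))"
    have w: "w \<in> carrier_vec (2 * n)" by (simp add: w_def)
    obtain i where i: "i < 2 * n" "v $ i \<noteq> 0" using v by (metis carrier_vecD eq_vecI index_zero_vec)
    have "w $ (if i < n then n + i else i - n) = v $ i" using i by (auto simp: w_def)
    then have "w \<noteq> 0\<^sub>v (2 * n)" using i by (auto split: if_splits)
    then have "0 < Re (ip w (K *\<^sub>v w))" using K w unfolding pos_def_UNIV_iff by blast
    also have "ip w (K *\<^sub>v w) = (\<Sum>i<2 * n. \<Sum>j<2 * n. cnj (w $ i) * K $$ (i, j) * w $ j)"
      using Kc w by (simp add: ip_def mult_mat_vec_nth sum_distrib_left mult.assoc del: index_mult_mat_vec)
    also have "\<dots> = (\<Sum>i<2 * n. \<Sum>j<2 * n. cnj (v $ i) * ?K $$ (i, j) * v $ j)"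
      unfolding sum_double by (simp add: nth w_def sum.distrib add_ac)
    also have "\<dots> = ip v (?K *\<^sub>v v)"
      using c v by (simp add: ip_def mult_mat_vec_nth sum_distrib_left mult.assoc del: index_mult_mat_vec)
    finally show "0 < Re (ip v (?K *\<^sub>v v))" .
  qed
qed

section \<open>Symbols of the strip and of the half-planes\<close>

context lattice
begin

lemma sn_simps [simp]: "j < n1 \<Longrightarrow> sn j = (South, j)" "sn (n1 + j) = (North, j)"
  by (simp_all add: sn_def)

lemma shape_Line: "shape n1 n2 Line Unit = {South, North} \<times> UNIV \<times> {..<n1}"
  "shape n1 n2 Line Neg = {North} \<times> UNIV \<times> {..<n1}" "shape n1 n2 Line Pos = {South} \<times> UNIV \<times> {..<n1}"
  by (auto simp: shape_def)

text \<open>A region of horizontal extent \<open>Line\<close> has no West or East side, so all its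
  vertical edges are interior.\<close>

lemma vertical_balance:
  assumes 0: "\<And>e. e \<in> edges (region Line v) \<Longrightarrow> e \<notin> embed Line v ` shape n1 n2 Line v \<Longrightarrow> form (region Line v) (delta e) X = 0"
    and l: "l \<in> positions v" and j: "j < n2"
  shows "face_force X (k, l) (West, j) + face_force X (k - 1, l) (East, j) = 0"
proof -
  have "(False, k, l, j) \<notin> embed Line v ` shape n1 n2 Line v" by (auto simp: shape_def)
  moreover have "(False, k, l, j) \<in> edges (region Line v)" using l j edges_iff(2)[of k l j Line v] by simp
  ultimately have "form (region Line v) (delta (False, k, l, j)) X = 0" by (rule 0[rotated])
  then show ?thesis using l by (simp add: form_delta_vertical[OF j])
qed

text \<open>The rows on both sides of the edge lie in the region, so the edge is interior.\<close>

lemma horizontal_balance: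
  assumes 0: "\<And>e. e \<in> edges (region Line v) \<Longrightarrow> e \<notin> embed Line v ` shape n1 n2 Line v \<Longrightarrow> form (region Line v) (delta e) X = 0"
    and l: "l \<in> positions v" "l - 1 \<in> positions v" and j: "j < n1"
  shows "face_force X (k, l) (South, j) + face_force X (k, l - 1) (North, j) = 0"
proof -
  have "(True, k, l, j) \<notin> embed Line v ` shape n1 n2 Line v" using l by (cases v) (auto simp: shape_def)
  moreover have "(True, k, l, j) \<in> edges (region Line v)" using l j edges_iff(1)[of k l j Line v] by simp
  ultimately have "form (region Line v) (delta (True, k, l, j)) X = 0" by (rule 0[rotated])
  then show ?thesis using l by (simp add: form_delta_horizontal[OF j])
qed

text \<open>A strip is one row with both horizontal sides on the boundary: once the vertical edges
  are eliminated, the remaining forces are the output.\<close>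

theorem strip_symbol:
  assumes S: "\<And>\<theta>. is_strip (cis (- \<theta>)) (S (cis \<theta>))"
  shows "has_symbol \<K> [South, North] n1 S (dtn Line Unit)"
  unfolding has_symbol_def
proof
  let ?D = "dtn Line Unit"
  fix x assume "x \<in> \<L> (set [South, North] \<times> (UNIV :: int set) \<times> {..<n1})"
  then have x: "x \<in> \<L> (shape n1 n2 Line Unit)" by (simp add: shape_Line)
  obtain X where X: "X \<in> \<L> (edges (region Line Unit))" "\<And>a. a \<in> shape n1 n2 Line Unit \<Longrightarrow> X (embed Line Unit a) = x a"
    "\<And>a. a \<in> shape n1 n2 Line Unit \<Longrightarrow> form (region Line Unit) (delta (embed Line Unit a)) X = ?D x a"
    "\<And>e. e \<in> edges (region Line Unit) \<Longrightarrow> e \<notin> embed Line Unit ` shape n1 n2 Line Unit \<Longrightarrow> form (region Line Unit) (delta e) X = 0"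
    using dtn_strongE[OF x] by blast
  obtain F where F: "\<And>h l j. fourier_L2 (\<lambda>k. X (h, k, l, j)) (F h l j)" using transforms_ex[OF X(1)] by blast
  have bd: "X (True, k, 0, j) = x (South, k, j)" "X (True, k, 1, j) = x (North, k, j)" if "j < n1" for k j
    using X(2)[of "(South, k, j)"] X(2)[of "(North, k, j)"] that by (simp_all add: shape_Line)
  have force: "face_force X (k, 0) (South, j) = ?D x (South, k, j)" "face_force X (k, 0) (North, j) = ?D x (North, k, j)"
    if "j < n1" for k j
    using X(3)[of "(South, k, j)"] X(3)[of "(North, k, j)"] that by (simp_all add: shape_Line form_delta_horizontal)
  have ae: "AE \<theta> in circ. \<forall>i<2 * n1. row_force F 0 \<theta> (sn i) = (S (cis \<theta>) *\<^sub>v hvec F 0 \<theta>) $ i"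
    by (rule AE_strip[OF X(1) F vertical_balance[OF X(4)] S]) simp_all
  have out: "fourier_L2 (\<lambda>k. face_force X (k, 0) (sn i)) (\<lambda>\<theta>. (S (cis \<theta>) *\<^sub>v hvec F 0 \<theta>) $ i)" if "i < 2 * n1" for i
    by (rule fourier_L2_AE[OF fourier_force[OF X(1) F]], rule AE_mp[OF ae], intro AE_I2) (use that in blast)
  show "\<exists>f'. (\<forall>\<theta>. f' \<theta> \<in> carrier_vec (length [South, North] * n1)) \<and> (\<forall>p<length [South, North]. \<forall>j<n1.
      fourier_L2 (\<lambda>k. x ([South, North] ! p, k, j)) (\<lambda>\<theta>. f' \<theta> $ (p * n1 + j)) \<and>
      fourier_L2 (\<lambda>k. ?D x ([South, North] ! p, k, j)) (\<lambda>\<theta>. (S (cis \<theta>) *\<^sub>v f' \<theta>) $ (p * n1 + j)))"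
  proof (intro exI[of _ "hvec F 0"] conjI allI impI)
    show "hvec F 0 \<theta> \<in> carrier_vec (length [South, North] * n1)" for \<theta> by (simp add: hvec_def)
    fix p j assume p: "p < length [South, North]" and j: "j < n1"
    then consider "p = 0" | "p = 1" by fastforce
    then have "fourier_L2 (\<lambda>k. x ([South, North] ! p, k, j)) (\<lambda>\<theta>. hvec F 0 \<theta> $ (p * n1 + j)) \<and>
      fourier_L2 (\<lambda>k. ?D x ([South, North] ! p, k, j)) (\<lambda>\<theta>. (S (cis \<theta>) *\<^sub>v hvec F 0 \<theta>) $ (p * n1 + j))"
    proof cases
      case 1
      then show ?thesis using F[of True 0 j] out[of j] j by (simp add: hvec_def bd force del: index_mult_mat_vec)
    next
      case 2
      then show ?thesis using F[of True 1 j] out[of "n1 + j"] j by (simp add: hvec_def bd force del: index_mult_mat_vec)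
    qed
    then show "fourier_L2 (\<lambda>k. x ([South, North] ! p, k, j)) (\<lambda>\<theta>. hvec F 0 \<theta> $ (p * n1 + j))"
      "fourier_L2 (\<lambda>k. ?D x ([South, North] ! p, k, j)) (\<lambda>\<theta>. (S (cis \<theta>) *\<^sub>v hvec F 0 \<theta>) $ (p * n1 + j))" by blast+
  qed
qed

text \<open>At almost every angle the rows of a half-plane form a decaying chain of the strip symbol,
  numbered from the boundary.\<close>

theorem half_plane_symbol_Neg:
  assumes S: "\<And>\<theta>. is_strip (cis (- \<theta>)) (S (cis \<theta>))"
  shows "has_symbol \<K> [North] n1 (\<lambda>u. G_L n1 (S u)) (dtn Line Neg)"
  unfolding has_symbol_def
proof
  let ?D = "dtn Line Neg"
  fix x assume "x \<in> \<L> (set [North] \<times> (UNIV :: int set) \<times> {..<n1})"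
  then have x: "x \<in> \<L> (shape n1 n2 Line Neg)" by (simp add: shape_Line)
  obtain X where X: "X \<in> \<L> (edges (region Line Neg))" "\<And>a. a \<in> shape n1 n2 Line Neg \<Longrightarrow> X (embed Line Neg a) = x a"
    "\<And>a. a \<in> shape n1 n2 Line Neg \<Longrightarrow> form (region Line Neg) (delta (embed Line Neg a)) X = ?D x a"
    "\<And>e. e \<in> edges (region Line Neg) \<Longrightarrow> e \<notin> embed Line Neg ` shape n1 n2 Line Neg \<Longrightarrow> form (region Line Neg) (delta e) X = 0"
    using dtn_strongE[OF x] by blast
  obtain F where F: "\<And>h l j. fourier_L2 (\<lambda>k. X (h, k, l, j)) (F h l j)" using transforms_ex[OF X(1)] by blast
  define H where "H \<theta> m = vec n1 (\<lambda>j. F True (- int m) j \<theta>)" for \<theta> m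
  \<comment> \<open>Rows are numbered downwards from the boundary: row number m lies between the
    heights -m - 1 and -m, so its South side is the cut number m + 1.\<close>
  define r where "r m = - int (Suc m)" for m
  define a where "a \<theta> m = vec n1 (\<lambda>j. row_force F (r m) \<theta> (North, j))" for \<theta> m
  have bd: "X (True, k, 0, j) = x (North, k, j)" if "j < n1" for k j
    using X(2)[of "(North, k, j)"] that by (simp add: shape_Line)
  have force: "face_force X (k, - 1) (North, j) = ?D x (North, k, j)" if "j < n1" for k j
    using X(3)[of "(North, k, j)"] that by (simp add: shape_Line form_delta_horizontal)
  \<comment> \<open>There are countably many rows, so a single null set of angles serves them
    all.\<close>
  have strip: "AE \<theta> in circ. \<forall>m. \<forall>i<2 * n1. row_force F (r m) \<theta> (sn i) = (S (cis \<theta>) *\<^sub>v hvec F (r m) \<theta>) $ i"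
    by (subst AE_all_countable, intro allI AE_strip[OF X(1) F vertical_balance[OF X(4)] S]) (simp_all add: r_def)
  have rows: "AE \<theta> in circ. \<forall>m. \<forall>j<n1. row_force F (r m) \<theta> (South, j) + row_force F (r m - 1) \<theta> (North, j) = 0"
    by (subst AE_all_countable, rule allI, rule AE_rows_balanced[OF X(1) F horizontal_balance[OF X(4)]]) (simp_all add: r_def)
  have decay: "AE \<theta> in circ. \<forall>j<n1. (\<lambda>m. F True (- int m) j \<theta>) \<longlonglongrightarrow> 0"
    by (rule AE_decay[OF X(1) F]) (auto simp: inj_def)
  have ae: "AE \<theta> in circ. a \<theta> 0 = G_L n1 (S (cis \<theta>)) *\<^sub>v H \<theta> 0"
    using strip rows decay
  proof eventually_elim
    case (elim \<theta>)
    let ?K = "S (cis \<theta>)"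
    have Kp: "pos_def UNIV (2 * n1) ?K" by (rule is_strip_pos_def[OF _ S]) simp
    interpret K: pos_pair n1 ?K by standard (rule Kp)
    have c: "H \<theta> m \<in> carrier_vec n1" "a \<theta> m \<in> carrier_vec n1" "hvec F l \<theta> \<in> carrier_vec (2 * n1)" for m l
      by (auto simp: H_def a_def hvec_def)
    have "(?K *\<^sub>v hvec F (r m) \<theta>) $ i = (K.LL *\<^sub>v H \<theta> (Suc m)) $ i + (K.LR *\<^sub>v H \<theta> m) $ i"
      "(?K *\<^sub>v hvec F (r m) \<theta>) $ (n1 + i) = (K.RL *\<^sub>v H \<theta> (Suc m)) $ i + (K.RR *\<^sub>v H \<theta> m) $ i" if "i < n1" for m i
      by (rule K.mult_blk[OF c(3) c(1) c(1) _ _ that]; simp add: hvec_def H_def r_def)+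
    with elim(1) have f: "row_force F (r m) \<theta> (South, i) = (K.LL *\<^sub>v H \<theta> (Suc m)) $ i + (K.LR *\<^sub>v H \<theta> m) $ i"
      "row_force F (r m) \<theta> (North, i) = (K.RL *\<^sub>v H \<theta> (Suc m)) $ i + (K.RR *\<^sub>v H \<theta> m) $ i" if "i < n1" for m i
      using that elim(1)[rule_format, of i m] elim(1)[rule_format, of "n1 + i" m] by (simp_all del: index_mult_mat_vec)
    show ?case
    proof (rule K.chain_force[OF riccati_G_L[OF Kp] c(1,2)])
      fix m
      show "K.RL *\<^sub>v H \<theta> (Suc m) + K.RR *\<^sub>v H \<theta> m = a \<theta> m"
        by (rule eq_vecI) (auto simp: a_def f simp del: index_mult_mat_vec)
      have "r m - 1 = r (Suc m)" by (simp add: r_def)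
      show "K.LL *\<^sub>v H \<theta> (Suc m) + K.LR *\<^sub>v H \<theta> m = - a \<theta> (Suc m)"
      proof (rule eq_vecI)
        fix i assume "i < dim_vec (- a \<theta> (Suc m))"
        then have i: "i < n1" by (simp add: a_def)
        have "row_force F (r m) \<theta> (South, i) = - row_force F (r (Suc m)) \<theta> (North, i)"
          using elim(2)[rule_format, OF i, of m] \<open>r m - 1 = r (Suc m)\<close> by (simp add: eq_neg_iff_add_eq_0)
        then show "(K.LL *\<^sub>v H \<theta> (Suc m) + K.LR *\<^sub>v H \<theta> m) $ i = (- a \<theta> (Suc m)) $ i"
          using i by (simp add: f a_def del: index_mult_mat_vec)
      qed (simp add: a_def)
    qed (use elim(3) in \<open>simp add: H_def\<close>)
  qed
  show "\<exists>f'. (\<forall>\<theta>. f' \<theta> \<in> carrier_vec (length [North] * n1)) \<and> (\<forall>p<length [North]. \<forall>j<n1.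
      fourier_L2 (\<lambda>k. x ([North] ! p, k, j)) (\<lambda>\<theta>. f' \<theta> $ (p * n1 + j)) \<and>
      fourier_L2 (\<lambda>k. ?D x ([North] ! p, k, j)) (\<lambda>\<theta>. (G_L n1 (S (cis \<theta>)) *\<^sub>v f' \<theta>) $ (p * n1 + j)))"
  proof (intro exI[of _ "\<lambda>\<theta>. H \<theta> 0"] conjI allI impI)
    show "H \<theta> 0 \<in> carrier_vec (length [North] * n1)" for \<theta> by (simp add: H_def)
    fix p j assume "p < length [North]" and j: "j < n1"
    then have p: "p = 0" by simp
    show "fourier_L2 (\<lambda>k. x ([North] ! p, k, j)) (\<lambda>\<theta>. H \<theta> 0 $ (p * n1 + j))"
      using F[of True 0 j] j by (simp add: p H_def bd)
    have "AE \<theta> in circ. row_force F (- 1) \<theta> (North, j) = (G_L n1 (S (cis \<theta>)) *\<^sub>v H \<theta> 0) $ j"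
      using ae
    proof eventually_elim
      case (elim \<theta>)
      have "a \<theta> 0 $ j = row_force F (- 1) \<theta> (North, j)" using j by (simp add: a_def r_def)
      then show ?case by (simp only: elim)
    qed
    from fourier_L2_AE[OF fourier_force[OF X(1) F] this]
    show "fourier_L2 (\<lambda>k. ?D x ([North] ! p, k, j)) (\<lambda>\<theta>. (G_L n1 (S (cis \<theta>)) *\<^sub>v H \<theta> 0) $ (p * n1 + j))"
      using j by (simp add: p force del: index_mult_mat_vec)
  qed
qed

text \<open>Counted from the boundary of a Northern half-plane, each row is met from its South side;
  exchanging the sides of the symbol gives the chain the orientation of the Southern case.\<close>

theorem half_plane_symbol_Pos:
  assumes S: "\<And>\<theta>. is_strip (cis (- \<theta>)) (S (cis \<theta>))"
  shows "has_symbol \<K> [South] n1 (\<lambda>u. G_R n1 (S u)) (dtn Line Pos)"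
  unfolding has_symbol_def
proof
  let ?D = "dtn Line Pos"
  fix x assume "x \<in> \<L> (set [South] \<times> (UNIV :: int set) \<times> {..<n1})"
  then have x: "x \<in> \<L> (shape n1 n2 Line Pos)" by (simp add: shape_Line)
  obtain X where X: "X \<in> \<L> (edges (region Line Pos))" "\<And>a. a \<in> shape n1 n2 Line Pos \<Longrightarrow> X (embed Line Pos a) = x a"
    "\<And>a. a \<in> shape n1 n2 Line Pos \<Longrightarrow> form (region Line Pos) (delta (embed Line Pos a)) X = ?D x a"
    "\<And>e. e \<in> edges (region Line Pos) \<Longrightarrow> e \<notin> embed Line Pos ` shape n1 n2 Line Pos \<Longrightarrow> form (region Line Pos) (delta e) X = 0"
    using dtn_strongE[OF x] by blast
  obtain F where F: "\<And>h l j. fourier_L2 (\<lambda>k. X (h, k, l, j)) (F h l j)" using transforms_ex[OF X(1)] by blast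
  define H where "H \<theta> m = vec n1 (\<lambda>j. F True (int m) j \<theta>)" for \<theta> m
    define a where "a \<theta> m = vec n1 (\<lambda>j. row_force F (int m) \<theta> (South, j))" for \<theta> m
  have bd: "X (True, k, 0, j) = x (South, k, j)" if "j < n1" for k j
    using X(2)[of "(South, k, j)"] that by (simp add: shape_Line)
  have force: "face_force X (k, 0) (South, j) = ?D x (South, k, j)" if "j < n1" for k j
    using X(3)[of "(South, k, j)"] that by (simp add: shape_Line form_delta_horizontal)
  have strip: "AE \<theta> in circ. \<forall>m. \<forall>i<2 * n1. row_force F (int m) \<theta> (sn i) = (S (cis \<theta>) *\<^sub>v hvec F (int m) \<theta>) $ i"
    by (subst AE_all_countable, rule allI, rule AE_strip[OF X(1) F vertical_balance[OF X(4)] S]) simp_all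
  have rows: "AE \<theta> in circ. \<forall>m. \<forall>j<n1. row_force F (int (Suc m)) \<theta> (South, j) + row_force F (int (Suc m) - 1) \<theta> (North, j) = 0"
    by (subst AE_all_countable, rule allI, rule AE_rows_balanced[OF X(1) F horizontal_balance[OF X(4)]]) simp_all
  have decay: "AE \<theta> in circ. \<forall>j<n1. (\<lambda>m. F True (int m) j \<theta>) \<longlonglongrightarrow> 0"
    by (rule AE_decay[OF X(1) F]) (auto simp: inj_def)
  have ae: "AE \<theta> in circ. a \<theta> 0 = G_R n1 (S (cis \<theta>)) *\<^sub>v H \<theta> 0"
    using strip rows decay
  proof eventually_elim
    case (elim \<theta>)
    let ?K = "S (cis \<theta>)"
    have Kp: "pos_def UNIV (2 * n1) ?K" by (rule is_strip_pos_def[OF _ S]) simp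
    interpret K0: pos_pair n1 ?K by standard (rule Kp)
    interpret K: pos_pair n1 "swap_pair n1 ?K" by standard (rule pos_def_swap_pair[OF Kp])
    have c: "H \<theta> m \<in> carrier_vec n1" "a \<theta> m \<in> carrier_vec n1" "hvec F l \<theta> \<in> carrier_vec (2 * n1)" for m l
      by (auto simp: H_def a_def hvec_def)
    have "(?K *\<^sub>v hvec F (int m) \<theta>) $ i = (K0.LL *\<^sub>v H \<theta> m) $ i + (K0.LR *\<^sub>v H \<theta> (Suc m)) $ i"
      "(?K *\<^sub>v hvec F (int m) \<theta>) $ (n1 + i) = (K0.RL *\<^sub>v H \<theta> m) $ i + (K0.RR *\<^sub>v H \<theta> (Suc m)) $ i" if "i < n1" for m i
      by (rule K0.mult_blk[OF c(3) c(1) c(1) _ _ that]; simp add: hvec_def H_def add.commute)+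
    with elim(1) have f: "row_force F (int m) \<theta> (South, i) = (K.RR *\<^sub>v H \<theta> m) $ i + (K.RL *\<^sub>v H \<theta> (Suc m)) $ i"
      "row_force F (int m) \<theta> (North, i) = (K.LR *\<^sub>v H \<theta> m) $ i + (K.LL *\<^sub>v H \<theta> (Suc m)) $ i" if "i < n1" for m i
      using that elim(1)[rule_format, of i m] elim(1)[rule_format, of "n1 + i" m]
      by (simp_all add: blk_swap_pair del: index_mult_mat_vec)
    show ?case
      unfolding G_R_eq_G_L
    proof (rule K.chain_force[OF riccati_G_L[OF pos_def_swap_pair[OF Kp]] c(1,2)])
      fix m
      show "K.RL *\<^sub>v H \<theta> (Suc m) + K.RR *\<^sub>v H \<theta> m = a \<theta> m"
        by (rule eq_vecI) (auto simp: a_def f add.commute simp del: index_mult_mat_vec)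
      show "K.LL *\<^sub>v H \<theta> (Suc m) + K.LR *\<^sub>v H \<theta> m = - a \<theta> (Suc m)"
      proof (rule eq_vecI)
        fix i assume "i < dim_vec (- a \<theta> (Suc m))"
        then have i: "i < n1" by (simp add: a_def)
        have "int (Suc m) - 1 = int m" by simp
        then have "row_force F (int (Suc m)) \<theta> (South, i) + row_force F (int m) \<theta> (North, i) = 0"
          using elim(2)[rule_format, OF i, of m] by (simp only:)
        then have "row_force F (int m) \<theta> (North, i) = - row_force F (int (Suc m)) \<theta> (South, i)"
          by (simp only: eq_neg_iff_add_eq_0 add.commute)
        moreover have "(K.LL *\<^sub>v H \<theta> (Suc m) + K.LR *\<^sub>v H \<theta> m) $ i = row_force F (int m) \<theta> (North, i)"
          using i by (simp add: f(2) del: index_mult_mat_vec)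
        moreover have "(- a \<theta> (Suc m)) $ i = - row_force F (int (Suc m)) \<theta> (South, i)"
          using i by (simp add: a_def)
        ultimately show "(K.LL *\<^sub>v H \<theta> (Suc m) + K.LR *\<^sub>v H \<theta> m) $ i = (- a \<theta> (Suc m)) $ i" by simp
      qed (simp add: a_def)
    qed (use elim(3) in \<open>simp add: H_def\<close>)
  qed
  show "\<exists>f'. (\<forall>\<theta>. f' \<theta> \<in> carrier_vec (length [South] * n1)) \<and> (\<forall>p<length [South]. \<forall>j<n1.
      fourier_L2 (\<lambda>k. x ([South] ! p, k, j)) (\<lambda>\<theta>. f' \<theta> $ (p * n1 + j)) \<and>
      fourier_L2 (\<lambda>k. ?D x ([South] ! p, k, j)) (\<lambda>\<theta>. (G_R n1 (S (cis \<theta>)) *\<^sub>v f' \<theta>) $ (p * n1 + j)))"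
  proof (intro exI[of _ "\<lambda>\<theta>. H \<theta> 0"] conjI allI impI)
    show "H \<theta> 0 \<in> carrier_vec (length [South] * n1)" for \<theta> by (simp add: H_def)
    fix p j assume "p < length [South]" and j: "j < n1"
    then have p: "p = 0" by simp
    show "fourier_L2 (\<lambda>k. x ([South] ! p, k, j)) (\<lambda>\<theta>. H \<theta> 0 $ (p * n1 + j))"
      using F[of True 0 j] j by (simp add: p H_def bd)
    have "AE \<theta> in circ. row_force F 0 \<theta> (South, j) = (G_R n1 (S (cis \<theta>)) *\<^sub>v H \<theta> 0) $ j"
      using ae
    proof eventually_elim
      case (elim \<theta>)
      have "a \<theta> 0 $ j = row_force F 0 \<theta> (South, j)" using j by (simp add: a_def)
      then show ?case by (simp only: elim)
    qed
    from fourier_L2_AE[OF fourier_force[OF X(1) F] this]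
    show "fourier_L2 (\<lambda>k. ?D x ([South] ! p, k, j)) (\<lambda>\<theta>. (G_R n1 (S (cis \<theta>)) *\<^sub>v H \<theta> 0) $ (p * n1 + j))"
      using j by (simp add: p force del: index_mult_mat_vec)
  qed
qed

end

section \<open>Symmetries\<close>

text \<open>On the sides of a square, \<open>flip\<close> is the reflection in the diagonal and
  \<open>reflect\<close> the one in a vertical line; together they generate its symmetry
  group.\<close>

fun flip :: "edge \<Rightarrow> edge" where
  "flip South = West" | "flip West = South" | "flip North = East" | "flip East = North" | "flip Cut = Cut"

fun reflect :: "edge \<Rightarrow> edge" where
  "reflect West = East" | "reflect East = West" | "reflect e = e"

definition flip_label :: "label \<Rightarrow> label" where
  "flip_label = (\<lambda>(e, k, j). (flip e, k, j))"

fun flip_edge :: "lattice_edge \<Rightarrow> lattice_edge" where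
  "flip_edge (h, k, l, j) = (\<not> h, l, k, j)"

lemma flip_flip [simp]: "flip (flip e) = e" "flip_label (flip_label a) = a" "flip_edge (flip_edge c) = c"
proof -
  show ff: "flip (flip e) = e" for e by (cases e) simp_all
  show "flip_label (flip_label a) = a" by (simp add: flip_label_def ff case_prod_unfold)
  show "flip_edge (flip_edge c) = c" by (cases c) simp
qed

lemma sum_sum_reindex:
  assumes "bij_betw g A A"
  shows "(\<Sum>a\<in>A. \<Sum>b\<in>A. f a b :: complex) = (\<Sum>a\<in>A. \<Sum>b\<in>A. f (g a) (g b))"
proof -
  have "(\<Sum>a\<in>A. \<Sum>b\<in>A. f (g a) (g b)) = (\<Sum>a\<in>A. \<Sum>b\<in>A. f (g a) b)"
    by (intro sum.cong refl sum.reindex_bij_betw assms)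
  also have "\<dots> = (\<Sum>a\<in>A. \<Sum>b\<in>A. f a b)" by (rule sum.reindex_bij_betw[OF assms])
  finally show ?thesis by (rule sym)
qed

lemma bij_flip_label: "bij flip_label"
  by (rule involuntory_imp_bij) simp

text \<open>The reflection renames sides and keeps the positions along them, so the Fourier series
  and the symbol stay the same.\<close>

lemma has_symbol_flip:
  assumes s: "has_symbol \<K> es n F M"
    and M': "\<And>x. x \<in> l2_space \<K> (set (map flip es) \<times> UNIV \<times> {..<n}) \<Longrightarrow> M' x = (\<lambda>a. M (\<lambda>b. x (flip_label b)) (flip_label a))"
  shows "has_symbol \<K> (map flip es) n F M'"
  unfolding has_symbol_def
proof
  fix x :: "label \<Rightarrow> complex" assume x: "x \<in> l2_space \<K> (set (map flip es) \<times> UNIV \<times> {..<n})"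
  have l2: "l2 (\<lambda>b. x (flip_label b))"
    using l2_reindex[OF l2_spaceD[OF x] bij_is_inj[OF bij_flip_label]] by (simp add: restr_def)
  have "flip e \<in> flip ` A \<longleftrightarrow> e \<in> A" for e A by (metis flip_flip(1) image_iff)
  then have mem: "flip_label b \<in> set (map flip es) \<times> UNIV \<times> {..<n} \<longleftrightarrow> b \<in> set es \<times> UNIV \<times> {..<n}" for b
    by (cases b) (simp add: flip_label_def)
  have "(\<lambda>b. x (flip_label b)) \<in> l2_space \<K> (set es \<times> UNIV \<times> {..<n})"
    unfolding l2_space_iff
  proof (intro conjI ballI allI impI l2)
    note x' = x[unfolded l2_space_iff, THEN conjunct1, THEN bspec] x[unfolded l2_space_iff, THEN conjunct2, THEN conjunct1, rule_format]
    fix b :: label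
    show "x (flip_label b) \<in> \<K>" if "b \<in> set es \<times> UNIV \<times> {..<n}"
      by (rule x'(1)) (simp only: mem that)
    show "x (flip_label b) = 0" if "b \<notin> set es \<times> UNIV \<times> {..<n}"
      by (rule x'(2)) (use that in \<open>simp only: mem simp_thms\<close>)
  qed
  then obtain f' where f': "\<And>\<theta>. f' \<theta> \<in> carrier_vec (length es * n)"
    "\<And>p j. p < length es \<Longrightarrow> j < n \<Longrightarrow> fourier_L2 (\<lambda>k. x (flip_label (es ! p, k, j))) (\<lambda>\<theta>. f' \<theta> $ (p * n + j)) \<and>
        fourier_L2 (\<lambda>k. M (\<lambda>b. x (flip_label b)) (es ! p, k, j)) (\<lambda>\<theta>. (F (cis \<theta>) *\<^sub>v f' \<theta>) $ (p * n + j))"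
    using s[unfolded has_symbol_def, THEN bspec] by meson
  show "\<exists>f'. (\<forall>\<theta>. f' \<theta> \<in> carrier_vec (length (map flip es) * n)) \<and> (\<forall>p<length (map flip es). \<forall>j<n.
      fourier_L2 (\<lambda>k. x (map flip es ! p, k, j)) (\<lambda>\<theta>. f' \<theta> $ (p * n + j)) \<and>
      fourier_L2 (\<lambda>k. M' x (map flip es ! p, k, j)) (\<lambda>\<theta>. (F (cis \<theta>) *\<^sub>v f' \<theta>) $ (p * n + j)))"
  proof (intro exI[of _ f'] conjI allI impI)
    fix p j assume p: "p < length (map flip es)" and j: "j < n"
    then show "fourier_L2 (\<lambda>k. x (map flip es ! p, k, j)) (\<lambda>\<theta>. f' \<theta> $ (p * n + j))"
      "fourier_L2 (\<lambda>k. M' x (map flip es ! p, k, j)) (\<lambda>\<theta>. (F (cis \<theta>) *\<^sub>v f' \<theta>) $ (p * n + j))"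
      using f'(2)[of p j] by (simp_all add: M'[OF x] flip_label_def)
  qed (use f'(1) in simp)
qed

definition mirror :: "edge \<times> nat \<Rightarrow> edge \<times> nat" where
  "mirror a = (reflect (fst a), snd a)"

lemma mirror_mirror: "mirror (mirror a) = a"
proof -
  obtain e j where "a = (e, j)" by (rule prod.exhaust)
  then show ?thesis by (cases e) (simp_all add: mirror_def)
qed

context lattice
begin

lemma mirror_loc: "mirror a \<in> loc \<longleftrightarrow> a \<in> loc"
proof -
  obtain e j where "a = (e, j)" by (rule prod.exhaust)
  then show ?thesis by (cases e) (simp_all add: mirror_def loc_iff)
qed

text \<open>The horizontal multipliers of an arbitrary face operator are lattice operators of its
  mirror image; this makes the lattice results available for them.\<close>

lemma lattice_mirror: "lattice \<K> n1 n2 (\<lambda>a b. q (mirror a) (mirror b))"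
proof (intro lattice.intro lattice_axioms.intro, fold loc_def)
  show "scalars \<K>" by (rule scalars_axioms)
  fix a b assume "a \<in> loc" "b \<in> loc"
  then have ab: "mirror a \<in> loc" "mirror b \<in> loc" by (simp_all only: mirror_loc)
  show "q (mirror a) (mirror b) \<in> \<K>" by (rule q_K[OF ab])
  show "q (mirror b) (mirror a) = cnj (q (mirror a) (mirror b))" by (rule q_sym[OF ab])
next
  have bij: "bij_betw mirror loc loc"
    by (rule bij_betwI[where g = mirror]) (simp_all only: Pi_iff mirror_loc mirror_mirror, blast+)
  fix y :: "edge \<times> nat \<Rightarrow> complex"
  assume y: "\<And>a. a \<in> loc \<Longrightarrow> y a \<in> \<K>" "\<exists>a\<in>loc. y a \<noteq> 0"
  have "0 < Re (\<Sum>a\<in>loc. \<Sum>b\<in>loc. cnj (y (mirror a)) * q a b * y (mirror b))"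
  proof (rule q_pos)
    show "y (mirror a) \<in> \<K>" if "a \<in> loc" for a by (rule y(1)) (simp only: mirror_loc that)
    obtain a where "a \<in> loc" "y a \<noteq> 0" using y(2) by blast
    then show "\<exists>a\<in>loc. y (mirror a) \<noteq> 0" by (intro bexI[of _ "mirror a"]) (simp_all only: mirror_loc mirror_mirror simp_thms)
  qed
  also have "(\<Sum>a\<in>loc. \<Sum>b\<in>loc. cnj (y (mirror a)) * q a b * y (mirror b)) =
      (\<Sum>a\<in>loc. \<Sum>b\<in>loc. cnj (y (mirror (mirror a))) * q (mirror a) (mirror b) * y (mirror (mirror b)))"
    by (rule sum_sum_reindex[OF bij])
  finally show "0 < Re (\<Sum>a\<in>loc. \<Sum>b\<in>loc. cnj (y a) * q (mirror a) (mirror b) * y b)"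
    by (simp only: mirror_mirror)
qed

text \<open>Each face form is invariant, so the reflected equilibrium field is in equilibrium with
  the reflected boundary value.\<close>

lemma dtn_flip:
  assumes n: "n1 = n2"
    and q: "\<And>e i e' j. (e, i) \<in> loc \<Longrightarrow> (e', j) \<in> loc \<Longrightarrow> q (flip e, i) (flip e', j) = q (e, i) (e', j)"
    and x: "x \<in> \<L> (shape n1 n2 v h)"
  shows "dtn v h x = (\<lambda>a. dtn h v (\<lambda>b. x (flip_label b)) (flip_label a))"
proof -
  let ?I = "shape n1 n2 h v" and ?I' = "shape n1 n2 v h"
  have shp: "flip_label a \<in> ?I \<longleftrightarrow> a \<in> ?I'" for a
    by (cases a; cases "fst a"; auto simp: flip_label_def shape_iff n)
  have emb: "embed v h a = flip_edge (embed h v (flip_label a))" if "a \<in> ?I'" for a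
    using that by (cases a; cases "fst a"; auto simp: flip_label_def shape_iff)
  have edg: "flip_edge e \<in> edges (region v h) \<longleftrightarrow> e \<in> edges (region h v)" for e h v
  proof -
    have nn: "j < n1 \<longleftrightarrow> j < n2" for j by (simp add: n)
    obtain d k l j where "e = (d, k, l, j)" by (metis surj_pair)
    then show ?thesis by (cases d) (simp_all only: flip_edge.simps edges_iff nn not_True_eq_False not_False_eq_True conj_ac)
  qed
  have inj: "inj flip_edge" by (rule inj_on_inverseI[of _ flip_edge]) simp
  have flipL: "(\<lambda>e. X (flip_edge e)) \<in> \<L> (edges (region h v))" if "X \<in> \<L> (edges (region v h))" for h v X
  proof -
    have "l2 (restr UNIV (\<lambda>e. X (flip_edge e)))" by (rule l2_reindex[OF l2_spaceD[OF that] inj])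
    then have "l2 (\<lambda>e. X (flip_edge e))" by (simp add: restr_def)
    moreover have "X (flip_edge e) = 0" if "e \<notin> edges (region h v)" for e
      by (rule L_0[OF \<open>X \<in> \<L> (edges (region v h))\<close>]) (use that edg in blast)
    ultimately show ?thesis unfolding l2_space_iff using L_K[OF that] by blast
  qed
  have labL: "(\<lambda>b. y (flip_label b)) \<in> \<L> (shape n1 n2 h v)" if "y \<in> \<L> (shape n1 n2 v h)" for y h v
  proof -
    have *: "flip_label a \<in> shape n1 n2 v h \<longleftrightarrow> a \<in> shape n1 n2 h v" for a
      by (cases a; cases "fst a"; auto simp: flip_label_def shape_iff n)
    have "l2 (restr UNIV (\<lambda>b. y (flip_label b)))"
      by (rule l2_reindex[OF l2_spaceD[OF that] bij_is_inj[OF bij_flip_label]])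
    then have "l2 (\<lambda>b. y (flip_label b))" by (simp add: restr_def)
    moreover have "y (flip_label a) = 0" if "a \<notin> shape n1 n2 h v" for a
      by (rule L_0[OF \<open>y \<in> \<L> (shape n1 n2 v h)\<close>]) (use that * in blast)
    ultimately show ?thesis unfolding l2_space_iff using L_K[OF that] by blast
  qed
  let ?x = "\<lambda>b. x (flip_label b)"
  have x': "?x \<in> \<L> ?I" by (rule labL[OF x])
  obtain X where X: "X \<in> \<L> (edges (region h v))" "\<And>a. a \<in> ?I \<Longrightarrow> X (embed h v a) = ?x a"
    "\<And>Z. Z \<in> \<L> (edges (region h v)) \<Longrightarrow> form (region h v) Z X = l2_inner (pull (embed h v) ?I Z) (dtn h v ?x)"
    using dtn_weakE[OF x'] by blast
  show ?thesis
  proof (rule dtn_weakI[OF flipL[OF X(1)] _ x labL[OF coer_closed[OF dtn_coer x']]])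
    show "X (flip_edge (embed v h a)) = x a" if "a \<in> ?I'" for a
      using X(2)[of "flip_label a"] that by (simp add: emb shp)
    fix Z assume Z: "Z \<in> \<L> (edges (region v h))"
    let ?\<tau> = "\<lambda>(e, i). (flip e, i :: nat)"
    have bij: "bij_betw ?\<tau> loc loc"
    proof (rule bij_betwI[where g = ?\<tau>])
      show "?\<tau> \<in> loc \<rightarrow> loc"
      proof
        fix a assume "a \<in> loc"
        then show "?\<tau> a \<in> loc" by (cases a; cases "fst a"; auto simp: loc_iff n)
      qed
      then show "?\<tau> \<in> loc \<rightarrow> loc" .
      show "?\<tau> (?\<tau> a) = a" for a by (cases a) simp
      show "?\<tau> (?\<tau> a) = a" for a by (cases a) simp
    qed
    have side: "side_edge (snd \<phi>, fst \<phi>) (?\<tau> a) = flip_edge (side_edge \<phi> a)" if "a \<in> loc" for \<phi> a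
      using that by (cases \<phi>; cases a; cases "fst a"; auto simp: loc_iff)
    have ff: "face_form (snd \<phi>, fst \<phi>) Z (\<lambda>e. X (flip_edge e)) = face_form \<phi> (\<lambda>e. Z (flip_edge e)) X" for \<phi>
    proof -
      have "face_form (snd \<phi>, fst \<phi>) Z (\<lambda>e. X (flip_edge e)) =
        (\<Sum>a\<in>loc. \<Sum>b\<in>loc. cnj (Z (side_edge (snd \<phi>, fst \<phi>) (?\<tau> a))) * q (?\<tau> a) (?\<tau> b) * X (flip_edge (side_edge (snd \<phi>, fst \<phi>) (?\<tau> b))))"
        unfolding face_form_def by (rule sum_sum_reindex[OF bij])
      also have "\<dots> = face_form \<phi> (\<lambda>e. Z (flip_edge e)) X"
        unfolding face_form_def
      proof (intro sum.cong refl)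
        fix a b assume ab: "a \<in> loc" "b \<in> loc"
        then have "q (?\<tau> a) (?\<tau> b) = q a b" using q[of "fst a" "snd a" "fst b" "snd b"] by (simp add: case_prod_unfold)
        then show "cnj (Z (side_edge (snd \<phi>, fst \<phi>) (?\<tau> a))) * q (?\<tau> a) (?\<tau> b) * X (flip_edge (side_edge (snd \<phi>, fst \<phi>) (?\<tau> b))) =
          cnj (Z (flip_edge (side_edge \<phi> a))) * q a b * X (side_edge \<phi> b)"
          unfolding side[OF ab(1)] side[OF ab(2)] flip_flip by simp
      qed
      finally show ?thesis .
    qed
    have "form (region v h) Z (\<lambda>e. X (flip_edge e)) = form (region h v) (\<lambda>e. Z (flip_edge e)) X"
      unfolding form_def
      by (rule infsum_reindex_bij_witness[where i = "\<lambda>\<phi>. (snd \<phi>, fst \<phi>)" and j = "\<lambda>\<phi>. (snd \<phi>, fst \<phi>)"])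
        (auto simp: ff[symmetric])
    also have "\<dots> = l2_inner (pull (embed h v) ?I (\<lambda>e. Z (flip_edge e))) (dtn h v ?x)" by (rule X(3)[OF flipL[OF Z]])
    also have "\<dots> = l2_inner (\<lambda>a. pull (embed h v) ?I (\<lambda>e. Z (flip_edge e)) (flip_label a)) (\<lambda>a. dtn h v ?x (flip_label a))"
      unfolding l2_inner_def by (rule infsum_reindex_bij_betw[OF bij_flip_label, symmetric])
    also have "(\<lambda>a. pull (embed h v) ?I (\<lambda>e. Z (flip_edge e)) (flip_label a)) = pull (embed v h) ?I' Z"
      by (rule ext) (auto simp: pull_def restr_def shp emb)
    finally show "form (region v h) Z (\<lambda>e. X (flip_edge e)) = l2_inner (pull (embed v h) ?I' Z) (\<lambda>a. dtn h v ?x (flip_label a))" .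
  qed
qed

end

section \<open>The strip functions of a face operator\<close>

context lattice
begin

lemma sn_cases: "i < 2 * n1 \<Longrightarrow> sn i \<in> loc" "reflect (fst (sn i)) = fst (sn i)" "face_index n1 n2 (sn i) = i"
  by (auto simp: sn_def loc_iff face_index_def)

lemma mirror_sn [simp]: "mirror (sn i) = sn i"
  by (simp add: mirror_def sn_cases(2))

lemma mirror_simps [simp]: "mirror (West, j) = (East, j)" "mirror (East, j) = (West, j)"
  by (simp_all add: mirror_def)

text \<open>With the Fourier series \<open>\<Sum>\<^sub>k a(k) e\<^sup>i\<^sup>k\<^sup>\<theta>\<close> the symbol of a row is the strip function at
  \<open>e\<^sup>-\<^sup>i\<^sup>\<theta>\<close>, which is the strip function at \<open>e\<^sup>i\<^sup>\<theta>\<close> of the mirrored face operator.\<close>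

lemma is_strip_WE:
  assumes q: "\<And>a b. a \<in> loc \<Longrightarrow> b \<in> loc \<Longrightarrow> q a b = face_kernel n1 n2 Q (mirror a) (mirror b)"
  shows "is_strip (cis (- \<theta>)) (strip_WE n1 n2 Q (cis \<theta>))"
proof -
  have c: "inverse (cis (- \<theta>)) = cis \<theta>" "inverse (cis \<theta>) = cis (- \<theta>)" by simp_all
  have cc: "cis \<theta> * (cis (- \<theta>) * y) = y" "cis (- \<theta>) * (cis \<theta> * y) = y" for y
    by (simp_all add: mult.assoc[symmetric] cis_mult)
  have ix: "face_index n1 n2 (West, j) = 2 * n1 + j" "face_index n1 n2 (East, j) = 2 * n1 + n2 + j" for j
    by (simp_all add: face_index_def)
  note k = face_kernel_def ix sn_cases(3) secSN_def q sn_cases(1) loc_iff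
  show ?thesis
    unfolding strip_WE_def Let_def
  \<comment> \<open>The West edge of \<open>Q\<close> is the East edge of the mirrored face. The
    strip function is thus written in the field on the East edge, which is
    \<open>cis (- \<theta>)\<close> times the one on the West edge, and c compensates.\<close>
  proof (rule is_stripI[where c = "cis \<theta>"])
    show "phi_WE n1 n2 Q (cis \<theta>) = strip_mat (cis (- \<theta>))"
      by (rule eq_matI) (auto simp: phi_WE_def strip_mat_def k c)
  qed (auto simp: k c cc distrib_left)
qed

end

text \<open>\<open>phi_SN\<close> and the off-diagonal factors of \<open>strip_SN\<close> use opposite orientations of \<open>w\<close>; the
  mirror invariance makes this difference disappear.\<close>

lemma (in lattice) is_strip_SN:
  assumes n: "n1 = n2"
    and q: "q = face_kernel n1 n2 Q"
    and flip: "\<And>e i e' j. (e, i) \<in> loc \<Longrightarrow> (e', j) \<in> loc \<Longrightarrow> q (flip e, i) (flip e', j) = q (e, i) (e', j)"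
    and mirror: "\<And>a b. a \<in> loc \<Longrightarrow> b \<in> loc \<Longrightarrow> q (mirror a) (mirror b) = q a b"
  shows "is_strip (cis (- \<theta>)) (strip_SN n1 n2 Q (cis \<theta>))"
proof -
  have c: "inverse (cis (- \<theta>)) = cis \<theta>" "inverse (cis \<theta>) = cis (- \<theta>)" by simp_all
  \<comment> \<open>The vertical labels in the order of the coordinates of \<open>strip_SN\<close>;
    \<open>flip\<close> matches them with the horizontal labels listed by \<open>sn\<close>.\<close>
  define r where "r i = (if i < n1 then (West, i) else (East, i - n1))" for i :: nat
  have r: "q (r i) (r j) = q (sn i) (sn j)" "q (r i) (South, l) = q (sn i) (West, l)" "q (r i) (North, l) = q (sn i) (East, l)"
    "q (South, l) (r i) = q (West, l) (sn i)" "q (North, l) (r i) = q (East, l) (sn i)"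
    if "i < 2 * n1" "j < 2 * n1" "l < n1" for i j l
  proof -
    have rs: "r k = (flip (fst (sn k)), snd (sn k))" for k by (simp add: r_def sn_def)
    have loc: "(fst (sn i), snd (sn i)) \<in> loc" "(fst (sn j), snd (sn j)) \<in> loc" "(West, l) \<in> loc" "(East, l) \<in> loc"
      using sn_cases(1) that n by (simp_all add: loc_iff)
    show "q (r i) (r j) = q (sn i) (sn j)" "q (r i) (South, l) = q (sn i) (West, l)" "q (r i) (North, l) = q (sn i) (East, l)"
      "q (South, l) (r i) = q (West, l) (sn i)" "q (North, l) (r i) = q (East, l) (sn i)"
      unfolding rs
      using flip[OF loc(1,2)] flip[OF loc(1,3)] flip[OF loc(1,4)] flip[OF loc(3,1)] flip[OF loc(4,1)] by simp_all
  qed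
  have Q: "q (r i) (r j) = Q $$ (2 * n1 + i, 2 * n1 + j)" "q (r i) (South, l) = Q $$ (2 * n1 + i, l)"
    "q (r i) (North, l) = Q $$ (2 * n1 + i, n1 + l)" "q (South, l) (r i) = Q $$ (l, 2 * n1 + i)"
    "q (North, l) (r i) = Q $$ (n1 + l, 2 * n1 + i)" for i j l
    unfolding q by (auto simp: face_kernel_def face_index_def r_def n)
  have QR: "i < 2 * n1 \<Longrightarrow> j < 2 * n1 \<Longrightarrow> Q $$ (2 * n1 + i, 2 * n1 + j) = q (sn i) (sn j)" for i j
    using r(1)[of i j 0] by (simp add: Q(1)[symmetric])
  have QR2: "Q $$ (2 * n1 + i, l) = q (sn i) (West, l)" "Q $$ (2 * n1 + i, n1 + l) = q (sn i) (East, l)"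
    "Q $$ (l, 2 * n1 + i) = q (West, l) (sn i)" "Q $$ (n1 + l, 2 * n1 + i) = q (East, l) (sn i)"
    if "i < 2 * n1" "l < n1" for i l
    using r(2-5)[OF that(1) that(1) that(2)] unfolding Q by blast+
  have phi: "Q $$ (i, j) = q (West, i) (West, j)" "Q $$ (n1 + i, n1 + j) = q (East, i) (East, j)"
    "Q $$ (i, n1 + j) = q (East, i) (West, j)" "Q $$ (n1 + i, j) = q (West, i) (East, j)" if "i < n1" "j < n1" for i j
  proof -
    have "q (South, i) (South, j) = q (West, i) (West, j)" "q (North, i) (North, j) = q (East, i) (East, j)"
      "q (South, i) (North, j) = q (West, i) (East, j)" "q (North, i) (South, j) = q (East, i) (West, j)"
      "q (West, i) (East, j) = q (East, i) (West, j)"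
      using that flip[of West i West j] flip[of East i East j] flip[of West i East j] flip[of East i West j]
        mirror[of "(East, i)" "(West, j)"] n by (simp_all add: loc_iff mirror_def)
    then show "Q $$ (i, j) = q (West, i) (West, j)" "Q $$ (n1 + i, n1 + j) = q (East, i) (East, j)"
      "Q $$ (i, n1 + j) = q (East, i) (West, j)" "Q $$ (n1 + i, j) = q (West, i) (East, j)"
      unfolding q by (simp_all add: face_kernel_def face_index_def)
  qed
  have S: "strip_mat (cis (- \<theta>)) = mat n1 n1 (\<lambda>(i, j). q (West, i) (West, j) + q (East, i) (East, j) +
     cis (- \<theta>) * q (West, i) (East, j) + inverse (cis (- \<theta>)) * q (East, i) (West, j))"
    unfolding strip_mat_def using n by simp
  show ?thesis
    unfolding strip_SN_def Let_def
  proof (rule is_stripI[where c = 1])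
    show "phi_SN n1 n2 Q (cis \<theta>) = strip_mat (cis (- \<theta>))"
      unfolding S by (rule eq_matI) (auto simp: phi_SN_def phi c)
  qed (auto simp: secWE_def QR QR2 c n[symmetric])
qed

lemma dihedral_kernel:
  assumes "dihedral_invariant \<K> n1 n2 Q"
  shows "n1 = n2"
    "\<And>a b. a \<in> face_labels n1 n2 \<Longrightarrow> b \<in> face_labels n1 n2 \<Longrightarrow> face_kernel n1 n2 Q (mirror a) (mirror b) = face_kernel n1 n2 Q a b"
    "\<And>e i e' j. (e, i) \<in> face_labels n1 n2 \<Longrightarrow> (e', j) \<in> face_labels n1 n2 \<Longrightarrow>
       face_kernel n1 n2 Q (flip e, i) (flip e', j) = face_kernel n1 n2 Q (e, i) (e', j)"
proof -
  obtain T A U where n: "n1 = n2" and TAU: "T \<in> carrier_mat n1 n1" "A \<in> carrier_mat n1 n1" "U \<in> carrier_mat n1 n1"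
    and Q: "Q = four_block_mat (four_block_mat T A A T) (four_block_mat U U U U)
                           (four_block_mat U U U U) (four_block_mat T A A T)"
    using assms unfolding dihedral_invariant_def by blast
  show "n1 = n2" by (rule n)
  \<comment> \<open>\<open>flip (reflect (flip e))\<close> exchanges South and North. The block
    therefore depends only on whether the two sides are equal, opposite or adjacent, which both
    reflections preserve.\<close>
  define B where "B e e' = (if e = e' then T else if e' = reflect e \<or> e' = flip (reflect (flip e)) then A else U)" for e e'
  have ent: "face_kernel n1 n2 Q (e, i) (e', j) = B e e' $$ (i, j)"
    if "e \<noteq> Cut" "e' \<noteq> Cut" "i < n1" "j < n1" for e e' i j
    using that TAU by (cases e; cases e') (simp_all add: face_kernel_def face_index_def Q B_def n[symmetric])
  have lab: "e \<noteq> Cut \<and> i < n1" if "(e, i) \<in> face_labels n1 n2" for e i using that n by auto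
  have B: "B (reflect e) (reflect e') = B e e'" "B (flip e) (flip e') = B e e'" if "e \<noteq> Cut" "e' \<noteq> Cut" for e e'
    using that by (cases e; cases e'; simp add: B_def)+
  have C: "reflect e \<noteq> Cut" "flip e \<noteq> Cut" if "e \<noteq> Cut" for e using that by (cases e; simp)+
  show "face_kernel n1 n2 Q (flip e, i) (flip e', j) = face_kernel n1 n2 Q (e, i) (e', j)"
    if "(e, i) \<in> face_labels n1 n2" "(e', j) \<in> face_labels n1 n2" for e i e' j
    using lab[OF that(1)] lab[OF that(2)] by (simp add: ent C B)
  fix a b assume "a \<in> face_labels n1 n2" "b \<in> face_labels n1 n2"
  moreover obtain e i e' j where "a = (e, i)" "b = (e', j)" by (metis surj_pair)
  ultimately show "face_kernel n1 n2 Q (mirror a) (mirror b) = face_kernel n1 n2 Q a b"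
    using lab[of e i] lab[of e' j] by (simp add: mirror_def ent C B)
qed

lemma (in lattice) horizontal_multipliers:
  assumes q: "\<And>a b. a \<in> loc \<Longrightarrow> b \<in> loc \<Longrightarrow> q a b = face_kernel n1 n2 Q (mirror a) (mirror b)"
  shows "Q_infWE \<K> n1 n2 Q = dtn Line Unit" "Q_infWE_infS \<K> n1 n2 Q = dtn Line Neg"
    "Q_infWE_infN \<K> n1 n2 Q = dtn Line Pos"
proof -
  note S = is_strip_WE[OF q]
  show "Q_infWE \<K> n1 n2 Q = dtn Line Unit"
    unfolding Q_infWE_def
    by (rule multiplier_eqI[OF _ strip_symbol[OF S]]) (use dtn_coercive[of Line Unit] in \<open>simp_all add: shape_Line\<close>)
  have "G_inf_S n1 n2 Q = (\<lambda>u. G_L n1 (strip_WE n1 n2 Q u))" by (rule ext) (rule G_inf_S_def)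
  then show "Q_infWE_infS \<K> n1 n2 Q = dtn Line Neg"
    unfolding Q_infWE_infS_def
    by (simp only:) (rule multiplier_eqI[OF _ half_plane_symbol_Neg[OF S]], use dtn_coercive[of Line Neg] in \<open>simp_all add: shape_Line\<close>)
  have "G_inf_N n1 n2 Q = (\<lambda>u. G_R n1 (strip_WE n1 n2 Q u))" by (rule ext) (rule G_inf_N_def)
  then show "Q_infWE_infN \<K> n1 n2 Q = dtn Line Pos"
    unfolding Q_infWE_infN_def
    by (simp only:) (rule multiplier_eqI[OF _ half_plane_symbol_Pos[OF S]], use dtn_coercive[of Line Pos] in \<open>simp_all add: shape_Line\<close>)
qed

text \<open>By invariance \<open>strip_SN\<close> is a row symbol of the same kernel, and the
  diagonal reflection turns horizontal strips and half-planes into vertical ones.\<close>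

lemma (in lattice) vertical_multipliers:
  assumes q: "q = face_kernel n1 n2 Q" and d: "dihedral_invariant \<K> n1 n2 Q"
  shows "Q_infSN \<K> n1 n2 Q = dtn Unit Line" "Q_infW_infSN \<K> n1 n2 Q = dtn Neg Line"
    "Q_infE_infSN \<K> n1 n2 Q = dtn Pos Line"
proof -
  note n = dihedral_kernel(1)[OF d]
  have mirror: "q (mirror a) (mirror b) = q a b" if "a \<in> loc" "b \<in> loc" for a b
    using dihedral_kernel(2)[OF d, of a b] that unfolding q loc_def by blast
  have flip: "q (flip e, i) (flip e', j) = q (e, i) (e', j)" if "(e, i) \<in> loc" "(e', j) \<in> loc" for e i e' j
    using dihedral_kernel(3)[OF d, of e i e' j] that unfolding q loc_def by blast
  note S = is_strip_SN[OF n q flip mirror]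
  have shp: "shape n1 n2 Unit Line = {West, East} \<times> UNIV \<times> {..<n2}" "shape n1 n2 Neg Line = {East} \<times> UNIV \<times> {..<n2}"
    "shape n1 n2 Pos Line = {West} \<times> UNIV \<times> {..<n2}" by (auto simp: shape_def)
  have fl: "dtn v Line x = (\<lambda>a. dtn Line v (\<lambda>b. x (flip_label b)) (flip_label a))" if "x \<in> \<L> (shape n1 n2 v Line)" for v x
    by (rule dtn_flip[OF n flip that])
  have "has_symbol \<K> (map flip [South, North]) n1 (strip_SN n1 n2 Q) (dtn Unit Line)"
    by (rule has_symbol_flip[OF strip_symbol[OF S]], assumption+, rule fl) (simp only: shp, simp add: n)
  then show "Q_infSN \<K> n1 n2 Q = dtn Unit Line"
    unfolding Q_infSN_def using dtn_coercive[of Unit Line, unfolded shp] by (intro multiplier_eqI) (simp_all add: n)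
  have "G_inf_W n1 n2 Q = (\<lambda>u. G_L n1 (strip_SN n1 n2 Q u))" unfolding n by (rule ext) (rule G_inf_W_def)
  moreover have "has_symbol \<K> (map flip [North]) n1 (\<lambda>u. G_L n1 (strip_SN n1 n2 Q u)) (dtn Neg Line)"
    by (rule has_symbol_flip[OF half_plane_symbol_Neg[OF S]], assumption+, rule fl) (simp only: shp, simp add: n)
  ultimately show "Q_infW_infSN \<K> n1 n2 Q = dtn Neg Line"
    unfolding Q_infW_infSN_def using dtn_coercive[of Neg Line, unfolded shp] by (intro multiplier_eqI) (simp_all add: n)
  have "G_inf_E n1 n2 Q = (\<lambda>u. G_R n1 (strip_SN n1 n2 Q u))" unfolding n by (rule ext) (rule G_inf_E_def)
  moreover have "has_symbol \<K> (map flip [South]) n1 (\<lambda>u. G_R n1 (strip_SN n1 n2 Q u)) (dtn Pos Line)"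
    by (rule has_symbol_flip[OF half_plane_symbol_Pos[OF S]], assumption+, rule fl) (simp only: shp, simp add: n)
  ultimately show "Q_infE_infSN \<K> n1 n2 Q = dtn Pos Line"
    unfolding Q_infE_infSN_def using dtn_coercive[of Pos Line, unfolded shp] by (intro multiplier_eqI) (simp_all add: n)
qed

theorem theorem3p4:
  fixes \<K> :: "complex set" and n1 n2 :: nat and Q :: "complex mat"
  assumes "\<K> = \<real> \<or> \<K> = UNIV"
    and "face_operator \<K> n1 n2 Q"
    and "two_D_simple n1 n2 Q"
  shows "(Q_infWE \<K> n1 n2 Q \<in> shape_ops \<K> n1 n2 Line Unit \<and>
          Q_infWE_infS \<K> n1 n2 Q \<in> shape_ops \<K> n1 n2 Line Neg \<and>
          Q_infWE_infN \<K> n1 n2 Q \<in> shape_ops \<K> n1 n2 Line Pos) \<and>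
    (dihedral_invariant \<K> n1 n2 Q \<longrightarrow>
       Q_infWE \<K> n1 n2 Q =
         hglue \<K> n1 n2 Unit Neg (fix_W \<K> n1 n2 Q) Pos (fix_E \<K> n1 n2 Q) \<and>
       Q_infWE_infS \<K> n1 n2 Q =
         hglue \<K> n1 n2 Neg Neg (fix_SW \<K> n1 n2 Q) Pos (fix_SE \<K> n1 n2 Q) \<and>
       Q_infWE_infN \<K> n1 n2 Q =
         hglue \<K> n1 n2 Pos Neg (fix_NW \<K> n1 n2 Q) Pos (fix_NE \<K> n1 n2 Q) \<and>
       Q_infSN \<K> n1 n2 Q =
         vglue \<K> n1 n2 Unit Neg (fix_S \<K> n1 n2 Q) Pos (fix_N \<K> n1 n2 Q) \<and>
       Q_infW_infSN \<K> n1 n2 Q =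
         vglue \<K> n1 n2 Neg Neg (fix_SW \<K> n1 n2 Q) Pos (fix_NW \<K> n1 n2 Q) \<and>
       Q_infE_infSN \<K> n1 n2 Q =
         vglue \<K> n1 n2 Pos Neg (fix_SE \<K> n1 n2 Q) Pos (fix_NE \<K> n1 n2 Q))"
proof (rule conjI[OF _ impI])
  let ?loc = "{South, North} \<times> {..<n1} \<union> {West, East} \<times> {..<n2}"
  interpret L: lattice \<K> n1 n2 "face_kernel n1 n2 Q" ?loc
    by (rule lattice_face_operator[OF assms(1,2)]) simp_all
  \<comment> \<open>For membership the multipliers are identified with operators of the mirrored
    lattice, which are coercive like those of any lattice.\<close>
  interpret M: lattice \<K> n1 n2 "\<lambda>a b. face_kernel n1 n2 Q (mirror a) (mirror b)" ?loc
    by (rule L.lattice_mirror) simp_all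
  note h = M.horizontal_multipliers[OF refl]
  show "Q_infWE \<K> n1 n2 Q \<in> shape_ops \<K> n1 n2 Line Unit \<and>
          Q_infWE_infS \<K> n1 n2 Q \<in> shape_ops \<K> n1 n2 Line Neg \<and>
          Q_infWE_infN \<K> n1 n2 Q \<in> shape_ops \<K> n1 n2 Line Pos"
    unfolding h by (intro conjI M.dtn_coercive)
  assume d: "dihedral_invariant \<K> n1 n2 Q"
  \<comment> \<open>Invariance makes the mirrored kernel agree with the original one on the labels
    of a face, so the multipliers now live on the same lattice as the fixed points.\<close>
  note L.horizontal_multipliers[OF dihedral_kernel(2)[OF d, symmetric]] L.vertical_multipliers[OF refl d]
    L.fix_half_strips[OF refl] L.fix_corners[OF refl] L.hglue_dtn[of Neg Pos Line 0 0 0] L.vglue_dtn[of Neg Pos Line 0 0 0]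
  then show "Q_infWE \<K> n1 n2 Q =
         hglue \<K> n1 n2 Unit Neg (fix_W \<K> n1 n2 Q) Pos (fix_E \<K> n1 n2 Q) \<and>
       Q_infWE_infS \<K> n1 n2 Q =
         hglue \<K> n1 n2 Neg Neg (fix_SW \<K> n1 n2 Q) Pos (fix_SE \<K> n1 n2 Q) \<and>
       Q_infWE_infN \<K> n1 n2 Q =
         hglue \<K> n1 n2 Pos Neg (fix_NW \<K> n1 n2 Q) Pos (fix_NE \<K> n1 n2 Q) \<and>
       Q_infSN \<K> n1 n2 Q =
         vglue \<K> n1 n2 Unit Neg (fix_S \<K> n1 n2 Q) Pos (fix_N \<K> n1 n2 Q) \<and>
       Q_infW_infSN \<K> n1 n2 Q =
         vglue \<K> n1 n2 Neg Neg (fix_SW \<K> n1 n2 Q) Pos (fix_NW \<K> n1 n2 Q) \<and>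
       Q_infE_infSN \<K> n1 n2 Q =
         vglue \<K> n1 n2 Pos Neg (fix_SE \<K> n1 n2 Q) Pos (fix_NE \<K> n1 n2 Q)"
    by simp
qed

end
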